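(* Let $t>1$ be real and $x\in(0,\pi)$. Then \begin{align*} 0 & < \left( -4\pi \sqrt{t} \cot\frac{x}{2} \sum_{\gamma>0} \frac{\sinh x \alpha}{\sinh \pi \alpha} \cos(\alpha \log t) + 4\pi \sqrt{t} \, g(x,t) \cot \frac{x}{2} \right) - \Lambda(t) \\ & < F(t) + 4 \cos^2 \frac{x}{2} \left(3 t^2\log t + \frac{\pi^2}{2} t + \frac14 \log t + 0.6 \right), \end{align*} where \begin{multline*} g(x,t)=\frac{(1+t)\sin\frac{x}{2}}{2\sqrt{t}}-\frac{\sqrt{t}\sin \frac{x}{2}}{8\sqrt{t}\cos \frac{x}{2}+4(1+t)}-\frac{t\sin x\, (C+\log 8\pi)}{2\pi(1+t^2+2t \cos x)} \\ -\frac{(1+t)\sqrt{t} \cos \frac{x}{2}}{4\pi(1+t^2+2t \cos x)} \, \log \frac{1+t-2\sqrt{t}\sin \frac{x}{2}}{1+t+2\sqrt{t}\sin \frac{x}{2}} - \frac{(t-1)\sqrt{t} \sin \frac{x}{2}}{2\pi(1+t^2+2t \cos x)} \arctan \frac{t-1}{2\sqrt{t}\cos\frac{x}{2}}, \end{multline*} and \[ F(t) = E(t) \cdot 4 t \sqrt{t} \frac{\Lambda(\lfloor t \rfloor) \sqrt{\lfloor t \rfloor} \cos^2 \frac{x}{2} }{ (\{t\})^2 + 4 t \lfloor t \rfloor \cos^2 \frac{x}{2}} + 4 t \sqrt{t} \frac{\Lambda(\lfloor t \rfloor + 1) \sqrt{\lfloor t \rfloor + 1} \cos^2 \frac{x}{2}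 }{ (1-\{t\})^2 + 4 t (\lfloor t \rfloor + 1) \cos^2 \frac{x}{2}}, \] with $E(t)=0$ if $t$ is an integer and $E(t)=1$ otherwise.
   Context: For real $t$, $\Lambda(t)=\log p$ if $t$ is a positive integer power of a prime $p$, and $\Lambda(t)=0$ otherwise (von Mangoldt function). $\lfloor t\rfloor$ and $\{t\}=t-\lfloor t\rfloor$ denote the integer and fractional parts. $C$ is the Euler–Mascheroni constant. $\rho=\beta+i\gamma$ runs over the non-trivial zeros of the Riemann zeta function (counted with multiplicity), and for each zero $\alpha=-i(\rho-\tfrac12)$. The sum $\sum_{\gamma>0}$ is over the non-trivial zeros with positive imaginary part. *)

theory Defs
  imports "HOL-Complex_Analysis.Complex_Analysis" "HOL-Number_Theory.Prime_Powers"
begin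

definition riemann_zeta :: "complex \<Rightarrow> complex" where
  "riemann_zeta = (SOME f. f holomorphic_on (- {1}) \<and>
      (\<forall>s. 1 < Re s \<longrightarrow> f s = (\<Sum>n. 1 / (of_nat (Suc n)) powr s)))"

definition nontrivial_zeros :: "complex set" where
  "nontrivial_zeros = {\<rho>. \<rho> \<noteq> 1 \<and> riemann_zeta \<rho> = 0 \<and>
      \<not> (\<exists>n::nat. n \<ge> 1 \<and> \<rho> = - 2 * of_nat n)}"

definition Lambda_real :: "real \<Rightarrow> real" where
  "Lambda_real t = (if t \<in> \<int> \<and> t \<ge> 1 then mangoldt (nat \<lfloor>t\<rfloor>) else 0)"

definition g_fun :: "real \<Rightarrow> real \<Rightarrow> real" where
  "g_fun x t =
     (1 + t) * sin (x/2) / (2 * sqrt t)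
   - sqrt t * sin (x/2) / (8 * sqrt t * cos (x/2) + 4 * (1 + t))
   - t * sin x * (euler_mascheroni + ln (8 * pi)) / (2 * pi * (1 + t^2 + 2 * t * cos x))
   - (1 + t) * sqrt t * cos (x/2) / (4 * pi * (1 + t^2 + 2 * t * cos x))
       * ln ((1 + t - 2 * sqrt t * sin (x/2)) / (1 + t + 2 * sqrt t * sin (x/2)))
   - (t - 1) * sqrt t * sin (x/2) / (2 * pi * (1 + t^2 + 2 * t * cos x))
       * arctan ((t - 1) / (2 * sqrt t * cos (x/2)))"

definition F_fun :: "real \<Rightarrow> real \<Rightarrow> real" where
  "F_fun x t =
     (if t \<in> \<int> then 0 else 1) *
       (4 * t * sqrt t * (Lambda_real (of_int \<lfloor>t\<rfloor>) * sqrt (of_int \<lfloor>t\<rfloor>) * (cos (x/2))^2)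
         / ((frac t)^2 + 4 * t * of_int \<lfloor>t\<rfloor> * (cos (x/2))^2))
   + 4 * t * sqrt t * (Lambda_real (of_int \<lfloor>t\<rfloor> + 1) * sqrt (of_int \<lfloor>t\<rfloor> + 1) * (cos (x/2))^2)
         / ((1 - frac t)^2 + 4 * t * (of_int \<lfloor>t\<rfloor> + 1) * (cos (x/2))^2)"

definition zero_term :: "real \<Rightarrow> real \<Rightarrow> complex \<Rightarrow> complex" where
  "zero_term x t \<rho> = (let \<alpha> = - \<i> * (\<rho> - 1/2) in
      of_int (zorder riemann_zeta \<rho>) *
        (sinh (of_real x * \<alpha>) / sinh (of_real pi * \<alpha>) * cos (\<alpha> * of_real (ln t))))"

definition upper_zeros :: "complex set" where
  "upper_zeros = {\<rho> \<in> nontrivial_zeros. Im \<rho> > 0}"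

end

theory Submission
  imports Defs "HOL-Real_Asymp.Real_Asymp"
begin

text \<open>
  Put \<open>z = \<rho> - 1/2\<close> and \<open>H(z) = sin (x z) cosh (z log t) / sin (\<pi> z)\<close>, an even function that decays
  exponentially along vertical lines. Integrating \<open>H(s - 1/2) \<zeta>'(s)/\<zeta>(s)\<close> around a tall rectangle with sides
  \<open>Re s = -1/4\<close> and \<open>Re s = 5/4\<close>, and folding the left side onto the right one with the functional equation,
  expresses twice the sum over the upper zeros through integrals of \<open>H\<close> against a constant, a tangent, the
  digamma function and the Dirichlet series of \<open>\<Lambda>\<close>. Each integral is a combination of integrals of
  \<open>exp (w z) / sin (\<pi> z)\<close> at \<open>w = \<plusminus>log t \<plusminus> i x\<close>, which follow from the periodicity of the kernel; the first
  three, together with the residue at the pole of \<open>\<zeta>\<close>, add up to \<open>2 g(x, t)\<close>. The Dirichlet series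
  contributes \<open>\<Lambda>(n)\<close> times the Fourier transform of the kernel, so that, with \<open>c = cos (x/2)\<close>, the quantity to be
  estimated is
  \<open>4 t \<surd>t c\<^sup>2 \<Sum>n. \<Lambda>(n) \<surd>n (1 / ((n - t)\<^sup>2 + 4 n t c\<^sup>2) + 1 / ((n t - 1)\<^sup>2 + 4 n t c\<^sup>2)) - \<Lambda>(t)\<close>.
  If \<open>t\<close> is an integer, its own term is \<open>\<Lambda>(t)\<close>; all other terms are nonnegative, and \<open>F(t)\<close> is the
  contribution of the integers next to \<open>t\<close>.

  In the remaining terms \<open>4 n t c\<^sup>2\<close> is dropped. For \<open>n > 3 t\<close> they are compared with \<open>\<Lambda>(n) n\<^bsup>-3/2\<^esup>\<close>, whose sum
  \<open>-\<zeta>'(3/2)/\<zeta>(3/2)\<close> is bounded numerically. For the others \<open>\<Lambda>(n) \<le> log n\<close> suffices, since convexity of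
  \<open>1 / d\<^sup>2\<close>, applied to pairs of integers on either side of \<open>t\<close>, gives \<open>\<Sum> 1 / (n - t)\<^sup>2 \<le> \<pi>\<^sup>2/3 - 1 < 3\<close>.
\<close>

section \<open>Zero counting and lower bounds away from the zeros\<close>

text \<open>Nothing is known about the choice \<open>riemann_zeta\<close> until a continuation is
  exhibited, so zeta is built here: the trapezoidal rule reaches Re s > -1, and two evaluations of
  the Mellin transform of coth (x/2) / 2 - 1/x give the functional equation for real -1 < s < 0,
  from where it spreads by analytic continuation. The kernel decays like exp (-(pi - x) |Im z|), so
  on the horizontal sides any subexponential bound of zeta'/zeta will do. Jensen's inequality and a
  lower bound for |zeta| off its zeros provide exp (O(log T log log T)) at suitable heights. The
  lines Re s = -1/4 and 5/4 are exchanged by s -> 1 - s. Between them |Re z| <= 3/4, so z = 0 is the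
  only zero of sin (pi z), and sin (x z) cancels it. The coefficient 3 of t^2 log t exceeds pi^2/3 -
  1 < 2.29 by 0.71; this slack pays for the harmonic sum and the tail, which are estimated crudely.
  Near t = 1 the logarithm gives no room, and the constants pi^2/2 and 0.6 must carry the
  estimate.\<close>

lemma borel_caratheodory_lower_bound:
  fixes G :: "complex \<Rightarrow> complex"
  assumes hol: "G holomorphic_on ball 0 R" and nz: "\<And>z. z \<in> ball 0 R \<Longrightarrow> G z \<noteq> 0"
    and bd: "\<And>z. z \<in> ball 0 R \<Longrightarrow> norm (G z) < M"
    and c: "0 < c" "c \<le> norm (G 0)" and r: "0 < r" "r < R" "norm z \<le> r"
  shows "c * exp (- (2 * r / (R - r)) * ln (M / c)) \<le> norm (G z)"
proof -
  have R0: "0 < R" using r by simp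
  define A where "A = ln (M / c)"
  have cM: "c < M" using bd[of 0] c R0 by auto
  have A0: "0 < A" unfolding A_def using c cM by simp
  define G' where "G' z = G z / G 0" for z
  have G0: "G 0 \<noteq> 0" using nz R0 by simp
  have "G' holomorphic_on ball 0 R" unfolding G'_def using hol G0 by (intro holomorphic_intros) auto
  moreover have "\<And>z. z \<in> ball 0 R \<Longrightarrow> G' z \<noteq> 0" using nz G0 by (auto simp: G'_def)
  ultimately obtain L0 where L0: "L0 holomorphic_on ball 0 R" "\<And>z. z \<in> ball 0 R \<Longrightarrow> exp (L0 z) = G' z"
    using holomorphic_logarithm_exists[of "ball 0 R" G' 0] R0 by (metis convex_ball open_ball centre_in_ball)
  define L where "L z = L0 z - L0 0" for z
  have Lhol: "L holomorphic_on ball 0 R" unfolding L_def by (intro holomorphic_intros L0)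
  have eL: "exp (L z) = G' z" if "z \<in> ball 0 R" for z
    using L0(2)[OF that] L0(2)[of 0] R0 G0 by (simp add: L_def exp_diff G'_def)
  have ReL: "Re (L z) < A" if z: "z \<in> ball 0 R" for z
  proof -
    have "exp (Re (L z)) = norm (G z) / norm (G 0)"
      using eL[OF z] by (metis norm_exp_eq_Re G'_def norm_divide)
    also have "\<dots> \<le> norm (G z) / c" using c by (intro divide_left_mono mult_pos_pos) auto
    also have "\<dots> < M / c" using bd[OF z] c by (simp add: divide_strict_right_mono)
    also have "\<dots> = exp A" unfolding A_def using c cM by simp
    finally show ?thesis by simp
  qed
  \<comment> \<open>The map w -> w / (2 A - w) sends the half plane Re w < A into the unit disc and
    fixes 0, so Schwarz's lemma bounds |L|; then |G z| is at least |G 0| exp (- |L z|).\<close>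
  define phi where "phi z = L (of_real R * z) / (2 * of_real A - L (of_real R * z))" for z
  have inb: "of_real R * z \<in> ball 0 R" if "norm z < 1" for z :: complex
    using that R0 by (simp add: norm_mult)
  have den: "norm (L w) < norm (2 * of_real A - L w)" if "w \<in> ball 0 R" for w
  proof -
    have "(norm (2 * of_real A - L w))\<^sup>2 - (norm (L w))\<^sup>2 = 4 * A * (A - Re (L w))"
      unfolding cmod_power2 by (simp add: power2_eq_square algebra_simps)
    also have "\<dots> > 0" using A0 ReL[OF that] by simp
    finally have "(norm (L w))\<^sup>2 < (norm (2 * of_real A - L w))\<^sup>2" by linarith
    then show ?thesis by (rule power_less_imp_less_base) (rule norm_ge_zero)
  qed
  have den0: "2 * of_real A - L w \<noteq> 0" if "w \<in> ball 0 R" for w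
    using den[OF that] by auto
  have phihol: "phi holomorphic_on ball 0 1"
    unfolding phi_def
    by (intro holomorphic_intros holomorphic_on_compose_gen[OF _ Lhol, unfolded o_def])
       (use inb den0 in auto)
  have phi0: "phi 0 = 0" by (simp add: phi_def L_def)
  have phi1: "norm (phi z) < 1" if "norm z < 1" for z
  proof -
    have "0 < norm (2 * of_real A - L (of_real R * z))" using den0[OF inb[OF that]] by simp
    then show ?thesis unfolding phi_def norm_divide
      using den[OF inb[OF that]] by (subst divide_less_eq_1_pos) auto
  qed
  define u where "u = z / of_real R"
  have u1: "norm u \<le> r / R" using r R0 by (simp add: u_def norm_divide divide_right_mono)
  have rR: "r / R < 1" using r R0 by simp
  have u2: "norm u < 1" using u1 rR by linarith
  have phiu: "norm (phi u) \<le> r / R"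
    using Schwarz_Lemma(1)[OF phihol phi0 phi1 u2] u1 by linarith
  have zb: "z \<in> ball 0 R" using r by simp
  have Ru: "of_real R * u = z" using R0 by (simp add: u_def)
  have eq: "L z = phi u * (2 * of_real A - L z)"
    using den0[OF zb] Ru by (simp add: phi_def)
  have "norm (L z) \<le> (r / R) * norm (2 * of_real A - L z)"
    by (subst eq, subst norm_mult) (intro mult_right_mono phiu norm_ge_zero)
  also have "\<dots> \<le> (r / R) * (2 * A + norm (L z))"
    using r R0 A0 by (intro mult_left_mono) (auto intro: order_trans[OF norm_triangle_ineq4] simp: norm_mult)
  finally have "norm (L z) * R \<le> r * (2 * A + norm (L z))" using R0 by (simp add: field_simps)
  then have "norm (L z) * (R - r) \<le> 2 * r * A" by (simp add: algebra_simps)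
  then have nL: "norm (L z) \<le> 2 * r / (R - r) * A" using r by (simp add: field_simps)
  have "c * exp (- (2 * r / (R - r)) * ln (M / c)) \<le> c * exp (Re (L z))"
  proof -
    have "- (2 * r / (R - r)) * ln (M / c) \<le> - norm (L z)" using nL by (simp add: A_def)
    also have "\<dots> \<le> Re (L z)" using abs_Re_le_cmod[of "L z"] by linarith
    finally show ?thesis using c by simp
  qed
  also have "\<dots> \<le> norm (G 0) * exp (Re (L z))" using c by simp
  also have "\<dots> = norm (G z)"
    using eL[OF zb] G0 by (metis G'_def nonzero_eq_divide_eq norm_exp_eq_Re norm_mult mult.commute)
  finally show ?thesis .
qed

text \<open>A disc slightly larger than |z| <= r contains no further zero. There f and the
  polynomial formed from its zeros have equal orders everywhere, so the quotient has neither zeros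
  nor poles. The surplus \<open>R' > r\<close> makes it usable on the closed disc.\<close>

lemma holomorphic_factor_zeros:
  fixes f :: "complex \<Rightarrow> complex"
  assumes hol: "f holomorphic_on ball 0 R" and R: "0 < r" "r < R" and f0: "f 0 \<noteq> 0"
  obtains R' h where "r < R'" "R' \<le> R" "finite {z \<in> cball 0 r. f z = 0}" "h holomorphic_on ball 0 R'"
    "\<And>z. z \<in> ball 0 R' \<Longrightarrow> h z \<noteq> 0"
    "\<And>z. z \<in> ball 0 R' \<Longrightarrow> f z = h z * (\<Prod>p\<in>{z \<in> cball 0 r. f z = 0}. (z - p) ^ nat (zorder f p))"
    "\<And>p. p \<in> {z \<in> cball 0 r. f z = 0} \<Longrightarrow> 0 < zorder f p"
proof -
  define s where "s = (r + R) / 2"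
  have s: "r < s" "s < R" using R by (auto simp: s_def)
  define Z where "Z = {z \<in> cball 0 r. f z = 0}"
  \<comment> \<open>Finiteness of the zeros in a compact set is a theorem on nonconstant functions;
    a constant f has no zeros because \<open>f 0\<close> is nonzero.\<close>
  have nc: "\<not> f constant_on ball 0 R \<or> finite {z \<in> cball 0 s. f z = 0}"
  proof (cases "f constant_on ball 0 R")
    case True
    then have "\<And>z. z \<in> ball 0 R \<Longrightarrow> f z = f 0" using R unfolding constant_on_def by fastforce
    then have "{z \<in> cball 0 s. f z = 0} = {}" using f0 s by fastforce
    then show ?thesis by (metis finite.emptyI)
  qed simp
  have fin_s: "finite {z \<in> cball 0 s. f z = 0}"
    using nc holomorphic_compact_finite_zeros[OF hol open_ball connected_ball compact_cball, of 0 s] s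
    by (auto simp: cball_subset_ball_iff)
  have finZ: "finite Z" unfolding Z_def by (rule finite_subset[OF _ fin_s]) (use s in auto)
  \<comment> \<open>The least modulus of a zero beyond r, capped by s: the open disc of radius
    \<open>R'\<close> gains no zero.\<close>
  define R' where "R' = Min (insert s (norm ` {z \<in> cball 0 s. f z = 0 \<and> norm z > r}))"
  have fin': "finite {z \<in> cball 0 s. f z = 0 \<and> norm z > r}" by (rule finite_subset[OF _ fin_s]) auto
  have R'1: "r < R'" unfolding R'_def using fin' s by (subst Min_gr_iff) auto
  have R's: "R' \<le> s" unfolding R'_def using fin' by (intro Min_le) auto
  have R'2: "\<not> (f z = 0 \<and> r < norm z)" if "norm z < R'" for z
  proof
    assume "f z = 0 \<and> r < norm z"
    then have "norm z \<in> insert s (norm ` {z \<in> cball 0 s. f z = 0 \<and> norm z > r})" using that R's by auto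
    then have "R' \<le> norm z" unfolding R'_def using fin' by (intro Min_le) auto
    then show False using that by simp
  qed
  have hol': "f holomorphic_on ball 0 R'" using hol R's s by (auto intro: holomorphic_on_subset)
  have zo: "0 < zorder f p" if "p \<in> Z" for p
  proof -
    have "\<exists>w\<in>ball 0 R. f w \<noteq> 0" using f0 R by (intro bexI[of _ 0]) auto
    then show ?thesis using zorder_exist_zero[OF hol open_ball connected_ball, of p] that R by (auto simp: Z_def)
  qed
  define P where "P z = (\<Prod>p\<in>Z. (z - p) ^ nat (zorder f p))" for z
  have P0: "P z = 0 \<longleftrightarrow> z \<in> Z" for z
    unfolding P_def using finZ zo by (auto simp: prod_zero_iff)
  have Pz: "f z = 0 \<longleftrightarrow> P z = 0" if "z \<in> ball 0 R'" for z
    unfolding P0 using that R'2[of z] by (auto simp: Z_def)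
  have zPZ: "zorder P z = zorder f z" if z: "z \<in> Z" for z
  proof (rule zorder_eqI[of UNIV])
    show "(\<lambda>w. \<Prod>p\<in>Z - {z}. (w - p) ^ nat (zorder f p)) holomorphic_on UNIV"
      by (intro holomorphic_intros)
    show "(\<Prod>p\<in>Z - {z}. (z - p) ^ nat (zorder f p)) \<noteq> 0" using finZ by (auto simp: prod_zero_iff)
    show "P w = (\<Prod>p\<in>Z - {z}. (w - p) ^ nat (zorder f p)) * (w - z) powi zorder f z" if "w \<noteq> z" for w
      unfolding P_def using prod.remove[OF finZ z, of "\<lambda>p. (w - p) ^ nat (zorder f p)"] zo[OF z]
      by (simp add: power_int_def mult.commute)
  qed auto
  have zorP: "zorder f z = zorder P z" if z: "z \<in> ball 0 R'" for z
  proof (cases "z \<in> Z")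
    case False
    have "f z \<noteq> 0" "P z \<noteq> 0" using False P0 Pz[OF z] by auto
    moreover have "P holomorphic_on UNIV" unfolding P_def by (intro holomorphic_intros)
    moreover have "z \<in> ball 0 R" using z R's s by simp
    ultimately show ?thesis
      using zorder_exist_zero[OF hol open_ball connected_ball, of z]
        zorder_exist_zero[of P UNIV z] by (metis UNIV_I open_UNIV connected_UNIV)
  qed (simp add: zPZ)
  have "P holomorphic_on ball 0 R'" unfolding P_def by (intro holomorphic_intros)
  from holomorphic_zorder_factorization[OF hol' open_ball connected_ball this] Pz zorP
  obtain h where h: "h holomorphic_on ball 0 R'" "\<And>z. z \<in> ball 0 R' \<Longrightarrow> h z \<noteq> 0"
     "\<And>z. z \<in> ball 0 R' \<Longrightarrow> f z = h z * P z" by metis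
  show ?thesis
    by (rule that[of R' h]) (use R'1 R's s finZ h zo in \<open>auto simp: Z_def P_def\<close>)
qed

text \<open>Rests on |R^2 - cnj p z|^2 - |R (z - p)|^2 = (R^2 - |p|^2) (R^2 - |z|^2), which is
  nonnegative in the disc and vanishes on its boundary.\<close>

lemma blaschke_factor_bounds:
  fixes p z :: complex
  assumes "norm p < R" "norm z \<le> R"
  shows "norm (of_real R * (z - p)) \<le> norm ((of_real R)\<^sup>2 - cnj p * z)"
    and "norm z = R \<Longrightarrow> norm (of_real R * (z - p)) = norm ((of_real R)\<^sup>2 - cnj p * z)"
    and "0 < norm ((of_real R)\<^sup>2 - cnj p * z)"
    and "norm ((of_real R)\<^sup>2 - cnj p * z) \<le> 2 * R\<^sup>2"
proof -
  have R: "0 < R" using assms(1) norm_ge_zero[of p] by linarith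
  have eq: "(norm ((of_real R)\<^sup>2 - cnj p * z))\<^sup>2 - (norm (of_real R * (z - p)))\<^sup>2
      = (R\<^sup>2 - (norm p)\<^sup>2) * (R\<^sup>2 - (norm z)\<^sup>2)"
    by (simp add: cmod_power2 norm_mult power_mult_distrib) (simp add: power2_eq_square algebra_simps)
  have p: "(norm p)\<^sup>2 \<le> R\<^sup>2" using assms by (intro power_mono) auto
  have z: "(norm z)\<^sup>2 \<le> R\<^sup>2" using assms by (intro power_mono) auto
  have "(norm (of_real R * (z - p)))\<^sup>2 \<le> (norm ((of_real R)\<^sup>2 - cnj p * z))\<^sup>2"
    using eq mult_nonneg_nonneg[of "R\<^sup>2 - (norm p)\<^sup>2" "R\<^sup>2 - (norm z)\<^sup>2"] p z by linarith
  then show "norm (of_real R * (z - p)) \<le> norm ((of_real R)\<^sup>2 - cnj p * z)"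
    by (rule power2_le_imp_le) auto
  show "norm (of_real R * (z - p)) = norm ((of_real R)\<^sup>2 - cnj p * z)" if "norm z = R"
    proof -
    have "(norm (of_real R * (z - p)))\<^sup>2 = (norm ((of_real R)\<^sup>2 - cnj p * z))\<^sup>2"
      using eq unfolding that by simp
    then show ?thesis by (rule power2_eq_imp_eq) auto
  qed
  have pz: "norm p * norm z \<le> norm p * R" by (intro mult_left_mono assms) auto
  have pR: "norm p * R < R * R" using assms R by simp
  have pzR: "norm p * norm z < R * R" using pz pR by linarith
  have "norm (cnj p * z) < norm ((of_real R :: complex)\<^sup>2)"
    using pzR by (simp add: norm_mult norm_power power2_eq_square)
  then show "0 < norm ((of_real R)\<^sup>2 - cnj p * z)" by auto
  have "norm ((of_real R)\<^sup>2 - cnj p * z) \<le> norm ((of_real R :: complex)\<^sup>2) + norm (cnj p * z)"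
    by (rule norm_triangle_ineq4)
  also have "\<dots> \<le> 2 * R\<^sup>2" using pzR by (simp add: norm_mult norm_power power2_eq_square)
  finally show "norm ((of_real R)\<^sup>2 - cnj p * z) \<le> 2 * R\<^sup>2" .
qed

text \<open>Dividing out the Blaschke product of the zeros leaves a zero-free function with the same bound,
  to which Jensen's inequality and the Borel--Caratheodory theorem apply.\<close>

lemma zero_count_and_lower_bound:
  fixes f :: "complex \<Rightarrow> complex"
  assumes hol: "f holomorphic_on ball 0 R0" and R: "0 < r" "r < s" "s < R" "R < R0"
    and M: "\<And>z. norm z \<le> R \<Longrightarrow> norm (f z) \<le> M" and c: "0 < c" "c \<le> norm (f 0)"
  defines "Z \<equiv> {z \<in> cball 0 s. f z = 0}"
  shows "finite Z" and "\<And>p. p \<in> Z \<Longrightarrow> 0 < zorder f p"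
    and "real (\<Sum>p\<in>Z. nat (zorder f p)) * ln (R / s) \<le> ln (M / c)"
    and "\<And>z d. \<lbrakk>norm z \<le> r; 0 < d; d \<le> 2 * R; \<And>p. p \<in> Z \<Longrightarrow> d \<le> norm (z - p)\<rbrakk> \<Longrightarrow>
        c * exp (- (2 * r / (s - r)) * ln (2 * M / c)) * (d / (2 * R)) ^ (\<Sum>p\<in>Z. nat (zorder f p)) \<le> norm (f z)"
proof -
  have f0: "f 0 \<noteq> 0" using c by auto
  obtain R' h where h: "R < R'" "R' \<le> R0" "finite {z \<in> cball 0 R. f z = 0}" "h holomorphic_on ball 0 R'"
    "\<And>z. z \<in> ball 0 R' \<Longrightarrow> h z \<noteq> 0"
    "\<And>z. z \<in> ball 0 R' \<Longrightarrow> f z = h z * (\<Prod>p\<in>{z \<in> cball 0 R. f z = 0}. (z - p) ^ nat (zorder f p))"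
    "\<And>p. p \<in> {z \<in> cball 0 R. f z = 0} \<Longrightarrow> 0 < zorder f p"
    by (rule holomorphic_factor_zeros[OF hol _ R(4) f0]) (use R in auto)
  define ZR where "ZR = {z \<in> cball 0 R. f z = 0}"
  have ZZR: "Z \<subseteq> ZR" using R by (auto simp: Z_def ZR_def)
  have finR: "finite ZR" using h ZR_def by simp
  show fin: "finite Z" using finite_subset[OF ZZR finR] .
  show zo: "0 < zorder f p" if "p \<in> Z" for p using h(7) that ZZR ZR_def by blast
  define m where "m p = nat (zorder f p)" for p
  define N where "N = (\<Sum>p\<in>Z. m p)"
  have Rp: "0 < R" "0 < s" using R by auto
  define D where "D p z = ((of_real R)\<^sup>2 - cnj p * z) / of_real R" for p z :: complex
  \<comment> \<open>Only the zeros with |p| <= s are exchanged for Blaschke denominators. Those with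
    s < |p| <= R stay in G, which is therefore zero-free only on |z| < s; the lower bound is applied
    on that smaller disc.\<close>
  define G where "G z = h z * (\<Prod>p\<in>ZR - Z. (z - p) ^ m p) * (\<Prod>p\<in>Z. D p z ^ m p)" for z
  define B where "B z = (\<Prod>p\<in>Z. ((z - p) / D p z) ^ m p)" for z
  have Znorm: "norm p \<le> s" if "p \<in> Z" for p using that by (simp add: Z_def)
  have Dn: "norm (D p z) > 0" "norm (z - p) \<le> norm (D p z)" "norm z = R \<Longrightarrow> norm (z - p) = norm (D p z)"
     "norm (D p z) \<le> 2 * R" if "p \<in> Z" "norm z \<le> R" for p z
  proof -
    have pR: "norm p < R" using Znorm[OF that(1)] R by simp
    note b = blaschke_factor_bounds[OF pR that(2)]
    have D: "norm (D p z) = norm ((of_real R)\<^sup>2 - cnj p * z) / R"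
      using Rp by (simp add: D_def norm_divide)
    have e: "norm (of_real R * (z - p)) = R * norm (z - p)" using Rp by (simp add: norm_mult)
    show "norm (D p z) > 0" unfolding D using b(3) Rp by simp
    show "norm (z - p) \<le> norm (D p z)" unfolding D using b(1) Rp unfolding e by (simp add: field_simps)
    show "norm (z - p) = norm (D p z)" if "norm z = R" unfolding D using b(2)[OF that] Rp unfolding e by (simp add: field_simps)
    show "norm (D p z) \<le> 2 * R" unfolding D using b(4) Rp by (simp add: field_simps power2_eq_square)
  qed
  have fG: "f z = G z * B z" if "norm z \<le> R" for z
  proof -
    have "(\<Prod>p\<in>Z. D p z ^ m p) * B z = (\<Prod>p\<in>Z. (z - p) ^ m p)"
      unfolding B_def prod.distrib[symmetric] using Dn(1)[OF _ that]
      by (intro prod.cong refl) (auto simp: power_mult_distrib[symmetric])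
    moreover have "(\<Prod>p\<in>ZR. (z - p) ^ m p) = (\<Prod>p\<in>ZR - Z. (z - p) ^ m p) * (\<Prod>p\<in>Z. (z - p) ^ m p)"
      by (rule prod.subset_diff[OF ZZR finR])
    ultimately show ?thesis
      using h(6)[of z] that h(1) unfolding G_def ZR_def[symmetric] m_def[symmetric]
      by (simp add: mult_ac)
  qed
  have Ghol: "G holomorphic_on ball 0 R'"
    unfolding G_def D_def using Rp by (intro holomorphic_intros h) auto
  have Gnz: "G z \<noteq> 0" if "norm z < s" for z
  proof -
    have "norm z \<le> R" using that R by simp
    then have "h z \<noteq> 0" using h by auto
    moreover have "(\<Prod>p\<in>ZR - Z. (z - p) ^ m p) \<noteq> 0"
      using finR that by (auto simp: prod_zero_iff Z_def ZR_def)
    moreover have "(\<Prod>p\<in>Z. D p z ^ m p) \<noteq> 0"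
      using fin Dn(1)[OF _ \<open>norm z \<le> R\<close>] by (fastforce simp: prod_zero_iff)
    ultimately show ?thesis by (simp add: G_def)
  qed
  have B1: "norm (B z) = 1" if "norm z = R" for z
    unfolding B_def prod_norm[symmetric] norm_power norm_divide
    using Dn(1)[of _ z] Dn(3)[of _ z] that by (intro prod.neutral ballI) auto
  \<comment> \<open>On |z| = R the Blaschke product has modulus 1, so |G| = |f| <= M there, and the
    maximum principle carries the bound inside.\<close>
  have GM: "norm (G z) \<le> M" if "norm z \<le> R" for z
  proof (rule maximum_modulus_frontier[of G "cball 0 R"])
    show "G holomorphic_on interior (cball 0 R)" using Ghol h(1) by (auto intro: holomorphic_on_subset)
    show "continuous_on (closure (cball 0 R)) G"
      using holomorphic_on_imp_continuous_on[OF Ghol] h(1) by (auto intro: continuous_on_subset)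
    show "norm (G w) \<le> M" if "w \<in> frontier (cball 0 R)" for w
    proof -
      have w: "norm w = R" using that Rp by (simp add: frontier_cball)
      have "norm (G w) = norm (f w)" using fG[of w] w B1[OF w] by (simp add: norm_mult)
      then show ?thesis using M[of w] w by simp
    qed
  qed (use that in auto)
  have B0: "norm (B 0) \<le> (s / R) ^ N"
  proof -
    have "norm (B 0) = (\<Prod>p\<in>Z. (norm p / R) ^ m p)"
      unfolding B_def prod_norm[symmetric] using Rp
      by (intro prod.cong refl) (simp add: norm_power norm_divide D_def norm_mult power2_eq_square)
    also have "\<dots> \<le> (\<Prod>p\<in>Z. (s / R) ^ m p)"
      using Rp Znorm by (intro prod_mono conjI power_mono divide_right_mono) auto
    also have "\<dots> = (s / R) ^ N" by (simp add: N_def power_sum)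
    finally show ?thesis .
  qed
  have sR: "s / R < 1" "0 < s / R" using R Rp by auto
  \<comment> \<open>Jensen's inequality in multiplicative form: each zero costs a factor s / R at
    the origin. Taking logarithms bounds their number.\<close>
  have c1: "c \<le> M * (s / R) ^ N"
  proof -
    have "c \<le> norm (G 0) * norm (B 0)" using c fG[of 0] Rp by (simp add: norm_mult)
    also have "\<dots> \<le> M * (s / R) ^ N" using B0 GM[of 0] Rp
      by (intro mult_mono) (auto intro: order_trans[OF norm_ge_zero])
    finally show ?thesis .
  qed
  have Mp: "0 < M" using c M[of 0] Rp by auto
  have "ln c \<le> ln M + real N * ln (s / R)"
  proof -
    have "ln c \<le> ln (M * (s / R) ^ N)" using c1 c by (intro ln_mono) auto
    also have "\<dots> = ln M + real N * ln (s / R)"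
      using ln_mult_pos[OF Mp zero_less_power[OF sR(2)]] by (simp only: ln_realpow)
    finally show ?thesis .
  qed
  then show "real (\<Sum>p\<in>Z. nat (zorder f p)) * ln (R / s) \<le> ln (M / c)"
    using Mp c Rp unfolding m_def[symmetric] N_def[symmetric] by (simp add: ln_div algebra_simps)
  have G0c: "c \<le> norm (G 0)"
  proof -
    have "c \<le> norm (G 0) * norm (B 0)" using c fG[of 0] Rp by (simp add: norm_mult)
    also have "\<dots> \<le> norm (G 0) * 1"
      using B0 power_le_one[of "s / R" N] sR by (intro mult_left_mono) auto
    finally show ?thesis by simp
  qed
  show "c * exp (- (2 * r / (s - r)) * ln (2 * M / c)) * (d / (2 * R)) ^ (\<Sum>p\<in>Z. nat (zorder f p)) \<le> norm (f z)"
    if z: "norm z \<le> r" and d: "0 < d" "d \<le> 2 * R" and dist: "\<And>p. p \<in> Z \<Longrightarrow> d \<le> norm (z - p)" for z d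
  proof -
    have zR: "norm z \<le> R" using z R by simp
    have 1: "c * exp (- (2 * r / (s - r)) * ln (2 * M / c)) \<le> norm (G z)"
    proof (rule borel_caratheodory_lower_bound[where G = G and z = z])
      show "G holomorphic_on ball 0 s" by (rule holomorphic_on_subset[OF Ghol]) (use R h(1) in auto)
      \<comment> \<open>The lower bound asks for a strict majorant, whence 2 M in place of
        M.\<close>
      show "norm (G w) < 2 * M" if "w \<in> ball 0 s" for w using GM[of w] that R Mp by simp
    qed (use Gnz G0c c R z in auto)
    have 2: "(d / (2 * R)) ^ N \<le> norm (B z)"
    proof -
      have "(d / (2 * R)) ^ N = (\<Prod>p\<in>Z. (d / (2 * R)) ^ m p)" by (simp add: N_def power_sum)
      also have "\<dots> \<le> (\<Prod>p\<in>Z. norm (((z - p) / D p z) ^ m p))"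
      proof (intro prod_mono conjI)
        fix p assume p: "p \<in> Z"
        show "0 \<le> (d / (2 * R)) ^ m p" using d Rp by simp
        have "d / (2 * R) \<le> norm (z - p) / norm (D p z)"
          using dist[OF p] Dn[OF p zR] d by (intro frac_le) auto
        then show "(d / (2 * R)) ^ m p \<le> norm (((z - p) / D p z) ^ m p)"
          unfolding norm_power norm_divide using d Rp by (intro power_mono) auto
      qed
      finally show ?thesis by (simp add: B_def prod_norm)
    qed
    have "c * exp (- (2 * r / (s - r)) * ln (2 * M / c)) * (d / (2 * R)) ^ N \<le> norm (G z) * norm (B z)"
      using 1 2 d Rp by (intro mult_mono) auto
    then show ?thesis using fG[OF zR] by (simp add: norm_mult N_def m_def)
  qed
qed

section \<open>Continuation of the zeta function to \<open>Re s > -1\<close>\<close>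

text \<open>From n = 2 on, the term n^(-p) is at most the integral of u^(-p) over [n - 1, n]; these
  integrals telescope to 1 / (p - 1), and the first term adds 1.\<close>

lemma sum_powr_bound:
  fixes p :: real
  assumes "p > 1"
  shows "summable (\<lambda>n. real (Suc n) powr - p)" "(\<Sum>n. real (Suc n) powr - p) \<le> p / (p - 1)"
proof -
  have stepk: "real (Suc (Suc n)) powr - p \<le> (real (Suc n) powr (1 - p) - real (Suc (Suc n)) powr (1 - p)) / (p - 1)" for n
  proof -
    have "\<exists>z>real (Suc n). z < real (Suc (Suc n)) \<and>
        real (Suc (Suc n)) powr (1 - p) - real (Suc n) powr (1 - p)
          = (real (Suc (Suc n)) - real (Suc n)) * ((1 - p) * z powr (- p))"
      by (rule MVT2) (auto intro!: DERIV_fun_powr[OF DERIV_ident, THEN DERIV_cong])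
    then obtain z where z: "real (Suc n) < z" "z < real (Suc (Suc n))"
      "real (Suc (Suc n)) powr (1 - p) - real (Suc n) powr (1 - p) = (1 - p) * z powr (- p)" by auto
    have "real (Suc (Suc n)) powr - p \<le> z powr - p" using z assms by (intro powr_mono2') auto
    also have "\<dots> = (real (Suc n) powr (1 - p) - real (Suc (Suc n)) powr (1 - p)) / (p - 1)"
      using z(3) assms by (simp add: field_simps)
    finally show ?thesis .
  qed
  show s: "summable (\<lambda>n. real (Suc n) powr - p)"
    using summable_real_powr_iff[of "- p"] assms by (subst summable_Suc_iff) auto
  have part: "(\<Sum>n<N. real (Suc n) powr - p) \<le> p / (p - 1) - real N powr (1 - p) / (p - 1)" if "N \<ge> 1" for N
    using that
  proof (induction N rule: dec_induct)
    case base
    have "p / (p - 1) - 1 / (p - 1) = 1" using assms by (simp add: diff_divide_distrib[symmetric])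
    then show ?case by simp
  next
    case (step N)
    obtain k where k: "N = Suc k" using step by (cases N) auto
    show ?case using step.IH stepk[of k] unfolding k by (simp add: diff_divide_distrib)
  qed
  show "(\<Sum>n. real (Suc n) powr - p) \<le> p / (p - 1)"
  proof (rule suminf_le_const[OF s])
    fix N
    have "(\<Sum>n<N. real (Suc n) powr - p) \<le> (\<Sum>n<Suc N. real (Suc n) powr - p)"
      by simp
    also have "\<dots> \<le> p / (p - 1)"
      using part[of "Suc N"] assms by (smt (verit) divide_nonneg_pos le_add1 plus_1_eq_Suc powr_ge_zero)
    finally show "(\<Sum>n<N. real (Suc n) powr - p) \<le> p / (p - 1)" .
  qed
qed

text \<open>\<open>trap s a\<close> is \<open>s - 1\<close> times the error of the trapezoidal rule for \<open>u powr - s\<close>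
  on \<open>[a, a + 1]\<close>; the factor makes it entire in \<open>s\<close>.\<close>

definition trap :: "complex \<Rightarrow> real \<Rightarrow> complex" where
  "trap s a = (s - 1) / 2 * (of_real a powr - s + of_real (a + 1) powr - s)
     + of_real (a + 1) powr (1 - s) - of_real a powr (1 - s)"

text \<open>Replace the right end a + 1 by a + v. The resulting f satisfies f 0 = f' 0 = 0 and f'' =
  (s - 1) s (s + 1) / 2 * v (a + v)^(-s-2), which is bounded by K. Two applications of the mean
  value inequality along [0, 1] give |f 1| <= K.\<close>

lemma norm_trap_le:
  assumes a: "a > 0" and s: "Re s > -2"
  shows "norm (trap s a) \<le> norm (s - 1) * norm s * norm (s + 1) / 2 * a powr (- Re s - 2)"
proof -
  define S :: "complex set" where "S = closed_segment 0 1"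
  have S: "\<exists>t. 0 \<le> t \<and> t \<le> 1 \<and> v = of_real t" if "v \<in> S" for v
    using that by (auto simp: S_def in_segment scaleR_conv_of_real)
  define f where "f v = (s - 1) / 2 * v * (of_real a powr - s + (of_real a + v) powr - s)
     + (of_real a + v) powr (1 - s) - of_real a powr (1 - s)" for v
  define g where "g v = (s - 1) / 2 * (of_real a powr - s - (of_real a + v) powr - s
     - v * s * (of_real a + v) powr (- s - 1))" for v
  define h where "h v = (s - 1) / 2 * (v * s * (s + 1) * (of_real a + v) powr (- s - 2))" for v
  have nonpos: "of_real a + v \<notin> \<real>\<^sub>\<le>\<^sub>0" "of_real a + v \<noteq> 0" if vS: "v \<in> S" for v
  proof -
    obtain t where t: "0 \<le> t" "v = of_real t" using S[OF vS] by auto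
    have e: "of_real a + v = of_real (a + t)" by (simp add: t)
    show "of_real a + v \<notin> \<real>\<^sub>\<le>\<^sub>0" "of_real a + v \<noteq> 0" unfolding e using t a
      by (auto simp: complex_nonpos_Reals_iff simp del: of_real_add)
  qed
  have conv: "convex S" by (simp add: S_def)
  define K where "K = norm (s - 1) / 2 * (norm s * norm (s + 1) * a powr (- Re s - 2))"
  have df: "(f has_field_derivative g v) (at v within S)" if "v \<in> S" for v
    unfolding f_def g_def using nonpos[OF that]
    by (auto intro!: derivative_eq_intros) (simp add: field_simps)
  have dg: "(g has_field_derivative h v) (at v within S)" if "v \<in> S" for v
  proof -
    have e: "- 2 - s = - s - 2" by simp
    show ?thesis unfolding g_def h_def using nonpos[OF that]
      by (auto intro!: derivative_eq_intros) (simp add: algebra_simps e)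
  qed
  have hK: "norm (h v) \<le> K" if vS: "v \<in> S" for v
  proof -
    obtain t where t: "0 \<le> t" "t \<le> 1" "v = of_real t" using S[OF vS] by auto
    have e: "of_real a + v = of_real (a + t)" by (simp add: t)
    have "norm ((of_real a + v) powr (- s - 2)) = (a + t) powr (- Re s - 2)"
      unfolding e using t a by (subst norm_powr_real_powr) auto
    also have "\<dots> \<le> a powr (- Re s - 2)" using t a s by (intro powr_mono2') auto
    finally have 1: "norm ((of_real a + v) powr (- s - 2)) \<le> a powr (- Re s - 2)" .
    have "norm (h v) = norm (s - 1) / 2 * (t * norm s * norm (s + 1) * norm ((of_real a + v) powr (- s - 2)))"
      using t by (simp add: h_def norm_mult norm_divide)
    also have "\<dots> \<le> norm (s - 1) / 2 * (1 * norm s * norm (s + 1) * a powr (- Re s - 2))"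
      using t 1 by (intro mult_left_mono mult_mono) auto
    finally show ?thesis by (simp add: K_def mult_ac)
  qed
  have z: "0 \<in> S" "1 \<in> S" by (simp_all add: S_def)
  have g0: "g 0 = 0" by (simp add: g_def)
  have K0: "0 \<le> K" using hK[OF z(1)] norm_ge_zero order_trans by blast
  have nS: "norm v \<le> 1" if "v \<in> S" for v using S[OF that] by auto
  have gK: "norm (g v) \<le> K" if v: "v \<in> S" for v
  proof -
    have "norm (g v - g 0) \<le> K * norm (v - 0)"
      by (rule field_differentiable_bound[OF conv dg hK v z(1)])
    also have "\<dots> \<le> K" using nS[OF v] K0 by (simp add: mult_left_le)
    finally show ?thesis by (simp add: g0)
  qed
  have "norm (f 1 - f 0) \<le> K * norm (1 - 0 :: complex)"
    by (rule field_differentiable_bound[OF conv df gK z(2) z(1)])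
  moreover have "f 1 - f 0 = trap s a" by (simp add: f_def trap_def)
  ultimately show ?thesis by (simp add: K_def mult_ac)
qed

text \<open>\<open>zeta_reg s = (s - 1) \<zeta>(s)\<close>, by the trapezoidal rule.\<close>

definition zeta_reg :: "complex \<Rightarrow> complex" where
  "zeta_reg s = 1 + (s - 1) / 2 + (\<Sum>n. trap s (real (Suc n)))"

lemma trap_sum_bound:
  assumes s: "Re s \<ge> \<sigma>" "\<sigma> > -1"
  shows "norm (trap s (real (Suc n))) \<le> norm (s - 1) * norm s * norm (s + 1) / 2 * real (Suc n) powr - (\<sigma> + 2)"
proof -
  have "norm (trap s (real (Suc n))) \<le> norm (s - 1) * norm s * norm (s + 1) / 2 * real (Suc n) powr (- Re s - 2)"
    using s by (intro norm_trap_le) auto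
  also have "\<dots> \<le> norm (s - 1) * norm s * norm (s + 1) / 2 * real (Suc n) powr - (\<sigma> + 2)"
    using s by (intro mult_left_mono powr_mono) auto
  finally show ?thesis .
qed

lemma summable_trap:
  assumes "Re s > -1" shows "summable (\<lambda>n. norm (trap s (real (Suc n))))" "summable (\<lambda>n. trap s (real (Suc n)))"
proof -
  show "summable (\<lambda>n. norm (trap s (real (Suc n))))"
  proof (rule summable_comparison_test'[where N = 0])
    show "summable (\<lambda>n. norm (s - 1) * norm s * norm (s + 1) / 2 * real (Suc n) powr - (Re s + 2))"
      using assms by (intro summable_mult sum_powr_bound) auto
  qed (use trap_sum_bound[of "Re s" s] assms in auto)
  then show "summable (\<lambda>n. trap s (real (Suc n)))" by (rule summable_norm_cancel)
qed

text \<open>The explicit constant is used twice: for the polynomial growth of zeta in a vertical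
  strip, and to exclude zeros on the real segment [-1/4, 1).\<close>

lemma zeta_reg_diff_bound:
  assumes s: "Re s \<ge> \<sigma>" "\<sigma> > -1"
  shows "norm (zeta_reg s - (1 + s) / 2) \<le> norm (s - 1) * norm s * norm (s + 1) / 2 * ((\<sigma> + 2) / (\<sigma> + 1))"
proof -
  have "zeta_reg s - (1 + s) / 2 = (\<Sum>n. trap s (real (Suc n)))" by (simp add: zeta_reg_def field_simps)
  also have "norm \<dots> \<le> (\<Sum>n. norm (trap s (real (Suc n))))"
    using s by (intro summable_norm summable_trap) auto
  also have "\<dots> \<le> (\<Sum>n. norm (s - 1) * norm s * norm (s + 1) / 2 * real (Suc n) powr - (\<sigma> + 2))"
    using s by (intro suminf_le trap_sum_bound summable_trap summable_mult sum_powr_bound) auto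
  also have "\<dots> = norm (s - 1) * norm s * norm (s + 1) / 2 * (\<Sum>n. real (Suc n) powr - (\<sigma> + 2))"
    using s by (intro suminf_mult sum_powr_bound) auto
  also have "\<dots> \<le> norm (s - 1) * norm s * norm (s + 1) / 2 * ((\<sigma> + 2) / (\<sigma> + 1))"
    using sum_powr_bound(2)[of "\<sigma> + 2"] s by (intro mult_left_mono) (auto simp: add.commute)
  finally show ?thesis .
qed

lemma holomorphic_trap: "a > 0 \<Longrightarrow> (\<lambda>s. trap s a) holomorphic_on S"
  unfolding trap_def by (auto intro!: holomorphic_intros)

lemma holomorphic_zeta_reg: "zeta_reg holomorphic_on {s. Re s > -1}"
proof -
  define T where "T s = (\<Sum>n. trap s (real (Suc n)))" for s
  have "T holomorphic_on {s. Re s > -1}"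
  proof (rule holomorphic_uniform_sequence[where f = "\<lambda>N s. \<Sum>n<N. trap s (real (Suc n))"])
    show "open {s. Re s > -1}" by (simp add: open_halfspace_Re_gt)
    show "(\<lambda>s. \<Sum>n<N. trap s (real (Suc n))) holomorphic_on {s. Re s > -1}" for N
      by (intro holomorphic_intros holomorphic_trap) auto
    fix s assume "s \<in> {s. Re s > -1}"
    then have s: "Re s > -1" by simp
    \<comment> \<open>Half the distance to Re s = -1, so that a single exponent sigma + 2 > 1 serves
      on the whole closed disc.\<close>
    define d where "d = (Re s + 1) / 2"
    define \<sigma> where "\<sigma> = (Re s - 1) / 2"
    define B where "B = (norm s + d + 1) ^ 3"
    have d: "d > 0" and sg: "\<sigma> > -1" using s by (auto simp: d_def \<sigma>_def)
    have Rew: "Re w \<ge> \<sigma>" if "w \<in> cball s d" for w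
      using abs_Re_le_cmod[of "s - w"] that by (simp add: dist_norm d_def \<sigma>_def field_simps)
    have sub: "cball s d \<subseteq> {s. Re s > -1}" using Rew sg by force
    have bd: "norm (trap w (real (Suc n))) \<le> B * real (Suc n) powr - (\<sigma> + 2)" if w: "w \<in> cball s d" for w n
    proof -
      have nw: "norm w \<le> norm s + d" using w norm_triangle_sub[of w s] by (simp add: dist_norm norm_minus_commute)
      have "norm (w - 1) * norm w * norm (w + 1) \<le> (norm s + d + 1) * (norm s + d + 1) * (norm s + d + 1)"
        using nw norm_triangle_ineq4[of w 1] norm_triangle_ineq[of w 1] d by (intro mult_mono) auto
      then have "norm (w - 1) * norm w * norm (w + 1) / 2 \<le> B"
        unfolding B_def power3_eq_cube using norm_ge_zero[of "w - 1"]
        by (smt (verit) field_sum_of_halves mult_nonneg_nonneg norm_ge_zero)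
      then have "norm (w - 1) * norm w * norm (w + 1) / 2 * real (Suc n) powr - (\<sigma> + 2) \<le> B * real (Suc n) powr - (\<sigma> + 2)"
        by (intro mult_right_mono) auto
      with trap_sum_bound[OF Rew[OF w] sg, of n] show ?thesis by linarith
    qed
    have "uniform_limit (cball s d) (\<lambda>N s. \<Sum>n<N. trap s (real (Suc n))) T sequentially"
      unfolding T_def
      by (rule Weierstrass_m_test[OF bd], assumption, intro summable_mult sum_powr_bound) (use sg in auto)
    with d sub show "\<exists>d>0. cball s d \<subseteq> {s. Re s > -1} \<and>
       uniform_limit (cball s d) (\<lambda>N s. \<Sum>n<N. trap s (real (Suc n))) T sequentially" by blast
  qed
  then show ?thesis unfolding zeta_reg_def T_def by (intro holomorphic_intros) auto
qed

lemma summable_dirichlet: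
  assumes "Re s > 1"
  shows "summable (\<lambda>n. 1 / (of_nat (Suc n) :: complex) powr s)"
    "summable (\<lambda>n. norm (1 / (of_nat (Suc n) :: complex) powr s))"
proof -
  have "norm (1 / (of_nat (Suc n) :: complex) powr s) = real (Suc n) powr - Re s" for n
    using norm_powr_real_powr[of "of_nat (Suc n)" s] by (simp add: norm_divide powr_minus field_simps)
  then show "summable (\<lambda>n. norm (1 / (of_nat (Suc n) :: complex) powr s))"
    using sum_powr_bound(1)[OF assms] by simp
  then show "summable (\<lambda>n. 1 / (of_nat (Suc n) :: complex) powr s)" by (rule summable_norm_cancel)
qed

lemma zeta_reg_eq_dirichlet:
  assumes s: "Re s > 1"
  shows "zeta_reg s = (s - 1) * (\<Sum>n. 1 / (of_nat (Suc n)) powr s)"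
proof -
  let ?c = "\<lambda>n. of_nat n :: complex"
  \<comment> \<open>Each interior point collects half a weight from either side and the powers with
    exponent 1 - s telescope; what remains at the end point N + 1 tends to 0 for Re s > 1.\<close>
  have part: "1 + (s - 1) / 2 + (\<Sum>n<N. trap s (real (Suc n))) =
     (s - 1) * ((\<Sum>n<N. 1 / ?c (Suc n) powr s) + ?c (Suc N) powr - s / 2) + ?c (Suc N) powr (1 - s)" for N
  proof (induction N)
    case (Suc N)
    have e: "1 / ?c (Suc N) powr s = ?c (Suc N) powr - s" by (simp add: powr_minus field_simps)
    have "1 + (s - 1) / 2 + (\<Sum>n<Suc N. trap s (real (Suc n))) =
      (1 + (s - 1) / 2 + (\<Sum>n<N. trap s (real (Suc n)))) + trap s (real (Suc N))" by simp
    also have "\<dots> = (s - 1) * ((\<Sum>n<Suc N. 1 / ?c (Suc n) powr s) + ?c (Suc (Suc N)) powr - s / 2) + ?c (Suc (Suc N)) powr (1 - s)"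
      unfolding Suc.IH sum.lessThan_Suc e unfolding trap_def
      by (simp add: algebra_simps add_divide_distrib diff_divide_distrib)
    finally show ?case .
  qed simp
  have lim0: "(\<lambda>N. ?c (Suc N) powr - p) \<longlonglongrightarrow> 0" if "Re p > 0" for p
  proof (rule tendsto_norm_zero_cancel)
    have "norm (?c (Suc N) powr - p) = real (Suc N) powr - Re p" for N
      using norm_powr_real_powr[of "of_nat (Suc N)" "- p"] by simp
    moreover have "(\<lambda>N. real (Suc N) powr - Re p) \<longlonglongrightarrow> 0"
      using that by (intro tendsto_neg_powr filterlim_compose[OF filterlim_real_sequentially filterlim_Suc]) auto
    ultimately show "(\<lambda>N. norm (?c (Suc N) powr - p)) \<longlonglongrightarrow> 0" by simp
  qed
  have l1: "(\<lambda>N. ?c (Suc N) powr - s) \<longlonglongrightarrow> 0" using s by (intro lim0) auto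
  have l2: "(\<lambda>N. ?c (Suc N) powr (1 - s)) \<longlonglongrightarrow> 0" using lim0[of "s - 1"] s by simp
  have "(\<lambda>N. (s - 1) * ((\<Sum>n<N. 1 / ?c (Suc n) powr s) + ?c (Suc N) powr - s / 2) + ?c (Suc N) powr (1 - s))
     \<longlonglongrightarrow> (s - 1) * ((\<Sum>n. 1 / ?c (Suc n) powr s) + 0 / 2) + 0"
    by (intro tendsto_intros l1 l2 summable_LIMSEQ summable_dirichlet s) auto
  moreover have "(\<lambda>N. 1 + (s - 1) / 2 + (\<Sum>n<N. trap s (real (Suc n)))) \<longlonglongrightarrow> zeta_reg s"
    unfolding zeta_reg_def using s by (intro tendsto_intros summable_LIMSEQ summable_trap) auto
  ultimately show ?thesis unfolding part using LIMSEQ_unique by fastforce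
qed

lemma zeta_reg_1 [simp]: "zeta_reg 1 = 1"
proof -
  have "trap 1 a = 0" if "a > 0" for a
    using that of_real_eq_0_iff[of "a + 1", where ?'a = complex] by (simp add: trap_def del: of_real_add)
  then show ?thesis by (simp add: zeta_reg_def del: of_nat_Suc)
qed

lemma zeta_reg_cnj:
  assumes "Re s > -1"
  shows "zeta_reg (cnj s) = cnj (zeta_reg s)"
proof -
  have "cnj (trap s (real (Suc n))) = trap (cnj s) (real (Suc n))" for n
    by (simp add: trap_def cnj_powr del: of_nat_Suc)
  then have "(\<lambda>n. trap (cnj s) (real (Suc n))) sums cnj (\<Sum>n. trap s (real (Suc n)))"
    using summable_sums[OF summable_trap(2)[OF assms]] sums_cnj[of "\<lambda>n. trap s (real (Suc n))"] by simp
  then show ?thesis by (simp add: zeta_reg_def sums_iff)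
qed

text \<open>A real zero would lie inside the contour but not among those with gamma > 0. The main
  part (1 + s) / 2 wins: with sigma = -1/4 the relative error is (1 - s) |s| * 7/3 <= 35/48.\<close>

lemma zeta_reg_real_nonzero:
  assumes s: "-1/4 \<le> s" "s < 1"
  shows "zeta_reg (of_real s) \<noteq> 0"
proof
  assume z: "zeta_reg (of_real s) = 0"
  have "norm (zeta_reg (of_real s) - (1 + of_real s) / 2)
     \<le> norm (of_real s - 1 :: complex) * norm (of_real s :: complex) * norm (of_real s + 1 :: complex) / 2 * ((-1/4 + 2) / (-1/4 + 1))"
    by (rule zeta_reg_diff_bound) (use s in auto)
  moreover have "norm (of_real s - 1 :: complex) = 1 - s" "norm (of_real s + 1 :: complex) = 1 + s"
    "norm ((1 + of_real s :: complex) / 2) = (1 + s) / 2"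
    using s norm_of_real[of "s - 1", where ?'a = complex] norm_of_real[of "s + 1", where ?'a = complex]
      norm_of_real[of "(1 + s) / 2", where ?'a = complex] by auto
  ultimately have "(1 + s) / 2 \<le> (1 - s) * \<bar>s\<bar> * (1 + s) / 2 * (7 / 3)" using z by (simp add: norm_minus_commute)
  then have "(1 + s) * 1 \<le> (1 + s) * ((1 - s) * \<bar>s\<bar> * (7 / 3))" by (simp add: field_simps)
  then have "1 \<le> (1 - s) * \<bar>s\<bar> * (7 / 3)" using s by (subst (asm) mult_le_cancel_left_pos) auto
  moreover have "(1 - s) * \<bar>s\<bar> \<le> 5 / 16"
  proof (cases "s \<ge> 0")
    case True
    have "(1 - s) * s \<le> 1 / 4" using zero_le_power2[of "s - 1/2"] by (simp add: power2_eq_square algebra_simps)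
    then show ?thesis using True by simp
  next
    case False
    have "(1 - s) * (- s) \<le> (5 / 4) * (1 / 4)" using s False by (intro mult_mono) auto
    then show ?thesis using False by simp
  qed
  ultimately show False by linarith
qed

section \<open>The functional equation on a real interval\<close>

text \<open>The Gamma integral, rescaled. All integrands in the Mellin computation are nonnegative,
  so extended-valued integrals are used: exchange of integrals and sums is then free, and finiteness
  comes with the value.\<close>

lemma nn_integral_powr_exp:
  fixes a u :: real
  assumes a: "a > 0" and u: "u > 0"
  shows "(\<integral>\<^sup>+x. ennreal (indicator {0<..} x * (x powr (a - 1) * exp (- (u * x)))) \<partial>lborel)
    = ennreal (Gamma a * u powr - a)"
proof -
  have "(\<integral>\<^sup>+x. ennreal (indicator {0<..} x * (x powr (a - 1) * exp (- (u * x)))) \<partial>lborel)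
     = \<bar>1 / u\<bar> * (\<integral>\<^sup>+x. ennreal (indicator {0<..} (0 + 1 / u * x) * ((0 + 1 / u * x) powr (a - 1) * exp (- (u * (0 + 1 / u * x))))) \<partial>lborel)"
    using u by (intro nn_integral_real_affine) auto
  also have "(\<integral>\<^sup>+x. ennreal (indicator {0<..} (0 + 1 / u * x) * ((0 + 1 / u * x) powr (a - 1) * exp (- (u * (0 + 1 / u * x))))) \<partial>lborel)
     = (\<integral>\<^sup>+x. ennreal (u powr (1 - a)) * ennreal (indicator {0..} x * x powr (a - 1) / exp x) \<partial>lborel)"
  proof (intro nn_integral_cong_AE eventually_mono[OF AE_lborel_singleton[of 0]])
    fix x :: real assume "x \<noteq> 0"
    then show "ennreal (indicator {0<..} (0 + 1 / u * x) * ((0 + 1 / u * x) powr (a - 1) * exp (- (u * (0 + 1 / u * x)))))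
      = ennreal (u powr (1 - a)) * ennreal (indicator {0..} x * x powr (a - 1) / exp x)"
      using u by (cases "x > 0")
        (auto simp: ennreal_mult'[symmetric] powr_divide exp_minus powr_diff field_simps zero_less_divide_iff)
  qed
  also have "\<dots> = ennreal (u powr (1 - a)) * ennreal (Gamma a)"
    by (subst nn_integral_cmult) (auto simp: Gamma_conv_nn_integral_real[OF a])
  also have "ennreal \<bar>1 / u\<bar> * (ennreal (u powr (1 - a)) * ennreal (Gamma a)) = ennreal (Gamma a * u powr - a)"
    using u a Gamma_real_pos[OF a] by (simp add: ennreal_mult'[symmetric] powr_diff powr_minus field_simps)
  finally show ?thesis .
qed

text \<open>Write 1 / (1 + w) as the integral of exp (- y (1 + w)) over y > 0 and exchange: the
  integral in w yields Gamma a * y^(-a) exp (- y), the one in y then Gamma (1 - a).\<close>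

lemma nn_integral_inverse_linear:
  fixes a :: real
  assumes a: "0 < a" "a < 1"
  shows "(\<integral>\<^sup>+w. ennreal (indicator {0<..} w * (w powr (a - 1) / (1 + w))) \<partial>lborel) = ennreal (Gamma a * Gamma (1 - a))"
proof -
  have "(\<integral>\<^sup>+w. ennreal (indicator {0<..} w * (w powr (a - 1) / (1 + w))) \<partial>lborel)
     = (\<integral>\<^sup>+w. \<integral>\<^sup>+y. ennreal (indicator {0<..} w * indicator {0<..} y * (w powr (a - 1) * exp (- (y * (1 + w))))) \<partial>lborel \<partial>lborel)"
  proof (rule nn_integral_cong)
    fix w :: real
    show "ennreal (indicator {0<..} w * (w powr (a - 1) / (1 + w)))
       = (\<integral>\<^sup>+y. ennreal (indicator {0<..} w * indicator {0<..} y * (w powr (a - 1) * exp (- (y * (1 + w))))) \<partial>lborel)"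
    proof (cases "w > 0")
      case True
      have "(\<integral>\<^sup>+y. ennreal (indicator {0<..} w * indicator {0<..} y * (w powr (a - 1) * exp (- (y * (1 + w))))) \<partial>lborel)
        = (\<integral>\<^sup>+y. ennreal (w powr (a - 1)) * ennreal (indicator {0<..} y * (y powr (1 - 1) * exp (- ((1 + w) * y)))) \<partial>lborel)"
        using True by (intro nn_integral_cong) (auto simp: ennreal_mult'[symmetric] indicator_def mult.commute)
      also have "\<dots> = ennreal (w powr (a - 1)) * ennreal (Gamma 1 * (1 + w) powr - 1)"
        using True by (subst nn_integral_cmult, measurable, subst nn_integral_powr_exp) auto
      also have "\<dots> = ennreal (indicator {0<..} w * (w powr (a - 1) / (1 + w)))"
        using True by (simp add: ennreal_mult'[symmetric] powr_minus divide_inverse)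
      finally show ?thesis by simp
    qed simp
  qed
  also have "\<dots> = (\<integral>\<^sup>+y. \<integral>\<^sup>+w. ennreal (indicator {0<..} w * indicator {0<..} y * (w powr (a - 1) * exp (- (y * (1 + w))))) \<partial>lborel \<partial>lborel)"
    by (rule lborel_pair.Fubini') measurable
  also have "\<dots> = (\<integral>\<^sup>+y. ennreal (Gamma a) * ennreal (indicator {0<..} y * (y powr ((1 - a) - 1) * exp (- (1 * y)))) \<partial>lborel)"
  proof (rule nn_integral_cong)
    fix y :: real
    show "(\<integral>\<^sup>+w. ennreal (indicator {0<..} w * indicator {0<..} y * (w powr (a - 1) * exp (- (y * (1 + w))))) \<partial>lborel)
        = ennreal (Gamma a) * ennreal (indicator {0<..} y * (y powr ((1 - a) - 1) * exp (- (1 * y))))"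
    proof (cases "y > 0")
      case True
      have "(\<integral>\<^sup>+w. ennreal (indicator {0<..} w * indicator {0<..} y * (w powr (a - 1) * exp (- (y * (1 + w))))) \<partial>lborel)
         = (\<integral>\<^sup>+w. ennreal (exp (- y)) * ennreal (indicator {0<..} w * (w powr (a - 1) * exp (- (y * w)))) \<partial>lborel)"
        using True by (intro nn_integral_cong)
          (auto simp: ennreal_mult'[symmetric] indicator_def algebra_simps exp_diff exp_minus field_simps)
      also have "\<dots> = ennreal (exp (- y)) * ennreal (Gamma a * y powr - a)"
        using True a by (subst nn_integral_cmult, measurable, subst nn_integral_powr_exp) auto
      finally show ?thesis using True a Gamma_real_pos[of a] by (simp add: ennreal_mult'[symmetric] mult_ac)
    qed simp
  qed
  also have "\<dots> = ennreal (Gamma a) * ennreal (Gamma (1 - a) * 1 powr - (1 - a))"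
    using a by (subst nn_integral_cmult, measurable, subst nn_integral_powr_exp) auto
  also have "\<dots> = ennreal (Gamma a * Gamma (1 - a))"
    using a Gamma_real_pos[of a] by (simp add: ennreal_mult'[symmetric])
  finally show ?thesis .
qed

lemma has_integral_nn_integral_indicator:
  fixes f :: "real \<Rightarrow> real"
  assumes m: "(\<lambda>x. indicator S x * f x) \<in> borel_measurable borel" and nn: "\<And>x. x \<in> S \<Longrightarrow> 0 \<le> f x" and r: "0 \<le> r"
    and I: "(\<integral>\<^sup>+x. ennreal (indicator S x * f x) \<partial>lborel) = ennreal r"
  shows "(f has_integral r) S"
proof -
  have "((\<lambda>x. indicator S x * f x) has_integral r) UNIV"
    by (rule nn_integral_has_integral[OF m _ I r]) (auto simp: indicator_def nn)
  then have "((\<lambda>x. if x \<in> S then f x else 0) has_integral r) UNIV"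
    by (rule has_integral_eq[rotated]) (auto simp: indicator_def)
  then show ?thesis by (simp only: has_integral_restrict_UNIV)
qed

text \<open>The substitution w = (x / c)^2 leads to the previous integral with a = (s + 1) / 2, and
  the value pi / sin (pi a) from the reflection formula becomes pi / cos (pi s / 2).\<close>

lemma nn_integral_inverse_quadratic:
  fixes s c :: real
  assumes s: "-1 < s" "s < 1" and c: "c > 0"
  shows "(\<integral>\<^sup>+x. ennreal (indicator {0<..} x * (2 * x powr s / (x\<^sup>2 + c\<^sup>2))) \<partial>lborel)
    = ennreal (c powr (s - 1) * (pi / cos (pi * s / 2)))"
proof -
  define a where "a = (s + 1) / 2"
  have a: "0 < a" "a < 1" using s by (auto simp: a_def)
  define G where "G = Gamma a * Gamma (1 - a)"
  have G0: "G \<ge> 0" unfolding G_def using a Gamma_real_pos[of a] Gamma_real_pos[of "1 - a"] by simp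
  have "of_real G = Gamma (of_real a) * Gamma (1 - of_real a :: complex)"
    by (simp add: G_def Gamma_complex_of_real[symmetric])
  also have "\<dots> = of_real (pi / sin (pi * a))"
    by (simp add: Gamma_reflection_complex flip: sin_of_real)
  finally have G: "G = pi / cos (pi * s / 2)"
  proof -
    have e: "pi * a = pi * s / 2 + pi / 2" by (simp add: a_def field_simps)
    show "of_real G = complex_of_real (pi / sin (pi * a)) \<Longrightarrow> ?thesis" unfolding of_real_eq_iff e by (simp add: sin_add)
  qed
  have "((\<lambda>w. w powr (a - 1) / (1 + w)) has_integral G) {0<..}"
    unfolding G_def by (rule has_integral_nn_integral_indicator[OF _ _ _ nn_integral_inverse_linear[OF a]])
       (use G0 G_def in auto)
  moreover have "g ` {0<..} = {0<..}" if "g = (\<lambda>x. (x / c)\<^sup>2)" for g :: "real \<Rightarrow> real"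
  proof -
    have "x \<in> g ` {0<..}" if "x > 0" for x
      by (rule image_eqI[of _ _ "c * sqrt x"]) (use that c \<open>g = _\<close> in auto)
    then show ?thesis using c \<open>g = _\<close> by auto
  qed
  moreover have "(\<lambda>w. w powr (a - 1) / (1 + w)) absolutely_integrable_on {0<..}"
    using calculation(1) by (intro nonnegative_absolutely_integrable_1) auto
  ultimately have "(\<lambda>w. w powr (a - 1) / (1 + w)) absolutely_integrable_on (\<lambda>x. (x / c)\<^sup>2) ` {0<..} \<and>
     integral ((\<lambda>x. (x / c)\<^sup>2) ` {0<..}) (\<lambda>w. w powr (a - 1) / (1 + w)) = G" by (simp add: integral_unique)
  then have *: "(\<lambda>x. \<bar>2 * x / c\<^sup>2\<bar> * (((x / c)\<^sup>2) powr (a - 1) / (1 + (x / c)\<^sup>2))) absolutely_integrable_on {0<..} \<and>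
     integral {0<..} (\<lambda>x. \<bar>2 * x / c\<^sup>2\<bar> * (((x / c)\<^sup>2) powr (a - 1) / (1 + (x / c)\<^sup>2))) = G"
  proof (rule has_absolute_integral_change_of_variables_1'[THEN iffD2, rotated 3])
    show "((\<lambda>x. (x / c)\<^sup>2) has_field_derivative 2 * x / c\<^sup>2) (at x within {0<..})" for x
      using c by (auto intro!: derivative_eq_intros simp: power2_eq_square)
    show "inj_on (\<lambda>x. (x / c)\<^sup>2) {0<..}"
      using c by (auto intro!: inj_onI simp: power_divide)
  qed auto
  then have "((\<lambda>x. \<bar>2 * x / c\<^sup>2\<bar> * (((x / c)\<^sup>2) powr (a - 1) / (1 + (x / c)\<^sup>2))) has_integral G) {0<..}"
    using integrable_integral[OF set_lebesgue_integral_eq_integral(1)[OF conjunct1[OF *]]] conjunct2[OF *] by metis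
  then have "((\<lambda>x. c powr (s - 1) * (\<bar>2 * x / c\<^sup>2\<bar> * (((x / c)\<^sup>2) powr (a - 1) / (1 + (x / c)\<^sup>2)))) has_integral c powr (s - 1) * G) {0<..}"
    by (rule has_integral_mult_right)
  moreover have "c powr (s - 1) * (\<bar>2 * x / c\<^sup>2\<bar> * (((x / c)\<^sup>2) powr (a - 1) / (1 + (x / c)\<^sup>2))) = 2 * x powr s / (x\<^sup>2 + c\<^sup>2)"
    if x: "x > 0" for x
  proof -
    have "((x / c)\<^sup>2) powr (a - 1) = ((x / c) powr 2) powr (a - 1)" using x c by simp
    also have "\<dots> = (x / c) powr (2 * (a - 1))" by (rule powr_powr)
    also have "(x / c) powr (2 * (a - 1)) = (x / c) powr (s - 1)"
    proof -
      have "2 * (a - 1) = s - 1" by (simp add: a_def field_simps)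
      then show ?thesis by (simp only:)
    qed
    also have "\<dots> = x powr s / x / (c powr (s - 1))"
      using x c by (simp add: powr_divide powr_diff)
    finally have e: "((x / c)\<^sup>2) powr (a - 1) = x powr s / x / (c powr (s - 1))" .
    have e2: "1 + (x / c)\<^sup>2 = (x\<^sup>2 + c\<^sup>2) / c\<^sup>2" using c by (simp add: power_divide field_simps)
    have "x\<^sup>2 + c\<^sup>2 \<noteq> 0" using x by (simp add: sum_power2_eq_zero_iff)
    moreover have "k * (\<bar>2 * x / c\<^sup>2\<bar> * (x powr s / x / k / (N / c\<^sup>2))) = 2 * x powr s / N" if "k > 0" "N \<noteq> 0" for k N
      using that x c by simp
    moreover have "c powr (s - 1) > 0" using c by simp
    ultimately show ?thesis unfolding e e2 by blast
  qed
  ultimately have "((\<lambda>x. 2 * x powr s / (x\<^sup>2 + c\<^sup>2)) has_integral c powr (s - 1) * G) {0<..}"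
    by (subst has_integral_cong[of _ _ "\<lambda>x. c powr (s - 1) * (\<bar>2 * x / c\<^sup>2\<bar> * (((x / c)\<^sup>2) powr (a - 1) / (1 + (x / c)\<^sup>2)))"]) auto
  from nn_integral_has_integral_lebesgue[OF _ this] show ?thesis unfolding G by simp
qed

text \<open>Differentiating rGamma z * rGamma (1 - z) = sin (pi z) / pi gives Digamma (1 - z) -
  Digamma z = pi cot (pi z). At z = i x / (2 pi) the cotangent becomes coth (x / 2), and the two
  digamma series combine to the partial fractions.\<close>

lemma half_coth_pfd:
  fixes x :: real
  assumes x: "x > 0"
  shows "(\<lambda>n. 2 * x / (x\<^sup>2 + (2 * pi * real (Suc n))\<^sup>2)) sums ((exp x + 1) / (exp x - 1) / 2 - 1 / x)"
proof -
  define y where "y = x / (2 * pi)"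
  define z where "z = \<i> * of_real y"
  have y: "y > 0" using x by (simp add: y_def)
  have zn: "z \<noteq> 0" using y by (simp add: z_def)
  have np: "z \<notin> \<int>\<^sub>\<le>\<^sub>0" "1 - z \<notin> \<int>\<^sub>\<le>\<^sub>0" "1 + z \<notin> \<int>\<^sub>\<le>\<^sub>0"
    using y by (auto simp: z_def complex_eq_iff elim!: nonpos_Ints_cases)
  have d1: "((\<lambda>z. rGamma z * rGamma (1 - z)) has_field_derivative
      - rGamma z * Digamma z * rGamma (1 - z) + rGamma z * (rGamma (1 - z) * Digamma (1 - z))) (at z)"
    using np by (auto intro!: derivative_eq_intros has_field_derivative_rGamma_no_nonpos_int[THEN DERIV_chain2] simp: algebra_simps)
  have d2: "((\<lambda>z. rGamma z * rGamma (1 - z)) has_field_derivative cos (of_real pi * z)) (at z)"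
    unfolding rGamma_reflection_complex by (auto intro!: derivative_eq_intros)
  have "cos (of_real pi * z) = rGamma z * rGamma (1 - z) * (Digamma (1 - z) - Digamma z)"
    using DERIV_unique[OF d2 d1] by (simp add: algebra_simps)
  also have "\<dots> = sin (of_real pi * z) / of_real pi * (Digamma (1 - z) - Digamma (1 + z) + 1 / z)"
    unfolding rGamma_reflection_complex using Digamma_plus1[OF zn] by (simp add: add.commute)
  finally have e1: "cos (of_real pi * z) = sin (of_real pi * z) / of_real pi * (Digamma (1 - z) - Digamma (1 + z) + 1 / z)" .
  have S: "(\<lambda>k. inverse (of_nat (Suc k)) - inverse (w + of_nat k)) sums (Digamma w + euler_mascheroni)" if "w \<notin> \<int>\<^sub>\<le>\<^sub>0" for w :: complex
  proof -
    have "w \<noteq> 0" using that by auto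
    then show ?thesis using summable_sums[OF summable_Digamma[of w]] by (simp add: Digamma_def)
  qed
  have "(\<lambda>k. (inverse (of_nat (Suc k)) - inverse (1 - z + of_nat k)) - (inverse (of_nat (Suc k)) - inverse (1 + z + of_nat k)))
     sums (Digamma (1 - z) + euler_mascheroni - (Digamma (1 + z) + euler_mascheroni))"
    by (intro sums_diff S np)
  moreover have "(inverse (of_nat (Suc k)) - inverse (1 - z + of_nat k)) - (inverse (of_nat (Suc k)) - inverse (1 + z + of_nat k))
     = - \<i> * of_real (2 * y / (y\<^sup>2 + (real (Suc k))\<^sup>2))" for k
  proof -
    define m where "m = real (Suc k)"
    have m: "m > 0" by (simp add: m_def)
    have n1: "of_real m + z \<noteq> 0" "of_real m - z \<noteq> 0" using m by (auto simp: z_def complex_eq_iff)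
    have n3: "(of_real m + z) * (of_real m - z) = of_real (y\<^sup>2 + m\<^sup>2)"
      by (simp add: z_def algebra_simps power2_eq_square)
    have "inverse (of_real m + z) - inverse (of_real m - z) = - 2 * z / ((of_real m + z) * (of_real m - z))"
      using n1 by (simp add: field_simps)
    also have "\<dots> = - \<i> * of_real (2 * y / (y\<^sup>2 + m\<^sup>2))" unfolding n3 by (simp add: z_def)
    finally show ?thesis by (simp add: m_def algebra_simps)
  qed
  ultimately have s1: "(\<lambda>k. - \<i> * of_real (2 * y / (y\<^sup>2 + (real (Suc k))\<^sup>2))) sums (Digamma (1 - z) - Digamma (1 + z))" by simp
  have sn: "sin (of_real pi * z) = \<i> * of_real (sinh (pi * y))"
    by (simp add: z_def sin_exp_eq sinh_def exp_minus scaleR_conv_of_real field_simps flip: exp_of_real)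
  have cs: "cos (of_real pi * z) = of_real (cosh (pi * y))"
    by (simp add: z_def cos_exp_eq cosh_def exp_minus scaleR_conv_of_real field_simps flip: exp_of_real)
  have sh: "sinh (pi * y) > 0" using y by simp
  have sn0: "sin (of_real pi * z) \<noteq> 0" unfolding sn using sh y by simp
  have "Digamma (1 - z) - Digamma (1 + z) + 1 / z = of_real pi * cos (of_real pi * z) / sin (of_real pi * z)"
    unfolding e1 using sn0 by simp
  then have "Digamma (1 - z) - Digamma (1 + z) = of_real pi * cos (of_real pi * z) / sin (of_real pi * z) - 1 / z"
    by (simp add: eq_diff_eq)
  also have "\<dots> = - \<i> * of_real (pi * cosh (pi * y) / sinh (pi * y) - 1 / y)"
    unfolding sn cs using sh y by (simp add: z_def field_simps)
  finally have "(\<lambda>k. - \<i> * of_real (2 * y / (y\<^sup>2 + (real (Suc k))\<^sup>2))) sums (- \<i> * of_real (pi * cosh (pi * y) / sinh (pi * y) - 1 / y))"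
    using s1 by simp
  then have "(\<lambda>k. complex_of_real (2 * y / (y\<^sup>2 + (real (Suc k))\<^sup>2))) sums (of_real (pi * cosh (pi * y) / sinh (pi * y) - 1 / y))"
    by (subst (asm) sums_mult_iff) auto
  then have "(\<lambda>k. 2 * y / (y\<^sup>2 + (real (Suc k))\<^sup>2)) sums (pi * cosh (pi * y) / sinh (pi * y) - 1 / y)"
    by (simp only: sums_of_real_iff)
  then have "(\<lambda>k. 2 * y / (y\<^sup>2 + (real (Suc k))\<^sup>2) / (2 * pi)) sums ((pi * cosh (pi * y) / sinh (pi * y) - 1 / y) / (2 * pi))"
    by (rule sums_divide)
  moreover have "2 * y / (y\<^sup>2 + (real (Suc k))\<^sup>2) / (2 * pi) = 2 * x / (x\<^sup>2 + (2 * pi * real (Suc k))\<^sup>2)" for k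
  proof -
    have "y\<^sup>2 + (real (Suc k))\<^sup>2 = (x\<^sup>2 + (2 * pi * real (Suc k))\<^sup>2) / (4 * pi\<^sup>2)"
      by (simp add: y_def power_divide power_mult_distrib add_divide_distrib)
    then have "2 * y / (y\<^sup>2 + (real (Suc k))\<^sup>2) / (2 * pi) = 2 * y / (u / (4 * pi\<^sup>2)) / (2 * pi)"
      if "u = x\<^sup>2 + (2 * pi * real (Suc k))\<^sup>2" for u using that by simp
    also have "2 * y / (u / (4 * pi\<^sup>2)) / (2 * pi) = 2 * x / u" for u
      by (simp add: y_def power2_eq_square)
    finally show ?thesis by simp
  qed
  moreover have "(pi * cosh (pi * y) / sinh (pi * y) - 1 / y) / (2 * pi) = (exp x + 1) / (exp x - 1) / 2 - 1 / x"
  proof -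
    have e: "pi * y = x / 2" by (simp add: y_def)
    have ex: "exp x = exp (x / 2) * exp (x / 2)" by (simp flip: exp_add)
    have p: "exp (x / 2) > 1" using x by simp
    then have "exp (x/2) * exp (x/2) > 1 * 1" by (intro mult_strict_mono) auto
    then have "cosh (x / 2) / sinh (x / 2) = (exp x + 1) / (exp x - 1)"
      unfolding ex cosh_def sinh_def using p by (simp add: exp_minus field_simps)
    moreover have "(pi * cosh (pi * y) / sinh (pi * y) - 1 / y) / (2 * pi) = cosh (x / 2) / sinh (x / 2) / 2 - 1 / x"
      unfolding e using x by (simp add: y_def field_simps)
    ultimately show ?thesis by simp
  qed
  ultimately show ?thesis by simp
qed

text \<open>The Peano kernel v (1 - v) / 2 of the trapezoidal rule applied to exp (- v x): the
  bracket on the right is the trapezoidal value minus the integral over [0, 1].\<close>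

lemma trapezoid_kernel_exp:
  fixes x :: real
  assumes x: "x > 0"
  shows "(\<integral>\<^sup>+v. ennreal (indicator {0..1} v * (v * (1 - v) * exp (- (v * x)))) \<partial>lborel)
    = ennreal (2 / x\<^sup>2 * ((1 + exp (- x)) / 2 - (1 - exp (- x)) / x))" (is "?I = ennreal ?r")
    and "0 \<le> 2 / x\<^sup>2 * ((1 + exp (- x)) / 2 - (1 - exp (- x)) / x)"
proof -
  define W where "W v = - (v * (1 - v) / x + (1 - 2 * v) / x\<^sup>2 - 2 / x ^ 3) * exp (- (v * x))" for v
  have hi: "((\<lambda>v. v * (1 - v) * exp (- (v * x))) has_integral (W 1 - W 0)) {0..1}"
  proof (rule fundamental_theorem_of_calculus)
    fix v :: real
    show "(W has_vector_derivative v * (1 - v) * exp (- (v * x))) (at v within {0..1})"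
      unfolding W_def has_real_derivative_iff_has_vector_derivative[symmetric] using x
      by (auto intro!: derivative_eq_intros simp: field_simps power2_eq_square power3_eq_cube)
  qed simp
  have W: "W 1 - W 0 = ?r"
    using x by (simp add: W_def field_simps power2_eq_square power3_eq_cube)
  show "0 \<le> ?r" unfolding W[symmetric] by (rule has_integral_nonneg[OF hi]) auto
  from nn_integral_has_integral_lebesgue[OF _ hi] show "?I = ennreal ?r" unfolding W by simp
qed

text \<open>The Peano kernel again, now for u^(-s) on [a, a + 1]. The case a = 0 is included because
  the interval [0, 1] has to enter the sum for zeta; the second derivative is singular at 0, but the
  factor v makes the integral converge for s < 0.\<close>

lemma trapezoid_kernel_powr:
  fixes s a :: real
  assumes s: "-1 < s" "s < 0" and a: "a \<ge> 0"
  shows "(\<integral>\<^sup>+v. ennreal (indicator {0..1} v * (v * (1 - v) * (a + v) powr (- s - 2))) \<partial>lborel)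
    = ennreal (2 / (s * (s + 1)) * ((a powr - s + (a + 1) powr - s) / 2 - ((a + 1) powr (1 - s) - a powr (1 - s)) / (1 - s)))" (is "?I = ennreal ?r")
    and "0 \<le> 2 / (s * (s + 1)) * ((a powr - s + (a + 1) powr - s) / 2 - ((a + 1) powr (1 - s) - a powr (1 - s)) / (1 - s))"
proof -
  \<comment> \<open>The product v (a + v)^(-s-1) is written as (a + v)^(-s) - a (a + v)^(-s-1): for
    a = 0 the singular power carries the coefficient 0, so W is continuous up to v = 0 and the
    fundamental theorem with interior derivatives applies.\<close>
  define W where "W v = (1 - v) * ((a + v) powr - s - a * (a + v) powr (- s - 1)) / (- s - 1)
     + (1 - 2 * v) * (a + v) powr - s / ((- s - 1) * s) - 2 * (a + v) powr (1 - s) / ((s + 1) * s * (1 - s))" for v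
  have hi: "((\<lambda>v. v * (1 - v) * (a + v) powr (- s - 2)) has_integral (W 1 - W 0)) {0..1}"
  proof (rule fundamental_theorem_of_calculus_interior)
    have c: "continuous_on {0..1} (\<lambda>v. (a + v) powr p)" if "p > 0" for p
      using a that by (intro continuous_on_powr' continuous_intros) auto
    have "continuous_on {0..1} (\<lambda>v. a * (a + v) powr (- s - 1))"
    proof (cases "a = 0")
      case False
      then show ?thesis using a by (intro continuous_intros) auto
    qed simp
    moreover have "continuous_on {0..1} (\<lambda>v. (a + v) powr - s)" "continuous_on {0..1} (\<lambda>v. (a + v) powr (1 - s))"
      using s by (intro c; simp)+
    ultimately have cW: "continuous_on {0..1} (\<lambda>v. (a + v) powr - s - a * (a + v) powr (- s - 1))"
      and c2: "continuous_on {0..1} (\<lambda>v. (a + v) powr - s)" and c3: "continuous_on {0..1} (\<lambda>v. (a + v) powr (1 - s))"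
      by (auto intro: continuous_on_diff)
    have gen: "continuous_on A (\<lambda>v. (1 - v) * f v / c1 + (1 - 2 * v) * g v / c2 - 2 * h v / c3)"
      if "continuous_on A f" "continuous_on A g" "continuous_on A h" for A f g h and c1 c2 c3 :: real
      unfolding divide_inverse by (intro continuous_intros that)
    show "continuous_on {0..1} W" unfolding W_def by (rule gen[OF cW c2 c3])
    fix v :: real assume v: "v \<in> {0<..<1}"
    then have av: "a + v > 0" using a by simp
    define p where "p = (a + v) powr (- s - 2)"
    have p1: "(a + v) powr (- s - 1) = (a + v) * p" "(a + v) powr - s = (a + v)\<^sup>2 * p" "(a + v) powr (1 - s) = (a + v)^3 * p"
    proof -
      define q where "q = - s - 2"
      have e: "- s - 1 = 1 + q" "- s = 2 + q" "1 - s = 3 + q" "- s - 2 = q" by (auto simp: q_def)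
      show "(a + v) powr (- s - 1) = (a + v) * p" "(a + v) powr - s = (a + v)\<^sup>2 * p" "(a + v) powr (1 - s) = (a + v)^3 * p"
        unfolding p_def e using av powr_mult_base[of "a + v" q] powr_add[of "a + v" 2 q] powr_add[of "a + v" 3 q] by simp_all
    qed
    have "(W has_real_derivative
       (- 1) * ((a + v) powr - s - a * (a + v) powr (- s - 1)) / (- s - 1)
        + (1 - v) * (- s * (a + v) powr (- s - 1) - a * ((- s - 1) * (a + v) powr (- s - 2))) / (- s - 1)
        + ((- 2) * (a + v) powr - s + (1 - 2 * v) * (- s * (a + v) powr (- s - 1))) / ((- s - 1) * s)
        - 2 * ((1 - s) * (a + v) powr - s) / ((s + 1) * s * (1 - s))) (at v)"
    proof -
      have d: "((\<lambda>v. (a + v) powr q) has_real_derivative q * (a + v) powr (q - 1)) (at v)" for q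
        using av by (auto intro!: derivative_eq_intros DERIV_fun_powr[THEN DERIV_cong])
      have d1: "((\<lambda>v. (a + v) powr (- s - 1)) has_real_derivative (- s - 1) * (a + v) powr (- s - 2)) (at v)"
      proof -
        have e: "(- s - 1) - 1 = - s - 2" by simp
        show ?thesis using d[of "- s - 1"] unfolding e .
      qed
      have d2: "((\<lambda>v. (a + v) powr (1 - s)) has_real_derivative (1 - s) * (a + v) powr - s) (at v)"
        using d[of "1 - s"] by simp
      have a1: "((\<lambda>v. 1 - v) has_real_derivative - 1) (at v)" "((\<lambda>v. 1 - 2 * v) has_real_derivative - 2) (at v)"
        by (auto intro!: derivative_eq_intros)
      show ?thesis unfolding W_def
        by (rule DERIV_cong[OF DERIV_diff[OF DERIV_add[OF DERIV_cdivide[OF DERIV_mult[OF a1(1) DERIV_diff[OF d DERIV_cmult[OF d1]]]]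
            DERIV_cdivide[OF DERIV_mult[OF a1(2) d]]] DERIV_cdivide[OF DERIV_cmult[OF d2]]]])
           (simp add: algebra_simps add_divide_distrib diff_divide_distrib)
    qed
    moreover have "(- 1) * ((a + v) powr - s - a * (a + v) powr (- s - 1)) / (- s - 1)
        + (1 - v) * (- s * (a + v) powr (- s - 1) - a * ((- s - 1) * (a + v) powr (- s - 2))) / (- s - 1)
        + ((- 2) * (a + v) powr - s + (1 - 2 * v) * (- s * (a + v) powr (- s - 1))) / ((- s - 1) * s)
        - 2 * ((1 - s) * (a + v) powr - s) / ((s + 1) * s * (1 - s)) = v * (1 - v) * (a + v) powr (- s - 2)"
    proof -
      have nz: "s + 1 \<noteq> 0" "s \<noteq> 0" "1 - s \<noteq> 0" "- s - 1 \<noteq> 0" using s by auto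
      show ?thesis unfolding p1 p_def[symmetric] using nz
        by (simp add: divide_simps) (simp add: algebra_simps power2_eq_square)
    qed
    ultimately show "(W has_vector_derivative v * (1 - v) * (a + v) powr (- s - 2)) (at v)"
      by (simp add: has_real_derivative_iff_has_vector_derivative)
  qed simp
  have W: "W 1 - W 0 = 2 / (s * (s + 1)) * ((a powr - s + (a + 1) powr - s) / 2 - ((a + 1) powr (1 - s) - a powr (1 - s)) / (1 - s))"
  proof -
    have nz: "s + 1 \<noteq> 0" "s \<noteq> 0" "1 - s \<noteq> 0" "- s - 1 \<noteq> 0" using s by auto
    have "a * a powr (- s - 1) = a powr - s" using a powr_add[of a 1 "- s - 1"] by (cases "a = 0") auto
    then show ?thesis using nz by (simp add: W_def divide_simps) (simp add: algebra_simps)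
  qed
  show "0 \<le> ?r" unfolding W[symmetric] by (rule has_integral_nonneg[OF hi]) auto
  from nn_integral_has_integral_lebesgue[OF _ hi] show "?I = ennreal ?r" unfolding W by simp
qed

section \<open>The functional equation\<close>

text \<open>Trapezoidal value minus integral of u^(-s) over [a, a + 1]. At a = 0 the convention
  \<open>0 powr r = 0\<close> gives the right boundary values, as - s > 0 where this case is
  used.\<close>

definition trapE :: "real \<Rightarrow> real \<Rightarrow> real" where
  "trapE s a = (a powr - s + (a + 1) powr - s) / 2 - ((a + 1) powr (1 - s) - a powr (1 - s)) / (1 - s)"

lemma trap_of_real:
  assumes "a > 0" "s \<noteq> 1"
  shows "trap (of_real s) a = of_real ((s - 1) * trapE s a)"
proof -
  have p: "complex_of_real b powr (of_real p) = of_real (b powr p)" if "b > 0" for b p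
    using that by (simp add: powr_of_real)
  have "(1 - s) \<noteq> 0" using assms by simp
  have "trap (of_real s) a = of_real ((s - 1) / 2 * (a powr - s + (a + 1) powr - s) + (a + 1) powr (1 - s) - a powr (1 - s))"
    unfolding trap_def using p[of a "- s"] p[of "a + 1" "- s"] p[of a "1 - s"] p[of "a + 1" "1 - s"] assms by simp
  also have "(s - 1) / 2 * (a powr - s + (a + 1) powr - s) + (a + 1) powr (1 - s) - a powr (1 - s) = (s - 1) * trapE s a"
    unfolding trapE_def using \<open>1 - s \<noteq> 0\<close> by (simp add: field_simps)
  finally show ?thesis .
qed

text \<open>The interval [0, 1], whose error is 1/2 + 1 / (s - 1), absorbs the elementary part of
  \<open>zeta_reg\<close>: for -1 < s < 0 zeta itself is a sum of trapezoidal errors.\<close>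

lemma zeta_reg_real_sums:
  assumes s: "-1 < s" "s < 0"
  shows "(\<lambda>n. trapE s (real n)) sums (Re (zeta_reg (of_real s)) / (s - 1))"
    and "zeta_reg (of_real s) = of_real (Re (zeta_reg (of_real s)))"
proof -
  have "(\<lambda>n. trap (of_real s) (real (Suc n))) sums (\<Sum>n. trap (of_real s) (real (Suc n)))"
    using s by (intro summable_sums summable_trap) auto
  then have S: "(\<lambda>n. complex_of_real ((s - 1) * trapE s (real (Suc n)))) sums (zeta_reg (of_real s) - 1 - (of_real s - 1) / 2)"
    using trap_of_real[of "real (Suc _)" s] s by (simp add: zeta_reg_def)
  have R: "(\<lambda>n. (s - 1) * trapE s (real (Suc n))) sums (Re (zeta_reg (of_real s)) - 1 - (s - 1) / 2)"
    using sums_Re[OF S] by simp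
  have "cnj (zeta_reg (of_real s)) = zeta_reg (of_real s)"
    using zeta_reg_cnj[of "of_real s"] s by simp
  then show "zeta_reg (of_real s) = of_real (Re (zeta_reg (of_real s)))" by (simp add: complex_eq_iff)
  have "(\<lambda>n. (s - 1) * trapE s (real (Suc n)) / (s - 1)) sums ((Re (zeta_reg (of_real s)) - 1 - (s - 1) / 2) / (s - 1))"
    by (rule sums_divide[OF R])
  then have "(\<lambda>n. trapE s (real (Suc n))) sums ((Re (zeta_reg (of_real s)) - 1 - (s - 1) / 2) / (s - 1))"
    using s by simp
  then have "(\<lambda>n. trapE s (real n)) sums ((Re (zeta_reg (of_real s)) - 1 - (s - 1) / 2) / (s - 1) + trapE s (real 0))"
    by (rule sums_Suc)
  moreover have "trapE s (real 0) = 1 / 2 + 1 / (s - 1)"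
  proof -
    have "1 - s \<noteq> 0" "s - 1 \<noteq> 0" using s by auto
    then show ?thesis using s by (simp add: trapE_def field_simps)
  qed
  moreover have "(Re (zeta_reg (of_real s)) - 1 - (s - 1) / 2) / (s - 1) + (1 / 2 + 1 / (s - 1)) = Re (zeta_reg (of_real s)) / (s - 1)"
  proof -
    have "(z - 1 - d / 2) / d + (1 / 2 + 1 / d) = z / d" if "d \<noteq> 0" for z d :: real
      using that by (simp add: field_simps)
    then show ?thesis using s by simp
  qed
  ultimately show "(\<lambda>n. trapE s (real n)) sums (Re (zeta_reg (of_real s)) / (s - 1))" by simp
qed

text \<open>This is coth (x / 2) / 2 - 1 / x, or 1 / (exp x - 1) + 1/2 - 1 / x, whose Mellin
  transform on -1 < s < 0 is Gamma s times zeta s.\<close>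

definition kcoth :: "real \<Rightarrow> real" where
  "kcoth x = (exp x + 1) / (exp x - 1) / 2 - 1 / x"

text \<open>One has kcoth x = tau x / (1 - exp (- x)), where tau is the trapezoidal error of exp (-
  v x) on [0, 1]. Expanding the geometric series, writing tau by its Peano kernel and integrating
  first in x turns the n-th term into the Peano form of the error of u^(-s) on [n, n + 1]. The
  factor Gamma (s + 2) / (s (s + 1)) is Gamma s.\<close>

lemma mellin_kcoth_left:
  assumes s: "-1 < s" "s < 0"
  shows "(\<integral>\<^sup>+x. ennreal (indicator {0<..} x * (x powr (s - 1) * kcoth x)) \<partial>lborel)
    = ennreal (Gamma (s + 2) / (s * (s + 1)) * (Re (zeta_reg (of_real s)) / (s - 1)))"
proof -
  define \<tau> where "\<tau> x = (1 + exp (- x)) / 2 - (1 - exp (- x)) / x" for x :: real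
  have \<tau>: "ennreal (\<tau> x) = ennreal (x\<^sup>2 / 2) * (\<integral>\<^sup>+v. ennreal (indicator {0..1} v * (v * (1 - v) * exp (- (v * x)))) \<partial>lborel)"
    if "x > 0" for x
  proof -
    have "ennreal (x\<^sup>2 / 2) * ennreal (2 / x\<^sup>2 * \<tau> x) = ennreal (x\<^sup>2 / 2 * (2 / x\<^sup>2 * \<tau> x))"
      by (rule ennreal_mult'[symmetric]) simp
    also have "x\<^sup>2 / 2 * (2 / x\<^sup>2 * \<tau> x) = \<tau> x" using that by simp
    finally show ?thesis using trapezoid_kernel_exp(1)[OF that] by (simp add: \<tau>_def)
  qed
  have \<tau>0: "\<tau> x \<ge> 0" if x: "x > 0" for x
  proof -
    have "0 \<le> x\<^sup>2 / 2 * (2 / x\<^sup>2 * \<tau> x)"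
      unfolding \<tau>_def by (rule mult_nonneg_nonneg[OF _ trapezoid_kernel_exp(2)[OF x]]) simp
    then show ?thesis using x by simp
  qed
  have k_sum: "(\<Sum>n. ennreal (indicator {0<..} x * (x powr (s - 1) * exp (- (real n * x)) * \<tau> x)))
     = ennreal (indicator {0<..} x * (x powr (s - 1) * kcoth x))" for x
  proof (cases "x > 0")
    case True
    have e1: "norm (exp (- x)) < 1" using True by simp
    have "(\<lambda>n. exp (- x) ^ n * (x powr (s - 1) * \<tau> x)) sums (1 / (1 - exp (- x)) * (x powr (s - 1) * \<tau> x))"
      by (intro sums_mult2 geometric_sums e1)
    moreover have "1 / (1 - exp (- x)) * (x powr (s - 1) * \<tau> x) = x powr (s - 1) * kcoth x"
    proof -
      have ne: "exp x - 1 \<noteq> 0" "1 - exp (- x) \<noteq> 0" using True by auto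
      have "1 / (1 - exp (- x)) * \<tau> x = kcoth x"
      proof -
        have "(1 + exp (- x)) / (1 - exp (- x)) = (exp x + 1) / (exp x - 1)"
          using ne by (simp add: exp_minus field_simps)
        moreover have "1 / (1 - exp (- x)) * \<tau> x = (1 + exp (- x)) / (1 - exp (- x)) / 2 - 1 / x"
        proof -
          have "1 / d * (p / 2 - d / x) = p / d / 2 - 1 / x" if "d \<noteq> 0" for d p :: real
            using that by (simp add: right_diff_distrib)
          then show ?thesis unfolding \<tau>_def using ne by blast
        qed
        ultimately show ?thesis by (simp add: kcoth_def)
      qed
      then show ?thesis by (metis mult.assoc mult.commute)
    qed
    moreover have "exp (- x) ^ n * (x powr (s - 1) * \<tau> x) = x powr (s - 1) * exp (- (real n * x)) * \<tau> x" for n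
      by (simp add: exp_of_nat_mult[symmetric] mult_ac)
    ultimately have S: "(\<lambda>n. x powr (s - 1) * exp (- (real n * x)) * \<tau> x) sums (x powr (s - 1) * kcoth x)" by simp
    have "(\<Sum>n. ennreal (x powr (s - 1) * exp (- (real n * x)) * \<tau> x)) = ennreal (x powr (s - 1) * kcoth x)"
      by (subst suminf_ennreal_eq[OF _ S]) (use \<tau>0[OF True] in auto)
    then show ?thesis using True by simp
  qed simp
  have each: "(\<integral>\<^sup>+x. ennreal (indicator {0<..} x * (x powr (s - 1) * exp (- (real n * x)) * \<tau> x)) \<partial>lborel)
     = ennreal (Gamma (s + 2) / (s * (s + 1)) * trapE s (real n))" for n
  proof -
    have "(\<integral>\<^sup>+x. ennreal (indicator {0<..} x * (x powr (s - 1) * exp (- (real n * x)) * \<tau> x)) \<partial>lborel)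
      = (\<integral>\<^sup>+x. \<integral>\<^sup>+v. ennreal (indicator {0<..} x * indicator {0..1} v * (1 / 2 * (v * (1 - v)) * (x powr (s + 1) * exp (- ((real n + v) * x))))) \<partial>lborel \<partial>lborel)"
    proof (rule nn_integral_cong)
      fix x :: real
      show "ennreal (indicator {0<..} x * (x powr (s - 1) * exp (- (real n * x)) * \<tau> x))
        = (\<integral>\<^sup>+v. ennreal (indicator {0<..} x * indicator {0..1} v * (1 / 2 * (v * (1 - v)) * (x powr (s + 1) * exp (- ((real n + v) * x))))) \<partial>lborel)"
      proof (cases "x > 0")
        case True
        have "ennreal (indicator {0<..} x * (x powr (s - 1) * exp (- (real n * x)) * \<tau> x))
          = ennreal (x powr (s - 1) * exp (- (real n * x))) * ennreal (\<tau> x)"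
          using True \<tau>0 by (simp add: ennreal_mult)
        also have "\<dots> = ennreal (x powr (s - 1) * exp (- (real n * x))) * ennreal (x\<^sup>2 / 2)
            * (\<integral>\<^sup>+v. ennreal (indicator {0..1} v * (v * (1 - v) * exp (- (v * x)))) \<partial>lborel)"
          using \<tau>[OF True] by (simp add: mult.assoc)
        also have "\<dots> = (\<integral>\<^sup>+v. ennreal (x powr (s - 1) * exp (- (real n * x))) * ennreal (x\<^sup>2 / 2)
            * ennreal (indicator {0..1} v * (v * (1 - v) * exp (- (v * x)))) \<partial>lborel)"
          by (rule nn_integral_cmult[symmetric]) measurable
        also have "\<dots> = (\<integral>\<^sup>+v. ennreal (indicator {0<..} x * indicator {0..1} v * (1 / 2 * (v * (1 - v)) * (x powr (s + 1) * exp (- ((real n + v) * x))))) \<partial>lborel)"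
        proof (rule nn_integral_cong)
          fix v :: real
          have "x powr (s + 1) = x powr (s - 1) * x\<^sup>2"
          proof -
            have e: "s + 1 = (s - 1) + 2" by simp
            show ?thesis unfolding e powr_add using True by simp
          qed
          moreover have "exp (- ((real n + v) * x)) = exp (- (real n * x)) * exp (- (v * x))"
            by (simp add: exp_add[symmetric] algebra_simps)
          ultimately have "x powr (s - 1) * exp (- (real n * x)) * (x\<^sup>2 / 2) * (indicator {0..1} v * (v * (1 - v) * exp (- (v * x))))
            = indicator {0..1} v * (1 / 2 * (v * (1 - v)) * (x powr (s + 1) * exp (- ((real n + v) * x))))"
            by (simp add: mult_ac)
          note E = this
          have gen: "ennreal A * ennreal B * ennreal C = ennreal (A * B * C)" if "0 \<le> A" "0 \<le> B" for A B C
            using that by (simp add: ennreal_mult'[symmetric])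
          show "ennreal (x powr (s - 1) * exp (- (real n * x))) * ennreal (x\<^sup>2 / 2) * ennreal (indicator {0..1} v * (v * (1 - v) * exp (- (v * x))))
             = ennreal (indicator {0<..} x * indicator {0..1} v * (1 / 2 * (v * (1 - v)) * (x powr (s + 1) * exp (- ((real n + v) * x)))))"
            by (subst gen, simp, simp, subst E) (simp add: True)
        qed
        finally show ?thesis .
      qed simp
    qed
    also have "\<dots> = (\<integral>\<^sup>+v. \<integral>\<^sup>+x. ennreal (indicator {0<..} x * indicator {0..1} v * (1 / 2 * (v * (1 - v)) * (x powr (s + 1) * exp (- ((real n + v) * x))))) \<partial>lborel \<partial>lborel)"
      by (rule lborel_pair.Fubini') measurable
    also have "\<dots> = (\<integral>\<^sup>+v. ennreal (Gamma (s + 2) / 2) * ennreal (indicator {0..1} v * (v * (1 - v) * (real n + v) powr (- s - 2))) \<partial>lborel)"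
    proof (rule nn_integral_cong)
      fix v :: real
      show "(\<integral>\<^sup>+x. ennreal (indicator {0<..} x * indicator {0..1} v * (1 / 2 * (v * (1 - v)) * (x powr (s + 1) * exp (- ((real n + v) * x))))) \<partial>lborel)
         = ennreal (Gamma (s + 2) / 2) * ennreal (indicator {0..1} v * (v * (1 - v) * (real n + v) powr (- s - 2)))"
      \<comment> \<open>For n = 0 the Gamma integral in x needs v > 0; at v = 0 both sides vanish
        with the kernel.\<close>
      proof (cases "v \<in> {0<..1}")
        case True
        have "(\<integral>\<^sup>+x. ennreal (indicator {0<..} x * indicator {0..1} v * (1 / 2 * (v * (1 - v)) * (x powr (s + 1) * exp (- ((real n + v) * x))))) \<partial>lborel)
          = (\<integral>\<^sup>+x. ennreal (1 / 2 * (v * (1 - v))) * ennreal (indicator {0<..} x * (x powr ((s + 2) - 1) * exp (- ((real n + v) * x)))) \<partial>lborel)"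
        proof (rule nn_integral_cong)
          fix x :: real
          have e: "s + 2 - 1 = s + 1" by simp
          show "ennreal (indicator {0<..} x * indicator {0..1} v * (1 / 2 * (v * (1 - v)) * (x powr (s + 1) * exp (- ((real n + v) * x)))))
            = ennreal (1 / 2 * (v * (1 - v))) * ennreal (indicator {0<..} x * (x powr ((s + 2) - 1) * exp (- ((real n + v) * x))))"
            unfolding e using True by (subst ennreal_mult'[symmetric]) (auto simp: mult_ac)
        qed
        also have "\<dots> = ennreal (1 / 2 * (v * (1 - v))) * ennreal (Gamma (s + 2) * (real n + v) powr - (s + 2))"
          using True s by (subst nn_integral_cmult, measurable, subst nn_integral_powr_exp) auto
        also have "\<dots> = ennreal (Gamma (s + 2) / 2) * ennreal (indicator {0..1} v * (v * (1 - v) * (real n + v) powr (- s - 2)))"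
        proof -
          have e: "- (s + 2) = - s - 2" by simp
          show ?thesis unfolding e using True s Gamma_real_pos[of "s + 2"]
            by (subst (1 2) ennreal_mult'[symmetric]) (auto simp: mult_ac)
        qed
        finally show ?thesis .
      qed (auto simp: indicator_def)
    qed
    also have "\<dots> = ennreal (Gamma (s + 2) / 2) * ennreal (2 / (s * (s + 1)) * trapE s (real n))"
      using s by (subst nn_integral_cmult, measurable, subst trapezoid_kernel_powr) (auto simp: trapE_def)
    also have "\<dots> = ennreal (Gamma (s + 2) / (s * (s + 1)) * trapE s (real n))"
      using s Gamma_real_pos[of "s + 2"] by (subst ennreal_mult'[symmetric]) (auto simp: field_simps)
    finally show ?thesis .
  qed
  have nn: "0 \<le> Gamma (s + 2) / (s * (s + 1)) * trapE s (real n)" for n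
  proof -
    have "0 \<le> Gamma (s + 2) / 2 * (2 / (s * (s + 1)) * trapE s (real n))"
      unfolding trapE_def by (rule mult_nonneg_nonneg[OF _ trapezoid_kernel_powr(2)[OF s]])
        (use s Gamma_real_pos[of "s + 2"] in auto)
    then show ?thesis by simp
  qed
  have "(\<integral>\<^sup>+x. ennreal (indicator {0<..} x * (x powr (s - 1) * kcoth x)) \<partial>lborel)
    = (\<integral>\<^sup>+x. (\<Sum>n. ennreal (indicator {0<..} x * (x powr (s - 1) * exp (- (real n * x)) * \<tau> x))) \<partial>lborel)"
    by (simp add: k_sum)
  also have "\<dots> = (\<Sum>n. ennreal (Gamma (s + 2) / (s * (s + 1)) * trapE s (real n)))"
  proof -
    have meas: "(\<lambda>x. ennreal (indicator {0<..} x * (x powr (s - 1) * exp (- (real n * x)) * \<tau> x))) \<in> borel_measurable lborel" for n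
      unfolding \<tau>_def by measurable
    show ?thesis by (simp only: nn_integral_suminf[OF meas] each)
  qed
  also have "\<dots> = ennreal (Gamma (s + 2) / (s * (s + 1)) * (Re (zeta_reg (of_real s)) / (s - 1)))"
    by (rule suminf_ennreal_eq[OF nn]) (intro sums_mult zeta_reg_real_sums s)
  finally show ?thesis .
qed

text \<open>Termwise integration of the partial fractions of coth, with c = 2 pi (n + 1); the powers
  c^(s - 1) assemble to zeta (1 - s).\<close>

lemma mellin_kcoth_right:
  assumes s: "-1 < s" "s < 0"
  shows "(\<integral>\<^sup>+x. ennreal (indicator {0<..} x * (x powr (s - 1) * kcoth x)) \<partial>lborel)
    = ennreal ((2 * pi) powr (s - 1) * (pi / cos (pi * s / 2)) * (\<Sum>n. real (Suc n) powr (s - 1)))"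
proof -
  have ps: "- pi < pi * s" "pi * s < 0" using mult_strict_left_mono[of "-1" s pi] s by (auto simp: mult_pos_neg)
  have cpos: "cos (pi * s / 2) > 0"
    using ps s by (intro cos_gt_zero_pi) auto
  have "(\<integral>\<^sup>+x. ennreal (indicator {0<..} x * (x powr (s - 1) * kcoth x)) \<partial>lborel)
    = (\<integral>\<^sup>+x. (\<Sum>n. ennreal (indicator {0<..} x * (2 * x powr s / (x\<^sup>2 + (2 * pi * real (Suc n))\<^sup>2)))) \<partial>lborel)"
  proof (rule nn_integral_cong)
    fix x :: real
    show "ennreal (indicator {0<..} x * (x powr (s - 1) * kcoth x))
      = (\<Sum>n. ennreal (indicator {0<..} x * (2 * x powr s / (x\<^sup>2 + (2 * pi * real (Suc n))\<^sup>2))))"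
    proof (cases "x > 0")
      case True
      have "x powr (s - 1) * x = x powr s" using True by (simp add: powr_diff)
      then have "x powr (s - 1) * (2 * x / (x\<^sup>2 + (2 * pi * real (Suc n))\<^sup>2)) = 2 * x powr s / (x\<^sup>2 + (2 * pi * real (Suc n))\<^sup>2)" for n
        by simp
      note e = this
      have "(\<lambda>n. 2 * x powr s / (x\<^sup>2 + (2 * pi * real (Suc n))\<^sup>2)) sums (x powr (s - 1) * kcoth x)"
        using sums_mult[OF half_coth_pfd[OF True], of "x powr (s - 1)"] unfolding e kcoth_def[symmetric] .
      then have "(\<Sum>n. ennreal (2 * x powr s / (x\<^sup>2 + (2 * pi * real (Suc n))\<^sup>2))) = ennreal (x powr (s - 1) * kcoth x)"
        by (rule suminf_ennreal_eq[rotated]) (use True in simp)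
      then show ?thesis using True by (simp del: of_nat_Suc)
    qed simp
  qed
  also have "\<dots> = (\<Sum>n. ennreal ((2 * pi * real (Suc n)) powr (s - 1) * (pi / cos (pi * s / 2))))"
    using s by (subst nn_integral_suminf, measurable, subst nn_integral_inverse_quadratic) auto
  also have "\<dots> = ennreal ((2 * pi) powr (s - 1) * (pi / cos (pi * s / 2)) * (\<Sum>n. real (Suc n) powr (s - 1)))"
  proof (rule suminf_ennreal_eq)
    have e: "s - 1 = - (1 - s)" by simp
    have "(\<lambda>n. real (Suc n) powr (s - 1)) sums (\<Sum>n. real (Suc n) powr (s - 1))"
      unfolding e using s by (intro summable_sums sum_powr_bound) auto
    then have "(\<lambda>n. (2 * pi) powr (s - 1) * (pi / cos (pi * s / 2)) * real (Suc n) powr (s - 1)) sums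
      ((2 * pi) powr (s - 1) * (pi / cos (pi * s / 2)) * (\<Sum>n. real (Suc n) powr (s - 1)))" by (rule sums_mult)
    then show "(\<lambda>n. (2 * pi * real (Suc n)) powr (s - 1) * (pi / cos (pi * s / 2))) sums
      ((2 * pi) powr (s - 1) * (pi / cos (pi * s / 2)) * (\<Sum>n. real (Suc n) powr (s - 1)))"
      by (simp add: powr_mult mult_ac del: of_nat_Suc)
  qed (use cpos in auto)
  finally show ?thesis .
qed

text \<open>The two evaluations of the Mellin transform are equated; the reflection formula for
  Gamma s together with sin (pi s) = 2 sin (pi s / 2) cos (pi s / 2) removes the cosine.\<close>

lemma zeta_functional_equation_real:
  assumes s: "-1 < s" "s < 0"
  shows "zeta_reg (of_real s) / (of_real s - 1) = 2 * (2 * of_real pi) powr (of_real s - 1) * sin (of_real pi * of_real s / 2)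
     * Gamma (1 - of_real s) * (zeta_reg (1 - of_real s) / (- of_real s))"
proof -
  define D where "D = (\<Sum>n. real (Suc n) powr (s - 1))"
  have Dsum: "summable (\<lambda>n. real (Suc n) powr (s - 1))"
  proof -
    have e: "s - 1 = - (1 - s)" by simp
    show ?thesis unfolding e using s by (intro sum_powr_bound) auto
  qed
  have D0: "D \<ge> 0" unfolding D_def by (intro suminf_nonneg Dsum) auto
  have "zeta_reg (of_real (1 - s)) = (of_real (1 - s) - 1) * (\<Sum>n. 1 / (of_nat (Suc n)) powr (of_real (1 - s)))"
    using s by (intro zeta_reg_eq_dirichlet) auto
  moreover have "1 / (of_nat (Suc n)) powr (complex_of_real (1 - s)) = of_real (real (Suc n) powr (s - 1))" for n
  proof -
    have "(of_nat (Suc n)) powr (complex_of_real (1 - s)) = of_real (real (Suc n) powr (1 - s))"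
      using powr_of_real[of "real (Suc n)" "1 - s"] by (simp del: of_nat_Suc of_real_diff)
    then show ?thesis by (simp add: powr_diff del: of_nat_Suc of_real_diff)
  qed
  ultimately have zD: "zeta_reg (1 - of_real s) = - of_real s * of_real D"
    using Dsum by (simp add: D_def suminf_of_real)
  define c where "c = cos (pi * s / 2)"
  have ps: "- pi < pi * s" "pi * s < 0" using mult_strict_left_mono[of "-1" s pi] s by (auto simp: mult_pos_neg)
  have cpos: "c > 0" unfolding c_def using ps s by (intro cos_gt_zero_pi) auto
  define z where "z = Re (zeta_reg (of_real s))"
  \<comment> \<open>Equality of extended values descends to the reals only between nonnegative
    numbers; the sign comes from the Peano integrals.\<close>
  have L0: "0 \<le> Gamma (s + 2) / (s * (s + 1)) * (z / (s - 1))"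
  proof -
    have "0 \<le> Gamma (s + 2) / 2 * (2 / (s * (s + 1)) * trapE s (real n))" for n
      unfolding trapE_def by (rule mult_nonneg_nonneg[OF _ trapezoid_kernel_powr(2)[OF s]])
        (use s Gamma_real_pos[of "s + 2"] in auto)
    then have "0 \<le> Gamma (s + 2) / (s * (s + 1)) * trapE s (real n)" for n by simp
    moreover have "(\<lambda>n. Gamma (s + 2) / (s * (s + 1)) * trapE s (real n)) sums (Gamma (s + 2) / (s * (s + 1)) * (z / (s - 1)))"
      unfolding z_def by (intro sums_mult zeta_reg_real_sums s)
    ultimately show ?thesis by (rule sums_le[OF _ sums_zero])
  qed
  have "ennreal (Gamma (s + 2) / (s * (s + 1)) * (z / (s - 1))) = ennreal ((2 * pi) powr (s - 1) * (pi / c) * D)"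
    using mellin_kcoth_left[OF s] mellin_kcoth_right[OF s] by (simp add: z_def c_def D_def)
  then have eq: "Gamma (s + 2) / (s * (s + 1)) * (z / (s - 1)) = (2 * pi) powr (s - 1) * (pi / c) * D"
    using L0 D0 cpos by (subst (asm) ennreal_inj) auto
  have G: "Gamma (s + 2) / (s * (s + 1)) = Gamma s"
  proof -
    have "s \<notin> \<int>\<^sub>\<le>\<^sub>0" "s + 1 \<notin> \<int>\<^sub>\<le>\<^sub>0" using s by (auto elim!: nonpos_Ints_cases)
    then have "Gamma ((s + 1) + 1) = (s + 1) * (s * Gamma s)" by (simp only: Gamma_plus1 not_False_eq_True)
    moreover have "s + 2 = (s + 1) + 1" by simp
    ultimately have "Gamma (s + 2) = (s + 1) * (s * Gamma s)" by (simp only:)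
    moreover have "s \<noteq> 0" "s + 1 \<noteq> 0" using s by auto
    ultimately show ?thesis by simp
  qed
  define sn where "sn = sin (pi * s / 2)"
  have refl: "Gamma s * Gamma (1 - s) = pi / (2 * sn * c)"
  proof -
    have "complex_of_real (Gamma s * Gamma (1 - s)) = Gamma (of_real s) * Gamma (1 - of_real s)"
      by (simp add: Gamma_complex_of_real[symmetric])
    also have "\<dots> = of_real (pi / sin (pi * s))" by (simp add: Gamma_reflection_complex flip: sin_of_real)
    finally have "Gamma s * Gamma (1 - s) = pi / sin (2 * (pi * s / 2))" unfolding of_real_eq_iff by simp
    then show ?thesis unfolding sin_double sn_def c_def .
  qed
  have snn: "sn \<noteq> 0"
  proof -
    have "sin (- (pi * s / 2)) > 0" using ps by (intro sin_gt_zero) auto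
    then show ?thesis by (simp add: sn_def)
  qed
  have "z / (s - 1) = 2 * (2 * pi) powr (s - 1) * sn * Gamma (1 - s) * D"
  proof -
    have "Gamma s * (z / (s - 1)) * Gamma (1 - s) = (2 * pi) powr (s - 1) * (pi / c) * D * Gamma (1 - s)"
      using eq unfolding G by simp
    then have "pi / (2 * sn * c) * (z / (s - 1)) = (2 * pi) powr (s - 1) * (pi / c) * D * Gamma (1 - s)"
      unfolding refl[symmetric] by (simp add: mult_ac)
    then have "pi / (2 * sn * c) * (z / (s - 1)) * (2 * sn * c / pi) = (2 * pi) powr (s - 1) * (pi / c) * D * Gamma (1 - s) * (2 * sn * c / pi)"
      by simp
    moreover have "pi / (2 * sn * c) * q * (2 * sn * c / pi) = q" for q using cpos snn by simp
    moreover have "p * (pi / c) * D * Gamma (1 - s) * (2 * sn * c / pi) = 2 * p * sn * Gamma (1 - s) * D" for p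
      using cpos by simp
    ultimately show ?thesis by metis
  qed
  then have "complex_of_real (z / (s - 1)) = of_real (2 * (2 * pi) powr (s - 1) * sn * Gamma (1 - s) * D)" by simp
  moreover have "(2 * complex_of_real pi) powr (of_real s - 1) = of_real ((2 * pi) powr (s - 1))"
    using powr_of_real[of "2 * pi" "s - 1"] by simp
  moreover have "sin (complex_of_real pi * of_real s / 2) = of_real sn" unfolding sn_def by (simp flip: sin_of_real)
  moreover have "Gamma (1 - complex_of_real s) = of_real (Gamma (1 - s))" by (simp add: Gamma_complex_of_real[symmetric])
  ultimately show ?thesis
    using zeta_reg_real_sums(2)[OF s] s unfolding zD z_def[symmetric] by simp
qed

text \<open>The right side of the functional equation, with zeta (1 - s) as
  \<open>zeta_reg (1 - s) / (- s)\<close> because (1 - s) - 1 = - s. For Re s < 0 it lies in the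
  range already constructed, so it can serve as the continuation to the left.\<close>

definition zeta_left :: "complex \<Rightarrow> complex" where
  "zeta_left s = 2 * (2 * of_real pi) powr (s - 1) * sin (of_real pi * s / 2) * Gamma (1 - s) * (zeta_reg (1 - s) / (- s))"

lemma holomorphic_zeta_left: "zeta_left holomorphic_on {s. Re s < 0}"
proof -
  have "(\<lambda>s. zeta_reg (1 - s)) holomorphic_on {s. Re s < 0}"
    by (rule holomorphic_on_compose_gen[OF _ holomorphic_zeta_reg, unfolded o_def]) (auto intro!: holomorphic_intros)
  then show ?thesis unfolding zeta_left_def
    by (intro holomorphic_intros) (auto elim!: nonpos_Ints_cases simp: complex_eq_iff)
qed

text \<open>Both sides are holomorphic in the strip and agree on the real segment, which accumulates
  at -1/2.\<close>

lemma zeta_left_eq: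
  assumes s: "-1 < Re s" "Re s < 0"
  shows "zeta_reg s / (s - 1) = zeta_left s"
proof -
  define S where "S = {s. Re s < 0 \<and> -1 < Re s}"
  have S: "S = {s. Re s < 0} \<inter> {s. Re s > -1}" by (auto simp: S_def)
  have "zeta_reg s / (s - 1) - zeta_left s = 0"
  proof (rule analytic_continuation[of "\<lambda>s. zeta_reg s / (s - 1) - zeta_left s" S "of_real ` {-1<..<0}" "of_real (-1/2)"])
    show "open S" unfolding S by (intro open_Int open_halfspace_Re_lt open_halfspace_Re_gt)
    show "connected S" unfolding S
      by (intro convex_connected convex_Int convex_halfspace_Re_lt convex_halfspace_Re_gt)
    show "(\<lambda>s. zeta_reg s / (s - 1) - zeta_left s) holomorphic_on S"
      by (intro holomorphic_intros holomorphic_on_subset[OF holomorphic_zeta_reg] holomorphic_on_subset[OF holomorphic_zeta_left])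
         (auto simp: S_def)
    show "complex_of_real ` {-1<..<0} \<subseteq> S" "complex_of_real (-1/2) \<in> S" by (auto simp: S_def)
    have "(-1/2 :: real) islimpt {-1<..<0}" by (intro interior_limit_point) auto
    then show "complex_of_real (-1/2) islimpt complex_of_real ` {-1<..<0}"
    proof (rule islimpt_isCont_image)
      show "\<forall>\<^sub>F y in at (-1/2). complex_of_real y \<noteq> complex_of_real (-1/2)"
        unfolding of_real_eq_iff by (auto simp: eventually_at_filter)
    qed auto
    show "zeta_reg z / (z - 1) - zeta_left z = 0" if "z \<in> complex_of_real ` {-1<..<0}" for z
      using that zeta_functional_equation_real by (auto simp: zeta_left_def)
    show "s \<in> S" using s by (simp add: S_def)
  qed
  then show ?thesis by simp
qed

text \<open>Two pieces that agree on the overlap -1 < Re s < 0. This is the witness that makes the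
  choice in \<open>riemann_zeta\<close> meaningful.\<close>

definition zeta_all :: "complex \<Rightarrow> complex" where
  "zeta_all s = (if Re s < 0 then zeta_left s else zeta_reg s / (s - 1))"

lemma zeta_all_eq: "Re s > -1 \<Longrightarrow> zeta_all s = zeta_reg s / (s - 1)"
  using zeta_left_eq[of s] by (auto simp: zeta_all_def)

lemma holomorphic_zeta_all: "zeta_all holomorphic_on - {1}"
proof -
  have "zeta_all holomorphic_on ({s. Re s < 0} \<union> ({s. Re s > -1} - {1}))"
  proof (rule holomorphic_on_Un)
    show "zeta_all holomorphic_on {s. Re s < 0}"
      by (rule holomorphic_transform[OF holomorphic_zeta_left]) (simp add: zeta_all_def)
    have "(\<lambda>s. zeta_reg s / (s - 1)) holomorphic_on {s. Re s > -1} - {1}"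
      by (intro holomorphic_intros holomorphic_on_subset[OF holomorphic_zeta_reg]) auto
    then show "zeta_all holomorphic_on {s. Re s > -1} - {1}"
      by (rule holomorphic_transform) (simp add: zeta_all_eq)
  qed (auto intro!: open_halfspace_Re_lt open_Diff open_halfspace_Re_gt)
  then show ?thesis by (rule holomorphic_on_subset) auto
qed

lemma riemann_zeta_spec:
  "riemann_zeta holomorphic_on (- {1})"
  "1 < Re s \<Longrightarrow> riemann_zeta s = (\<Sum>n. 1 / (of_nat (Suc n)) powr s)"
proof -
  have ex: "\<exists>f. f holomorphic_on (- {1}) \<and>
      (\<forall>s. 1 < Re s \<longrightarrow> f s = (\<Sum>n. 1 / (of_nat (Suc n)) powr s))"
  proof (intro exI conjI allI impI)
    show "zeta_all holomorphic_on - {1}" by (rule holomorphic_zeta_all)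
    fix s :: complex assume s: "1 < Re s"
    then have "zeta_all s = zeta_reg s / (s - 1)" by (intro zeta_all_eq) auto
    also have "\<dots> = (\<Sum>n. 1 / (of_nat (Suc n)) powr s)"
      using s zeta_reg_eq_dirichlet[OF s] by auto
    finally show "zeta_all s = (\<Sum>n. 1 / (of_nat (Suc n)) powr s)" .
  qed
  note r = someI_ex[OF ex, folded riemann_zeta_def]
  show "riemann_zeta holomorphic_on (- {1})" using r by simp
  show "1 < Re s \<Longrightarrow> riemann_zeta s = (\<Sum>n. 1 / (of_nat (Suc n)) powr s)" using r by simp
qed

lemma riemann_zeta_eq_zeta_all:
  assumes "s \<noteq> 1"
  shows "riemann_zeta s = zeta_all s"
proof (rule analytic_continuation_open[of "{s. Re s > 1}" "- {1}" riemann_zeta zeta_all])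
  show "connected (- {1 :: complex})" by (simp add: connected_punctured_universe)
  show "{s. 1 < Re s} \<noteq> {}" by (auto intro!: exI[of _ 2])
  show "riemann_zeta z = zeta_all z" if "z \<in> {s. 1 < Re s}" for z
    using that riemann_zeta_spec(2)[of z] zeta_all_eq[of z] zeta_reg_eq_dirichlet[of z] by auto
qed (use assms in \<open>auto intro!: open_halfspace_Re_gt riemann_zeta_spec holomorphic_zeta_all\<close>)

lemma riemann_zeta_eq:
  assumes "Re s > -1" "s \<noteq> 1"
  shows "riemann_zeta s = zeta_reg s / (s - 1)"
  using riemann_zeta_eq_zeta_all zeta_all_eq assms by simp

text \<open>True by construction for Re s < 0 and extended by the identity theorem. Re s < 1 keeps
  Gamma (1 - s) away from its poles; at s = 0 the right side would involve
  \<open>riemann_zeta\<close> at its pole.\<close>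

theorem riemann_zeta_functional_equation:
  assumes s: "Re s < 1" "s \<noteq> 0"
  shows "riemann_zeta s = 2 * (2 * of_real pi) powr (s - 1) * sin (of_real pi * s / 2) * Gamma (1 - s) * riemann_zeta (1 - s)"
proof (rule analytic_continuation_open[of "{s. Re s < 0}" "{s. Re s < 1} - {0}" riemann_zeta
    "\<lambda>s. 2 * (2 * of_real pi) powr (s - 1) * sin (of_real pi * s / 2) * Gamma (1 - s) * riemann_zeta (1 - s)"])
  show "connected ({s. Re s < 1} - {0 :: complex})"
    by (intro connected_open_delete open_halfspace_Re_lt convex_connected convex_halfspace_Re_lt) auto
  show "{s. Re s < 0} \<noteq> {}" by (auto intro!: exI[of _ "-1"])
  show "riemann_zeta holomorphic_on {s. Re s < 1} - {0}"
    by (rule holomorphic_on_subset[OF riemann_zeta_spec(1)]) auto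
  have "(\<lambda>s. riemann_zeta (1 - s)) holomorphic_on {s. Re s < 1} - {0}"
    by (rule holomorphic_on_compose_gen[OF _ riemann_zeta_spec(1), unfolded o_def]) (auto intro!: holomorphic_intros)
  then show "(\<lambda>s. 2 * (2 * of_real pi) powr (s - 1) * sin (of_real pi * s / 2) * Gamma (1 - s) * riemann_zeta (1 - s))
      holomorphic_on {s. Re s < 1} - {0}"
    by (intro holomorphic_intros) (auto elim!: nonpos_Ints_cases simp: complex_eq_iff)
  show "riemann_zeta z = 2 * (2 * of_real pi) powr (z - 1) * sin (of_real pi * z / 2) * Gamma (1 - z) * riemann_zeta (1 - z)"
    if "z \<in> {s. Re s < 0}" for z
  proof -
    have z: "Re z < 0" using that by simp
    then have "z \<noteq> 1" "1 - z \<noteq> 1" "-1 < Re (1 - z)" by auto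
    then have "riemann_zeta z = zeta_left z" "riemann_zeta (1 - z) = zeta_reg (1 - z) / (1 - z - 1)"
      using riemann_zeta_eq_zeta_all[of z] z riemann_zeta_eq[of "1 - z"] by (auto simp: zeta_all_def)
    then show ?thesis by (simp add: zeta_left_def)
  qed
qed (use s in \<open>auto intro!: open_halfspace_Re_lt open_Diff\<close>)

section \<open>Vertical integrals and residues\<close>

text \<open>The integral of \<open>K(z) dz / (2 \<pi> i)\<close> along \<open>Re z = c\<close>.\<close>

definition vint :: "real \<Rightarrow> (complex \<Rightarrow> complex) \<Rightarrow> complex" where
  "vint c K = of_real (1 / (2 * pi)) * (LINT y|lborel. K (Complex c y))"

lemma integrable_exp_abs:
  fixes \<delta> :: real
  assumes \<delta>: "\<delta> > 0"
  shows "integrable lborel (\<lambda>y. exp (- \<delta> * \<bar>y\<bar>))"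
proof -
  have 1: "((\<lambda>x. exp (- (\<delta> * x))) has_integral exp (- \<delta> * 0) / \<delta>) {0..}"
    using has_integral_exp_minus_to_infinity[OF \<delta>, of 0] by simp
  have "((\<lambda>y. exp (- \<delta> * \<bar>y\<bar>)) has_integral exp (- \<delta> * 0) / \<delta>) {0..}"
    by (rule has_integral_eq[OF _ 1]) auto
  then have a: "(\<lambda>y. exp (- \<delta> * \<bar>y\<bar>)) integrable_on {0..}" by blast
  define f where "f y = indicator {0..} y *\<^sub>R exp (- \<delta> * \<bar>y\<bar>)" for y :: real
  have "(\<lambda>y. exp (- \<delta> * \<bar>y\<bar>)) absolutely_integrable_on {0..}"
    by (rule nonnegative_absolutely_integrable_1[OF a]) auto
  then have f: "integrable lborel f"
    unfolding f_def set_integrable_def by (subst (asm) integrable_completion) auto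
  have "integrable lborel (\<lambda>y. f (0 + (- 1) * y))"
    by (rule lborel_integrable_real_affine[OF f]) simp
  then have "integrable lborel (\<lambda>y. f y + f (- y))" using f by simp
  then show ?thesis
    by (rule Bochner_Integration.integrable_bound) (auto simp: f_def indicator_def)
qed

text \<open>Decay is asked only for large |y|, where the sine in the denominator is under control;
  continuity on a compact interval covers the rest.\<close>

lemma integrable_decay:
  fixes f :: "real \<Rightarrow> complex"
  assumes cont: "continuous_on UNIV f" and \<delta>: "\<delta> > 0"
    and bd: "\<And>y. \<bar>y\<bar> \<ge> Y \<Longrightarrow> norm (f y) \<le> C * exp (- \<delta> * \<bar>y\<bar>)"
  shows "integrable lborel f"
proof -
  have m: "f \<in> borel_measurable lborel" using borel_measurable_continuous_onI[OF cont] by simp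
  have "compact (f ` {-\<bar>Y\<bar>..\<bar>Y\<bar>})"
    by (intro compact_continuous_image continuous_on_subset[OF cont]) auto
  then obtain B where B: "\<And>y. y \<in> {-\<bar>Y\<bar>..\<bar>Y\<bar>} \<Longrightarrow> norm (f y) \<le> B"
    using compact_imp_bounded bounded_iff by (metis imageI)
  define D where "D = \<bar>B\<bar> * exp (\<delta> * \<bar>Y\<bar>) + \<bar>C\<bar>"
  have i: "integrable lborel (\<lambda>y. D * exp (- \<delta> * \<bar>y\<bar>))"
    by (intro integrable_mult_right integrable_exp_abs \<delta>)
  have "norm (f y) \<le> D * exp (- \<delta> * \<bar>y\<bar>)" for y
  proof (cases "\<bar>y\<bar> \<ge> \<bar>Y\<bar>")
    case True
    have "norm (f y) \<le> C * exp (- \<delta> * \<bar>y\<bar>)" using True by (intro bd) auto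
    also have "\<dots> \<le> D * exp (- \<delta> * \<bar>y\<bar>)"
      unfolding D_def by (intro mult_right_mono) (auto intro: order_trans[OF abs_ge_self])
    finally show ?thesis .
  next
    case False
    have "norm (f y) \<le> \<bar>B\<bar> * 1" proof -
      have "y \<in> {-\<bar>Y\<bar>..\<bar>Y\<bar>}" using False by (simp add: abs_le_iff) linarith
      from B[OF this] show ?thesis by linarith
    qed
    also have "\<dots> \<le> \<bar>B\<bar> * exp (\<delta> * \<bar>Y\<bar> - \<delta> * \<bar>y\<bar>)"
      using False \<delta> by (intro mult_left_mono) auto
    also have "\<dots> = \<bar>B\<bar> * exp (\<delta> * \<bar>Y\<bar>) * exp (- \<delta> * \<bar>y\<bar>)" by (simp add: exp_diff exp_minus field_simps)
    also have "\<dots> \<le> D * exp (- \<delta> * \<bar>y\<bar>)" unfolding D_def by (intro mult_right_mono) auto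
    finally show ?thesis .
  qed
  then show ?thesis
    by (intro Bochner_Integration.integrable_bound[OF i m]) (auto intro: order_trans[OF _ abs_ge_self])
qed

lemma continuous_on_Complex_line:
  assumes "K holomorphic_on S" "\<And>y. Complex c y \<in> S"
  shows "continuous_on UNIV (\<lambda>y. K (Complex c y))"
  by (rule continuous_on_compose2[OF holomorphic_on_imp_continuous_on[OF assms(1)]])
     (use assms in \<open>auto intro!: continuous_intros simp: Complex_eq\<close>)

lemma tendsto_integral_symmetric:
  fixes f :: "real \<Rightarrow> complex"
  assumes i: "integrable lborel f" and T: "filterlim T at_top sequentially"
  shows "(\<lambda>k. integral {- T k..T k} f) \<longlonglongrightarrow> (LINT y|lborel. f y)"
proof -
  have "(\<lambda>k. LINT y|lborel. indicator {- T k..T k} y *\<^sub>R f y) \<longlonglongrightarrow> (LINT y|lborel. f y)"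
  proof (rule integral_dominated_convergence[where w = "\<lambda>y. norm (f y)"])
    show "AE x in lborel. (\<lambda>k. indicator {- T k..T k} x *\<^sub>R f x) \<longlonglongrightarrow> f x"
    proof (rule AE_I2)
      fix x :: real
      have "eventually (\<lambda>k. T k \<ge> \<bar>x\<bar>) sequentially" using T by (simp add: filterlim_at_top)
      then have "eventually (\<lambda>k. indicator {- T k..T k} x *\<^sub>R f x = f x) sequentially"
        by eventually_elim (auto simp: indicator_def)
      then show "(\<lambda>k. indicator {- T k..T k} x *\<^sub>R f x) \<longlonglongrightarrow> f x" by (rule tendsto_eventually)
    qed
  qed (use i in \<open>auto simp: indicator_def\<close>)
  moreover have "(LINT y|lborel. indicator {- T k..T k} y *\<^sub>R f y) = integral {- T k..T k} f" for k
  proof -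
    have "set_integrable lborel {- T k..T k} f"
      unfolding set_integrable_def using i by (intro integrable_mult_indicator) auto
    from set_borel_integral_eq_integral(2)[OF this] show ?thesis
      by (simp add: set_lebesgue_integral_def)
  qed
  ultimately show ?thesis by simp
qed

text \<open>P may be infinite, so only the partial sums over |Im p| < T k appear. The heights avoid
  the ordinates of P, and the horizontal sides vanish in the limit through
  \<open>\<epsilon>\<close>. The margins a' < a and b < b' put the closed rectangle into an open
  domain.\<close>

lemma rectangle_limit:
  fixes K :: "complex \<Rightarrow> complex"
  assumes ab: "a' < a" "a < b" "b < b'"
    and holo: "K holomorphic_on ({z. a' < Re z \<and> Re z < b'} - P)"
    and P: "P \<subseteq> {z. a < Re z \<and> Re z < b}" and fin: "\<And>T. finite {p \<in> P. \<bar>Im p\<bar> \<le> T}"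
    and ia: "integrable lborel (\<lambda>y. K (Complex a y))" and ib: "integrable lborel (\<lambda>y. K (Complex b y))"
    and T: "filterlim T at_top sequentially" "\<And>k p. p \<in> P \<Longrightarrow> \<bar>Im p\<bar> \<noteq> T k"
    and \<epsilon>: "\<epsilon> \<longlonglongrightarrow> 0" and T0: "\<And>k. T k > 0"
    and hor: "\<And>k z. \<lbrakk>a \<le> Re z; Re z \<le> b; \<bar>Im z\<bar> = T k\<rbrakk> \<Longrightarrow> norm (K z) \<le> \<epsilon> k"
  shows "(\<lambda>k. \<Sum>p\<in>{p \<in> P. \<bar>Im p\<bar> < T k}. residue K p) \<longlonglongrightarrow> vint b K - vint a K"
proof -
  define S where "S k = {z. a' < Re z \<and> Re z < b' \<and> - (T k + 1) < Im z \<and> Im z < T k + 1}" for k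
  define rp where "rp k = rectpath (Complex a (- T k)) (Complex b (T k))" for k
  have Sbox: "S k = box (Complex a' (- (T k + 1))) (Complex b' (T k + 1))" for k
    by (auto simp: S_def in_box_complex_iff)
  have int: "contour_integral (rp k) K = 2 * pi * \<i> * (\<Sum>p\<in>{p \<in> P. \<bar>Im p\<bar> < T k}. residue K p)" for k
  proof -
    \<comment> \<open>The open neighbourhood S k reaches 1 above and below the rectangle; the poles
      in this collar are removed as well and drop out with winding number 0.\<close>
    define Q where "Q = {p \<in> P. \<bar>Im p\<bar> \<le> T k + 1}"
    have pin: "path_image (rp k) \<subseteq> S k - Q"
    proof -
      have "path_image (rp k) \<subseteq> cbox (Complex a (- T k)) (Complex b (T k))"
        unfolding rp_def using ab T0[of k] by (intro path_image_rectpath_subset_cbox) auto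
      also have "\<dots> \<subseteq> S k" using ab by (auto simp: S_def in_cbox_complex_iff)
      finally have 1: "path_image (rp k) \<subseteq> S k" .
      have "p \<notin> path_image (rp k)" if "p \<in> Q" for p
      proof -
        have "p \<in> P" using that by (simp add: Q_def)
        then have "a < Re p" "Re p < b" "\<bar>Im p\<bar> \<noteq> T k" using P T(2) by auto
        then show ?thesis unfolding rp_def using ab T0[of k]
          by (subst path_image_rectpath) auto
      qed
      with 1 show ?thesis by blast
    qed
    have "contour_integral (rp k) K = 2 * pi * \<i> * (\<Sum>p\<in>Q. winding_number (rp k) p * residue K p)"
    proof (rule Residue_theorem[of "S k"])
      show "open (S k)" "connected (S k)" unfolding Sbox by (auto intro: convex_connected convex_box)
      show "finite Q" unfolding Q_def by (rule fin)
      show "K holomorphic_on S k - Q"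
        by (rule holomorphic_on_subset[OF holo]) (auto simp: S_def Q_def)
      show "valid_path (rp k)" "pathfinish (rp k) = pathstart (rp k)" by (auto simp: rp_def)
      show "\<forall>z. z \<notin> S k \<longrightarrow> winding_number (rp k) z = 0"
        unfolding rp_def using ab T0[of k]
        by (intro allI impI winding_number_rectpath_outside) (auto simp: S_def in_cbox_complex_iff)
    qed (fact pin)
    also have "(\<Sum>p\<in>Q. winding_number (rp k) p * residue K p)
       = (\<Sum>p\<in>{p \<in> P. \<bar>Im p\<bar> < T k}. winding_number (rp k) p * residue K p)"
    proof (rule sum.mono_neutral_right)
      show "finite Q" unfolding Q_def by (rule fin)
      show "{p \<in> P. \<bar>Im p\<bar> < T k} \<subseteq> Q" by (auto simp: Q_def)
      show "\<forall>p\<in>Q - {p \<in> P. \<bar>Im p\<bar> < T k}. winding_number (rp k) p * residue K p = 0"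
      proof
        fix p assume "p \<in> Q - {p \<in> P. \<bar>Im p\<bar> < T k}"
        then have "p \<in> P" "\<bar>Im p\<bar> \<ge> T k" by (auto simp: Q_def)
        then have "\<bar>Im p\<bar> > T k" using T(2)[of p k] by simp
        then have "winding_number (rp k) p = 0" unfolding rp_def using ab T0[of k]
          by (intro winding_number_rectpath_outside) (auto simp: in_cbox_complex_iff)
        then show "winding_number (rp k) p * residue K p = 0" by simp
      qed
    qed
    also have "\<dots> = (\<Sum>p\<in>{p \<in> P. \<bar>Im p\<bar> < T k}. residue K p)"
    proof (rule sum.cong)
      fix p assume "p \<in> {p \<in> P. \<bar>Im p\<bar> < T k}"
      then have "p \<in> box (Complex a (- T k)) (Complex b (T k))" using P by (auto simp: in_box_complex_iff)
      from winding_number_rectpath[OF this] show "winding_number (rp k) p * residue K p = residue K p"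
        by (simp add: rp_def)
    qed simp
    finally show ?thesis .
  qed
  have dom: "z \<in> {z. a' < Re z \<and> Re z < b'} - P" if "a \<le> Re z" "Re z \<le> b" "Re z = a \<or> Re z = b \<or> \<bar>Im z\<bar> = T k" for z k
    using that ab P T(2)[of z k] by force
  have cont: "continuous_on A K" if "A \<subseteq> {z. a' < Re z \<and> Re z < b'} - P" for A
    using holomorphic_on_imp_continuous_on[OF holo] that by (rule continuous_on_subset)
  have split: "contour_integral (rp k) K = \<i> * integral {- T k..T k} (\<lambda>y. K (Complex b y))
      - \<i> * integral {- T k..T k} (\<lambda>y. K (Complex a y))
      + (contour_integral (linepath (Complex a (- T k)) (Complex b (- T k))) K
         - contour_integral (linepath (Complex a (T k)) (Complex b (T k))) K)"
    and horb: "norm (contour_integral (linepath (Complex a (- T k)) (Complex b (- T k))) K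
         - contour_integral (linepath (Complex a (T k)) (Complex b (T k))) K) \<le> 2 * (b - a) * \<epsilon> k" for k
  proof -
    let ?a1 = "Complex a (- T k)" and ?a2 = "Complex b (- T k)" and ?a3 = "Complex b (T k)" and ?a4 = "Complex a (T k)"
    have segv: "closed_segment (Complex c (- T k)) (Complex c (T k)) \<subseteq> {z. a' < Re z \<and> Re z < b'} - P" if "c = a \<or> c = b" for c
    proof
      fix z assume "z \<in> closed_segment (Complex c (- T k)) (Complex c (T k))"
      then have "Re z = c" using closed_segment_same_Re[of "Complex c (- T k)" "Complex c (T k)"] by auto
      then show "z \<in> {z. a' < Re z \<and> Re z < b'} - P" using dom[of z k] that ab by auto
    qed
    have segh0: "Im z = t \<and> a \<le> Re z \<and> Re z \<le> b" if "z \<in> closed_segment (Complex a t) (Complex b t)" for z t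
      using that ab closed_segment_same_Im[of "Complex a t" "Complex b t"] by (auto simp: closed_segment_eq_real_ivl)
    have segh: "closed_segment (Complex a t) (Complex b t) \<subseteq> {z. a' < Re z \<and> Re z < b'} - P" if "t = T k \<or> t = - T k" for t
    proof
      fix z assume "z \<in> closed_segment (Complex a t) (Complex b t)"
      from segh0[OF this] show "z \<in> {z. a' < Re z \<and> Re z < b'} - P" using dom[of z k] that T0[of k] by auto
    qed
    have i1: "K contour_integrable_on linepath ?a1 ?a2" and i2: "K contour_integrable_on linepath ?a2 ?a3"
      and i3: "K contour_integrable_on linepath ?a4 ?a3" and i4: "K contour_integrable_on linepath ?a1 ?a4"
      using segh segv by (auto intro!: contour_integrable_continuous_linepath cont)
    have i3': "K contour_integrable_on linepath ?a3 ?a4" and i4': "K contour_integrable_on linepath ?a4 ?a1"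
      using contour_integrable_reversepath[OF _ i3] contour_integrable_reversepath[OF _ i4] by auto
    have r3: "contour_integral (linepath ?a3 ?a4) K = - contour_integral (linepath ?a4 ?a3) K"
      using contour_integral_reversepath[of "linepath ?a4 ?a3" K] by simp
    have r4: "contour_integral (linepath ?a4 ?a1) K = - contour_integral (linepath ?a1 ?a4) K"
      using contour_integral_reversepath[of "linepath ?a1 ?a4" K] by simp
    have "contour_integral (rp k) K = contour_integral (linepath ?a1 ?a2) K + (contour_integral (linepath ?a2 ?a3) K
       + (contour_integral (linepath ?a3 ?a4) K + contour_integral (linepath ?a4 ?a1) K))"
    proof -
      have v: "valid_path (linepath ?a3 ?a4 +++ linepath ?a4 ?a1)"
        "valid_path (linepath ?a2 ?a3 +++ linepath ?a3 ?a4 +++ linepath ?a4 ?a1)"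
        by (auto intro!: valid_path_join)
      have j34: "K contour_integrable_on (linepath ?a3 ?a4 +++ linepath ?a4 ?a1)"
        by (rule contour_integrable_joinI[OF i3' i4']) auto
      have j: "K contour_integrable_on (linepath ?a2 ?a3 +++ linepath ?a3 ?a4 +++ linepath ?a4 ?a1)"
        by (rule contour_integrable_joinI[OF i2 j34]) (use v in auto)
      show ?thesis unfolding rp_def rectpath_def Let_def complex.sel
        contour_integral_join[OF i1 j valid_path_linepath v(2)] contour_integral_join[OF i2 j34 valid_path_linepath v(1)]
        contour_integral_join[OF i3' i4' valid_path_linepath valid_path_linepath] ..
    qed
    moreover have "contour_integral (linepath ?a2 ?a3) K = \<i> * integral {- T k..T k} (\<lambda>y. K (Complex b y))"
      "contour_integral (linepath ?a1 ?a4) K = \<i> * integral {- T k..T k} (\<lambda>y. K (Complex a y))"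
      using T0[of k] by (auto intro!: contour_integral_linepath_same_Re)
    ultimately show "contour_integral (rp k) K = \<i> * integral {- T k..T k} (\<lambda>y. K (Complex b y))
      - \<i> * integral {- T k..T k} (\<lambda>y. K (Complex a y))
      + (contour_integral (linepath ?a1 ?a2) K - contour_integral (linepath ?a4 ?a3) K)"
      unfolding r3 r4 by simp
    have e0: "0 \<le> \<epsilon> k" 
      by (rule order_trans[OF norm_ge_zero hor[of "Complex a (T k)"]]) (use ab T0[of k] in auto)
    have "norm (contour_integral (linepath ?a1 ?a2) K) \<le> \<epsilon> k * norm (?a2 - ?a1)"
      using segh0[of _ "- T k"] T0[of k] by (intro contour_integral_bound_linepath i1 e0 hor) auto
    moreover have "norm (contour_integral (linepath ?a4 ?a3) K) \<le> \<epsilon> k * norm (?a3 - ?a4)"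
      using segh0[of _ "T k"] T0[of k] by (intro contour_integral_bound_linepath i3 e0 hor) auto
    moreover have "norm (?a2 - ?a1) = b - a" "norm (?a3 - ?a4) = b - a"
      using ab by (auto simp: cmod_def)
    ultimately show "norm (contour_integral (linepath ?a1 ?a2) K - contour_integral (linepath ?a4 ?a3) K) \<le> 2 * (b - a) * \<epsilon> k"
      by (intro order_trans[OF norm_triangle_ineq4]) (simp add: algebra_simps)
  qed
  define h where "h k = contour_integral (linepath (Complex a (- T k)) (Complex b (- T k))) K
         - contour_integral (linepath (Complex a (T k)) (Complex b (T k))) K" for k
  have h0: "h \<longlonglongrightarrow> 0"
  proof (rule Lim_null_comparison)
    show "\<forall>\<^sub>F k in sequentially. norm (h k) \<le> 2 * (b - a) * \<epsilon> k" unfolding h_def using horb by (intro always_eventually allI)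
    show "(\<lambda>k. 2 * (b - a) * \<epsilon> k) \<longlonglongrightarrow> 0" using tendsto_mult_right_zero[OF \<epsilon>] by simp
  qed
  have "(\<lambda>k. (\<i> * integral {- T k..T k} (\<lambda>y. K (Complex b y)) - \<i> * integral {- T k..T k} (\<lambda>y. K (Complex a y)) + h k) / (2 * pi * \<i>))
     \<longlonglongrightarrow> (\<i> * (LINT y|lborel. K (Complex b y)) - \<i> * (LINT y|lborel. K (Complex a y)) + 0) / (2 * pi * \<i>)"
    by (intro tendsto_intros tendsto_integral_symmetric ia ib T(1) h0) auto
  moreover have "(\<i> * integral {- T k..T k} (\<lambda>y. K (Complex b y)) - \<i> * integral {- T k..T k} (\<lambda>y. K (Complex a y)) + h k) / (2 * pi * \<i>)
     = (\<Sum>p\<in>{p \<in> P. \<bar>Im p\<bar> < T k}. residue K p)" for k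
    unfolding h_def split[symmetric] int by simp
  moreover have "(\<i> * (LINT y|lborel. K (Complex b y)) - \<i> * (LINT y|lborel. K (Complex a y)) + 0) / (2 * pi * \<i>) = vint b K - vint a K"
    by (simp add: vint_def field_simps)
  ultimately show ?thesis by simp
qed

text \<open>With finitely many real poles and exponential decay the heights k + 1 suffice; all
  partial sums of residues then coincide, so the limit is an equality.\<close>

lemma vint_shift:
  fixes K :: "complex \<Rightarrow> complex"
  assumes ab: "a' < a" "a < b" "b < b'"
    and holo: "K holomorphic_on ({z. a' < Re z \<and> Re z < b'} - P)"
    and P: "P \<subseteq> {z. a < Re z \<and> Re z < b}" "finite P" "P \<subseteq> \<real>" and \<delta>: "\<delta> > 0"
    and bd: "\<And>z. \<lbrakk>a \<le> Re z; Re z \<le> b; \<bar>Im z\<bar> \<ge> 1\<rbrakk> \<Longrightarrow> norm (K z) \<le> C * exp (- \<delta> * \<bar>Im z\<bar>)"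
  shows "vint b K - vint a K = (\<Sum>p\<in>P. residue K p)"
    and "integrable lborel (\<lambda>y. K (Complex a y))" "integrable lborel (\<lambda>y. K (Complex b y))"
proof -
  have i: "integrable lborel (\<lambda>y. K (Complex c y))" if "c = a \<or> c = b" for c
  proof (rule integrable_decay[OF _ \<delta>, of _ 1])
    show "continuous_on UNIV (\<lambda>y. K (Complex c y))"
      by (rule continuous_on_Complex_line[OF holo]) (use that ab P in force)
    show "norm (K (Complex c y)) \<le> C * exp (- \<delta> * \<bar>y\<bar>)" if "1 \<le> \<bar>y\<bar>" for y
      using bd[of "Complex c y"] that ab \<open>c = a \<or> c = b\<close> by auto
  qed
  show "integrable lborel (\<lambda>y. K (Complex a y))" "integrable lborel (\<lambda>y. K (Complex b y))" by (auto intro: i)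
  define T where "T k = real (Suc k)" for k
  have Tl: "filterlim T at_top sequentially"
    unfolding T_def by (rule filterlim_compose[OF filterlim_real_sequentially filterlim_Suc])
  have P0: "Im p = 0" if "p \<in> P" for p using P(3) that complex_is_Real_iff by blast
  have "(\<lambda>k. \<Sum>p\<in>{p \<in> P. \<bar>Im p\<bar> < T k}. residue K p) \<longlonglongrightarrow> vint b K - vint a K"
  proof (rule rectangle_limit[OF ab holo P(1) _ i i Tl])
    show "(\<lambda>k. C * exp (- \<delta> * T k)) \<longlonglongrightarrow> 0"
    proof -
      have "filterlim (\<lambda>k. - \<delta> * T k) at_bot sequentially"
        using \<delta> by (intro filterlim_tendsto_neg_mult_at_bot[OF tendsto_const _ Tl]) auto
      then have "(\<lambda>k. exp (- \<delta> * T k)) \<longlonglongrightarrow> 0" by (rule filterlim_compose[OF exp_at_bot])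
      then show ?thesis by (rule tendsto_mult_right_zero)
    qed
    show "norm (K z) \<le> C * exp (- \<delta> * T k)" if "a \<le> Re z" "Re z \<le> b" "\<bar>Im z\<bar> = T k" for k z
      using bd[of z] that by (simp add: T_def)
  qed (use P P0 in \<open>auto simp: T_def intro: finite_subset\<close>)
  moreover have "{p \<in> P. \<bar>Im p\<bar> < T k} = P" for k using P0 by (auto simp: T_def)
  ultimately have "(\<lambda>k. \<Sum>p\<in>P. residue K p) \<longlonglongrightarrow> vint b K - vint a K" by simp
  then show "vint b K - vint a K = (\<Sum>p\<in>P. residue K p)" using LIMSEQ_unique tendsto_const by blast
qed

section \<open>The kernel \<open>exp (w z) / sin (\<pi> z)\<close>\<close>

text \<open>|sin (pi z)|^2 = (u^2 + u^(-2) - 2 cos (2 pi Re z)) / 4 with u = exp (pi |Im z|). The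
  cosine is harmless once u is large, and it disappears on lines such as Re z = 3/4.\<close>

lemma norm_sin_pi_ge:
  fixes z :: complex
  assumes "\<bar>Im z\<bar> \<ge> 1 \<or> cos (2 * pi * Re z) = 0"
  shows "exp (pi * \<bar>Im z\<bar>) / 4 \<le> norm (sin (of_real pi * z))"
proof -
  define u where "u = exp (pi * \<bar>Im z\<bar>)"
  have u1: "u \<ge> 1" by (simp add: u_def)
  have sq: "norm (sin (of_real pi * z)) ^ 2 = (u\<^sup>2 + 1 / u\<^sup>2 - 2 * cos (2 * pi * Re z)) / 4"
  proof -
    have "exp (2 * (pi * Im z)) + inverse (exp (2 * (pi * Im z))) = u\<^sup>2 + 1 / u\<^sup>2"
      by (cases "Im z \<ge> 0") (auto simp: u_def exp_double exp_minus power_inverse divide_inverse)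
    then show ?thesis by (simp add: norm_sin_squared mult.assoc)
  qed
  have "u\<^sup>2 / 16 \<le> norm (sin (of_real pi * z)) ^ 2"
  proof (cases "cos (2 * pi * Re z) = 0")
    case True
    then show ?thesis unfolding sq using u1 by (simp add: field_simps)
  next
    case False
    then have "pi * 1 \<le> pi * \<bar>Im z\<bar>" using assms by (intro mult_left_mono) auto
    then have "1 + 2 \<le> 1 + pi * \<bar>Im z\<bar>" using pi_gt3 by linarith
    also have "\<dots> \<le> u" unfolding u_def by (rule exp_ge_add_one_self)
    finally have "3 \<le> u" by simp
    then have "9 \<le> u\<^sup>2" using power_mono[of 3 u 2] by simp
    moreover have "0 \<le> 1 / u\<^sup>2" by simp
    moreover have "cos (2 * pi * Re z) \<le> 1" by simp
    ultimately have "u\<^sup>2 / 16 \<le> (u\<^sup>2 + 1 / u\<^sup>2 - 2 * cos (2 * pi * Re z)) / 4"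
      by argo
    then show ?thesis unfolding sq .
  qed
  then have "(u / 4)\<^sup>2 \<le> norm (sin (of_real pi * z)) ^ 2" by (simp add: power_divide)
  then show ?thesis unfolding u_def by (rule power2_le_imp_le) auto
qed

definition expsin :: "complex \<Rightarrow> complex \<Rightarrow> complex" where
  "expsin w z = exp (w * z) / sin (of_real pi * z)"

lemma norm_expsin_le:
  assumes "\<bar>Im z\<bar> \<ge> 1 \<or> cos (2 * pi * Re z) = 0"
  shows "norm (expsin w z) \<le> 4 * exp (Re w * Re z) * exp (- (pi - \<bar>Im w\<bar>) * \<bar>Im z\<bar>)"
proof -
  have 1: "norm (exp (w * z)) \<le> exp (Re w * Re z) * exp (\<bar>Im w\<bar> * \<bar>Im z\<bar>)"
    by (simp flip: exp_add abs_mult)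
  have "norm (expsin w z) = norm (exp (w * z)) / norm (sin (of_real pi * z))"
    by (simp add: expsin_def norm_divide)
  also have "\<dots> \<le> (exp (Re w * Re z) * exp (\<bar>Im w\<bar> * \<bar>Im z\<bar>)) / (exp (pi * \<bar>Im z\<bar>) / 4)"
    using norm_sin_pi_ge[OF assms] by (intro frac_le 1) auto
  also have "\<dots> = 4 * exp (Re w * Re z) * exp (- (pi - \<bar>Im w\<bar>) * \<bar>Im z\<bar>)"
    by (simp add: exp_minus exp_diff left_diff_distrib field_simps)
  finally show ?thesis .
qed

text \<open>The quasi-periodicity behind all evaluations of integrals of this kernel: moving the
  line by an integer reproduces the integral up to a factor, and the residues crossed supply a
  linear equation for it.\<close>

lemma expsin_plus1: "expsin w (z + 1) = - exp w * expsin w z"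
proof -
  have "sin (of_real pi * (z + 1)) = - sin (of_real pi * z)"
    using sin_plus_pi[of "of_real pi * z"] by (simp add: distrib_left)
  then show ?thesis by (simp add: expsin_def distrib_left exp_add mult.commute)
qed

lemma sin_pi_z_eq_0_iff: "sin (of_real pi * z) = 0 \<longleftrightarrow> z \<in> \<int>" for z :: complex
proof -
  have "(\<exists>n::int. of_real pi * z = of_real (n * pi)) \<longleftrightarrow> (\<exists>n::int. z = of_int n)"
    by (intro ex_cong1) (auto simp: field_simps)
  then show ?thesis by (auto simp: sin_eq_0 Ints_def)
qed

lemma complex_Ints_Re: "z \<in> \<int> \<Longrightarrow> \<exists>n::int. z = of_int n \<and> Re z = of_int n" for z :: complex
  by (auto elim!: Ints_cases)

lemma strip1_Ints:
  assumes "1/2 < Re z" "Re z < 2" "(z::complex) \<in> \<int>" shows "z = 1"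
proof -
  obtain n where n: "z = of_int n" "Re z = of_int n" using complex_Ints_Re[OF assms(3)] by auto
  then have "0 < n" "n < 2" using assms by linarith+
  then have "n = 1" by simp
  then show ?thesis using n by simp
qed

lemma one_plus_exp_nonzero:
  assumes "\<bar>Im w\<bar> < pi" shows "1 + exp w \<noteq> 0"
proof
  assume "1 + exp w = 0"
  then have "exp w = -1" by (simp add: add_eq_0_iff)
  then have "exp w = exp (\<i> * pi)" by simp
  then obtain n :: int where "w = \<i> * of_real pi + of_real (real_of_int (2 * n) * pi) * \<i>" unfolding exp_eq by blast
  then have "Im w = pi + 2 * of_int n * pi" by simp
  then have "\<bar>pi * (1 + 2 * of_int n)\<bar> < pi * 1" using assms by (simp add: algebra_simps)
  then have "\<bar>1 + 2 * of_int n :: real\<bar> < 1" by (simp add: abs_mult)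
  then have "- 1 < 1 + 2 * (of_int n :: real)" "1 + 2 * (of_int n :: real) < 1" by linarith+
  then have "- 1 < n" "n < 0" by linarith+
  then show False by linarith
qed

lemma vint_cmult: "vint c (\<lambda>z. k * K z) = k * vint c K"
  by (simp add: vint_def)

lemma vint_add:
  assumes "integrable lborel (\<lambda>y. K (Complex c y))" "integrable lborel (\<lambda>y. G (Complex c y))"
  shows "vint c (\<lambda>z. K z + G z) = vint c K + vint c G"
  using assms by (simp add: vint_def distrib_left)

lemma vint_plus1: "vint (c + 1) K = vint c (\<lambda>z. K (z + 1))"
proof -
  have "Complex c y + 1 = Complex (c + 1) y" for y by (simp add: complex_eq_iff)
  then show ?thesis by (simp add: vint_def)
qed

lemma residue_expsin:
  fixes h :: "complex \<Rightarrow> complex"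
  assumes n: "n = 1 \<or> n = (2::int)" and h: "h holomorphic_on S" "open S" "connected S" "of_int n \<in> S" "h (of_int n) \<noteq> 0"
  shows "residue (\<lambda>z. expsin w z * h z) (of_int n) = (-1) ^ nat n * exp (w * of_int n) * h (of_int n) / of_real pi"
proof -
  have c: "cos (of_real pi * of_int n :: complex) = (-1) ^ nat n" proof -
    have "cos (of_real pi * of_int n :: complex) = of_real (cos (pi * of_int n))"
      by (metis cos_of_real of_real_mult of_real_of_int_eq)
    also have "cos (pi * of_int n) = (-1) ^ nat n" using n by (auto simp: mult.commute[of pi 2])
    finally show ?thesis unfolding of_real_power of_real_minus of_real_1 .
  qed
  have s: "sin (of_real pi * of_int n :: complex) = 0" by (simp add: sin_pi_z_eq_0_iff)
  have "residue (\<lambda>z. (exp (w * z) * h z) / sin (of_real pi * z)) (of_int n) = (exp (w * of_int n) * h (of_int n)) / (of_real pi * cos (of_real pi * of_int n))"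
  proof (rule residue_simple_pole_deriv[of _ S])
    show "((\<lambda>z. sin (of_real pi * z)) has_field_derivative of_real pi * cos (of_real pi * of_int n)) (at (of_int n))"
      by (auto intro!: derivative_eq_intros)
    show "of_real pi * cos (of_real pi * of_int n :: complex) \<noteq> 0" unfolding c by simp
  qed (use h s in \<open>auto intro!: holomorphic_intros\<close>)
  then show ?thesis unfolding c using n by (auto simp: expsin_def)
qed

lemma expsin_shift1:
  fixes h :: "complex \<Rightarrow> complex"
  assumes w: "\<bar>Im w\<bar> < pi" and h: "h holomorphic_on {z. 1/2 < Re z}"
    and h1: "h 1 \<noteq> 0"
    and hb: "\<And>z. \<lbrakk>3/4 \<le> Re z; Re z \<le> 7/4\<rbrakk> \<Longrightarrow> norm (h z) \<le> B * (1 + \<bar>Im z\<bar>)"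
  shows "vint (3/4) (\<lambda>z. expsin w z * h z) + exp w * vint (3/4) (\<lambda>z. expsin w z * h (z + 1)) = exp w * h 1 / of_real pi"
    and "integrable lborel (\<lambda>y. expsin w (Complex (3/4) y) * h (Complex (3/4) y))"
    and "integrable lborel (\<lambda>y. expsin w (Complex (3/4) y) * h (Complex (3/4) y + 1))"
proof -
  \<comment> \<open>Half of the decay rate is spent on absorbing the linear growth of h.\<close>
  define \<delta> where "\<delta> = (pi - \<bar>Im w\<bar>) / 2"
  have \<delta>: "\<delta> > 0" using w by (simp add: \<delta>_def)
  define C where "C = 4 * exp (2 * \<bar>Re w\<bar>) * (\<bar>B\<bar> * (1 + 1 / \<delta>))"
  let ?K = "\<lambda>z. expsin w z * h z"
  have bd: "norm (?K z) \<le> C * exp (- \<delta> * \<bar>Im z\<bar>)" if z: "3/4 \<le> Re z" "Re z \<le> 7/4" "\<bar>Im z\<bar> \<ge> 1" for z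
  proof -
    have "Re w * Re z \<le> \<bar>Re w\<bar> * 2" proof -
      have "Re w * Re z \<le> \<bar>Re w\<bar> * \<bar>Re z\<bar>" using abs_ge_self[of "Re w * Re z"] by (simp only: abs_mult)
      also have "\<dots> \<le> \<bar>Re w\<bar> * 2" using z by (intro mult_left_mono) auto
      finally show ?thesis .
    qed
    then have e1: "exp (Re w * Re z) \<le> exp (2 * \<bar>Re w\<bar>)" by simp
    have "\<delta> * \<bar>Im z\<bar> \<le> exp (\<delta> * \<bar>Im z\<bar>)" using exp_ge_add_one_self[of "\<delta> * \<bar>Im z\<bar>"] by linarith
    then have "\<bar>Im z\<bar> \<le> exp (\<delta> * \<bar>Im z\<bar>) / \<delta>" using \<delta> by (simp add: field_simps)
    moreover have "1 \<le> exp (\<delta> * \<bar>Im z\<bar>)" using \<delta> by simp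
    moreover have "(1 + 1 / \<delta>) * exp (\<delta> * \<bar>Im z\<bar>) = exp (\<delta> * \<bar>Im z\<bar>) + exp (\<delta> * \<bar>Im z\<bar>) / \<delta>" by (simp add: distrib_right)
    ultimately have "1 + \<bar>Im z\<bar> \<le> (1 + 1 / \<delta>) * exp (\<delta> * \<bar>Im z\<bar>)" by linarith
    then have "\<bar>B\<bar> * (1 + \<bar>Im z\<bar>) \<le> \<bar>B\<bar> * ((1 + 1 / \<delta>) * exp (\<delta> * \<bar>Im z\<bar>))" by (intro mult_left_mono) auto
    moreover have "norm (h z) \<le> \<bar>B\<bar> * (1 + \<bar>Im z\<bar>)"
      using hb[OF z(1,2)] mult_right_mono[OF abs_ge_self[of B], of "1 + \<bar>Im z\<bar>"] by linarith
    ultimately have h2: "norm (h z) \<le> \<bar>B\<bar> * (1 + 1 / \<delta>) * exp (\<delta> * \<bar>Im z\<bar>)" by simp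
    have "norm (expsin w z) \<le> 4 * exp (Re w * Re z) * exp (- (pi - \<bar>Im w\<bar>) * \<bar>Im z\<bar>)"
      by (rule norm_expsin_le) (use z in simp)
    also have "\<dots> \<le> 4 * exp (2 * \<bar>Re w\<bar>) * exp (- (2 * \<delta>) * \<bar>Im z\<bar>)" proof -
      have e: "pi - \<bar>Im w\<bar> = 2 * \<delta>" by (simp add: \<delta>_def)
      show ?thesis unfolding e by (intro mult_right_mono mult_left_mono e1) auto
    qed
    finally have "norm (?K z) \<le> (4 * exp (2 * \<bar>Re w\<bar>) * exp (- (2 * \<delta>) * \<bar>Im z\<bar>)) * (\<bar>B\<bar> * (1 + 1 / \<delta>) * exp (\<delta> * \<bar>Im z\<bar>))"
      unfolding norm_mult using h2 by (intro mult_mono) auto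
    also have "\<dots> = C * (exp (- (2 * \<delta>) * \<bar>Im z\<bar>) * exp (\<delta> * \<bar>Im z\<bar>))" by (simp add: C_def)
    also have "exp (- (2 * \<delta>) * \<bar>Im z\<bar>) * exp (\<delta> * \<bar>Im z\<bar>) = exp (- \<delta> * \<bar>Im z\<bar>)"
      by (simp flip: exp_add)
    finally show ?thesis .
  qed
  have holo: "?K holomorphic_on ({z. 1/2 < Re z \<and> Re z < 2} - {1})"
    unfolding expsin_def
    by (intro holomorphic_intros holomorphic_on_subset[OF h]) (use strip1_Ints sin_pi_z_eq_0_iff in auto)
  note sh = vint_shift[where K = ?K and a' = "1/2" and a = "3/4" and b = "7/4" and b' = 2 and P = "{1}", OF _ _ _ holo _ _ _ \<delta> bd]
  have "vint (7/4) ?K - vint (3/4) ?K = (\<Sum>p\<in>{1}. residue ?K p)"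
    by (rule sh(1)) auto
  also have "\<dots> = - exp w * h 1 / of_real pi"
    using residue_expsin[of 1 h "{z. 1/2 < Re z}" w, OF _ h open_halfspace_Re_gt convex_connected[OF convex_halfspace_Re_gt]] h1
    by simp
  finally have eq: "vint (7/4) ?K - vint (3/4) ?K = - exp w * h 1 / of_real pi" .
  have i1: "integrable lborel (\<lambda>y. ?K (Complex (3/4) y))" by (rule sh(2)) auto
  have i2: "integrable lborel (\<lambda>y. ?K (Complex (7/4) y))" by (rule sh(3)) auto
  have c: "Complex (7/4) y = Complex (3/4) y + 1" for y by (simp add: complex_eq_iff)
  show "integrable lborel (\<lambda>y. expsin w (Complex (3/4) y) * h (Complex (3/4) y))" by (fact i1)
  have "integrable lborel (\<lambda>y. - exp w * (expsin w (Complex (3/4) y) * h (Complex (3/4) y + 1)))"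
    using i2 unfolding c expsin_plus1 by (simp only: mult.assoc)
  note i3 = this
  show "integrable lborel (\<lambda>y. expsin w (Complex (3/4) y) * h (Complex (3/4) y + 1))"
  proof -
    have "integrable lborel (\<lambda>y. (- inverse (exp w)) * (- exp w * (expsin w (Complex (3/4) y) * h (Complex (3/4) y + 1))))"
      by (rule integrable_mult_right[OF i3])
    moreover have "(- inverse (exp w)) * (- exp w * X) = X" for X by simp
    ultimately show ?thesis by (simp only:)
  qed
  have "vint (7/4) ?K = vint (3/4) (\<lambda>z. - exp w * (expsin w z * h (z + 1)))"
    using vint_plus1[of "3/4" ?K] unfolding expsin_plus1 by (simp add: mult.assoc)
  also have "\<dots> = - exp w * vint (3/4) (\<lambda>z. expsin w z * h (z + 1))" by (rule vint_cmult)
  finally show "vint (3/4) ?K + exp w * vint (3/4) (\<lambda>z. expsin w z * h (z + 1)) = exp w * h 1 / of_real pi"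
    using eq by (simp add: algebra_simps)
qed

text \<open>For h = 1 the two integrals of the shift relation coincide, and 1 + exp w is nonzero for
  |Im w| < pi.\<close>

lemma vint_expsin:
  assumes w: "\<bar>Im w\<bar> < pi"
  shows "vint (3/4) (expsin w) = exp w / (of_real pi * (1 + exp w))"
    and "integrable lborel (\<lambda>y. expsin w (Complex (3/4) y))"
proof -
  have hb: "norm (1::complex) \<le> 1 * (1 + \<bar>Im z\<bar>)" for z by simp
  note s = expsin_shift1[OF w holomorphic_on_const _ hb]
  have "vint (3/4) (expsin w) + exp w * vint (3/4) (expsin w) = exp w / of_real pi"
    using s(1) by simp
  note a = this
  show "vint (3/4) (expsin w) = exp w / (of_real pi * (1 + exp w))"
  proof -
    have "vint (3/4) (expsin w) = (vint (3/4) (expsin w) + exp w * vint (3/4) (expsin w)) / (1 + exp w)"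
      using one_plus_exp_nonzero[OF w] by (simp add: eq_divide_eq algebra_simps)
    then show ?thesis unfolding a by simp
  qed
  show "integrable lborel (\<lambda>y. expsin w (Complex (3/4) y))" using s(2) by simp
qed

lemma integrable_expsin_mult:
  fixes h :: "complex \<Rightarrow> complex"
  assumes w: "\<bar>Im w\<bar> < pi" and c: "continuous_on UNIV (\<lambda>y. h (Complex (3/4) y))"
    and b: "\<And>y. norm (h (Complex (3/4) y)) \<le> B"
  shows "integrable lborel (\<lambda>y. expsin w (Complex (3/4) y) * h (Complex (3/4) y))"
proof (rule Bochner_Integration.integrable_bound)
  show "integrable lborel (\<lambda>y. B * norm (expsin w (Complex (3/4) y)))"
    by (intro integrable_mult_right integrable_norm vint_expsin w)
  have "(\<lambda>y. expsin w (Complex (3/4) y)) \<in> borel_measurable lborel"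
    using vint_expsin(2)[OF w] by simp
  moreover have "(\<lambda>y. h (Complex (3/4) y)) \<in> borel_measurable lborel"
    using borel_measurable_continuous_onI[OF c] by simp
  ultimately show "(\<lambda>y. expsin w (Complex (3/4) y) * h (Complex (3/4) y)) \<in> borel_measurable lborel" by simp
  show "AE y in lborel. norm (expsin w (Complex (3/4) y) * h (Complex (3/4) y)) \<le> norm (B * norm (expsin w (Complex (3/4) y)))"
  proof (rule AE_I2)
    fix y
    have "0 \<le> B" using b[of 0] norm_ge_zero order_trans by blast
    then show "norm (expsin w (Complex (3/4) y) * h (Complex (3/4) y)) \<le> norm (B * norm (expsin w (Complex (3/4) y)))"
      using b[of y] by (simp add: norm_mult) (metis mult.commute mult_right_mono norm_ge_zero)
  qed
qed

lemma norm_inverse_line: "norm (1 / (Complex (3/4) y + 1/2)) \<le> 1"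
proof -
  have "5/4 \<le> \<bar>Re (Complex (3/4) y + 1/2)\<bar>" by simp
  also have "\<dots> \<le> norm (Complex (3/4) y + 1/2)" by (rule abs_Re_le_cmod)
  finally have "1 \<le> norm (Complex (3/4) y + 1/2)" by simp
  moreover have "norm (1 / s) \<le> 1" if "1 \<le> norm s" for s :: complex
    using that by (simp add: norm_divide divide_le_eq)
  ultimately show ?thesis by blast
qed

lemma continuous_Complex_line [continuous_intros]: "continuous_on A (\<lambda>y. Complex c y)"
  by (simp add: Complex_eq continuous_intros)

lemma expsin_line_nonzero: "sin (of_real pi * Complex (3/4) y) \<noteq> 0"
proof
  assume "sin (of_real pi * Complex (3/4) y) = 0"
  then have "Complex (3/4) y \<in> \<int>" by (simp add: sin_pi_z_eq_0_iff)
  then obtain n :: int where "Complex (3/4) y = of_int n" by (auto elim: Ints_cases)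
  then have "real_of_int 3 = of_int (4 * n)" by (auto simp: complex_eq_iff)
  then have "3 = 4 * n" by (simp only: of_int_eq_iff)
  then show False by presburger
qed

text \<open>The factor \<open>1 / (z + 1/2)\<close> is removed by differentiating with respect to \<open>Re w\<close>.\<close>

lemma vint_expsin_inverse:
  assumes w: "\<bar>Im w\<bar> < pi"
  shows "exp (w / 2) * vint (3/4) (\<lambda>z. expsin w z * (1 / (z + 1/2))) = 2 / of_real pi * (exp (w / 2) - Arctan (exp (w / 2)))"
proof -
  define \<theta> where "\<theta> = Im w"
  define W where "W u = Complex u \<theta>" for u
  have W: "\<bar>Im (W u)\<bar> < pi" for u using w by (simp add: W_def \<theta>_def)
  \<comment> \<open>The factor exp (w / 2) makes the integrand exp (w (z + 1/2)) / ((z + 1/2) sin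
    (pi z)), whose derivative in w has lost z + 1/2. \<open>\<Phi>\<close> is the left side and
    \<open>\<Psi>\<close> the claimed value along the line Im w = theta; the increments of both are
    integrals of \<open>D\<close>.\<close>
  define \<Phi> where "\<Phi> u = exp (W u / 2) * vint (3/4) (\<lambda>z. expsin (W u) z * (1 / (z + 1/2)))" for u
  define \<Psi> where "\<Psi> u = 2 / of_real pi * (exp (W u / 2) - Arctan (exp (W u / 2)))" for u
  define D where "D u = exp (3 * W u / 2) / (of_real pi * (1 + exp (W u)))" for u
  have Wd: "(W has_vector_derivative 1) (at u within A)" for u A
    unfolding W_def Complex_eq by (auto intro!: derivative_eq_intros simp: has_vector_derivative_complex_iff)
  have Wc: "continuous_on A W" for A unfolding W_def Complex_eq by (intro continuous_intros)
  have \<Psi>d: "(\<Psi> has_vector_derivative D u) (at u within A)" for u A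
  proof -
    define q where "q = exp (W u / 2)"
    have qq: "q\<^sup>2 = exp (W u)" by (simp add: q_def power2_eq_square flip: exp_add)
    have qn: "1 + q\<^sup>2 \<noteq> 0" unfolding qq by (rule one_plus_exp_nonzero[OF W])
    \<comment> \<open>Keeps q off the branch cuts of Arctan, which lie on the imaginary
      axis.\<close>
    have Req: "Re q > 0" unfolding q_def using W[of u] by (auto simp: Re_exp intro!: mult_pos_pos cos_gt_zero_pi)
    have "((\<lambda>v. 2 / of_real pi * (exp (v / 2) - Arctan (exp (v / 2)))) has_field_derivative
       2 / of_real pi * (q * (1 / 2) - inverse (1 + q\<^sup>2) * (q * (1 / 2)))) (at (W u))"
      unfolding q_def using Req
      by (auto intro!: derivative_eq_intros has_field_derivative_Arctan[THEN DERIV_chain2] simp: q_def)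
    moreover have "2 / of_real pi * (q * (1 / 2) - inverse (1 + q\<^sup>2) * (q * (1 / 2))) = D u"
    proof -
      have e3: "exp (3 * W u / 2) = q ^ 3" by (simp add: q_def power3_eq_cube flip: exp_add)
      have "q - q / (1 + q\<^sup>2) = q ^ 3 / (1 + q\<^sup>2)" using qn by (simp add: field_simps power2_eq_square power3_eq_cube)
      have g: "2 / p * (q * (1 / 2) - inverse m * (q * (1 / 2))) = (q - q / m) / p" for p m :: complex
        by (simp add: right_diff_distrib diff_divide_distrib) (simp add: divide_inverse mult_ac)
      show ?thesis unfolding g D_def e3 qq[symmetric] \<open>q - q / (1 + q\<^sup>2) = q ^ 3 / (1 + q\<^sup>2)\<close> by (simp add: mult.commute)
    qed
    ultimately have d: "((\<lambda>v. 2 / of_real pi * (exp (v / 2) - Arctan (exp (v / 2)))) has_field_derivative D u) (at (W u) within W ` A)"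
      by (metis has_field_derivative_at_within)
    have \<Psi>o: "\<Psi> = (\<lambda>v. 2 / of_real pi * (exp (v / 2) - Arctan (exp (v / 2)))) \<circ> W" by (simp add: fun_eq_iff \<Psi>_def)
    show ?thesis unfolding \<Psi>o using field_vector_diff_chain_within[OF Wd d] by (simp only: mult_1)
  qed
  have Dcont: "continuous_on A D" for A
    unfolding D_def using one_plus_exp_nonzero[OF W] by (intro continuous_intros Wc) auto
  have ii: "integrable lborel (\<lambda>y. expsin (W u) (Complex (3/4) y) * (1 / (Complex (3/4) y + 1/2)))" for u
    by (rule integrable_expsin_mult[where h = "\<lambda>z. 1 / (z + 1/2)", OF W _ norm_inverse_line]) (auto intro!: continuous_intros simp: complex_eq_iff)
  \<comment> \<open>Instead of differentiating under the integral sign, the increment of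
    \<open>\<Phi>\<close> is obtained by Fubini from the integral of \<open>D\<close>.\<close>
  have "\<Phi> \<tau> - \<Phi> \<tau>0 = \<Psi> \<tau> - \<Psi> \<tau>0" if le: "\<tau>0 \<le> \<tau>" for \<tau>0 \<tau>
  proof -
    define s where "s y = Complex (3/4) y + 1/2" for y
    define sn where "sn y = sin (of_real pi * Complex (3/4) y)" for y
    define f where "f y u = indicator {\<tau>0..\<tau>} u *\<^sub>R (exp (W u * s y) / sn y)" for y u :: real
    have sn0: "sn y \<noteq> 0" for y unfolding sn_def by (rule expsin_line_nonzero)
    have s0: "s y \<noteq> 0" for y by (simp add: s_def complex_eq_iff)
    have csn: "continuous_on A sn" and cs: "continuous_on A s" for A
      unfolding sn_def s_def by (intro continuous_intros)+
    have nexp: "norm (exp (W u * s y)) = exp (5/4 * u) * norm (exp (Complex 0 \<theta> * s y))" for u y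
      by (simp add: W_def s_def flip: exp_add)
    have inner: "(LINT u|lborel. f y u) = (exp (W \<tau> * s y) - exp (W \<tau>0 * s y)) / (s y * sn y)" (is ?I)
      and iint: "integrable lborel (f y)" for y
    proof -
      have d: "((\<lambda>u. exp (W u * s y) / (s y * sn y)) has_vector_derivative exp (W u * s y) / sn y) (at u within {\<tau>0..\<tau>})" for u
      proof -
        have "((\<lambda>v. exp (v * s y) / (s y * sn y)) has_field_derivative exp (W u * s y) / sn y) (at (W u) within W ` {\<tau>0..\<tau>})"
          using sn0[of y] s0[of y] by (auto intro!: derivative_eq_intros)
        from field_vector_diff_chain_within[OF Wd this] show ?thesis by (simp add: o_def)
      qed
      have hi: "((\<lambda>u. exp (W u * s y) / sn y) has_integral
         exp (W \<tau> * s y) / (s y * sn y) - exp (W \<tau>0 * s y) / (s y * sn y)) {\<tau>0..\<tau>}"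
        by (rule fundamental_theorem_of_calculus[OF le d])
      have si: "set_integrable lborel {\<tau>0..\<tau>} (\<lambda>u. exp (W u * s y) / sn y)"
        by (rule borel_integrable_atLeastAtMost') (intro continuous_intros Wc sn0 ballI)
      moreover have "f y = (\<lambda>u. indicator {\<tau>0..\<tau>} u *\<^sub>R (exp (W u * s y) / sn y))" by (simp add: fun_eq_iff f_def)
      ultimately show "integrable lborel (f y)" by (simp only: set_integrable_def)
      have "(LINT u|lborel. f y u) = integral {\<tau>0..\<tau>} (\<lambda>u. exp (W u * s y) / sn y)"
        unfolding set_borel_integral_eq_integral(2)[OF si, symmetric] by (simp only: set_lebesgue_integral_def f_def)
      also have "\<dots> = exp (W \<tau> * s y) / (s y * sn y) - exp (W \<tau>0 * s y) / (s y * sn y)"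
        by (rule integral_unique[OF hi])
      finally show ?I by (simp only: diff_divide_distrib)
    qed
    have meas: "case_prod f \<in> borel_measurable (lborel \<Otimes>\<^sub>M lborel)"
    proof -
      have "continuous_on UNIV (\<lambda>p. exp (W (snd p) * s (fst p)) / sn (fst p))"
        using sn0 by (intro continuous_intros continuous_on_compose2[OF Wc[of UNIV]] continuous_on_compose2[OF cs[of UNIV]] continuous_on_compose2[OF csn[of UNIV]]) auto
      then have "(\<lambda>p. exp (W (snd p) * s (fst p)) / sn (fst p)) \<in> borel_measurable borel"
        by (rule borel_measurable_continuous_onI)
      then have [measurable]: "(\<lambda>p. exp (W (snd p) * s (fst p)) / sn (fst p)) \<in> borel_measurable (lborel \<Otimes>\<^sub>M lborel)"
        unfolding lborel_prod by simp
      have "(\<lambda>p. indicator {\<tau>0..\<tau>} (snd p) *\<^sub>R (exp (W (snd p) * s (fst p)) / sn (fst p))) \<in> borel_measurable (lborel \<Otimes>\<^sub>M lborel)"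
        by measurable
      then show ?thesis by (simp only: case_prod_unfold f_def)
    qed
    have fint: "integrable (lborel \<Otimes>\<^sub>M lborel) (case_prod f)"
    proof (rule lborel_pair.Fubini_integrable[OF meas])
      define c where "c = (LINT u|lborel. indicator {\<tau>0..\<tau>} u * exp (5/4 * u))"
      have "(LINT u|lborel. norm (f y u)) = c * norm (exp (Complex 0 \<theta> * s y) / sn y)" for y
      proof -
        have "norm (f y u) = (indicator {\<tau>0..\<tau>} u * exp (5/4 * u)) * norm (exp (Complex 0 \<theta> * s y) / sn y)" for u
          by (simp add: f_def norm_divide nexp indicator_def del: norm_exp_eq_Re)
        then show ?thesis by (simp add: c_def)
      qed
      moreover have "integrable lborel (\<lambda>y. c * norm (exp (Complex 0 \<theta> * s y) / sn y))"
      proof (intro integrable_mult_right integrable_norm)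
        have "integrable lborel (\<lambda>y. exp (Complex 0 \<theta> / 2) * expsin (Complex 0 \<theta>) (Complex (3/4) y))"
          using w by (intro integrable_mult_right vint_expsin) (simp add: \<theta>_def)
        moreover have "exp (Complex 0 \<theta> / 2) * expsin (Complex 0 \<theta>) (Complex (3/4) y) = exp (Complex 0 \<theta> * s y) / sn y" for y
          by (simp add: expsin_def sn_def s_def distrib_left exp_add)
        ultimately show "integrable lborel (\<lambda>y. exp (Complex 0 \<theta> * s y) / sn y)" by simp
      qed
      ultimately show "integrable lborel (\<lambda>x. LINT y|lborel. norm (case_prod f (x, y)))" by simp
      show "AE x in lborel. integrable lborel (\<lambda>y. case_prod f (x, y))" using iint by simp
    qed
    have F: "(LINT u|lborel. LINT y|lborel. f y u) = (LINT y|lborel. LINT u|lborel. f y u)"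
      by (rule lborel_pair.Fubini_integral[OF fint])
    have "(LINT y|lborel. LINT u|lborel. f y u) = 2 * pi * (\<Phi> \<tau> - \<Phi> \<tau>0)"
    proof -
      define X where "X u y = expsin (W u) (Complex (3/4) y) * (1 / (Complex (3/4) y + 1/2))" for u y
      have iX: "integrable lborel (X u)" for u using ii[of u] unfolding X_def[abs_def] .
      have \<Phi>X: "\<Phi> u = exp (W u / 2) * (of_real (1 / (2 * pi)) * (LINT y|lborel. X u y))" for u
        by (simp only: \<Phi>_def vint_def X_def)
      have "(LINT u|lborel. f y u) = exp (W \<tau> / 2) * X \<tau> y - exp (W \<tau>0 / 2) * X \<tau>0 y" for y
        unfolding inner X_def by (simp add: expsin_def sn_def s_def distrib_left exp_add diff_divide_distrib mult_ac)
      note E = this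
      have "(LINT y|lborel. LINT u|lborel. f y u) = exp (W \<tau> / 2) * (LINT y|lborel. X \<tau> y) - exp (W \<tau>0 / 2) * (LINT y|lborel. X \<tau>0 y)"
        unfolding E using iX by simp
      then show ?thesis unfolding \<Phi>X by (simp only:) (simp add: field_simps)
    qed
    moreover have "(LINT y|lborel. f y u) = 2 * pi * (indicator {\<tau>0..\<tau>} u *\<^sub>R D u)" for u
    proof -
      have "f y u = indicator {\<tau>0..\<tau>} u *\<^sub>R (exp (W u / 2) * expsin (W u) (Complex (3/4) y))" for y
        by (simp add: f_def expsin_def sn_def s_def distrib_left exp_add)
      then have "(LINT y|lborel. f y u) = indicator {\<tau>0..\<tau>} u *\<^sub>R (exp (W u / 2) * (2 * pi * vint (3/4) (expsin (W u))))"
        by (simp add: vint_def)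
      also have "exp (W u / 2) * (2 * pi * vint (3/4) (expsin (W u))) = 2 * pi * D u"
      proof -
        have "exp (3 * W u / 2) = exp (W u / 2) * exp (W u)" by (simp flip: exp_add)
        then show ?thesis by (simp add: vint_expsin(1)[OF W] D_def)
      qed
      finally show ?thesis by simp
    qed
    moreover have "(LINT u|lborel. indicator {\<tau>0..\<tau>} u *\<^sub>R D u) = \<Psi> \<tau> - \<Psi> \<tau>0"
    proof -
      have "(D has_integral \<Psi> \<tau> - \<Psi> \<tau>0) {\<tau>0..\<tau>}"
        by (rule fundamental_theorem_of_calculus[OF le \<Psi>d])
      moreover have "set_integrable lborel {\<tau>0..\<tau>} D" by (rule borel_integrable_atLeastAtMost'[OF Dcont])
      ultimately show ?thesis
        using set_borel_integral_eq_integral(2)[of "{\<tau>0..\<tau>}" D] by (simp add: set_lebesgue_integral_def integral_unique)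
    qed
    moreover have "(LINT u|lborel. 2 * pi * (indicator {\<tau>0..\<tau>} u *\<^sub>R D u)) = 2 * pi * (LINT u|lborel. indicator {\<tau>0..\<tau>} u *\<^sub>R D u)"
      by (rule integral_mult_right_zero)
    ultimately have "complex_of_real (2 * pi) * (\<Phi> \<tau> - \<Phi> \<tau>0) = complex_of_real (2 * pi) * (\<Psi> \<tau> - \<Psi> \<tau>0)" using F by (simp only:)
    then show ?thesis by simp
  qed
  then have const: "\<Phi> \<tau> = \<Psi> \<tau> + (\<Phi> \<tau>0 - \<Psi> \<tau>0)" if "\<tau>0 \<le> \<tau>" for \<tau> \<tau>0
    using that by (simp add: algebra_simps)
  \<comment> \<open>The constant of integration is found for Re w tending to minus infinity, where
    \<open>\<Phi>\<close> and \<open>\<Psi>\<close> both tend to 0.\<close>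
  have Wlim: "((\<lambda>u. exp (W u / 2)) \<longlongrightarrow> 0) at_bot"
  proof (rule tendsto_norm_zero_cancel)
    have "filterlim (\<lambda>u::real. (1/2) * u) at_bot at_bot"
      by (rule filterlim_tendsto_pos_mult_at_bot[OF tendsto_const _ filterlim_ident]) auto
    then have "((\<lambda>u::real. exp ((1/2) * u)) \<longlongrightarrow> 0) at_bot" by (rule filterlim_compose[OF exp_at_bot])
    then show "((\<lambda>u. norm (exp (W u / 2))) \<longlongrightarrow> 0) at_bot" by (simp add: W_def)
  qed
  have \<Psi>lim: "(\<Psi> \<longlongrightarrow> 0) at_bot"
  proof -
    have "isCont Arctan 0" by (rule continuous_at_Arctan) auto
    from isCont_tendsto_compose[OF this Wlim] have "((\<lambda>u. Arctan (exp (W u / 2))) \<longlongrightarrow> 0) at_bot" by simp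
    then have "(\<Psi> \<longlongrightarrow> 2 / of_real pi * (0 - 0)) at_bot" unfolding \<Psi>_def by (intro tendsto_intros Wlim)
    then show ?thesis by simp
  qed
  have \<Phi>lim: "(\<Phi> \<longlongrightarrow> 0) at_bot"
  proof (rule Lim_null_comparison)
    define C where "C = (LINT y|lborel. norm (expsin (Complex 0 \<theta>) (Complex (3/4) y)))"
    have bnd: "norm (\<Phi> u) \<le> 1 / (2 * pi) * (norm (exp (W u / 2)) * (exp (3/4 * u) * C))" for u
    proof -
      have "norm (LINT y|lborel. expsin (W u) (Complex (3/4) y) * (1 / (Complex (3/4) y + 1/2)))
         \<le> (LINT y|lborel. exp (3/4 * u) * norm (expsin (Complex 0 \<theta>) (Complex (3/4) y)))"
      proof (rule order_trans[OF integral_norm_bound], rule integral_mono)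
        show "integrable lborel (\<lambda>y. norm (expsin (W u) (Complex (3/4) y) * (1 / (Complex (3/4) y + 1/2))))"
          by (rule integrable_norm[OF ii])
        show "integrable lborel (\<lambda>y. exp (3/4 * u) * norm (expsin (Complex 0 \<theta>) (Complex (3/4) y)))"
          using w by (intro integrable_mult_right integrable_norm vint_expsin) (simp add: \<theta>_def)
        fix y
        have "norm (expsin (W u) (Complex (3/4) y) * (1 / (Complex (3/4) y + 1/2))) \<le> norm (expsin (W u) (Complex (3/4) y)) * 1"
          unfolding norm_mult by (intro mult_left_mono norm_inverse_line) auto
        also have "\<dots> = exp (3/4 * u) * norm (expsin (Complex 0 \<theta>) (Complex (3/4) y))"
          by (simp add: expsin_def norm_divide W_def flip: exp_add)
        finally show "norm (expsin (W u) (Complex (3/4) y) * (1 / (Complex (3/4) y + 1/2)))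
          \<le> exp (3/4 * u) * norm (expsin (Complex 0 \<theta>) (Complex (3/4) y))" .
      qed
      also have "\<dots> = exp (3/4 * u) * C" by (simp add: C_def)
      finally have "norm (vint (3/4) (\<lambda>z. expsin (W u) z * (1 / (z + 1/2)))) \<le> 1 / (2 * pi) * (exp (3/4 * u) * C)"
      proof -
        have "norm (complex_of_real (1 / (2 * pi))) = 1 / (2 * pi)" by (subst norm_of_real) simp
        then show "norm (LINT y|lborel. expsin (W u) (Complex (3/4) y) * (1 / (Complex (3/4) y + 1/2))) \<le> exp (3/4 * u) * C \<Longrightarrow> ?thesis"
          unfolding vint_def norm_mult by (simp only:) (intro mult_left_mono, auto)
      qed
      then have "norm (exp (W u / 2)) * norm (vint (3/4) (\<lambda>z. expsin (W u) z * (1 / (z + 1/2)))) \<le> norm (exp (W u / 2)) * (1 / (2 * pi) * (exp (3/4 * u) * C))"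
        by (intro mult_left_mono) auto
      then show ?thesis unfolding \<Phi>_def norm_mult by (simp add: mult_ac)
    qed
    show "\<forall>\<^sub>F u in at_bot. norm (\<Phi> u) \<le> 1 / (2 * pi) * (norm (exp (W u / 2)) * (exp (3/4 * u) * C))"
      using bnd by (intro always_eventually allI)
    have "filterlim (\<lambda>u::real. (3/4) * u) at_bot at_bot"
      by (rule filterlim_tendsto_pos_mult_at_bot[OF tendsto_const _ filterlim_ident]) auto
    then have "((\<lambda>u::real. exp ((3/4) * u)) \<longlongrightarrow> 0) at_bot" by (rule filterlim_compose[OF exp_at_bot])
    then have "((\<lambda>u. 1 / (2 * pi) * (norm (exp (W u / 2)) * (exp (3/4 * u) * C))) \<longlongrightarrow> 1 / (2 * pi) * (norm (0::complex) * (0 * C))) at_bot"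
      by (intro tendsto_intros Wlim)
    then show "((\<lambda>u. 1 / (2 * pi) * (norm (exp (W u / 2)) * (exp (3/4 * u) * C))) \<longlongrightarrow> 0) at_bot" by simp
  qed
  have "((\<lambda>u. \<Psi> (Re w) + (\<Phi> u - \<Psi> u)) \<longlongrightarrow> \<Psi> (Re w) + (0 - 0)) at_bot"
    by (intro tendsto_intros \<Phi>lim \<Psi>lim)
  moreover have "\<forall>\<^sub>F u in at_bot. \<Psi> (Re w) + (\<Phi> u - \<Psi> u) = \<Phi> (Re w)"
    using eventually_le_at_bot[of "Re w"] by eventually_elim (use const in simp)
  ultimately have "((\<lambda>u::real. \<Phi> (Re w)) \<longlongrightarrow> \<Psi> (Re w) + (0 - 0)) at_bot"
    by (rule Lim_transform_eventually)
  then have "((\<lambda>u::real. \<Phi> (Re w)) \<longlongrightarrow> \<Psi> (Re w)) at_bot" by simp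
  then have "\<Phi> (Re w) = \<Psi> (Re w)" using tendsto_unique[OF _ tendsto_const] by (metis trivial_limit_at_bot_linorder)
  moreover have "W (Re w) = w" by (simp add: W_def \<theta>_def)
  ultimately show ?thesis by (simp add: \<Phi>_def \<Psi>_def)
qed

section \<open>Digamma and tangent against the kernel\<close>

text \<open>Digamma s plus Euler's constant is the sum of (s - 1) / ((k + 1) (s + k)), and |s + k|
  >= k + 1. Linear growth is not sharp but harmless against the exponential decay of the
  kernel.\<close>

lemma norm_Digamma_le:
  fixes s :: complex
  assumes s: "Re s \<ge> 1"
  shows "norm (Digamma s) \<le> 1 + 2 * norm (s - 1)"
proof -
  have e: "inverse (of_nat (Suc k)) - inverse (s + of_nat k) = (s - 1) / (of_nat (Suc k) * (s + of_nat k))" for k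
  proof -
    have "s + of_nat k \<noteq> 0" using s by (auto simp: complex_eq_iff)
    moreover have "of_nat (Suc k) \<noteq> (0::complex)" by (simp del: of_nat_Suc)
    ultimately show ?thesis by (simp add: divide_simps del: of_nat_Suc) (simp add: algebra_simps)
  qed
  have b: "norm (inverse (of_nat (Suc k)) - inverse (s + of_nat k)) \<le> norm (s - 1) * real (Suc k) powr - 2" for k
  proof -
    have "real (Suc k) \<le> \<bar>Re (s + of_nat k)\<bar>" using s by simp
    also have "\<dots> \<le> norm (s + of_nat k)" by (rule abs_Re_le_cmod)
    finally have 1: "real (Suc k) \<le> norm (s + of_nat k)" .
    have "norm (inverse (of_nat (Suc k)) - inverse (s + of_nat k)) = norm (s - 1) / (real (Suc k) * norm (s + of_nat k))"
      unfolding e by (simp add: norm_divide norm_mult del: of_nat_Suc)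
    also have "\<dots> \<le> norm (s - 1) / (real (Suc k) * real (Suc k))"
      using 1 by (intro divide_left_mono mult_left_mono mult_pos_pos) auto
    also have "\<dots> = norm (s - 1) * real (Suc k) powr - 2"
      by (simp add: powr_minus powr_numeral power2_eq_square divide_inverse del: of_nat_Suc)
    finally show ?thesis .
  qed
  have "norm (\<Sum>k. inverse (of_nat (Suc k)) - inverse (s + of_nat k)) \<le> (\<Sum>k. norm (s - 1) * real (Suc k) powr - 2)"
  proof (rule order_trans[OF summable_norm suminf_le[OF b]])
    show S: "summable (\<lambda>k. norm (s - 1) * real (Suc k) powr - 2)" by (intro summable_mult sum_powr_bound) simp
    show "summable (\<lambda>k. norm (inverse (of_nat (Suc k)) - inverse (s + of_nat k)))"
      by (rule summable_comparison_test'[OF S, of 0]) (use b in simp)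
    then show "summable (\<lambda>k. norm (inverse (of_nat (Suc k)) - inverse (s + of_nat k)))" .
  qed
  also have "\<dots> = norm (s - 1) * (\<Sum>k. real (Suc k) powr - 2)"
    by (intro suminf_mult sum_powr_bound) simp
  also have "\<dots> \<le> norm (s - 1) * 2" using sum_powr_bound(2)[of 2] by (intro mult_left_mono) auto
  finally have "norm (\<Sum>k. inverse (of_nat (Suc k)) - inverse (s + of_nat k)) \<le> 2 * norm (s - 1)" by simp
  moreover have "norm (euler_mascheroni :: complex) \<le> 1"
  proof -
    have "norm (euler_mascheroni :: complex) = \<bar>euler_mascheroni :: real\<bar>"
      by (metis norm_of_real of_real_euler_mascheroni real_norm_def)
    then show ?thesis using euler_mascheroni_less_13_over_22 euler_mascheroni_pos by simp
  qed
  moreover have "Digamma s = (\<Sum>k. inverse (of_nat (Suc k)) - inverse (s + of_nat k)) - euler_mascheroni"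
    by (rule Digamma_def)
  ultimately show ?thesis
    using norm_triangle_ineq4[of "\<Sum>k. inverse (of_nat (Suc k)) - inverse (s + of_nat k)" euler_mascheroni] by simp
qed

lemma Digamma_three_halves: "Digamma (3/2 :: complex) = 2 - euler_mascheroni - 2 * of_real (ln 2)"
proof -
  have "Digamma (1/2 + 1 :: complex) = Digamma (1/2) + 1 / (1/2)" by (rule Digamma_plus1) simp
  moreover have "Digamma (1/2 :: complex) = - euler_mascheroni - of_real (2 * ln 2)" by (rule Digamma_one_half)
  ultimately show ?thesis by simp
qed

text \<open>The shift relation for h z = Digamma (z + 1/2): as h (z + 1) = h z + 1 / (z + 1/2), the
  unknown V satisfies V + exp w (V + N) = exp w Digamma (3/2) / pi, where N is the integral with 1 /
  (z + 1/2).\<close>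

lemma vint_expsin_Digamma:
  assumes w: "\<bar>Im w\<bar> < pi"
  defines "q \<equiv> exp (w / 2)"
  shows "vint (3/4) (\<lambda>z. expsin w z * Digamma (z + 1/2))
      = (2 * Arctan q * q - (euler_mascheroni + 2 * of_real (ln 2)) * q\<^sup>2) / (of_real pi * (1 + q\<^sup>2))"
    and "integrable lborel (\<lambda>y. expsin w (Complex (3/4) y) * Digamma (Complex (3/4) y + 1/2))"
proof -
  have qq: "q\<^sup>2 = exp w" by (simp add: q_def power2_eq_square flip: exp_add)
  have qn: "1 + q\<^sup>2 \<noteq> 0" unfolding qq by (rule one_plus_exp_nonzero[OF w])
  have hol: "(\<lambda>z. Digamma (z + 1/2)) holomorphic_on {z. 1/2 < Re z}"
  proof -
    have "Digamma holomorphic_on {z :: complex. 0 < Re z}"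
      by (rule holomorphic_on_Polygamma) (auto elim!: nonpos_Ints_cases)
    then show ?thesis
      by (rule holomorphic_on_compose_gen[of "\<lambda>z. z + 1/2", unfolded o_def, rotated]) (auto intro!: holomorphic_intros)
  qed
  have Dp: "Digamma (1 + 1/2 :: complex) = 2 - euler_mascheroni - 2 * of_real (ln 2)"
    using Digamma_three_halves by simp
  \<comment> \<open>The residue rule asks for a nonzero value of h at the pole; Digamma (3/2) is
    about 0.036.\<close>
  have nz: "Digamma (1 + 1/2 :: complex) \<noteq> 0"
  proof -
    have "Digamma (1 + 1/2 :: complex) = of_real (2 - euler_mascheroni - 2 * ln 2)" unfolding Dp by simp
    moreover have "2 - euler_mascheroni - 2 * ln 2 \<noteq> (0::real)"
      using euler_mascheroni_less_13_over_22 ln_2_less_1 ln2_le_25_over_36 by linarith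
    ultimately show ?thesis by (metis of_real_eq_0_iff)
  qed
  have bd: "norm (Digamma (z + 1/2)) \<le> 6 * (1 + \<bar>Im z\<bar>)" if z: "3/4 \<le> Re z" "Re z \<le> 7/4" for z :: complex
  proof -
    have "norm (Digamma (z + 1/2)) \<le> 1 + 2 * norm (z + 1/2 - 1)" using z by (intro norm_Digamma_le) auto
    also have "norm (z + 1/2 - 1) \<le> \<bar>Re (z + 1/2 - 1)\<bar> + \<bar>Im (z + 1/2 - 1)\<bar>" by (rule cmod_le)
    also have "\<dots> \<le> 2 + \<bar>Im z\<bar>" using z by simp
    finally show ?thesis by simp
  qed
  note sh = expsin_shift1[OF w hol nz bd]
  show i1: "integrable lborel (\<lambda>y. expsin w (Complex (3/4) y) * Digamma (Complex (3/4) y + 1/2))" by (rule sh(2))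
  define V where "V = vint (3/4) (\<lambda>z. expsin w z * Digamma (z + 1/2))"
  define N where "N = vint (3/4) (\<lambda>z. expsin w z * (1 / (z + 1/2)))"
  have i2: "integrable lborel (\<lambda>y. expsin w (Complex (3/4) y) * (1 / (Complex (3/4) y + 1/2)))"
    by (rule integrable_expsin_mult[where h = "\<lambda>z. 1 / (z + 1/2)", OF w _ norm_inverse_line]) (auto intro!: continuous_intros simp: complex_eq_iff)
  have "vint (3/4) (\<lambda>z. expsin w z * Digamma (z + 1 + 1/2)) = vint (3/4) (\<lambda>z. expsin w z * Digamma (z + 1/2) + expsin w z * (1 / (z + 1/2)))"
  proof -
    have "Complex (3/4) y + 1/2 \<noteq> 0" for y by (simp add: complex_eq_iff)
    then have "Digamma (Complex (3/4) y + 1 + 1/2) = Digamma (Complex (3/4) y + 1/2) + 1 / (Complex (3/4) y + 1/2)" for y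
      using Digamma_plus1[of "Complex (3/4) y + 1/2"] by (simp add: add_ac)
    then show ?thesis unfolding vint_def by (simp add: distrib_left)
  qed
  also have "\<dots> = V + N" unfolding V_def N_def by (rule vint_add[OF i1 i2])
  finally have "V + exp w * (V + N) = exp w * Digamma (1 + 1/2) / of_real pi" using sh(1) by (simp add: V_def)
  then have 1: "(1 + q\<^sup>2) * V = q\<^sup>2 * (Digamma (1 + 1/2) / of_real pi - N)"
    unfolding qq by (simp add: algebra_simps)
  have "q * N = 2 / of_real pi * (q - Arctan q)"
    using vint_expsin_inverse[OF w] by (simp add: N_def q_def)
  note a = this
  have 2: "q\<^sup>2 * N = 2 / of_real pi * (q\<^sup>2 - q * Arctan q)" 
  proof -
    have "q\<^sup>2 * N = q * (q * N)" by (simp add: power2_eq_square)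
    also have "\<dots> = 2 / of_real pi * (q\<^sup>2 - q * Arctan q)" unfolding a by (simp add: power2_eq_square right_diff_distrib diff_divide_distrib mult_ac)
    finally show ?thesis .
  qed
  have "(1 + q\<^sup>2) * V = q\<^sup>2 * Digamma (1 + 1/2) / of_real pi - q\<^sup>2 * N"
    unfolding 1 by (simp add: right_diff_distrib)
  also have "\<dots> = (2 * Arctan q * q - (euler_mascheroni + 2 * of_real (ln 2)) * q\<^sup>2) / of_real pi"
    unfolding 2 Dp by (simp add: field_simps)
  finally have "(1 + q\<^sup>2) * V = (2 * Arctan q * q - (euler_mascheroni + 2 * of_real (ln 2)) * q\<^sup>2) / of_real pi" .
  then have "V = ((2 * Arctan q * q - (euler_mascheroni + 2 * of_real (ln 2)) * q\<^sup>2) / of_real pi) / (1 + q\<^sup>2)"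
    using qn by (metis nonzero_mult_div_cancel_left)
  then show "vint (3/4) (\<lambda>z. expsin w z * Digamma (z + 1/2))
      = (2 * Arctan q * q - (euler_mascheroni + 2 * of_real (ln 2)) * q\<^sup>2) / (of_real pi * (1 + q\<^sup>2))"
    by (simp add: V_def)
qed

text \<open>This is tan (pi s / 2) at s = z + 1/2, which enters through the logarithmic derivative
  of the functional equation.\<close>

definition tanq :: "complex \<Rightarrow> complex" where
  "tanq z = tan (of_real pi * (z + 1/2) / 2)"

lemma cos_pi_half_eq_0: "cos (of_real pi * s / 2) = 0 \<Longrightarrow> \<exists>n::int. s = of_int (2 * n + 1)" for s :: complex
proof -
  assume "cos (of_real pi * s / 2) = 0"
  then have "\<exists>n::int. of_real pi * s / 2 = complex_of_real (of_int n * pi) + of_real pi / 2"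
    unfolding cos_eq_0 by auto
  then obtain n :: int where "of_real pi * s / 2 = complex_of_real (of_int n * pi) + of_real pi / 2" by blast
  then have "of_real pi * s = of_real pi * (2 * of_int n + 1)" by (simp add: field_simps)
  then have "s = 2 * of_int n + 1" by simp
  then show ?thesis by (intro exI[of _ n]) simp
qed

text \<open>|sin u|^2 and |cos u|^2 are the squared sine and cosine of Re u plus the common term d =
  sinh^2 (Im u) >= 9/16, and 1 + d <= 4 d.\<close>

lemma norm_tan_le:
  fixes u :: complex
  assumes "\<bar>Im u\<bar> \<ge> 1"
  shows "norm (tan u) \<le> 2"
proof -
  define e where "e = exp \<bar>Im u\<bar>"
  have e2: "e \<ge> 2" unfolding e_def using exp_ge_add_one_self[of "\<bar>Im u\<bar>"] assms by linarith
  define d where "d = (exp (Im u) - inverse (exp (Im u)))\<^sup>2 / 4"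
  have d: "d = (e - 1 / e)\<^sup>2 / 4"
  proof (cases "Im u \<ge> 0")
    case False
    then have "exp (Im u) = 1 / e" by (simp add: e_def exp_minus inverse_eq_divide)
    then have "exp (Im u) - inverse (exp (Im u)) = - (e - 1 / e)" by simp
    then show ?thesis unfolding d_def by (simp only: power2_minus)
  next
    case True
    then have "exp (Im u) = e" by (simp add: e_def)
    then show ?thesis unfolding d_def by (simp only: inverse_eq_divide)
  qed
  have "1 / e \<le> 1 / 2" using e2 by (simp add: field_simps)
  then have "3/2 \<le> e - 1 / e" using e2 by argo
  then have "(3/2)\<^sup>2 \<le> (e - 1 / e)\<^sup>2" by (rule power_mono) simp
  then have d1: "d \<ge> 9/16" unfolding d by (simp add: power2_eq_square)
  have c: "norm (cos u) ^ 2 = cos (Re u) ^ 2 + d" by (simp add: norm_cos_squared d_def)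
  have s: "norm (sin u) ^ 2 = sin (Re u) ^ 2 + d"
  proof -
    have "sin u = cos (u - of_real pi / 2)"
      unfolding cos_diff cos_of_real_pi_half sin_of_real_pi_half by simp
    then have "norm (sin u) ^ 2 = norm (cos (u - of_real pi / 2)) ^ 2" by (simp only:)
    also have "\<dots> = cos (Re (u - of_real pi / 2)) ^ 2 + d"
      unfolding norm_cos_squared d_def by simp
    also have "cos (Re (u - of_real pi / 2)) = sin (Re u)" by (simp add: cos_diff)
    finally show ?thesis .
  qed
  have "sin (Re u) ^ 2 \<le> 1" by (simp add: abs_square_le_1)
  then have "norm (sin u) ^ 2 \<le> 4 * norm (cos u) ^ 2" unfolding s c using d1 zero_le_power2[of "cos (Re u)"] by argo
  also have "\<dots> = (2 * norm (cos u)) ^ 2" by (simp add: power_mult_distrib)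
  finally have "norm (sin u) \<le> 2 * norm (cos u)" by (rule power2_le_imp_le) simp
  moreover have "norm (cos u) > 0" using c d1 zero_le_power2[of "cos (Re u)"]
    by (metis add_nonneg_pos dual_order.strict_trans2 norm_ge_zero less_eq_real_def zero_less_divide_iff zero_less_numeral zero_power2 less_irrefl)
  ultimately show ?thesis by (simp add: tan_def norm_divide divide_le_eq)
qed

text \<open>The tangent has period 2 in z, so the line moves by 2, across the poles 1 and 2 of the
  kernel and 5/2 of the tangent. The factor exp (2 w) - 1 has to be nonzero, hence the condition on
  Im w.\<close>

lemma vint_expsin_tan:
  assumes w: "\<bar>Im w\<bar> < pi" "Im w \<noteq> 0"
  defines "q \<equiv> exp (w / 2)"
  shows "vint (3/4) (\<lambda>z. expsin w z * tanq z) = - q\<^sup>2 * (1 + q + 2 * q\<^sup>2) / (of_real pi * ((1 + q) * (1 + q\<^sup>2)))"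
    and "integrable lborel (\<lambda>y. expsin w (Complex (3/4) y) * tanq (Complex (3/4) y))"
proof -
  have qq: "q\<^sup>2 = exp w" by (simp add: q_def power2_eq_square flip: exp_add)
  define \<delta> where "\<delta> = pi - \<bar>Im w\<bar>"
  have \<delta>: "\<delta> > 0" using w by (simp add: \<delta>_def)
  let ?K = "\<lambda>z. expsin w z * tanq z"
  define C where "C = 4 * exp (\<bar>Re w\<bar> * 3) * 2"
  have bd: "norm (?K z) \<le> C * exp (- \<delta> * \<bar>Im z\<bar>)" if z: "3/4 \<le> Re z" "Re z \<le> 11/4" "\<bar>Im z\<bar> \<ge> 1" for z
  proof -
    have "Re w * Re z \<le> \<bar>Re w\<bar> * \<bar>Re z\<bar>" using abs_ge_self[of "Re w * Re z"] by (simp only: abs_mult)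
    also have "\<dots> \<le> \<bar>Re w\<bar> * 3" using z by (intro mult_left_mono) auto
    finally have e1: "exp (Re w * Re z) \<le> exp (\<bar>Re w\<bar> * 3)" by simp
    have t: "norm (tanq z) \<le> 2" unfolding tanq_def
    proof (rule norm_tan_le)
      have "3 * 1 \<le> pi * \<bar>Im z\<bar>" using z pi_gt3 by (intro mult_mono) auto
      moreover have "Im (of_real pi * (z + 1/2) / 2) = pi * Im z / 2" by simp
      ultimately show "1 \<le> \<bar>Im (of_real pi * (z + 1/2) / 2)\<bar>" by (simp add: abs_mult)
    qed
    have "norm (expsin w z) \<le> 4 * exp (Re w * Re z) * exp (- (pi - \<bar>Im w\<bar>) * \<bar>Im z\<bar>)"
      by (rule norm_expsin_le) (use z in simp)
    also have "\<dots> \<le> 4 * exp (\<bar>Re w\<bar> * 3) * exp (- \<delta> * \<bar>Im z\<bar>)"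
      unfolding \<delta>_def by (intro mult_right_mono mult_left_mono e1) auto
    finally have "norm (?K z) \<le> 4 * exp (\<bar>Re w\<bar> * 3) * exp (- \<delta> * \<bar>Im z\<bar>) * 2"
      unfolding norm_mult using t by (intro mult_mono) auto
    then show ?thesis by (simp add: C_def mult_ac)
  qed
  define P where "P = {1, 2, 5/2 :: complex}"
  define S where "S = {z. 1/2 < Re z \<and> Re z < 3}"
  have Sop: "open S" "connected S"
  proof -
    have "S = {z. 1/2 < Re z} \<inter> {z. Re z < 3}" by (auto simp: S_def)
    then show "open S" "connected S"
      by (simp_all only:) (intro open_Int open_halfspace_Re_gt open_halfspace_Re_lt convex_connected convex_Int convex_halfspace_Re_gt convex_halfspace_Re_lt)+
  qed
  have sin0: "z = 1 \<or> z = 2" if "z \<in> S" "sin (of_real pi * z) = 0" for z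
  proof -
    have "z \<in> \<int>" using that by (simp add: sin_pi_z_eq_0_iff)
    then obtain n :: int where n: "z = of_int n" by (auto elim: Ints_cases)
    then have "1 / 2 < real_of_int n" "real_of_int n < 3" using that by (auto simp: S_def)
    then have "n = 1 \<or> n = 2" by linarith
    then show ?thesis using n by auto
  qed
  have cos0: "z = 5/2" if zS: "z \<in> S" "cos (of_real pi * (z + 1/2) / 2) = 0" for z
  proof -
    obtain n :: int where n: "z + 1/2 = of_int (2 * n + 1)" using cos_pi_half_eq_0[OF zS(2)] by blast
    then have "Re (z + 1/2) = of_int (2 * n + 1)" by simp
    then have r: "Re z = 2 * of_int n + 1/2" by simp
    then have "1 / 2 < 2 * real_of_int n + 1/2" "2 * real_of_int n + 1/2 < 3" using zS by (auto simp: S_def)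
    then have "n = 1" by linarith
    then show ?thesis using n by (simp add: eq_diff_eq[symmetric])
  qed
  have holo: "?K holomorphic_on ({z. 1/2 < Re z \<and> Re z < 3} - P)"
    unfolding expsin_def tanq_def tan_def S_def[symmetric]
    by (intro holomorphic_intros) (use sin0 cos0 P_def in auto)
  note sh = vint_shift[where K = ?K and a' = "1/2" and a = "3/4" and b = "11/4" and b' = 3 and P = P, OF _ _ _ holo _ _ _ \<delta> bd]
  have PR: "P \<subseteq> {z. 3/4 < Re z \<and> Re z < 11/4}" "finite P" "P \<subseteq> \<real>" by (auto simp: P_def complex_is_Real_iff)
  show i1: "integrable lborel (\<lambda>y. ?K (Complex (3/4) y))" by (rule sh(2)) (use PR in auto)
  have eq: "vint (11/4) ?K - vint (3/4) ?K = (\<Sum>p\<in>P. residue ?K p)"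
    by (rule sh(1)) (use PR in auto)
  have per: "?K (z + 2) = exp (2 * w) * ?K z" for z
  proof -
    have "expsin w (z + 1 + 1) = - exp w * (- exp w * expsin w z)" unfolding expsin_plus1 ..
    then have "expsin w (z + 2) = exp (2 * w) * expsin w z" by (simp add: exp_double power2_eq_square add.assoc)
    moreover have "tanq (z + 2) = tanq z"
    proof -
      have e: "of_real pi * (z + 2 + 1/2) / 2 = of_real pi * (z + 1/2) / 2 + of_real pi" by (simp add: field_simps)
      show ?thesis unfolding tanq_def e by (simp add: tan_def sin_add cos_add)
    qed
    ultimately show ?thesis by simp
  qed
  have "vint (11/4) ?K = vint (3/4) (\<lambda>z. ?K (z + 2))"
  proof -
    have "Complex (3/4) y + 2 = Complex (11/4) y" for y by (simp add: complex_eq_iff)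
    then show ?thesis by (simp add: vint_def)
  qed
  also have "\<dots> = exp (2 * w) * vint (3/4) ?K" unfolding per by (rule vint_cmult)
  finally have eq2: "(exp (2 * w) - 1) * vint (3/4) ?K = (\<Sum>p\<in>P. residue ?K p)" using eq by (simp add: algebra_simps)
  define G where "G z = sin (of_real pi * z) * cos (of_real pi * (z + 1/2) / 2)" for z :: complex
  have K: "?K = (\<lambda>z. (exp (w * z) * sin (of_real pi * (z + 1/2) / 2)) / G z)"
    by (simp add: fun_eq_iff expsin_def tanq_def tan_def G_def)
  have Gd: "(G has_field_derivative of_real pi * cos (of_real pi * z) * cos (of_real pi * (z + 1/2) / 2)
     + sin (of_real pi * z) * (- sin (of_real pi * (z + 1/2) / 2) * (of_real pi / 2))) (at z)" for z
    unfolding G_def by (auto intro!: derivative_eq_intros)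
  have h: "(\<lambda>z. exp (w * z) * sin (of_real pi * (z + 1/2) / 2)) holomorphic_on S" "G holomorphic_on S"
    unfolding G_def by (auto intro!: holomorphic_intros)
  note R = residue_simple_pole_deriv[OF h Sop _ Gd]
  have n: "cos (of_real pi * 1 :: complex) = -1" "sin (of_real pi * 1 :: complex) = 0"
    "cos (of_real pi * 2 :: complex) = 1" "sin (of_real pi * 2 :: complex) = 0"
    using sin_double[of "of_real pi :: complex"] cos_double[of "of_real pi :: complex"]
    by (simp_all add: mult.commute[of _ 2] flip: cos_of_real sin_of_real)
  have s32: "sin (of_real pi * (3/2) :: complex) = -1" and c32: "cos (of_real pi * (3/2) :: complex) = 0"
  proof -
    have e: "of_real pi * (3/2 :: complex) = of_real pi + of_real (pi / 2)" by simp
    show "sin (of_real pi * (3/2) :: complex) = -1" "cos (of_real pi * (3/2) :: complex) = 0"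
      unfolding e sin_add cos_add by (simp_all flip: cos_of_real sin_of_real add: of_real_divide)
  qed
  have s52: "sin (of_real pi * (5/2) :: complex) = 1"
  proof -
    have e: "of_real pi * (5/2 :: complex) = of_real pi * 2 + of_real (pi / 2)" by simp
    show ?thesis unfolding e sin_add n by (simp flip: cos_of_real sin_of_real add: of_real_divide)
  qed
  have r1: "residue ?K 1 = exp w / of_real pi"
  proof -
    \<comment> \<open>The tangent at 3 pi / 4 is read off from sin (2 A) = -1, which forces cos A =
      - sin A; likewise at 5 pi / 4 for the next residue.\<close>
    define A where "A = of_real pi * (1 + 1/2) / (2 :: complex)"
    have "2 * A = of_real pi * (3/2)" by (simp add: A_def)
    then have "sin (2 * A) = -1" using s32 by (simp only:)
    then have "(sin A + cos A)\<^sup>2 = 0"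
      unfolding power2_sum sin_cos_squared_add sin_double by (simp add: mult.assoc)
    then have cA: "cos A = - sin A" by (simp add: eq_neg_iff_add_eq_0 add.commute)
    have sA: "sin A \<noteq> 0" using sin_cos_squared_add[of A] cA by auto
    have "residue (\<lambda>z. (exp (w * z) * sin (of_real pi * (z + 1/2) / 2)) / G z) 1
      = (exp (w * 1) * sin A) / (of_real pi * cos (of_real pi * 1) * cos A + sin (of_real pi * 1) * (- sin A * (of_real pi / 2)))"
      unfolding A_def by (rule R) (use n cA sA in \<open>auto simp: S_def G_def A_def\<close>)
    also have "\<dots> = exp w / of_real pi" unfolding n cA using sA by simp
    finally show ?thesis unfolding K .
  qed
  have r2: "residue ?K 2 = exp (2 * w) / of_real pi"
  proof -
    define A where "A = of_real pi * (2 + 1/2) / (2 :: complex)"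
    have "2 * A = of_real pi * (5/2)" by (simp add: A_def)
    then have "sin (2 * A) = 1" using s52 by (simp only:)
    then have "(sin A - cos A)\<^sup>2 = 0"
      unfolding power2_diff sin_cos_squared_add sin_double by (simp add: mult.assoc)
    then have cA: "cos A = sin A" by simp
    have sA: "sin A \<noteq> 0" using sin_cos_squared_add[of A] cA by auto
    have "residue (\<lambda>z. (exp (w * z) * sin (of_real pi * (z + 1/2) / 2)) / G z) 2
      = (exp (w * 2) * sin A) / (of_real pi * cos (of_real pi * 2) * cos A + sin (of_real pi * 2) * (- sin A * (of_real pi / 2)))"
      unfolding A_def by (rule R) (use n cA sA in \<open>auto simp: S_def G_def A_def\<close>)
    also have "\<dots> = exp (2 * w) / of_real pi" unfolding n cA using sA by (simp add: mult.commute)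
    finally show ?thesis unfolding K .
  qed
  have r3: "residue ?K (5/2) = - 2 * exp (5/2 * w) / of_real pi"
  proof -
    have e: "of_real pi * (5/2 + 1/2) / 2 = of_real pi * (3/2 :: complex)" by simp
    have "residue (\<lambda>z. (exp (w * z) * sin (of_real pi * (z + 1/2) / 2)) / G z) (5/2)
      = (exp (w * (5/2)) * sin (of_real pi * (5/2 + 1/2) / 2)) / (of_real pi * cos (of_real pi * (5/2)) * cos (of_real pi * (5/2 + 1/2) / 2)
         + sin (of_real pi * (5/2)) * (- sin (of_real pi * (5/2 + 1/2) / 2) * (of_real pi / 2)))"
    proof (rule R)
      show "5/2 \<in> S" by (simp add: S_def)
      show "G (5/2) = 0" unfolding G_def e c32 by simp
      show "exp (w * (5/2)) * sin (of_real pi * (5/2 + 1/2) / 2) \<noteq> 0" unfolding e s32 by simp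
      show "of_real pi * cos (of_real pi * (5/2)) * cos (of_real pi * (5/2 + 1/2) / 2)
         + sin (of_real pi * (5/2)) * (- sin (of_real pi * (5/2 + 1/2) / 2) * (of_real pi / 2)) \<noteq> (0 :: complex)"
        unfolding e s32 c32 s52 by simp
    qed
    also have "\<dots> = - 2 * exp (5/2 * w) / of_real pi" unfolding e s32 c32 s52 by (simp add: mult.commute)
    finally show ?thesis unfolding K .
  qed
  show "vint (3/4) ?K = - q\<^sup>2 * (1 + q + 2 * q\<^sup>2) / (of_real pi * ((1 + q) * (1 + q\<^sup>2)))"
  proof -
    have e: "exp (2 * w) = q ^ 4" "exp w = q\<^sup>2" "exp (5/2 * w) = q ^ 5"
    proof -
      have q: "q ^ n = exp (of_nat n * (w / 2))" for n by (simp only: q_def exp_of_nat_mult)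
      show "exp (2 * w) = q ^ 4" "exp w = q\<^sup>2" "exp (5/2 * w) = q ^ 5" unfolding q by simp_all
    qed
    have S3: "(\<Sum>p\<in>P. residue ?K p) = (q\<^sup>2 + q ^ 4 - 2 * q ^ 5) / of_real pi"
    proof -
      have "(\<Sum>p\<in>P. residue ?K p) = residue ?K 1 + (residue ?K 2 + residue ?K (5/2))" by (simp add: P_def)
      also have "\<dots> = (q\<^sup>2 + q ^ 4 - 2 * q ^ 5) / of_real pi"
        unfolding r1 r2 r3 e by (simp add: diff_divide_distrib add_divide_distrib)
      finally show ?thesis .
    qed
    have n1: "1 + q\<^sup>2 \<noteq> 0" unfolding qq by (rule one_plus_exp_nonzero[OF w(1)])
    have im: "\<bar>Im (w / 2)\<bar> < pi" using w by simp
    have n2: "1 + q \<noteq> 0" unfolding q_def by (rule one_plus_exp_nonzero[OF im])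
    have n3: "q \<noteq> 1"
    proof
      assume "q = 1"
      then have "exp w = 1" using e by simp
      then obtain n :: int where "Im w = of_int (2 * n) * pi" by (auto simp: exp_eq_1)
      then have "\<bar>of_int (2 * n) * pi\<bar> < 1 * pi" "n \<noteq> 0" using w by auto
      then have "\<bar>real_of_int (2 * n)\<bar> < 1" by (simp add: abs_mult)
      then show False using \<open>n \<noteq> 0\<close> by linarith
    qed
    \<comment> \<open>Both exp (2 w) - 1 and the sum of residues contain the factor q - 1;
      cancelling it leaves the stated denominator (1 + q) (1 + q^2).\<close>
    have f: "exp (2 * w) - 1 = (q - 1) * ((1 + q) * (1 + q\<^sup>2))" unfolding e by (simp add: algebra_simps power2_eq_square power4_eq_xxxx)
    have g: "(q\<^sup>2 + q ^ 4 - 2 * q ^ 5) = (q - 1) * (- q\<^sup>2 * (1 + q + 2 * q\<^sup>2))"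
    proof -
      have p: "q\<^sup>2 = q * q" "q ^ 4 = q * q * q * q" "q ^ 5 = q * q * q * q * q" by (simp_all add: power_numeral_reduce)
      show ?thesis unfolding p by (simp add: algebra_simps)
    qed
    have "(q - 1) * (((1 + q) * (1 + q\<^sup>2)) * vint (3/4) ?K) = (q - 1) * ((- q\<^sup>2 * (1 + q + 2 * q\<^sup>2)) / of_real pi)"
      using eq2 unfolding S3 f g by (simp add: mult.assoc)
    moreover have "q - 1 \<noteq> 0" using n3 by simp
    ultimately have "((1 + q) * (1 + q\<^sup>2)) * vint (3/4) ?K = (- q\<^sup>2 * (1 + q + 2 * q\<^sup>2)) / of_real pi"
      using mult_left_cancel by blast
    moreover have "(1 + q) * (1 + q\<^sup>2) \<noteq> 0" using n1 n2 by simp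
    ultimately have "vint (3/4) ?K = (- q\<^sup>2 * (1 + q + 2 * q\<^sup>2)) / of_real pi / ((1 + q) * (1 + q\<^sup>2))"
      using nonzero_eq_divide_eq[of "(1 + q) * (1 + q\<^sup>2)"] by (simp only: mult.commute simp_thms)
    then show ?thesis by simp
  qed
qed

section \<open>The logarithmic derivative of the zeta function\<close>

lemma ln_le_powr:
  fixes x e :: real
  assumes "x \<ge> 1" "e > 0"
  shows "ln x \<le> x powr e / e"
proof -
  have "ln (x powr e) \<le> x powr e - 1" using assms by (intro ln_le_minus_one) auto
  then have "e * ln x \<le> x powr e" using assms by (simp add: ln_powr)
  then show ?thesis using assms by (simp add: field_simps)
qed

lemma norm_nat_powr: "n > 0 \<Longrightarrow> norm (1 / (of_nat n :: complex) powr s) = real n powr - Re s"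
  using norm_powr_real_powr[of "of_nat n" s] by (simp add: norm_divide powr_minus field_simps)

text \<open>log n <= n^e / e with e = (sigma - 1) / 2 spends half of the excess of sigma over 1 and
  leaves the exponent (sigma + 1) / 2 > 1, uniformly in Re s >= sigma.\<close>

lemma log_series_bound:
  assumes \<sigma>: "\<sigma> > 1" and s: "Re s \<ge> \<sigma>" and c: "0 \<le> c" "c \<le> ln (real (Suc n))"
  shows "norm (of_real c / (of_nat (Suc n) :: complex) powr s) \<le> 2 / (\<sigma> - 1) * real (Suc n) powr - ((\<sigma> + 1) / 2)"
proof -
  have "norm (of_real c / (of_nat (Suc n) :: complex) powr s) = c * real (Suc n) powr - Re s"
  proof -
    have "norm (of_real c / (of_nat (Suc n) :: complex) powr s) = c * norm (1 / (of_nat (Suc n) :: complex) powr s)"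
      using c by (simp add: norm_divide del: of_nat_Suc)
    then show ?thesis by (simp only: norm_nat_powr zero_less_Suc)
  qed
  also have "\<dots> \<le> (real (Suc n) powr ((\<sigma> - 1) / 2) / ((\<sigma> - 1) / 2)) * real (Suc n) powr - \<sigma>"
    using c s \<sigma> ln_le_powr[of "real (Suc n)" "(\<sigma> - 1) / 2"] by (intro mult_mono powr_mono) auto
  also have "\<dots> = 2 / (\<sigma> - 1) * (real (Suc n) powr ((\<sigma> - 1) / 2) * real (Suc n) powr - \<sigma>)" by simp
  also have "real (Suc n) powr ((\<sigma> - 1) / 2) * real (Suc n) powr - \<sigma> = real (Suc n) powr - ((\<sigma> + 1) / 2)"
  proof -
    have e: "(\<sigma> - 1) / 2 + - \<sigma> = - ((\<sigma> + 1) / 2)" by (simp add: field_simps)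
    show ?thesis by (simp only: powr_add[symmetric] e)
  qed
  finally show ?thesis .
qed

lemma summable_log_series_bound: "\<sigma> > (1::real) \<Longrightarrow> summable (\<lambda>n. 2 / (\<sigma> - 1) * real (Suc n) powr - ((\<sigma> + 1) / 2))"
  by (intro summable_mult sum_powr_bound) simp

lemma log_series_holomorphic:
  fixes c :: "nat \<Rightarrow> real"
  assumes c: "\<And>n. 0 \<le> c n" "\<And>n. c n \<le> ln (real (Suc n))"
  shows "(\<lambda>s. \<Sum>n. of_real (c n) / (of_nat (Suc n) :: complex) powr s) holomorphic_on {s. 1 < Re s}"
proof (rule holomorphic_uniform_sequence[where f = "\<lambda>N s. \<Sum>n<N. of_real (c n) / (of_nat (Suc n) :: complex) powr s"])
  show "open {s. 1 < Re s}" by (simp add: open_halfspace_Re_gt)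
  show "(\<lambda>s. \<Sum>n<N. of_real (c n) / (of_nat (Suc n) :: complex) powr s) holomorphic_on {s. 1 < Re s}" for N
    by (intro holomorphic_intros) (auto simp: powr_eq_0_iff simp del: of_nat_Suc)
  fix s assume "s \<in> {s. 1 < Re s}"
  then have s: "Re s > 1" by simp
  define d where "d = (Re s - 1) / 2"
  define \<sigma> where "\<sigma> = (Re s + 1) / 2"
  have d: "d > 0" "\<sigma> > 1" using s by (auto simp: d_def \<sigma>_def)
  have R: "Re w \<ge> \<sigma>" if "w \<in> cball s d" for w
    using abs_Re_le_cmod[of "s - w"] that by (simp add: dist_norm d_def \<sigma>_def field_simps)
  have "uniform_limit (cball s d) (\<lambda>N s. \<Sum>n<N. of_real (c n) / (of_nat (Suc n) :: complex) powr s)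
      (\<lambda>s. \<Sum>n. of_real (c n) / (of_nat (Suc n) :: complex) powr s) sequentially"
    by (rule Weierstrass_m_test[OF log_series_bound[OF d(2) R c] summable_log_series_bound[OF d(2)]])
  moreover have "cball s d \<subseteq> {s. 1 < Re s}" using R d by force
  ultimately show "\<exists>d>0. cball s d \<subseteq> {s. 1 < Re s} \<and>
      uniform_limit (cball s d) (\<lambda>N s. \<Sum>n<N. of_real (c n) / (of_nat (Suc n) :: complex) powr s)
        (\<lambda>s. \<Sum>n. of_real (c n) / (of_nat (Suc n) :: complex) powr s) sequentially" using d by blast
qed

text \<open>Arbitrary coefficients between 0 and log n, since the series of Lambda (n) and of log n
  are both needed.\<close>

lemma summable_log_series:
  fixes c :: "nat \<Rightarrow> real"
  assumes c: "\<And>n. 0 \<le> c n" "\<And>n. c n \<le> ln (real (Suc n))" and s: "Re s > 1"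
  shows "summable (\<lambda>n. norm (of_real (c n) / (of_nat (Suc n) :: complex) powr s))"
    "summable (\<lambda>n. of_real (c n) / (of_nat (Suc n) :: complex) powr s)"
proof -
  show 1: "summable (\<lambda>n. norm (of_real (c n) / (of_nat (Suc n) :: complex) powr s))"
    by (rule summable_comparison_test'[OF summable_log_series_bound[OF s], of 0])
       (use log_series_bound[OF s order_refl c] in simp)
  then show "summable (\<lambda>n. of_real (c n) / (of_nat (Suc n) :: complex) powr s)" by (rule summable_norm_cancel)
qed

text \<open>The Dirichlet series of the von Mangoldt function; it will turn out to be -
  zeta'/zeta.\<close>

definition Lser :: "complex \<Rightarrow> complex" where
  "Lser s = (\<Sum>n. of_real (mangoldt (Suc n)) / (of_nat (Suc n)) powr s)"

lemma mangoldt_Suc_bounds: "0 \<le> (mangoldt (Suc n) :: real)" "(mangoldt (Suc n) :: real) \<le> ln (real (Suc n))"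
  using mangoldt_le[of "Suc n"] by (auto simp: mangoldt_nonneg)

lemmas summable_Lser = summable_log_series[where c = "\<lambda>n. mangoldt (Suc n)", OF mangoldt_Suc_bounds]

lemma holomorphic_Lser: "Lser holomorphic_on {s. 1 < Re s}"
  unfolding Lser_def[abs_def] by (rule log_series_holomorphic[OF mangoldt_Suc_bounds])

text \<open>The values Lambda (d) over the divisors d of n add up to log n. Absolute convergence of
  the double series over (d, m) permits grouping by n = d m.\<close>

lemma Lser_mult_zeta:
  assumes s: "Re s > 1"
  shows "Lser s * (\<Sum>n. 1 / (of_nat (Suc n)) powr s) = (\<Sum>n. of_real (ln (real (Suc n))) / (of_nat (Suc n)) powr s)"
proof -
  define A where "A = ({1..} :: nat set)"
  define f where "f d = of_real (mangoldt d) / (of_nat d :: complex) powr s" for d :: nat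
  define g where "g m = 1 / (of_nat m :: complex) powr s" for m :: nat
  define l where "l n = of_real (ln (real n)) / (of_nat n :: complex) powr s" for n :: nat
  have bij: "bij_betw Suc UNIV A"
    unfolding A_def by (rule bij_betwI[where g = "\<lambda>n. n - 1"]) auto
  have conv: "(h has_sum S) A" "(\<lambda>x. norm (h x)) summable_on A" if "summable (\<lambda>n. norm (h (Suc n)))" "(\<lambda>n. h (Suc n)) sums S" for h :: "nat \<Rightarrow> complex" and S
  proof -
    show "(h has_sum S) A"
      using norm_summable_imp_has_sum[OF that] has_sum_reindex_bij_betw[OF bij, of h S] by simp
    have "(\<lambda>n. norm (h (Suc n))) summable_on UNIV"
      using that(1) by (intro summable_nonneg_imp_summable_on) auto
    then show "(\<lambda>x. norm (h x)) summable_on A" using summable_on_reindex_bij_betw[OF bij, of "\<lambda>n. norm (h n)"] by simp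
  qed
  have f: "(f has_sum Lser s) A" "(\<lambda>x. norm (f x)) summable_on A"
    unfolding Lser_def
    by (rule conv; use summable_Lser[OF s] in \<open>auto simp: f_def summable_sums simp del: of_nat_Suc\<close>)+
  have g: "(g has_sum (\<Sum>n. 1 / (of_nat (Suc n)) powr s)) A" "(\<lambda>x. norm (g x)) summable_on A"
    by (rule conv; use summable_dirichlet[OF s] in \<open>auto simp: g_def summable_sums simp del: of_nat_Suc\<close>)+
  have l: "(l has_sum (\<Sum>n. of_real (ln (real (Suc n))) / (of_nat (Suc n)) powr s)) A"
    by (rule conv; use summable_log_series[of "\<lambda>n. ln (real (Suc n))" s] s in \<open>auto simp: l_def summable_sums simp del: of_nat_Suc\<close>)
  have prod: "(\<lambda>p. norm ((\<lambda>(d, m). f d * g m) p)) summable_on A \<times> A"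
  proof (rule Infinite_Sum.abs_summable_on_Sigma_iff[THEN iffD2], intro conjI ballI)
    show "(\<lambda>y. norm (case (x, y) of (d, m) \<Rightarrow> f d * g m)) summable_on A" for x
      using g(2) by (simp add: norm_mult summable_on_cmult_right)
    have "infsum (\<lambda>y. norm (case (x, y) of (d, m) \<Rightarrow> f d * g m)) A = norm (f x) * infsum (\<lambda>y. norm (g y)) A" for x
      by (simp add: norm_mult infsum_cmult_right')
    moreover have "(\<lambda>x. norm (norm (f x) * infsum (\<lambda>y. norm (g y)) A)) summable_on A"
      using f(2) by (simp add: abs_mult summable_on_cmult_left)
    ultimately show "(\<lambda>x. norm (infsum (\<lambda>y. norm (case (x, y) of (d, m) \<Rightarrow> f d * g m)) A)) summable_on A" by simp
  qed
  then have psum: "(\<lambda>(d, m). f d * g m) summable_on A \<times> A" by (rule Infinite_Sum.abs_summable_summable)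
  define S where "S = infsum (\<lambda>(d, m). f d * g m) (A \<times> A)"
  have hs: "((\<lambda>(d, m). f d * g m) has_sum S) (A \<times> A)" unfolding S_def using psum by (rule has_sum_infsum)
  have "((\<lambda>d. f d * (\<Sum>n. 1 / (of_nat (Suc n)) powr s)) has_sum S) A"
    by (rule has_sum_SigmaD[OF hs]) (use g(1) in \<open>auto intro: has_sum_cmult_right\<close>)
  moreover have "((\<lambda>d. f d * (\<Sum>n. 1 / (of_nat (Suc n)) powr s)) has_sum (Lser s * (\<Sum>n. 1 / (of_nat (Suc n)) powr s))) A"
    by (rule has_sum_cmult_left[OF f(1)])
  ultimately have S1: "S = Lser s * (\<Sum>n. 1 / (of_nat (Suc n)) powr s)" by (rule has_sum_unique)
  have "((\<lambda>(n, d). f d * g (n div d)) has_sum S) (Sigma A (\<lambda>n. {d. d dvd n}))"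
  proof -
    have "((\<lambda>(n, d). f d * g (n div d)) has_sum S) (Sigma A (\<lambda>n. {d. d dvd n})) \<longleftrightarrow> ((\<lambda>(d, m). f d * g m) has_sum S) (A \<times> A)"
      by (rule has_sum_reindex_bij_witness[where i = "\<lambda>(d, m). (d * m, d)" and j = "\<lambda>(n, d). (d, n div d)"])
        (auto simp: A_def Suc_le_eq dvd_imp_le elim!: dvdE)
    with hs show ?thesis by simp
  qed
  moreover have "((\<lambda>d. case (n, d) of (n, d) \<Rightarrow> f d * g (n div d)) has_sum l n) {d. d dvd n}" if n: "n \<in> A" for n
  proof -
    have n0: "n > 0" using n by (simp add: A_def)
    have "(\<Sum>d | d dvd n. f d * g (n div d)) = (\<Sum>d | d dvd n. of_real (mangoldt d) / (of_nat n :: complex) powr s)"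
    proof (rule sum.cong)
      fix d assume d: "d \<in> {d. d dvd n}"
      then obtain m where m: "n = d * m" by auto
      then have dm: "d > 0" "m > 0" using n0 by auto
      have "(of_nat n :: complex) powr s = of_nat d powr s * of_nat m powr s"
        unfolding m of_nat_mult by (rule powr_times_real) auto
      then show "f d * g (n div d) = of_real (mangoldt d) / of_nat n powr s"
        using m dm by (simp add: f_def g_def)
    qed simp
    also have "\<dots> = of_real (\<Sum>d | d dvd n. mangoldt d) / (of_nat n :: complex) powr s"
      by (simp add: sum_divide_distrib)
    also have "\<dots> = l n" using mangoldt_sum[of n, where ?'a = real] n0 by (simp add: l_def)
    finally have "(\<Sum>d | d dvd n. f d * g (n div d)) = l n" .
    moreover have "finite {d. d dvd n}" using n0 by simp
    ultimately show ?thesis using has_sum_finite[of "{d. d dvd n}" "\<lambda>d. f d * g (n div d)"] by simp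
  qed
  ultimately have "(l has_sum S) A" by (rule has_sum_SigmaD)
  with l have "S = (\<Sum>n. of_real (ln (real (Suc n))) / (of_nat (Suc n)) powr s)" by (metis has_sum_unique)
  with S1 show ?thesis by simp
qed

lemma has_field_derivative_powr_uminus:
  fixes c :: complex
  assumes "c \<noteq> 0"
  shows "((\<lambda>w. c powr (- w)) has_field_derivative - Ln c * c powr (- x)) (at x)"
proof -
  have "((\<lambda>w. c powr (- w)) has_field_derivative (Ln c * c powr (- x)) * (- 1)) (at x)"
    by (rule DERIV_chain2[of "\<lambda>w. c powr w" _ "\<lambda>w. - w"])
       (use assms in \<open>auto intro!: has_field_derivative_powr_right derivative_eq_intros\<close>)
  then show ?thesis by simp
qed

text \<open>Termwise differentiation gives minus the series of log n, which the convolution identity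
  factors. The product form is kept because the nonvanishing of zeta is deduced from it.\<close>

lemma deriv_zeta_Lser:
  assumes s: "Re s > 1"
  shows "(riemann_zeta has_field_derivative - Lser s * riemann_zeta s) (at s)"
proof -
  define S where "S = {s. 1 < Re s}"
  define f where "f n s = 1 / (of_nat (Suc n) :: complex) powr s" for n s
  have So: "open S" unfolding S_def by (rule open_halfspace_Re_gt)
  have "\<exists>g g'. \<forall>x \<in> S. ((\<lambda>n. f n x) sums g x) \<and> ((\<lambda>n. - of_real (ln (real (Suc n))) / (of_nat (Suc n)) powr x) sums g' x) \<and> (g has_field_derivative g' x) (at x)"
  proof (rule series_and_derivative_comparison_complex[OF So])
    fix n x
    have "(of_nat (Suc n) :: complex) \<noteq> 0" by (simp del: of_nat_Suc)
    from has_field_derivative_powr_uminus[OF this, of x]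
    have "((\<lambda>w. (of_nat (Suc n) :: complex) powr (- w)) has_field_derivative - Ln (of_nat (Suc n)) * of_nat (Suc n) powr (- x)) (at x)" .
    moreover have "Ln (of_nat (Suc n)) = of_real (ln (real (Suc n)))"
      using Ln_of_real[of "real (Suc n)"] by simp
    ultimately show "(f n has_field_derivative - of_real (ln (real (Suc n))) / (of_nat (Suc n)) powr x) (at x)"
    proof -
      assume a: "((\<lambda>w. (of_nat (Suc n) :: complex) powr (- w)) has_field_derivative - Ln (of_nat (Suc n)) * of_nat (Suc n) powr (- x)) (at x)"
        and b: "Ln (of_nat (Suc n) :: complex) = of_real (ln (real (Suc n)))"
      have f: "f n = (\<lambda>w. (of_nat (Suc n) :: complex) powr (- w))" unfolding f_def by (simp only: powr_minus inverse_eq_divide)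
      have "- of_real (ln (real (Suc n))) / (of_nat (Suc n)) powr x = - Ln (of_nat (Suc n)) * (of_nat (Suc n) :: complex) powr (- x)"
        unfolding b by (simp only: powr_minus divide_inverse)
      then show ?thesis using a unfolding f by (simp only:)
    qed
  next
    fix x assume "x \<in> S"
    then have x: "Re x > 1" by (simp add: S_def)
    define d where "d = (Re x - 1) / 2"
    define \<sigma> where "\<sigma> = (Re x + 1) / 2"
    have d: "d > 0" "\<sigma> > 1" using x by (auto simp: d_def \<sigma>_def)
    have R: "Re w \<ge> \<sigma>" if "w \<in> ball x d" for w
      using abs_Re_le_cmod[of "x - w"] that by (simp add: dist_norm d_def \<sigma>_def field_simps)
    show "\<exists>d h. 0 < d \<and> summable h \<and> range h \<subseteq> \<real>\<^sub>\<ge>\<^sub>0 \<and> (\<forall>\<^sub>F n in sequentially. \<forall>y\<in>ball x d \<inter> S. cmod (f n y) \<le> cmod (h n))"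
    proof (intro exI conjI)
      show "summable (\<lambda>n. complex_of_real (real (Suc n) powr - \<sigma>))"
        using sum_powr_bound(1)[OF d(2)] by (rule summable_of_real)
      show "\<forall>\<^sub>F n in sequentially. \<forall>y\<in>ball x d \<inter> S. cmod (f n y) \<le> cmod (complex_of_real (real (Suc n) powr - \<sigma>))"
      proof (intro always_eventually allI ballI)
        fix n y assume y: "y \<in> ball x d \<inter> S"
        have "cmod (f n y) = real (Suc n) powr - Re y" unfolding f_def by (rule norm_nat_powr) simp
        also have "\<dots> \<le> real (Suc n) powr - \<sigma>" using R[of y] y by (intro powr_mono) auto
        finally show "cmod (f n y) \<le> cmod (complex_of_real (real (Suc n) powr - \<sigma>))" by simp
      qed
    qed (use d in auto)
  qed
  then obtain g g' where G: "\<And>x. x \<in> S \<Longrightarrow> (\<lambda>n. f n x) sums g x"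
    "\<And>x. x \<in> S \<Longrightarrow> (\<lambda>n. - of_real (ln (real (Suc n))) / (of_nat (Suc n)) powr x) sums g' x"
    "\<And>x. x \<in> S \<Longrightarrow> (g has_field_derivative g' x) (at x)" by blast
  have sS: "s \<in> S" using s by (simp add: S_def)
  have zg: "riemann_zeta x = g x" if "x \<in> S" for x
    using riemann_zeta_spec(2)[of x] sums_unique[OF G(1)[OF that]] that by (simp add: S_def f_def)
  have "g' s = - (\<Sum>n. of_real (ln (real (Suc n))) / (of_nat (Suc n)) powr s)"
  proof -
    have "(\<lambda>n. - (of_real (ln (real (Suc n))) / (of_nat (Suc n) :: complex) powr s)) sums - (\<Sum>n. of_real (ln (real (Suc n))) / (of_nat (Suc n)) powr s)"
      by (intro sums_minus summable_sums summable_log_series) (use s in auto)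
    then show ?thesis using G(2)[OF sS] sums_unique2 by (simp add: del: of_nat_Suc) blast
  qed
  also have "\<dots> = - Lser s * riemann_zeta s"
    unfolding riemann_zeta_spec(2)[OF s] Lser_mult_zeta[OF s, symmetric] by simp
  finally have "g' s = - Lser s * riemann_zeta s" .
  then have "(g has_field_derivative - Lser s * riemann_zeta s) (at s)" using G(3)[OF sS] by simp
  then show ?thesis
    by (rule has_field_derivative_transform_within_open[OF _ So sS]) (simp add: zg)
qed

text \<open>By zeta' = - Lser * zeta the product of zeta with exp of a primitive of Lser is constant
  on the half plane. One zero would make zeta vanish identically there, contrary to zeta 2 >
  0.\<close>

lemma zeta_nonzero_right:
  assumes s: "Re s > 1"
  shows "riemann_zeta s \<noteq> 0"
proof
  assume z: "riemann_zeta s = 0"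
  define S where "S = {s. 1 < Re s}"
  have So: "open S" "convex S" unfolding S_def by (auto simp: open_halfspace_Re_gt convex_halfspace_Re_gt)
  have hol: "Lser holomorphic_on S" unfolding S_def by (rule holomorphic_Lser)
  have "\<exists>G. \<forall>x\<in>S. (G has_field_derivative Lser x) (at x within S)"
    by (rule holomorphic_convex_primitive'[OF So(2) So(1) hol]) (intro exI ballI)
  then obtain G where G: "\<And>x. x \<in> S \<Longrightarrow> (G has_field_derivative Lser x) (at x within S)" by blast
  have G': "(G has_field_derivative Lser x) (at x)" if "x \<in> S" for x
    using G[OF that] unfolding at_within_open[OF that So(1)] .
  have "((\<lambda>x. riemann_zeta x * exp (G x)) has_field_derivative 0) (at x within S)" if x: "x \<in> S" for x
  proof -
    have "Re x > 1" using x by (simp add: S_def)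
    from deriv_zeta_Lser[OF this] G'[OF x]
    have "((\<lambda>x. riemann_zeta x * exp (G x)) has_field_derivative 0) (at x)"
      by (auto intro!: derivative_eq_intros simp: algebra_simps)
    then show ?thesis by (rule has_field_derivative_at_within)
  qed
  then have "\<exists>c. \<forall>x\<in>S. riemann_zeta x * exp (G x) = c"
    by (rule has_field_derivative_zero_constant[OF So(2)])
  then obtain c where c: "\<And>x. x \<in> S \<Longrightarrow> riemann_zeta x * exp (G x) = c" by blast
  have "c = 0" using c[of s] z s by (simp add: S_def)
  then have "riemann_zeta 2 = 0" using c[of 2] by (simp add: S_def)
  moreover have "(\<lambda>n. 1 / (of_nat (Suc n) :: complex) powr 2) sums riemann_zeta 2"
    using riemann_zeta_spec(2)[of 2] summable_sums[OF summable_dirichlet(1)[of 2]] by simp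
  ultimately have "(\<lambda>n. Re (1 / (of_nat (Suc n) :: complex) powr 2)) sums 0" using sums_Re by fastforce
  moreover have "Re (1 / (of_nat (Suc n) :: complex) powr 2) = 1 / (real (Suc n))\<^sup>2" for n
  proof -
    have "(of_nat (Suc n) :: complex) powr 2 = of_real ((real (Suc n))\<^sup>2)"
      using powr_of_real[of "real (Suc n)" 2] by (simp add: powr_numeral)
    then show ?thesis by (simp del: of_nat_Suc of_real_power)
  qed
  ultimately have "(\<lambda>n. 1 / (real (Suc n))\<^sup>2) sums 0" by simp
  then have "summable (\<lambda>n. 1 / (real (Suc n))\<^sup>2)" "(\<Sum>n. 1 / (real (Suc n))\<^sup>2) = 0"
    using sums_summable sums_unique by metis+
  then show False using suminf_pos[of "\<lambda>n. 1 / (real (Suc n))\<^sup>2"] by (simp del: of_nat_Suc)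
qed

lemma zeta_deriv_quotient_right:
  assumes "Re s > 1"
  shows "deriv riemann_zeta s / riemann_zeta s = - Lser s"
  using DERIV_imp_deriv[OF deriv_zeta_Lser[OF assms]] zeta_nonzero_right[OF assms] by simp

lemma norm_Lser_le:
  assumes "Re s \<ge> \<sigma>" "\<sigma> > 1"
  shows "norm (Lser s) \<le> (\<Sum>n. 2 / (\<sigma> - 1) * real (Suc n) powr - ((\<sigma> + 1) / 2))"
  unfolding Lser_def
  by (rule norm_suminf_le[OF log_series_bound[OF assms(2,1) mangoldt_Suc_bounds] summable_log_series_bound[OF assms(2)]])

section \<open>Zero-free half planes and the location of the zeros\<close>

lemma sin_pi_half_nonzero: "Im s \<noteq> 0 \<or> (\<forall>n::int. Re s \<noteq> 2 * of_int n) \<Longrightarrow> sin (of_real pi * s / 2) \<noteq> 0" for s :: complex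
proof
  assume a: "Im s \<noteq> 0 \<or> (\<forall>n::int. Re s \<noteq> 2 * of_int n)" and "sin (of_real pi * s / 2) = 0"
  then have "s / 2 \<in> \<int>" using sin_pi_z_eq_0_iff[of "s / 2"] by simp
  then obtain n :: int where "s / 2 = of_int n" by (auto elim: Ints_cases)
  then have "s = of_real (2 * of_int n)" by (simp add: field_simps)
  with a show False by auto
qed

lemma zeta_nonzero_left:
  assumes s: "Re s < 0" "Im s \<noteq> 0 \<or> Re s > -2"
  shows "riemann_zeta s \<noteq> 0"
proof -
  have "sin (of_real pi * s / 2) \<noteq> 0"
  proof (rule sin_pi_half_nonzero)
    have "Re s \<noteq> 2 * of_int n" if "Re s > -2" for n :: int
    proof
      assume "Re s = 2 * of_int n"
      then have "- 1 < (of_int n :: real)" "(of_int n :: real) < 0" using that s by auto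
      then have "- 1 < n" "n < 0" by linarith+
      then show False by linarith
    qed
    then show "Im s \<noteq> 0 \<or> (\<forall>n::int. Re s \<noteq> 2 * of_int n)" using s by blast
  qed
  moreover have "Gamma (1 - s) \<noteq> 0" using s by (subst Gamma_eq_zero_iff) (auto elim!: nonpos_Ints_cases simp: complex_eq_iff)
  moreover have "riemann_zeta (1 - s) \<noteq> 0" using s by (intro zeta_nonzero_right) auto
  moreover have "(2 * of_real pi :: complex) powr (s - 1) \<noteq> 0" by simp
  moreover have "s \<noteq> 0" using s by auto
  ultimately show ?thesis using riemann_zeta_functional_equation[of s] s by auto
qed

lemma zeta_zero_location:
  assumes "riemann_zeta s = 0" "s \<noteq> 1" "Re s > -2 \<or> Im s \<noteq> 0"
  shows "0 \<le> Re s" "Re s \<le> 1" "Im s \<noteq> 0"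
proof -
  show r: "0 \<le> Re s" "Re s \<le> 1" using zeta_nonzero_right[of s] zeta_nonzero_left[of s] assms by (auto simp: not_less[symmetric])
  show "Im s \<noteq> 0"
  proof
    assume i: "Im s = 0"
    then have "s = of_real (Re s)" by (simp add: complex_eq_iff)
    moreover have "Re s < 1" using r assms(2) i by (auto simp: complex_eq_iff less_le)
    ultimately have "zeta_reg s \<noteq> 0" using zeta_reg_real_nonzero[of "Re s"] r by simp
    then show False using riemann_zeta_eq[of s] assms r by auto
  qed
qed

text \<open>The condition on Im rho removes at once the trivial zeros and the point 1, where the
  value of \<open>riemann_zeta\<close> is arbitrary.\<close>

definition Zs :: "complex set" where "Zs = {\<rho>. Im \<rho> \<noteq> 0 \<and> riemann_zeta \<rho> = 0}"

lemma Zs_strip: "\<rho> \<in> Zs \<Longrightarrow> 0 \<le> Re \<rho> \<and> Re \<rho> \<le> 1"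
  using zeta_zero_location[of \<rho>] by (cases "\<rho> = 1") (auto simp: Zs_def)

lemma upper_zeros_eq: "upper_zeros = {\<rho> \<in> Zs. Im \<rho> > 0}"
  by (auto simp: upper_zeros_def nontrivial_zeros_def Zs_def)

section \<open>Consequences of the functional equation: reflected zeros and reflected logarithmic
  derivative\<close>

definition zeta_chi :: "complex \<Rightarrow> complex" where
  "zeta_chi s = 2 * (2 * of_real pi) powr (s - 1) * sin (of_real pi * s / 2) * Gamma (1 - s)"

lemma zeta_fe: "Re s < 1 \<Longrightarrow> s \<noteq> 0 \<Longrightarrow> riemann_zeta s = zeta_chi s * riemann_zeta (1 - s)"
  using riemann_zeta_functional_equation[of s] by (simp add: zeta_chi_def)

lemma zeta_chi_nonzero: "Re s < 1 \<Longrightarrow> Im s \<noteq> 0 \<Longrightarrow> zeta_chi s \<noteq> 0"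
proof -
  assume a: "Re s < 1" "Im s \<noteq> 0"
  have "Gamma (1 - s) \<noteq> 0" using a by (subst Gamma_eq_zero_iff) (auto elim!: nonpos_Ints_cases simp: complex_eq_iff)
  then show ?thesis unfolding zeta_chi_def using sin_pi_half_nonzero[of s] a by simp
qed

lemma holomorphic_zeta_chi: "zeta_chi holomorphic_on {s. Re s < 1}"
  unfolding zeta_chi_def by (intro holomorphic_intros) (auto elim!: nonpos_Ints_cases simp: complex_eq_iff)

text \<open>\<open>zeta_chi\<close> is holomorphic and nonzero at rho, so the local factorization of
  zeta at 1 - rho, carried over by the functional equation, is one at rho with the same
  exponent.\<close>

lemma Zs_reflect_aux:
  assumes "\<rho> \<in> Zs" "Re \<rho> < 1"
  shows "1 - \<rho> \<in> Zs" "zorder riemann_zeta (1 - \<rho>) = zorder riemann_zeta \<rho>"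
proof -
  have r: "Im \<rho> \<noteq> 0" "riemann_zeta \<rho> = 0" "\<rho> \<noteq> 0" using assms by (auto simp: Zs_def)
  show z: "1 - \<rho> \<in> Zs"
    using zeta_fe[of \<rho>] zeta_chi_nonzero[of \<rho>] r assms by (auto simp: Zs_def)
  define S where "S = - {1 :: complex}"
  have S: "open S" "connected S" "1 - \<rho> \<in> S" using r by (auto simp: S_def connected_punctured_universe)
  have hol: "riemann_zeta holomorphic_on S" unfolding S_def by (rule riemann_zeta_spec)
  define n where "n = zorder riemann_zeta (1 - \<rho>)"
  define g where "g = zor_poly riemann_zeta (1 - \<rho>)"
  have ex: "\<exists>w\<in>S. riemann_zeta w \<noteq> 0" using zeta_nonzero_right[of 2] by (intro bexI[of _ 2]) (auto simp: S_def)
  have "(if riemann_zeta (1 - \<rho>) = 0 then n > 0 else n = 0) \<and>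
    (\<exists>r. r > 0 \<and> cball (1 - \<rho>) r \<subseteq> S \<and> g holomorphic_on cball (1 - \<rho>) r
      \<and> (\<forall>w\<in>cball (1 - \<rho>) r. riemann_zeta w = g w * (w - (1 - \<rho>)) ^ nat n \<and> g w \<noteq> 0))"
    unfolding n_def g_def by (rule zorder_exist_zero[OF hol S ex])
  note ex0 = this
  have z0: "riemann_zeta (1 - \<rho>) = 0" using z by (simp add: Zs_def)
  have n0: "n > 0" using conjunct1[OF ex0] unfolding z0 by simp
  obtain r where r0: "r > 0" and gh: "g holomorphic_on cball (1 - \<rho>) r"
    and gw: "\<And>w. w \<in> cball (1 - \<rho>) r \<Longrightarrow> riemann_zeta w = g w * (w - (1 - \<rho>)) ^ nat n \<and> g w \<noteq> 0"
    using conjunct2[OF ex0] by blast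
  define T where "T = ball \<rho> r \<inter> {s. Re s < 1} - {0}"
  have To: "open T" "\<rho> \<in> T" unfolding T_def using r0 assms r by (auto intro!: open_Int open_Diff open_halfspace_Re_lt)
  have in_c: "1 - w \<in> cball (1 - \<rho>) r" if "w \<in> T" for w using that by (auto simp: T_def dist_norm norm_minus_commute)
  have "zorder riemann_zeta \<rho> = n"
  proof (rule zorder_eqI[OF To])
    show "(\<lambda>w. zeta_chi w * g (1 - w) * (- 1) ^ nat n) holomorphic_on T"
    proof (intro holomorphic_intros)
      show "zeta_chi holomorphic_on T" by (rule holomorphic_on_subset[OF holomorphic_zeta_chi]) (auto simp: T_def)
      show "(\<lambda>w. g (1 - w)) holomorphic_on T"
        by (rule holomorphic_on_compose_gen[OF _ gh, unfolded o_def]) (use in_c in \<open>auto intro!: holomorphic_intros\<close>)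
    qed
    show "zeta_chi \<rho> * g (1 - \<rho>) * (- 1) ^ nat n \<noteq> 0"
      using zeta_chi_nonzero[of \<rho>] assms r gw[of "1 - \<rho>"] r0 by simp
  next
    fix w assume w: "w \<in> T" "w \<noteq> \<rho>"
    show "riemann_zeta w = zeta_chi w * g (1 - w) * (- 1) ^ nat n * (w - \<rho>) powi n"
    proof -
      have "riemann_zeta w = zeta_chi w * riemann_zeta (1 - w)" using w by (intro zeta_fe) (auto simp: T_def)
      also have "riemann_zeta (1 - w) = g (1 - w) * (1 - w - (1 - \<rho>)) ^ nat n" using gw[OF in_c[OF w(1)]] by simp
      also have "1 - w - (1 - \<rho>) = (- 1) * (w - \<rho>)" by simp
      also have "((- 1) * (w - \<rho>)) ^ nat n = (- 1) ^ nat n * (w - \<rho>) powi n"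
        using n0 by (simp only: power_mult_distrib) (simp add: power_int_def)
      finally show ?thesis by (simp add: mult_ac)
    qed
  qed
  then show "zorder riemann_zeta (1 - \<rho>) = zorder riemann_zeta \<rho>" by (simp add: n_def)
qed

text \<open>The functional equation is stated for Re s < 1, and zeros with Re rho = 1 have not been
  excluded; for these the argument is run at 1 - rho, which has real part 0.\<close>

lemma Zs_reflect:
  assumes "\<rho> \<in> Zs"
  shows "1 - \<rho> \<in> Zs" "zorder riemann_zeta (1 - \<rho>) = zorder riemann_zeta \<rho>"
proof -
  have "1 - \<rho> \<in> Zs \<and> zorder riemann_zeta (1 - \<rho>) = zorder riemann_zeta \<rho>"
  proof (cases "Re \<rho> < 1")
    case True
    then show ?thesis using Zs_reflect_aux assms by blast
  next
    case False
    then have R: "Re \<rho> = 1" using Zs_strip[OF assms] by simp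
    have i: "Im \<rho> \<noteq> 0" "riemann_zeta \<rho> = 0" using assms by (auto simp: Zs_def)
    have "1 - \<rho> \<in> Zs" using zeta_fe[of "1 - \<rho>"] i R by (auto simp: Zs_def complex_eq_iff)
    then show ?thesis using Zs_reflect_aux[of "1 - \<rho>"] R by auto
  qed
  then show "1 - \<rho> \<in> Zs" "zorder riemann_zeta (1 - \<rho>) = zorder riemann_zeta \<rho>" by auto
qed

text \<open>Logarithmic derivative of zeta (1 - s) = 2 (2 pi)^(-s) cos (pi s / 2) Gamma s zeta s.
  For 1 < Re s < 3 no factor vanishes; the cosine has zeros at s = 1 and s = 3.\<close>

lemma zeta_deriv_quotient_left:
  assumes s: "1 < Re s" "Re s < 3"
  shows "deriv riemann_zeta (1 - s) / riemann_zeta (1 - s)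
    = of_real (ln (2 * pi)) + of_real pi / 2 * tan (of_real pi * s / 2) - Digamma s + Lser s"
proof -
  define S where "S = {s. 1 < Re s \<and> Re s < 3}"
  have So: "open S"
  proof -
    have "S = {s. 1 < Re s} \<inter> {s. Re s < 3}" by (auto simp: S_def)
    then show ?thesis by (simp only:) (intro open_Int open_halfspace_Re_gt open_halfspace_Re_lt)
  qed
  have sS: "s \<in> S" using s by (simp add: S_def)
  define h where "h w = 2 * (2 * of_real pi) powr (- w) * cos (of_real pi * w / 2) * Gamma w * riemann_zeta w" for w
  have eq: "riemann_zeta (1 - w) = h w" if "w \<in> S" for w
  proof -
    have w: "Re (1 - w) < 1" "1 - w \<noteq> 0" using that by (auto simp: S_def)
    have "sin (of_real pi * (1 - w) / 2) = cos (of_real pi * w / 2)"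
    proof -
      have "of_real pi * (1 - w) / 2 = of_real pi / 2 - of_real pi * w / 2" by (simp add: right_diff_distrib diff_divide_distrib)
      then show ?thesis using cos_sin_eq[of "of_real pi * w / 2"] by (simp only:)
    qed
    then show ?thesis using riemann_zeta_functional_equation[OF w] by (simp add: h_def)
  qed
  have np: "s \<notin> \<int>\<^sub>\<le>\<^sub>0" using s by (auto elim!: nonpos_Ints_cases)
  have c0: "cos (of_real pi * s / 2) \<noteq> 0"
  proof
    assume "cos (of_real pi * s / 2) = 0"
    from cos_pi_half_eq_0[OF this] obtain n :: int where n: "s = of_int (2 * n + 1)" by blast
    then have "1 < real_of_int (2 * n + 1)" "real_of_int (2 * n + 1) < 3" using s by auto
    then have "1 < 2 * n + 1" "2 * n + 1 < 3" by linarith+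
    then show False by presburger
  qed
  have nz: "riemann_zeta s \<noteq> 0" "Gamma s \<noteq> 0" using zeta_nonzero_right s np by (auto simp: Gamma_eq_zero_iff)
  have hs: "h s \<noteq> 0" using c0 nz by (simp add: h_def)
  have Ln2: "Ln (2 * of_real pi :: complex) = of_real (ln (2 * pi))" using Ln_of_real[of "2 * pi"] by simp
  define D where "D = h s * (- of_real (ln (2 * pi)) - of_real pi / 2 * tan (of_real pi * s / 2) + Digamma s - Lser s)"
  have dp: "((\<lambda>w. (2 * of_real pi :: complex) powr (- w)) has_field_derivative - of_real (ln (2 * pi)) * (2 * of_real pi) powr (- s)) (at s)"
    using has_field_derivative_powr_uminus[of "2 * of_real pi" s] unfolding Ln2 by simp
  have dc: "((\<lambda>w. cos (of_real pi * w / 2)) has_field_derivative - sin (of_real pi * s / 2) * (of_real pi / 2)) (at s)"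
    by (auto intro!: derivative_eq_intros)
  have dG: "(Gamma has_field_derivative Gamma s * Digamma s) (at s)" using np by (rule has_field_derivative_Gamma)
  have dz: "(riemann_zeta has_field_derivative - Lser s * riemann_zeta s) (at s)" by (rule deriv_zeta_Lser[OF s(1)])
  have "(h has_field_derivative D) (at s)"
    unfolding h_def
    by (rule DERIV_cong[OF DERIV_mult[OF DERIV_mult[OF DERIV_mult[OF DERIV_mult[OF DERIV_const dp] dc] dG] dz]])
       (use c0 in \<open>simp add: D_def h_def tan_def field_simps\<close>)
  then have "((\<lambda>w. riemann_zeta (1 - w)) has_field_derivative D) (at s)"
    by (rule has_field_derivative_transform_within_open[OF _ So sS]) (simp add: eq)
  moreover have "((\<lambda>w. riemann_zeta (1 - w)) has_field_derivative deriv riemann_zeta (1 - s) * (- 1)) (at s)"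
  proof (rule DERIV_chain2[of riemann_zeta _ "\<lambda>w. 1 - w"])
    have "riemann_zeta field_differentiable (at (1 - s))"
      by (rule holomorphic_on_imp_differentiable_at[OF riemann_zeta_spec(1)]) (use s in auto)
    then show "(riemann_zeta has_field_derivative deriv riemann_zeta (1 - s)) (at (1 - s))"
      using DERIV_deriv_iff_field_differentiable by blast
    show "((\<lambda>w. 1 - w) has_field_derivative - 1) (at s)" by (auto intro!: derivative_eq_intros)
  qed
  ultimately have "deriv riemann_zeta (1 - s) = - D" using DERIV_unique by fastforce
  then show ?thesis using hs eq[OF sS] by (simp add: D_def)
qed

section \<open>Zeros of the zeta function and good heights\<close>

text \<open>Majorant of |zeta| in discs about 3 + i T. Cubic growth is crude, but mainly its
  logarithm matters.\<close>

definition zM :: "real \<Rightarrow> real" where "zM T = 12 * (\<bar>T\<bar> + 8) ^ 3"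

text \<open>Bounds the number of zeros in such a disc: 2 \<open>zM T\<close> is the majorant divided
  by the lower bound 1/2 at the centre, and 19 comes from log (19/18) >= 1/19, where 19/18 is the
  ratio of the radii.\<close>

definition zB :: "real \<Rightarrow> real" where "zB T = 19 * ln (2 * zM T)"

lemma zM_ge: "zM T \<ge> 6000"
proof -
  have "8 ^ 3 \<le> (\<bar>T\<bar> + 8) ^ 3" by (intro power_mono) auto
  then show ?thesis by (simp add: zM_def)
qed

text \<open>The ranges contain the disc of radius 39/10 about 3 + i T, with -9/10 = 3 - 39/10; |Im
  s| >= 1 keeps away from the pole. For sigma = -9/10 the factor (sigma + 2) / (sigma + 1) is
  11.\<close>

lemma zeta_norm_le:
  assumes s: "Re s \<ge> - 9/10" "Re s \<le> 7" "\<bar>Im s\<bar> \<ge> 1" "\<bar>Im s\<bar> \<le> \<bar>T\<bar> + 4" and T: "\<bar>T\<bar> \<ge> 4"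
  shows "norm (riemann_zeta s) \<le> zM T"
proof -
  define A where "A = \<bar>T\<bar> + 8"
  have A: "A \<ge> 12" using T by (simp add: A_def)
  have n: "norm (s - 1) \<le> A + 4" "norm s \<le> A + 4" "norm (s + 1) \<le> A + 4"
    using cmod_le[of "s - 1"] cmod_le[of s] cmod_le[of "s + 1"] s by (auto simp: A_def abs_le_iff)
  have d: "norm (s - 1) \<ge> 1" using abs_Im_le_cmod[of "s - 1"] s by simp
  have s1: "s \<noteq> 1" using s by auto
  have "norm (zeta_reg s) \<le> norm ((1 + s) / 2) + norm (zeta_reg s - (1 + s) / 2)"
    using norm_triangle_ineq[of "(1 + s) / 2" "zeta_reg s - (1 + s) / 2"] by simp
  also have "norm (zeta_reg s - (1 + s) / 2) \<le> norm (s - 1) * norm s * norm (s + 1) / 2 * ((- (9/10) + 2) / (- (9/10) + 1))"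
    by (rule zeta_reg_diff_bound) (use s in auto)
  also have "\<dots> = norm (s - 1) * (norm s * norm (s + 1) * (11/2))" by simp
  also have "norm ((1 + s) / 2) \<le> norm (s - 1) * (norm (s + 1) / 2)"
  proof -
    have "1 * (norm (s + 1) / 2) \<le> norm (s - 1) * (norm (s + 1) / 2)" by (rule mult_right_mono[OF d]) simp
    then show ?thesis by (simp add: norm_divide add.commute)
  qed
  finally have z: "norm (zeta_reg s) \<le> norm (s - 1) * (norm (s + 1) / 2 + norm s * norm (s + 1) * (11/2))"
    by (simp add: distrib_left)
  have "norm (riemann_zeta s) = norm (zeta_reg s) / norm (s - 1)"
    using riemann_zeta_eq[of s] s s1 by (simp add: norm_divide)
  also have "\<dots> \<le> norm (s + 1) / 2 + norm s * norm (s + 1) * (11/2)"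
    using z d by (simp add: divide_le_eq mult.commute)
  also have "\<dots> \<le> (A + 4) / 2 + (A + 4) * (A + 4) * (11/2)"
    using n A by (intro add_mono divide_right_mono mult_right_mono mult_mono) auto
  also have "\<dots> \<le> 12 * A ^ 3"
  proof -
    have "A + 4 \<le> 2 * A" using A by simp
    then have "(A + 4) * (A + 4) \<le> (2 * A) * (2 * A)" using A by (intro mult_mono) auto
    then have "(A + 4) * (A + 4) \<le> 4 * (A * A)" by simp
    moreover have "(A + 4) / 2 + X * (11/2) \<le> A + 22 * Y" if "X \<le> 4 * Y" for X Y :: real
      using that A by argo
    ultimately have "(A + 4) / 2 + (A + 4) * (A + 4) * (11/2) \<le> A + 22 * (A * A)" by blast
    also have "\<dots> \<le> A * A + 22 * (A * A)" using A by (simp add: mult_le_cancel_right1)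
    also have "\<dots> = 23 * (A * A)" by simp
    also have "\<dots> \<le> (12 * A) * (A * A)" using A by (intro mult_right_mono) auto
    finally show ?thesis by (simp add: power3_eq_cube)
  qed
  finally show ?thesis by (simp add: zM_def A_def)
qed

text \<open>The terms from n = 2 on have total modulus at most zeta 3 - 1 <= 1/2, by the integral
  bound 3/2 for zeta 3.\<close>

lemma zeta_norm_ge_3: "norm (riemann_zeta (Complex 3 T)) \<ge> 1/2"
proof -
  have R: "Re (Complex 3 T) > 1" by simp
  define f where "f n = 1 / (of_nat (Suc n) :: complex) powr (Complex 3 T)" for n
  have nf: "norm (f n) = real (Suc n) powr - 3" for n unfolding f_def using norm_nat_powr[of "Suc n" "Complex 3 T"] by simp
  have sf: "summable f" "summable (\<lambda>n. norm (f n))" unfolding f_def using summable_dirichlet[OF R] by auto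
  have z: "riemann_zeta (Complex 3 T) = f 0 + (\<Sum>n. f (Suc n))"
  proof -
    have fe: "f = (\<lambda>n. 1 / (of_nat (Suc n)) powr (Complex 3 T))" by (simp add: fun_eq_iff f_def)
    have "riemann_zeta (Complex 3 T) = suminf f" unfolding fe by (rule riemann_zeta_spec(2)[OF R])
    then show ?thesis using suminf_split_head[OF sf(1)] by simp
  qed
  have "norm (\<Sum>n. f (Suc n)) \<le> (\<Sum>n. norm (f (Suc n)))" using sf(2) by (intro summable_norm) (subst summable_Suc_iff)
  also have "\<dots> = (\<Sum>n. norm (f n)) - norm (f 0)" by (rule suminf_split_head[OF sf(2)])
  also have "(\<Sum>n. norm (f n)) \<le> 3 / (3 - 1)" unfolding nf by (rule sum_powr_bound) simp
  also have "norm (f 0) = 1" by (simp add: f_def)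
  finally have "norm (\<Sum>n. f (Suc n)) \<le> 1/2" by simp
  moreover have "f 0 = 1" by (simp add: f_def)
  ultimately show ?thesis unfolding z using norm_triangle_ineq2[of 1 "- (\<Sum>n. f (Suc n))"] by simp
qed

text \<open>The disc of radius 33/10 about 3 + i T covers the segment -1/4 <= Re s <= 5/4 at height
  T, whose far end is at distance 13/4. The outer radii 18/5, 19/5 and 39/10 still miss the pole for
  |T| >= 5. The exponent 22 is 2 r / (s - r) for r = 33/10 and s = 18/5.\<close>

lemma zeta_zero_count_and_lower_bound:
  assumes T: "\<bar>T\<bar> \<ge> 5"
  defines "Z \<equiv> {\<rho> \<in> Zs. norm (\<rho> - Complex 3 T) \<le> 18/5}"
  shows "finite Z" and "\<And>\<rho>. \<rho> \<in> Z \<Longrightarrow> 0 < zorder riemann_zeta \<rho>"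
    and "real (\<Sum>\<rho>\<in>Z. nat (zorder riemann_zeta \<rho>)) \<le> zB T"
    and "\<And>s d. \<lbrakk>norm (s - Complex 3 T) \<le> 33/10; 0 < d; d \<le> 1; \<And>\<rho>. \<rho> \<in> Z \<Longrightarrow> d \<le> norm (s - \<rho>)\<rbrakk> \<Longrightarrow>
        1/2 * exp (- 22 * ln (4 * zM T)) * exp (zB T * ln (d / 8)) \<le> norm (riemann_zeta s)"
proof -
  define z0 where "z0 = Complex 3 T"
  define f where "f z = riemann_zeta (z + z0)" for z
  have im: "\<bar>Im (z + z0)\<bar> \<ge> 1" "\<bar>Im (z + z0)\<bar> \<le> \<bar>T\<bar> + 4" "Re (z + z0) \<ge> - 9/10" "Re (z + z0) \<le> 7" if "norm z \<le> 39/10" for z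
    using abs_Im_le_cmod[of z] abs_Re_le_cmod[of z] that T by (auto simp: z0_def abs_le_iff)
  have hol: "f holomorphic_on ball 0 (39/10)"
    unfolding f_def
  proof (rule holomorphic_on_compose_gen[OF _ riemann_zeta_spec(1), unfolded o_def])
    show "(\<lambda>z. z + z0) ` ball 0 (39/10) \<subseteq> - {1}"
    proof
      fix s assume "s \<in> (\<lambda>z. z + z0) ` ball 0 (39/10)"
      then have "\<bar>Im s\<bar> \<ge> 1" using im(1) by force
      then show "s \<in> - {1}" by auto
    qed
  qed (intro holomorphic_intros)
  have M: "norm (f z) \<le> zM T" if "norm z \<le> 19/5" for z
    unfolding f_def using im[of z] that T by (intro zeta_norm_le) auto
  have c: "0 < (1/2::real)" "1/2 \<le> norm (f 0)" using zeta_norm_ge_3[of T] by (auto simp: f_def z0_def)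
  define Z' where "Z' = {z \<in> cball 0 (18/5). f z = 0}"
  have R: "0 < (33/10::real)" "33/10 < (18/5::real)" "18/5 < (19/5::real)" "19/5 < (39/10::real)" by auto
  note L = zero_count_and_lower_bound[OF hol R M c]
  have Z'Z: "\<rho> - z0 \<in> Z' \<longleftrightarrow> \<rho> \<in> Z" for \<rho>
  proof
    assume "\<rho> - z0 \<in> Z'"
    then have a: "norm (\<rho> - z0) \<le> 18/5" "riemann_zeta \<rho> = 0" by (auto simp: Z'_def f_def)
    then have "\<bar>Im \<rho>\<bar> \<ge> 1" using im(1)[of "\<rho> - z0"] by simp
    then show "\<rho> \<in> Z" using a by (auto simp: Z_def Zs_def z0_def)
  qed (auto simp: Z_def Zs_def Z'_def f_def z0_def)
  have Zim: "Z = (\<lambda>z. z + z0) ` Z'"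
  proof (intro set_eqI iffI)
    fix \<rho> assume "\<rho> \<in> Z"
    then show "\<rho> \<in> (\<lambda>z. z + z0) ` Z'" using Z'Z[of \<rho>] by (intro image_eqI[of _ _ "\<rho> - z0"]) auto
  next
    fix \<rho> assume "\<rho> \<in> (\<lambda>z. z + z0) ` Z'"
    then show "\<rho> \<in> Z" using Z'Z[of \<rho>] by auto
  qed
  have zo: "zorder f p = zorder riemann_zeta (p + z0)" for p
  proof -
    have "zorder f p = zorder (\<lambda>u. f (u + p)) 0" by (rule zorder_shift)
    also have "(\<lambda>u. f (u + p)) = (\<lambda>u. riemann_zeta (u + (p + z0)))" by (simp add: f_def add.assoc)
    also have "zorder \<dots> 0 = zorder riemann_zeta (p + z0)" by (rule zorder_shift[symmetric])
    finally show ?thesis .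
  qed
  have sumeq: "(\<Sum>\<rho>\<in>Z. nat (zorder riemann_zeta \<rho>)) = (\<Sum>p\<in>Z'. nat (zorder f p))"
    unfolding Zim by (subst sum.reindex) (auto simp: zo)
  show "finite Z" unfolding Zim Z'_def by (intro finite_imageI L(1))
  show "0 < zorder riemann_zeta \<rho>" if "\<rho> \<in> Z" for \<rho>
    using L(2)[of "\<rho> - z0"] Z'Z[of \<rho>] that zo[of "\<rho> - z0"] unfolding Z'_def by simp
  have N: "real (\<Sum>\<rho>\<in>Z. nat (zorder riemann_zeta \<rho>)) \<le> zB T"
  proof -
    have "1 - 18/19 \<le> ln (19/18 :: real)"
      using ln_le_minus_one[of "18/19 :: real"] ln_inverse[of "18/19 :: real"] by simp
    moreover have "(19/5) / (18/5) = (19/18 :: real)" by simp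
    ultimately have l: "1/19 \<le> ln ((19/5) / (18/5) :: real)" by simp
    have "real (\<Sum>p\<in>Z'. nat (zorder f p)) * (1/19) \<le> real (\<Sum>p\<in>Z'. nat (zorder f p)) * ln ((19/5) / (18/5))"
      by (rule mult_left_mono[OF l of_nat_0_le_iff])
    also have "\<dots> \<le> ln (zM T / (1/2))" using L(3) unfolding Z'_def .
    finally show ?thesis unfolding sumeq zB_def by (simp add: mult.commute)
  qed
  then show "real (\<Sum>\<rho>\<in>Z. nat (zorder riemann_zeta \<rho>)) \<le> zB T" .
  show "1/2 * exp (- 22 * ln (4 * zM T)) * exp (zB T * ln (d / 8)) \<le> norm (riemann_zeta s)"
    if s: "norm (s - Complex 3 T) \<le> 33/10" and d: "0 < d" "d \<le> 1" and dist: "\<And>\<rho>. \<rho> \<in> Z \<Longrightarrow> d \<le> norm (s - \<rho>)" for s d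
  proof -
    define n where "n = (\<Sum>p\<in>Z'. nat (zorder f p))"
    have "1/2 * exp (- (2 * (33/10) / (18/5 - 33/10)) * ln (2 * zM T / (1/2))) * (d / (2 * (19/5))) ^ n \<le> norm (f (s - z0))"
      unfolding n_def Z'_def
    proof (rule L(4))
      show "d \<le> norm (s - z0 - p)" if "p \<in> {z \<in> cball 0 (18/5). f z = 0}" for p
        using dist[of "p + z0"] that Z'Z[of "p + z0"] by (simp add: Z'_def algebra_simps)
    qed (use s d in \<open>auto simp: z0_def\<close>)
    then have 1: "1/2 * exp (- 22 * ln (4 * zM T)) * (d / (38/5)) ^ n \<le> norm (riemann_zeta s)" by (simp add: f_def)
    have "exp (zB T * ln (d / 8)) \<le> exp (real n * ln (d / 8))"
    proof -
      have "ln (d / 8) \<le> 0" using d by simp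
      moreover have "real n \<le> zB T" using N unfolding sumeq n_def .
      ultimately show ?thesis by (simp add: mult_right_mono_neg)
    qed
    also have "\<dots> = (d / 8) ^ n" using d by (simp add: exp_of_nat_mult)
    also have "\<dots> \<le> (d / (38/5)) ^ n" using d by (intro power_mono) auto
    finally have "1/2 * exp (- 22 * ln (4 * zM T)) * exp (zB T * ln (d / 8)) \<le> 1/2 * exp (- 22 * ln (4 * zM T)) * (d / (38/5)) ^ n"
      by (intro mult_left_mono) auto
    with 1 show ?thesis by linarith
  qed
qed

text \<open>Cauchy's estimate with radius 1/2 bounds zeta', the lower bound off the zeros controls 1
  / zeta, and everything is collected in one exponent.\<close>

lemma zeta_log_deriv_bound:
  assumes T: "\<bar>T\<bar> \<ge> 5" and d: "0 < d" "d \<le> 1" and far: "\<And>\<rho>. \<rho> \<in> Zs \<Longrightarrow> \<bar>Im \<rho> - T\<bar> \<ge> d"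
    and s: "-1/4 \<le> Re s" "Re s \<le> 5/4" "Im s = T"
  shows "norm (deriv riemann_zeta s / riemann_zeta s) \<le> exp (24 * ln (4 * zM T) + zB T * ln (8 / d))"
proof -
  have l: "1/2 * exp (- 22 * ln (4 * zM T)) * exp (zB T * ln (d / 8)) \<le> norm (riemann_zeta s)"
  proof (rule zeta_zero_count_and_lower_bound(4)[OF T _ d])
    have "norm (s - Complex 3 T) \<le> \<bar>Re (s - Complex 3 T)\<bar> + \<bar>Im (s - Complex 3 T)\<bar>" by (rule cmod_le)
    also have "\<dots> \<le> 33/10" using s by simp
    finally show "norm (s - Complex 3 T) \<le> 33/10" .
    show "d \<le> norm (s - \<rho>)" if "\<rho> \<in> {\<rho> \<in> Zs. norm (\<rho> - Complex 3 T) \<le> 18/5}" for \<rho>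
      using far[of \<rho>] that abs_Im_le_cmod[of "s - \<rho>"] s by (simp add: abs_minus_commute)
  qed
  have zp: "norm (riemann_zeta s) > 0" using l by (intro less_le_trans[OF _ l]) simp
  have bd: "norm (riemann_zeta w) \<le> zM T" if "norm (s - w) \<le> 1/2" for w
    using abs_Re_le_cmod[of "s - w"] abs_Im_le_cmod[of "s - w"] that s T by (intro zeta_norm_le) (auto simp: abs_le_iff)
  have ne: "w \<noteq> 1" if "norm (s - w) \<le> 1/2" for w
    using abs_Im_le_cmod[of "s - w"] that s T by auto
  have "norm ((deriv ^^ 1) riemann_zeta s) \<le> fact 1 * zM T / (1/2) ^ 1"
  proof (rule Cauchy_inequality)
    show "riemann_zeta holomorphic_on ball s (1/2)"
      by (rule holomorphic_on_subset[OF riemann_zeta_spec(1)]) (use ne[of 1] in \<open>auto simp: dist_norm\<close>)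
    show "continuous_on (cball s (1/2)) riemann_zeta"
      by (rule holomorphic_on_imp_continuous_on, rule holomorphic_on_subset[OF riemann_zeta_spec(1)]) (use ne[of 1] in \<open>auto simp: dist_norm\<close>)
  qed (use bd in auto)
  then have dz: "norm (deriv riemann_zeta s) \<le> 2 * zM T" by simp
  have "norm (deriv riemann_zeta s / riemann_zeta s) \<le> (2 * zM T) / (1/2 * exp (- 22 * ln (4 * zM T)) * exp (zB T * ln (d / 8)))"
    unfolding norm_divide using dz l zp zM_ge[of T] by (intro frac_le) auto
  also have "\<dots> = (4 * zM T) * (exp (22 * ln (4 * zM T)) * exp (zB T * ln (8 / d)))"
    using d by (simp add: exp_minus ln_div field_simps right_diff_distrib exp_diff)
  also have "4 * zM T = exp (ln (4 * zM T))" using zM_ge[of T] by simp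
  also have "exp (ln (4 * zM T)) * (exp (22 * ln (exp (ln (4 * zM T)))) * exp (zB T * ln (8 / d))) = exp (23 * ln (4 * zM T) + zB T * ln (8 / d))"
    by (simp flip: exp_add)
  also have "\<dots> \<le> exp (24 * ln (4 * zM T) + zB T * ln (8 / d))" using zM_ge[of T] by simp
  finally show ?thesis .
qed

section \<open>Heights avoiding the zeros\<close>

lemma zM_mono: "\<bar>S\<bar> \<le> \<bar>T\<bar> \<Longrightarrow> zM S \<le> zM T"
  by (auto simp: zM_def intro!: power_mono)

lemma zB_mono: "\<bar>S\<bar> \<le> \<bar>T\<bar> \<Longrightarrow> zB S \<le> zB T"
  using zM_mono[of S T] zM_ge[of S] by (auto simp: zB_def)

lemma zB_pos: "zB T > 0"
  using zM_ge[of T] by (simp add: zB_def)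

lemma riemann_zeta_cnj: "Re s > -1 \<Longrightarrow> s \<noteq> 1 \<Longrightarrow> riemann_zeta (cnj s) = cnj (riemann_zeta s)"
proof -
  assume s: "Re s > -1" "s \<noteq> 1"
  have "cnj s \<noteq> 1" using s(2) by (metis complex_cnj_cnj complex_cnj_one)
  then show ?thesis using riemann_zeta_eq[of s] riemann_zeta_eq[of "cnj s"] zeta_reg_cnj[of s] s by simp
qed

lemma Zs_cnj: "\<rho> \<in> Zs \<Longrightarrow> cnj \<rho> \<in> Zs"
  using Zs_strip[of \<rho>] riemann_zeta_cnj[of \<rho>] by (cases "\<rho> = 1") (auto simp: Zs_def)

lemma finite_Zs_le: "finite {\<rho> \<in> Zs. \<bar>Im \<rho>\<bar> \<le> T}"
proof -
  define K where "K = cbox (Complex 0 (-\<bar>T\<bar>)) (Complex 1 \<bar>T\<bar>)"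
  have "finite {\<rho> \<in> K. zeta_reg \<rho> = 0}"
  proof (cases "zeta_reg constant_on {s. Re s > -1}")
    case True
    then obtain k where k: "\<And>\<rho>. Re \<rho> > -1 \<Longrightarrow> zeta_reg \<rho> = k" by (auto simp: constant_on_def)
    moreover have "k = 1" using k[of 1] by simp
    ultimately have "{\<rho> \<in> K. zeta_reg \<rho> = 0} = {}" by (fastforce simp: K_def in_cbox_complex_iff)
    then show ?thesis by (metis finite.emptyI)
  next
    case False
    show ?thesis
      by (rule holomorphic_compact_finite_zeros[OF holomorphic_zeta_reg _ _ _ _ False])
         (auto simp: K_def open_halfspace_Re_gt convex_connected convex_halfspace_Re_gt in_cbox_complex_iff)
  qed
  moreover have "{\<rho> \<in> Zs. \<bar>Im \<rho>\<bar> \<le> T} \<subseteq> {\<rho> \<in> K. zeta_reg \<rho> = 0}"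
  proof
    fix \<rho> assume r: "\<rho> \<in> {\<rho> \<in> Zs. \<bar>Im \<rho>\<bar> \<le> T}"
    then have st: "0 \<le> Re \<rho>" "Re \<rho> \<le> 1" and n1: "\<rho> \<noteq> 1" using Zs_strip by (auto simp: Zs_def)
    have "zeta_reg \<rho> = 0" using riemann_zeta_eq[of \<rho>] st n1 r by (auto simp: Zs_def)
    then show "\<rho> \<in> {\<rho> \<in> K. zeta_reg \<rho> = 0}" using r st by (auto simp: K_def in_cbox_complex_iff)
  qed
  ultimately show ?thesis by (rule rev_finite_subset)
qed

text \<open>Pigeonhole: of card D + 1 points with spacing h, each element of D can be closer than h
  / 2 to at most one, so some point keeps distance h / 2 from all of D.\<close>

lemma separated_point:
  fixes D :: "real set" and k :: real
  assumes fin: "finite D"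
  obtains t where "k \<le> t" "t \<le> k + 1" "\<And>\<gamma>. \<gamma> \<in> D \<Longrightarrow> 1 / (2 * (real (card D) + 1)) \<le> \<bar>\<gamma> - t\<bar>"
proof -
  define n where "n = card D"
  define h where "h = 1 / (real n + 1)"
  have h: "h > 0" by (simp add: h_def)
  define p where "p j = k + (real j + 1/2) * h" for j
  have "\<exists>j\<le>n. \<forall>\<gamma>\<in>D. h / 2 \<le> \<bar>\<gamma> - p j\<bar>"
  proof (rule ccontr)
    assume "\<not> (\<exists>j\<le>n. \<forall>\<gamma>\<in>D. h / 2 \<le> \<bar>\<gamma> - p j\<bar>)"
    then have "\<forall>j\<in>{..n}. \<exists>\<gamma>\<in>D. \<bar>\<gamma> - p j\<bar> < h / 2" by force
    then obtain g where g: "\<And>j. j \<in> {..n} \<Longrightarrow> g j \<in> D \<and> \<bar>g j - p j\<bar> < h / 2" by metis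
    have "inj_on g {..n}"
    proof (rule inj_onI)
      fix i j assume ij: "i \<in> {..n}" "j \<in> {..n}" "g i = g j"
      have "\<bar>p i - p j\<bar> < h" using g[OF ij(1)] g[OF ij(2)] ij(3) by argo
      moreover have "p i - p j = (real i - real j) * h" by (simp add: p_def algebra_simps)
      ultimately have "\<bar>real i - real j\<bar> * h < 1 * h" using h by (simp add: abs_mult)
      then have "\<bar>real i - real j\<bar> < 1" using h by (simp only: mult_less_cancel_right_pos)
      then show "i = j" by linarith
    qed
    then have "card {..n} \<le> card D" using g fin by (intro card_inj_on_le[of g]) auto
    then show False by (simp add: n_def)
  qed
  then obtain j where j: "j \<le> n" "\<And>\<gamma>. \<gamma> \<in> D \<Longrightarrow> h / 2 \<le> \<bar>\<gamma> - p j\<bar>" by blast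
  have "(real j + 1/2) * h \<le> 1"
  proof -
    have "(real j + 1/2) * h \<le> (real n + 1) * h" using j h by (intro mult_right_mono) auto
    also have "\<dots> = 1" by (simp add: h_def)
    finally show ?thesis .
  qed
  moreover have "0 \<le> (real j + 1/2) * h" using h by simp
  moreover have "h / 2 = 1 / (2 * (real (card D) + 1))" by (simp add: h_def n_def)
  ultimately have "k \<le> p j" "p j \<le> k + 1" "\<And>\<gamma>. \<gamma> \<in> D \<Longrightarrow> 1 / (2 * (real (card D) + 1)) \<le> \<bar>\<gamma> - p j\<bar>"
    using j(2) unfolding p_def by (simp, simp, metis)
  then show ?thesis by (rule that)
qed

text \<open>The window of height 3 is centred at T + 1/2. A zero in it has distance at most sqrt (9
  + 9/4) < 18/5 from 3 + i (T + 1/2), so the disc count applies. Positive multiplicities also bound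
  the number of distinct ordinates.\<close>

lemma zero_count_window:
  assumes "T \<ge> 6"
  defines "W \<equiv> {\<rho> \<in> Zs. T - 1 \<le> Im \<rho> \<and> Im \<rho> \<le> T + 2}"
  shows "finite W" "real (\<Sum>\<rho>\<in>W. nat (zorder riemann_zeta \<rho>)) \<le> zB (T + 1)" "real (card (Im ` W)) \<le> zB (T + 1)"
proof -
  define Z where "Z = {\<rho> \<in> Zs. norm (\<rho> - Complex 3 (T + 1/2)) \<le> 18/5}"
  have T5: "\<bar>T + 1/2\<bar> \<ge> 5" using assms by simp
  note c = zeta_zero_count_and_lower_bound(1-3)[OF T5, folded Z_def]
  have WZ: "W \<subseteq> Z"
  proof
    fix \<rho> assume r: "\<rho> \<in> W"
    have st: "0 \<le> Re \<rho>" "Re \<rho> \<le> 1" using r Zs_strip by (auto simp: W_def)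
    have "(norm (\<rho> - Complex 3 (T + 1/2)))\<^sup>2 = (3 - Re \<rho>)\<^sup>2 + (Im \<rho> - (T + 1/2))\<^sup>2"
      by (simp add: cmod_power2 power2_commute)
    also have "\<dots> \<le> 3\<^sup>2 + (3/2)\<^sup>2"
    proof (rule add_mono)
      show "(3 - Re \<rho>)\<^sup>2 \<le> 3\<^sup>2" using st by (intro power_mono) auto
      have "T - 1 \<le> Im \<rho>" "Im \<rho> \<le> T + 2" using r by (auto simp: W_def)
      then have "\<bar>Im \<rho> - (T + 1/2)\<bar> \<le> 3/2" unfolding abs_le_iff by argo
      then show "(Im \<rho> - (T + 1/2))\<^sup>2 \<le> (3/2)\<^sup>2" by (metis abs_ge_zero power2_abs power_mono)
    qed
    also have "\<dots> \<le> (18/5)\<^sup>2" by (simp add: power2_eq_square)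
    finally have "norm (\<rho> - Complex 3 (T + 1/2)) \<le> 18/5" by (rule power2_le_imp_le) simp
    then show "\<rho> \<in> Z" using r by (simp add: W_def Z_def)
  qed
  show fin: "finite W" using finite_subset[OF WZ c(1)] .
  have "(\<Sum>\<rho>\<in>W. nat (zorder riemann_zeta \<rho>)) \<le> (\<Sum>\<rho>\<in>Z. nat (zorder riemann_zeta \<rho>))"
    by (rule sum_mono2[OF c(1) WZ]) simp
  then have "real (\<Sum>\<rho>\<in>W. nat (zorder riemann_zeta \<rho>)) \<le> zB (T + 1/2)" using c(3) by linarith
  also have "\<dots> \<le> zB (T + 1)" using assms by (intro zB_mono) auto
  finally show s: "real (\<Sum>\<rho>\<in>W. nat (zorder riemann_zeta \<rho>)) \<le> zB (T + 1)" .
  have "card (Im ` W) \<le> card W" by (rule card_image_le[OF fin])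
  also have "\<dots> = (\<Sum>\<rho>\<in>W. 1)" by simp
  also have "\<dots> \<le> (\<Sum>\<rho>\<in>W. nat (zorder riemann_zeta \<rho>))"
    using c(2) WZ by (intro sum_mono) (auto simp: Suc_le_eq)
  finally show "real (card (Im ` W)) \<le> zB (T + 1)" using s by linarith
qed

text \<open>At most \<open>zB (k + 1)\<close> ordinates lie near [k, k + 1], so some T there keeps
  distance 1 / (2 (zB (k + 1) + 1)) from them; all others are at distance at least 1. Conjugation
  transfers this to - T.\<close>

lemma good_height:
  assumes k: "k \<ge> (6::real)"
  obtains T where "k \<le> T" "T \<le> k + 1" "\<And>\<rho>. \<rho> \<in> Zs \<Longrightarrow> \<bar>Im \<rho>\<bar> \<noteq> T"
    "\<And>s. \<lbrakk>-1/4 \<le> Re s; Re s \<le> 5/4; \<bar>Im s\<bar> = T\<rbrakk> \<Longrightarrow>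
      norm (deriv riemann_zeta s / riemann_zeta s) \<le> exp (24 * ln (4 * zM (k + 1)) + zB (k + 1) * ln (16 * (zB (k + 1) + 1)))"
proof -
  define W where "W = {\<rho> \<in> Zs. k - 1 \<le> Im \<rho> \<and> Im \<rho> \<le> k + 2}"
  note w = zero_count_window[OF k, folded W_def]
  obtain T where T: "k \<le> T" "T \<le> k + 1" "\<And>\<gamma>. \<gamma> \<in> Im ` W \<Longrightarrow> 1 / (2 * (real (card (Im ` W)) + 1)) \<le> \<bar>\<gamma> - T\<bar>"
    using separated_point[of "Im ` W" k] w(1) by blast
  define d where "d = 1 / (2 * (zB (k + 1) + 1))"
  have d: "0 < d" "d \<le> 1" using zB_pos[of "k + 1"] by (auto simp: d_def)
  have dc: "d \<le> 1 / (2 * (real (card (Im ` W)) + 1))" unfolding d_def using w(3) by (intro divide_left_mono) auto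
  have far0: "d \<le> \<bar>Im \<rho> - T\<bar>" if "\<rho> \<in> Zs" for \<rho>
  proof (cases "\<rho> \<in> W")
    case True
    then show ?thesis using T(3)[of "Im \<rho>"] dc by auto
  next
    case False
    then have "Im \<rho> < k - 1 \<or> k + 2 < Im \<rho>" using that by (auto simp: W_def)
    then show ?thesis using T d by auto
  qed
  have far: "d \<le> \<bar>Im \<rho> - t\<bar>" if "\<rho> \<in> Zs" "\<bar>t\<bar> = T" for \<rho> t
  proof (cases "t = T")
    case False
    then have "t = - T" using that(2) by auto
    then show ?thesis using far0[OF Zs_cnj[OF that(1)]] by (simp add: abs_minus_commute add.commute)
  qed (use far0 that in simp)
  have T0: "T \<ge> 6" using T k by simp
  show ?thesis
  proof (rule that[OF T(1,2)])
    show "\<bar>Im \<rho>\<bar> \<noteq> T" if "\<rho> \<in> Zs" for \<rho>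
      using far[OF that, of "Im \<rho>"] d by auto
    fix s assume s: "-1/4 \<le> Re s" "Re s \<le> 5/4" "\<bar>Im s\<bar> = T"
    have "norm (deriv riemann_zeta s / riemann_zeta s) \<le> exp (24 * ln (4 * zM (Im s)) + zB (Im s) * ln (8 / d))"
      using s T0 d far by (intro zeta_log_deriv_bound) auto
    also have "\<dots> \<le> exp (24 * ln (4 * zM (k + 1)) + zB (k + 1) * ln (16 * (zB (k + 1) + 1)))"
    proof -
      have e: "8 / d = 16 * (zB (k + 1) + 1)" by (simp add: d_def)
      have m: "\<bar>Im s\<bar> \<le> \<bar>k + 1\<bar>" using s T k by simp
      have "ln (4 * zM (Im s)) \<le> ln (4 * zM (k + 1))" using zM_mono[OF m] zM_ge[of "Im s"] by simp
      moreover have "zB (Im s) * ln (16 * (zB (k + 1) + 1)) \<le> zB (k + 1) * ln (16 * (zB (k + 1) + 1))"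
        using zB_mono[OF m] zB_pos[of "k + 1"] by (intro mult_right_mono) auto
      ultimately show ?thesis unfolding e by simp
    qed
    finally show "norm (deriv riemann_zeta s / riemann_zeta s) \<le> exp (24 * ln (4 * zM (k + 1)) + zB (k + 1) * ln (16 * (zB (k + 1) + 1)))" .
  qed
qed

text \<open>The exponent grows like log k log log k, so every exponential decay beats it.\<close>

lemma good_height_bound_tendsto:
  assumes "\<delta> > (0::real)"
  shows "((\<lambda>k. exp (24 * ln (4 * zM (k + 1)) + zB (k + 1) * ln (16 * (zB (k + 1) + 1))) * exp (- \<delta> * k)) \<longlongrightarrow> 0) at_top"
proof -
  have "((\<lambda>k::real. exp (24 * ln (4 * (12 * (k + 1 + 8) ^ 3)) + 19 * ln (2 * (12 * (k + 1 + 8) ^ 3)) * ln (16 * (19 * ln (2 * (12 * (k + 1 + 8) ^ 3)) + 1))) * exp (- \<delta> * k)) \<longlongrightarrow> 0) at_top"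
    using assms by real_asymp
  then show ?thesis
    by (rule Lim_transform_eventually)
       (use eventually_ge_at_top[of 0] in \<open>eventually_elim, simp add: zM_def zB_def\<close>)
qed

lemma zB_summable:
  assumes "\<delta> > (0::real)"
  shows "summable (\<lambda>n. zB (real n + 1) * exp (- \<delta> * real n))"
proof -
  have "(\<lambda>n. zB (real n + 1) * exp (- \<delta> * real n)) \<in> O(\<lambda>n. exp (- (\<delta> / 2) * real n))"
    unfolding zB_def zM_def using assms by real_asymp
  moreover have "summable (\<lambda>n. norm (exp (- (\<delta> / 2) * real n)))"
  proof -
    have "exp (- (\<delta> / 2) * real n) = exp (- (\<delta> / 2)) ^ n" for n by (simp flip: exp_of_nat_mult add: mult.commute)
    then show ?thesis using assms by simp
  qed
  ultimately show ?thesis by (rule summable_comparison_test_bigo[rotated])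
qed

section \<open>The sum over the zeros\<close>

text \<open>The summand over the zeros as a function of \<open>z = \<rho> - 1/2 = i \<alpha>\<close>, with \<open>L = ln t\<close>.\<close>

definition Hz :: "real \<Rightarrow> real \<Rightarrow> complex \<Rightarrow> complex" where
  "Hz x L z = sin (of_real x * z) / sin (of_real pi * z) * cosh (of_real L * z)"

lemma zero_term_Hz: "zero_term x t \<rho> = of_int (zorder riemann_zeta \<rho>) * Hz x (ln t) (\<rho> - 1/2)"
proof -
  define z where "z = \<rho> - 1/2"
  have s: "sinh (of_real r * (- \<i> * z)) = - \<i> * sin (of_real r * z)" for r
    using sin_conv_sinh[of "of_real r * z"] by (simp add: mult_ac)
  have c: "cos (- \<i> * z * of_real (ln t)) = cosh (of_real (ln t) * z)"
    using cosh_conv_cos[of "of_real (ln t) * z"] by (simp add: mult_ac)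
  show ?thesis unfolding zero_term_def Let_def z_def[symmetric] s c by (simp add: Hz_def)
qed

lemma Hz_even: "Hz x L (- z) = Hz x L z"
  by (simp add: Hz_def)

lemma Hz_expsin: "Hz x L z = (expsin (Complex L x) z + expsin (Complex (- L) x) z - expsin (Complex L (- x)) z - expsin (Complex (- L) (- x)) z) / (4 * \<i>)"
proof -
  have e: "exp (Complex a b * z) = exp (of_real a * z) * exp (\<i> * (of_real b * z))" for a b
  proof -
    have "Complex a b * z = of_real a * z + \<i> * (of_real b * z)" by (simp add: Complex_eq algebra_simps)
    then show ?thesis by (simp only: exp_add)
  qed
  have "sin (of_real x * z) * cosh (of_real L * z)
     = (exp (Complex L x * z) + exp (Complex (- L) x * z) - exp (Complex L (- x) * z) - exp (Complex (- L) (- x) * z)) / (4 * \<i>)"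
    unfolding e by (simp add: sin_exp_eq cosh_field_def field_simps)
  note sc = this
  have sw: "(a + b - c - d) / k / S = (a / S + b / S - c / S - d / S) / k" for a b c d k S :: complex
    by (simp add: add_divide_distrib diff_divide_distrib mult.commute)
  have "Hz x L z = sin (of_real x * z) * cosh (of_real L * z) / sin (of_real pi * z)" by (simp add: Hz_def)
  then show ?thesis unfolding sc sw expsin_def .
qed

definition Jint :: "real \<Rightarrow> real \<Rightarrow> (complex \<Rightarrow> complex) \<Rightarrow> complex" where
  "Jint x L X = vint (3/4) (\<lambda>z. Hz x L z * X z)"

lemma Jint_expsin:
  assumes i: "\<And>a b. \<lbrakk>\<bar>b\<bar> = x\<rbrakk> \<Longrightarrow> integrable lborel (\<lambda>y. expsin (Complex a b) (Complex (3/4) y) * X (Complex (3/4) y))"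
    and x: "x > 0"
  defines "V \<equiv> \<lambda>w. vint (3/4) (\<lambda>z. expsin w z * X z)"
  shows "Jint x L X = (V (Complex L x) + V (Complex (- L) x) - V (Complex L (- x)) - V (Complex (- L) (- x))) / (4 * \<i>)"
    and "integrable lborel (\<lambda>y. Hz x L (Complex (3/4) y) * X (Complex (3/4) y))"
proof -
  have ax: "\<bar>x\<bar> = x" "\<bar>- x\<bar> = x" using x by auto
  note I = i[OF ax(1)] i[OF ax(2)]
  have e: "Hz x L z * X z = (expsin (Complex L x) z * X z + expsin (Complex (- L) x) z * X z
      - expsin (Complex L (- x)) z * X z - expsin (Complex (- L) (- x)) z * X z) / (4 * \<i>)" for z
    by (simp add: Hz_expsin algebra_simps)
  show "integrable lborel (\<lambda>y. Hz x L (Complex (3/4) y) * X (Complex (3/4) y))"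
    unfolding e by (intro integrable_divide Bochner_Integration.integrable_diff Bochner_Integration.integrable_add I)
  show "Jint x L X = (V (Complex L x) + V (Complex (- L) x) - V (Complex L (- x)) - V (Complex (- L) (- x))) / (4 * \<i>)"
    unfolding Jint_def V_def vint_def e using I by (simp add: algebra_simps add_divide_distrib diff_divide_distrib)
qed

lemma norm_Hz_le:
  assumes x: "0 < x" "x < pi" and z: "\<bar>Im z\<bar> \<ge> 1" "\<bar>Re z\<bar> \<le> 1"
  shows "norm (Hz x L z) \<le> 4 * exp \<bar>L\<bar> * exp (- (pi - x) * \<bar>Im z\<bar>)"
proof -
  define B where "B = 4 * exp \<bar>L\<bar> * exp (- (pi - x) * \<bar>Im z\<bar>)"
  have b: "norm (expsin (Complex a b) z) \<le> B" if "\<bar>a\<bar> = \<bar>L\<bar>" "\<bar>b\<bar> = x" for a b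
  proof -
    have "norm (expsin (Complex a b) z) \<le> 4 * exp (a * Re z) * exp (- (pi - \<bar>b\<bar>) * \<bar>Im z\<bar>)"
      using norm_expsin_le[of z "Complex a b"] z by simp
    also have "a * Re z \<le> \<bar>L\<bar>"
    proof -
      have "a * Re z \<le> \<bar>a\<bar> * \<bar>Re z\<bar>" using abs_ge_self[of "a * Re z"] by (simp only: abs_mult)
      also have "\<dots> \<le> \<bar>L\<bar> * 1" using that z by (intro mult_mono) auto
      finally show ?thesis by simp
    qed
    then have "4 * exp (a * Re z) * exp (- (pi - \<bar>b\<bar>) * \<bar>Im z\<bar>) \<le> B"
      unfolding B_def that(2) by (intro mult_right_mono mult_left_mono) auto
    finally show ?thesis .
  qed
  have "norm (Hz x L z) = norm (expsin (Complex L x) z + expsin (Complex (- L) x) z - expsin (Complex L (- x)) z - expsin (Complex (- L) (- x)) z) / 4"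
    unfolding Hz_expsin by (simp add: norm_divide norm_mult)
  also have "\<dots> \<le> (B + B + B + B) / 4"
    using x by (intro divide_right_mono order_trans[OF norm_triangle_ineq4] order_trans[OF norm_triangle_ineq] add_mono b) auto
  finally show ?thesis by (simp add: B_def)
qed

text \<open>With f = g (s - p)^n near p the quotient f'/f is g'/g + n / (s - p); the integrand
  becomes phi / (s - p) with phi holomorphic and phi p = n h p.\<close>

lemma residue_logderiv:
  fixes f h :: "complex \<Rightarrow> complex"
  assumes S: "open S" "connected S" "p \<in> S" and f: "f holomorphic_on S" and nz: "\<exists>w\<in>S. f w \<noteq> 0"
    and h: "h holomorphic_on U" "open U" "p \<in> U"
  shows "residue (\<lambda>s. h s * (deriv f s / f s)) p = of_int (zorder f p) * h p"
proof -
  define n where "n = zorder f p"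
  define g where "g = zor_poly f p"
  have ex: "(if f p = 0 then n > 0 else n = 0) \<and>
    (\<exists>r. r > 0 \<and> cball p r \<subseteq> S \<and> g holomorphic_on cball p r \<and> (\<forall>w\<in>cball p r. f w = g w * (w - p) ^ nat n \<and> g w \<noteq> 0))"
    unfolding n_def g_def by (rule zorder_exist_zero[OF f S nz])
  then have n0: "n \<ge> 0" by (auto split: if_splits)
  obtain r where r: "r > 0" "cball p r \<subseteq> S" "g holomorphic_on cball p r"
    and gw: "\<And>w. w \<in> cball p r \<Longrightarrow> f w = g w * (w - p) ^ nat n \<and> g w \<noteq> 0"
    using conjunct2[OF ex] by blast
  define B where "B = ball p r \<inter> U"
  have B: "open B" "p \<in> B" using h r by (auto simp: B_def)
  have gB: "g holomorphic_on B" "g holomorphic_on ball p r" using r(3) by (auto intro: holomorphic_on_subset simp: B_def)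
  define \<phi> where "\<phi> w = h w * (of_int n + (w - p) * (deriv g w / g w))" for w
  have "\<phi> holomorphic_on B"
    unfolding \<phi>_def using gB h gw B
    by (intro holomorphic_intros holomorphic_on_subset[OF holomorphic_deriv[OF gB(2)]] holomorphic_on_subset[OF h(1)])
       (auto simp: B_def)
  from residue_simple[OF B this] have "residue (\<lambda>w. \<phi> w / (w - p)) p = \<phi> p" .
  moreover have "residue (\<lambda>s. h s * (deriv f s / f s)) p = residue (\<lambda>w. \<phi> w / (w - p)) p"
  proof (rule residue_cong)
    show "\<forall>\<^sub>F z in at p. h z * (deriv f z / f z) = \<phi> z / (z - p)"
    proof -
      have "\<forall>\<^sub>F w in at p. w \<in> B \<longrightarrow> h w * (deriv f w / f w) = \<phi> w / (w - p)"
        unfolding eventually_at_filter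
      proof (intro always_eventually allI impI)
        fix w assume w: "w \<noteq> p" "w \<in> B"
        then have wb: "w \<in> ball p r" by (simp add: B_def)
        have gd: "(g has_field_derivative deriv g w) (at w)"
          using holomorphic_derivI[OF gB(2) open_ball wb] .
        have "((\<lambda>w. g w * (w - p) ^ nat n) has_field_derivative
            deriv g w * (w - p) ^ nat n + g w * (of_nat (nat n) * (w - p) ^ (nat n - 1))) (at w)"
          by (rule derivative_eq_intros gd refl | simp)+
        then have "(f has_field_derivative
            deriv g w * (w - p) ^ nat n + g w * (of_nat (nat n) * (w - p) ^ (nat n - 1))) (at w)"
          by (rule has_field_derivative_transform_within_open[OF _ open_ball wb]) (use gw in simp)
        then have df: "deriv f w = deriv g w * (w - p) ^ nat n + g w * (of_nat (nat n) * (w - p) ^ (nat n - 1))"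
          by (rule DERIV_imp_deriv)
        have pw: "of_nat (nat n) * (w - p) ^ (nat n - 1) = of_int n * (w - p) ^ nat n / (w - p)"
        proof (cases "nat n")
          case 0
          then show ?thesis using n0 by simp
        next
          case (Suc m)
          have "of_nat (nat n) = (of_int n :: complex)" using n0 by simp
          then show ?thesis using Suc w by simp
        qed
        have g0: "g w \<noteq> 0" and fw: "f w = g w * (w - p) ^ nat n" using gw[of w] wb by auto
        have "deriv f w / f w = deriv g w / g w + of_int n / (w - p)"
          unfolding df fw pw using g0 w(1) by (simp add: field_simps)
        moreover have "H * (D + N / u) = H * (N + u * D) / u" if "u \<noteq> 0" for H D N u :: complex
          using that by (simp add: field_simps)
        ultimately show "h w * (deriv f w / f w) = \<phi> w / (w - p)" using w(1) by (simp add: \<phi>_def)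
      qed
      with eventually_at_in_open'[OF B] show ?thesis by eventually_elim simp
    qed
  qed simp
  ultimately show ?thesis by (simp add: \<phi>_def n_def)
qed

text \<open>A limit along one exhausting sequence does not establish an unordered sum; once
  summability is known it identifies the value.\<close>

lemma tendsto_quotient_sum_has_sum:
  fixes f :: "'a \<Rightarrow> complex"
  assumes s: "f summable_on A" and l: "(\<lambda>k. sum f (B k)) \<longlonglongrightarrow> l"
    and B: "\<And>k. finite (B k)" "\<And>k. B k \<subseteq> A" "\<And>p. p \<in> A \<Longrightarrow> \<forall>\<^sub>F k in sequentially. p \<in> B k"
  shows "(f has_sum l) A"
proof -
  have "filterlim B (finite_subsets_at_top A) sequentially"
    unfolding filterlim_finite_subsets_at_top
  proof (intro allI impI)
    fix X assume X: "finite X \<and> X \<subseteq> A"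
    then have "\<forall>\<^sub>F k in sequentially. \<forall>p\<in>X. p \<in> B k"
      using B(3) by (subst eventually_ball_finite_distrib) auto
    then show "\<forall>\<^sub>F k in sequentially. finite (B k) \<and> X \<subseteq> B k \<and> B k \<subseteq> A"
      by eventually_elim (use B in auto)
  qed
  moreover have hs: "(f has_sum infsum f A) A" using s by (rule has_sum_infsum)
  ultimately have "(\<lambda>k. sum f (B k)) \<longlonglongrightarrow> infsum f A"
    unfolding has_sum_def by (rule filterlim_compose[rotated])
  then have "infsum f A = l" using l LIMSEQ_unique by blast
  with hs show ?thesis by simp
qed

text \<open>Grouped by the integer part n of Im rho: a block holds O(log n) zeros with multiplicity,
  and each term is O(exp (- (pi - x) n)). The zeros with |Im rho| <= 6, below the range of the
  window count, are finite in number.\<close>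

lemma zero_sum_summable_upper:
  assumes x: "0 < x" "x < pi"
  shows "(\<lambda>\<rho>. norm (of_int (zorder riemann_zeta \<rho>) * Hz x L (\<rho> - 1/2))) summable_on upper_zeros"
proof (rule nonneg_bdd_above_summable_on)
  define f where "f \<rho> = norm (of_int (zorder riemann_zeta \<rho>) * Hz x L (\<rho> - 1/2))" for \<rho>
  define C where "C = 4 * exp \<bar>L\<bar>"
  define \<delta> where "\<delta> = pi - x"
  have \<delta>: "\<delta> > 0" using x by (simp add: \<delta>_def)
  define low where "low = {\<rho> \<in> Zs. \<bar>Im \<rho>\<bar> \<le> 6}"
  have lowfin: "finite low" unfolding low_def by (rule finite_Zs_le)
  have f0: "f \<rho> \<ge> 0" for \<rho> by (simp add: f_def)
  define b where "b n = C * (zB (real n + 1) * exp (- \<delta> * real n))" for n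
  have bs: "summable b" unfolding b_def by (intro summable_mult zB_summable \<delta>)
  have b0: "b n \<ge> 0" for n unfolding b_def C_def using zB_pos[of "real n + 1"] by simp
  have block: "(\<Sum>\<rho>\<in>{\<rho> \<in> F. nat \<lfloor>Im \<rho>\<rfloor> = n}. f \<rho>) \<le> b n" if F: "finite F" "F \<subseteq> {\<rho> \<in> Zs. Im \<rho> > 6}" for F n
  proof (cases "n \<ge> 6")
    case False
    have "{\<rho> \<in> F. nat \<lfloor>Im \<rho>\<rfloor> = n} = {}"
    proof (rule ccontr)
      assume "{\<rho> \<in> F. nat \<lfloor>Im \<rho>\<rfloor> = n} \<noteq> {}"
      then obtain \<rho> where r: "\<rho> \<in> F" "nat \<lfloor>Im \<rho>\<rfloor> = n" by blast
      then have "6 \<le> \<lfloor>Im \<rho>\<rfloor>" using F by (auto simp: le_floor_iff less_imp_le)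
      then show False using r False by linarith
    qed
    then show ?thesis by (simp only: sum.empty b0)
  next
    case True
    define W where "W = {\<rho> \<in> Zs. real n - 1 \<le> Im \<rho> \<and> Im \<rho> \<le> real n + 2}"
    have n6: "real n \<ge> 6" using True by simp
    note w = zero_count_window[OF n6, folded W_def]
    define E where "E = {\<rho> \<in> F. nat \<lfloor>Im \<rho>\<rfloor> = n}"
    have E: "\<rho> \<in> W \<and> real n \<le> Im \<rho>" if "\<rho> \<in> E" for \<rho>
    proof -
      have "Im \<rho> > 6" "nat \<lfloor>Im \<rho>\<rfloor> = n" "\<rho> \<in> Zs" using that F by (auto simp: E_def)
      then have "\<lfloor>Im \<rho>\<rfloor> = int n" by linarith
      then have "real n \<le> Im \<rho>" "Im \<rho> < real n + 1" by linarith+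
      then show ?thesis using \<open>\<rho> \<in> Zs\<close> by (simp add: W_def)
    qed
    have each: "f \<rho> \<le> real (nat (zorder riemann_zeta \<rho>)) * (C * exp (- \<delta> * real n))" if "\<rho> \<in> E" for \<rho>
    proof -
      have r: "\<rho> \<in> Zs" "real n \<le> Im \<rho>" "6 \<le> Im \<rho>" using E[OF that] n6 by (auto simp: W_def)
      have st: "0 \<le> Re \<rho>" "Re \<rho> \<le> 1" using Zs_strip[OF r(1)] by auto
      have "norm (Hz x L (\<rho> - 1/2)) \<le> 4 * exp \<bar>L\<bar> * exp (- (pi - x) * \<bar>Im (\<rho> - 1/2)\<bar>)"
        using st r by (intro norm_Hz_le x) (auto simp: abs_le_iff)
      also have "\<dots> \<le> C * exp (- \<delta> * real n)"
        unfolding C_def \<delta>_def using r x by (intro mult_left_mono) (auto simp: mult_left_mono)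
      finally have H: "norm (Hz x L (\<rho> - 1/2)) \<le> C * exp (- \<delta> * real n)" .
      have "zorder riemann_zeta \<rho> > 0"
      proof -
        have "\<bar>Im \<rho>\<bar> \<ge> 5" using r by simp
        from zeta_zero_count_and_lower_bound(2)[OF this, of \<rho>] show ?thesis
        proof -
          have "norm (\<rho> - Complex 3 (Im \<rho>)) \<le> 18/5"
            using cmod_le[of "\<rho> - Complex 3 (Im \<rho>)"] st by simp
          then show "(\<rho> \<in> {\<rho>' \<in> Zs. norm (\<rho>' - Complex 3 (Im \<rho>)) \<le> 18/5} \<Longrightarrow> 0 < zorder riemann_zeta \<rho>) \<Longrightarrow> ?thesis"
            using r(1) by blast
        qed
      qed
      then have "norm (of_int (zorder riemann_zeta \<rho>) :: complex) = real (nat (zorder riemann_zeta \<rho>))" by simp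
      then show ?thesis unfolding f_def norm_mult using H by (simp only:) (intro mult_left_mono, auto)
    qed
    have "(\<Sum>\<rho>\<in>E. f \<rho>) \<le> (\<Sum>\<rho>\<in>E. real (nat (zorder riemann_zeta \<rho>)) * (C * exp (- \<delta> * real n)))"
      by (rule sum_mono[OF each])
    also have "\<dots> \<le> (\<Sum>\<rho>\<in>W. real (nat (zorder riemann_zeta \<rho>)) * (C * exp (- \<delta> * real n)))"
      by (rule sum_mono2[OF w(1)]) (use E in \<open>auto simp: C_def\<close>)
    also have "\<dots> = real (\<Sum>\<rho>\<in>W. nat (zorder riemann_zeta \<rho>)) * (C * exp (- \<delta> * real n))"
      by (simp add: sum_distrib_right)
    also have "\<dots> \<le> zB (real n + 1) * (C * exp (- \<delta> * real n))"
      by (rule mult_right_mono[OF w(2)]) (simp add: C_def)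
    finally show ?thesis by (simp add: b_def E_def mult_ac)
  qed
  show "bdd_above (sum (\<lambda>\<rho>. norm (of_int (zorder riemann_zeta \<rho>) * Hz x L (\<rho> - 1/2))) ` {F. F \<subseteq> upper_zeros \<and> finite F})"
    unfolding f_def[symmetric]
  proof (rule bdd_aboveI2)
    fix F assume "F \<in> {F. F \<subseteq> upper_zeros \<and> finite F}"
    then have F: "finite F" "F \<subseteq> upper_zeros" by auto
    define F1 where "F1 = {\<rho> \<in> F. Im \<rho> > 6}"
    have F1: "finite F1" "F1 \<subseteq> {\<rho> \<in> Zs. Im \<rho> > 6}" using F by (auto simp: F1_def upper_zeros_eq)
    have F2: "F - F1 \<subseteq> low" using F by (auto simp: F1_def low_def upper_zeros_eq)
    have "sum f F = sum f (F - F1) + sum f F1" using F by (intro sum.subset_diff) (auto simp: F1_def)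
    also have "sum f (F - F1) \<le> sum f low" by (rule sum_mono2[OF lowfin F2]) (simp add: f0)
    also have "sum f F1 = (\<Sum>n\<in>(\<lambda>\<rho>. nat \<lfloor>Im \<rho>\<rfloor>) ` F1. sum f {\<rho> \<in> F1. nat \<lfloor>Im \<rho>\<rfloor> = n})"
      by (rule sum.image_gen[OF F1(1)])
    also have "\<dots> \<le> (\<Sum>n\<in>(\<lambda>\<rho>. nat \<lfloor>Im \<rho>\<rfloor>) ` F1. b n)" by (intro sum_mono block F1)
    also have "\<dots> \<le> suminf b" by (rule sum_le_suminf[OF bs]) (use F1 b0 in auto)
    finally show "sum f F \<le> sum f low + suminf b" by simp
  qed
qed simp

lemma Zs_bij_reflect: "bij_betw (\<lambda>\<rho>. 1 - \<rho>) upper_zeros {\<rho> \<in> Zs. Im \<rho> < 0}"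
  by (rule bij_betwI[where g = "\<lambda>\<rho>. 1 - \<rho>"]) (use Zs_reflect in \<open>auto simp: upper_zeros_eq\<close>)

text \<open>rho -> 1 - rho changes z into - z; \<open>Hz\<close> is even and the multiplicities
  agree, so the lower zeros repeat the sum over the upper ones.\<close>

lemma zero_sum_upper_Zs:
  fixes x L :: real
  assumes x: "0 < x" "x < pi"
  defines "f \<equiv> \<lambda>\<rho>. of_int (zorder riemann_zeta \<rho>) * Hz x L (\<rho> - 1/2)"
  shows "f summable_on upper_zeros" "(f has_sum (2 * infsum f upper_zeros)) Zs"
proof -
  show s: "f summable_on upper_zeros"
    unfolding f_def by (rule Infinite_Sum.abs_summable_summable[OF zero_sum_summable_upper[OF x]])
  have u: "(f has_sum infsum f upper_zeros) upper_zeros" by (rule has_sum_infsum[OF s])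
  have "f (1 - \<rho>) = f \<rho>" if "\<rho> \<in> upper_zeros" for \<rho>
  proof -
    have "Hz x L (1 - \<rho> - 1/2) = Hz x L (\<rho> - 1/2)" using Hz_even[of x L "\<rho> - 1/2"] by (simp add: algebra_simps)
    then show ?thesis using Zs_reflect(2)[of \<rho>] that by (simp add: f_def upper_zeros_eq)
  qed
  then have "((\<lambda>\<rho>. f (1 - \<rho>)) has_sum infsum f upper_zeros) upper_zeros"
    using u has_sum_cong by (metis (no_types, lifting))
  then have l: "(f has_sum infsum f upper_zeros) {\<rho> \<in> Zs. Im \<rho> < 0}"
    using has_sum_reindex_bij_betw[OF Zs_bij_reflect, of f] by simp
  have "(f has_sum (infsum f upper_zeros + infsum f upper_zeros)) (upper_zeros \<union> {\<rho> \<in> Zs. Im \<rho> < 0})"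
    by (rule has_sum_Un_disjoint[OF u l]) (auto simp: upper_zeros_eq)
  moreover have "upper_zeros \<union> {\<rho> \<in> Zs. Im \<rho> < 0} = Zs" by (auto simp: upper_zeros_eq Zs_def)
  ultimately show "(f has_sum (2 * infsum f upper_zeros)) Zs" by simp
qed

section \<open>The explicit formula\<close>

lemma deriv_zeta_near_1:
  assumes "Re s > -1" "s \<noteq> 1" "zeta_reg s \<noteq> 0"
  shows "deriv riemann_zeta s / riemann_zeta s = deriv zeta_reg s / zeta_reg s - 1 / (s - 1)"
proof -
  have o: "open ({s. Re s > -1} - {1 :: complex})" by (intro open_Diff open_halfspace_Re_gt) simp
  have d: "(zeta_reg has_field_derivative deriv zeta_reg s) (at s)"
    by (rule holomorphic_derivI[OF holomorphic_zeta_reg open_halfspace_Re_gt]) (use assms in simp)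
  have "((\<lambda>s. zeta_reg s / (s - 1)) has_field_derivative (deriv zeta_reg s * (s - 1) - zeta_reg s) / (s - 1)\<^sup>2) (at s)"
    by (rule derivative_eq_intros d refl | use assms in \<open>simp add: power2_eq_square\<close>)+
  then have "(riemann_zeta has_field_derivative (deriv zeta_reg s * (s - 1) - zeta_reg s) / (s - 1)\<^sup>2) (at s)"
    by (rule has_field_derivative_transform_within_open[OF _ o]) (use assms riemann_zeta_eq in auto)
  then have "deriv riemann_zeta s = (deriv zeta_reg s * (s - 1) - zeta_reg s) / (s - 1)\<^sup>2" by (rule DERIV_imp_deriv)
  moreover have "(d * u - g) / u\<^sup>2 / (g / u) = d / g - 1 / u" if "u \<noteq> 0" "g \<noteq> 0" for d u g :: complex
    using that by (simp add: field_simps power2_eq_square)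
  ultimately show ?thesis using riemann_zeta_eq[OF assms(1,2)] assms by simp
qed

lemma holomorphic_Hz:
  assumes "\<And>z. z \<in> A \<Longrightarrow> z \<notin> \<int>"
  shows "Hz x L holomorphic_on A"
proof -
  have "(\<lambda>z. sin (of_real x * z) / sin (of_real pi * z) * cosh (of_real L * z)) holomorphic_on A"
    using assms by (intro holomorphic_intros) (auto simp: sin_pi_z_eq_0_iff cosh_field_def intro!: holomorphic_intros)
  then show ?thesis by (simp add: Hz_def[abs_def])
qed

text \<open>At z = 0 the zero of sin (x z) cancels that of sin (pi z), so s = 1/2 contributes no
  residue.\<close>

lemma tendsto_Hz_0: "((\<lambda>z. Hz x L z * z) \<longlongrightarrow> 0) (at 0)"
proof -
  have "((\<lambda>z. sin (of_real pi * z)) has_field_derivative of_real pi) (at (0::complex))"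
    by (auto intro!: derivative_eq_intros)
  then have "((\<lambda>z::complex. sin (of_real pi * z) / z) \<longlongrightarrow> of_real pi) (at 0)"
    by (simp add: has_field_derivative_iff)
  then have 1: "((\<lambda>z::complex. inverse (sin (of_real pi * z) / z)) \<longlongrightarrow> inverse (of_real pi)) (at 0)"
    by (rule tendsto_inverse) simp
  have 2: "((\<lambda>z::complex. sin (of_real x * z) * ((exp (of_real L * z) + exp (- (of_real L * z))) / 2)) \<longlongrightarrow> sin (of_real x * 0) * ((exp (of_real L * 0) + exp (- (of_real L * 0))) / 2)) (at 0)"
    by (intro tendsto_intros) simp_all
  have "((\<lambda>z. (sin (of_real x * z) * ((exp (of_real L * z) + exp (- (of_real L * z))) / 2)) * inverse (sin (of_real pi * z) / z)) \<longlongrightarrow> 0) (at (0::complex))"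
    using tendsto_mult[OF 2 1] by simp
  then show ?thesis
    by (rule Lim_transform_eventually) (simp add: Hz_def cosh_field_def inverse_eq_divide)
qed

lemma times2_eq_1_iff: "s * 2 = 1 \<longleftrightarrow> Re s = 1/2 \<and> Im s = 0" for s :: complex
  by (auto simp: complex_eq_iff)

context
  fixes x L :: real
  assumes x: "0 < x" "x < pi"
begin

private definition K :: "complex \<Rightarrow> complex" where
  "K s = Hz x L (s - 1/2) * (deriv riemann_zeta s / riemann_zeta s)"

text \<open>Slightly wider than the rectangle; |Re s - 1/2| < 9/10, so s = 1/2 is the only point at
  which s - 1/2 is an integer.\<close>

private definition S :: "complex set" where "S = {z. - 2/5 < Re z \<and> Re z < 7/5}"
text \<open>The point 1/2 is listed because the quotient of sines is 0 / 0 there; its residue is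
  shown to vanish.\<close>

private definition P :: "complex set" where "P = {1/2, 1} \<union> Zs"

private lemma So: "open S"
proof -
  have e: "S = {z. - 2/5 < Re z} \<inter> {z. Re z < 7/5}" by (auto simp: S_def)
  show ?thesis unfolding e by (intro open_Int open_halfspace_Re_gt open_halfspace_Re_lt)
qed

private lemma S_Ints:
  assumes "s \<in> S" "s - 1/2 \<in> \<int>" shows "s = 1/2"
proof -
  obtain n :: int where n: "s - 1/2 = of_int n" using assms(2) by (auto elim: Ints_cases)
  then have "Re (s - 1/2) = of_int n" by simp
  then have "real_of_int n > - 1" "real_of_int n < 1" using assms(1) by (auto simp: S_def)
  then have "n = 0" by linarith
  then show ?thesis using n by simp
qed

private lemma zeta_nz: "s \<in> S \<Longrightarrow> s \<notin> P \<or> s = 1/2 \<Longrightarrow> riemann_zeta s \<noteq> 0 \<and> s \<noteq> 1"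
  using zeta_zero_location(3)[of s] zeta_zero_location(3)[of "1/2"]
  by (cases "s = 1/2") (simp only:, auto simp: P_def Zs_def S_def)

private lemma Lz_hol: "(\<lambda>s. deriv riemann_zeta s / riemann_zeta s) holomorphic_on A"
  if "\<And>s. s \<in> A \<Longrightarrow> s \<noteq> 1 \<and> riemann_zeta s \<noteq> 0"
  using that by (intro holomorphic_intros holomorphic_on_subset[OF riemann_zeta_spec(1)]
      holomorphic_on_subset[OF holomorphic_deriv[OF riemann_zeta_spec(1)]]) auto

private lemma Hz_hol: "(\<lambda>s. Hz x L (s - 1/2)) holomorphic_on A" if "A \<subseteq> S - {1/2}"
proof -
  have "(Hz x L \<circ> (\<lambda>s. s - 1/2)) holomorphic_on A"
    by (rule holomorphic_on_compose[OF _ holomorphic_Hz]) (use that S_Ints in \<open>auto intro!: holomorphic_intros\<close>)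
  then show ?thesis by (simp add: o_def)
qed

private lemma K_hol: "K holomorphic_on (S - P)"
  unfolding K_def[abs_def]
  by (intro holomorphic_on_mult Hz_hol Lz_hol) (use zeta_nz in \<open>auto simp: P_def\<close>)

private lemma finite_P: "finite {p \<in> P. \<bar>Im p\<bar> \<le> T}"
proof -
  have "{p \<in> P. \<bar>Im p\<bar> \<le> T} \<subseteq> {1/2, 1} \<union> {p \<in> Zs. \<bar>Im p\<bar> \<le> T}" by (auto simp: P_def)
  then show ?thesis by (rule finite_subset) (simp add: finite_Zs_le)
qed

private lemma isolating_nbhd:
  assumes "p \<in> S" "Im p = 0"
  obtains U where "open U" "p \<in> U" "U \<subseteq> S" "\<And>s. s \<in> U \<Longrightarrow> s \<in> P \<Longrightarrow> s = p"
proof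
  define U where "U = S \<inter> {s. Im s < 1} \<inter> {s. - 1 < Im s} - ({q \<in> P. \<bar>Im q\<bar> \<le> 1} - {p})"
  show "open U"
    unfolding U_def by (intro open_Diff open_Int So open_halfspace_Im_lt open_halfspace_Im_gt finite_imp_closed finite_Diff finite_P)
  show "p \<in> U" "U \<subseteq> S" "\<And>s. s \<in> U \<Longrightarrow> s \<in> P \<Longrightarrow> s = p" using assms by (auto simp: U_def)
qed

private lemma residue_half: "residue K (1/2) = 0"
proof -
  obtain U where U: "open U" "1/2 \<in> U" "U \<subseteq> S" "\<And>s. s \<in> U \<Longrightarrow> s \<in> P \<Longrightarrow> s = 1/2"
    by (rule isolating_nbhd[of "1/2"]) (auto simp: S_def)
  have hU: "(\<lambda>s. deriv riemann_zeta s / riemann_zeta s) holomorphic_on U"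
    by (rule Lz_hol) (use U zeta_nz in blast)
  then have "isCont (\<lambda>s. deriv riemann_zeta s / riemann_zeta s) (1/2)"
    using U holomorphic_on_imp_continuous_on continuous_on_eq_continuous_at by blast
  then have l1: "((\<lambda>s. deriv riemann_zeta s / riemann_zeta s) \<longlongrightarrow> deriv riemann_zeta (1/2) / riemann_zeta (1/2)) (at (1/2))"
    by (simp add: isCont_def)
  have l2: "((\<lambda>s. Hz x L (s - 1/2) * (s - 1/2)) \<longlongrightarrow> 0) (at (1/2))"
    using tendsto_Hz_0[of x L] by (subst at_to_0) (simp add: filterlim_filtermap)
  show ?thesis
  proof (rule residue_simple'[OF U(1,2)])
    show "K holomorphic_on U - {1/2}" by (rule holomorphic_on_subset[OF K_hol]) (use U in auto)
    show "((\<lambda>w. K w * (w - 1/2)) \<longlongrightarrow> 0) (at (1/2))"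
      using tendsto_mult[OF l2 l1] by (simp add: K_def mult_ac)
  qed
qed

text \<open>Since zeta = zeta_reg / (s - 1) and \<open>zeta_reg 1 = 1\<close>, near 1 the quotient
  zeta'/zeta is - 1 / (s - 1) plus a holomorphic function.\<close>

private lemma residue_one: "residue K 1 = - Hz x L (1/2)"
proof -
  obtain U where U: "open U" "1 \<in> U" "U \<subseteq> S" "\<And>s. s \<in> U \<Longrightarrow> s \<in> P \<Longrightarrow> s = 1"
    by (rule isolating_nbhd[of 1]) (auto simp: S_def)
  have US: "Re s > -1" "s \<noteq> 1/2" if "s \<in> U" for s
  proof -
    show "Re s > -1" using that U(3) by (auto simp: S_def)
    have "1/2 \<in> P" "1/2 \<noteq> (1::complex)" by (auto simp: P_def)
    then show "s \<noteq> 1/2" using that U(4)[of "1/2"] by blast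
  qed
  have reg: "zeta_reg s \<noteq> 0" if s: "s \<in> U" for s
  proof (cases "s = 1")
    case False
    then have "riemann_zeta s \<noteq> 0" using zeta_nz[of s] U s by blast
    then show ?thesis using riemann_zeta_eq[of s] US[OF s] False by auto
  qed simp
  have dr: "deriv zeta_reg holomorphic_on U" "zeta_reg holomorphic_on U"
    using US by (auto intro!: holomorphic_on_subset[OF holomorphic_deriv[OF holomorphic_zeta_reg open_halfspace_Re_gt]]
      holomorphic_on_subset[OF holomorphic_zeta_reg])
  have h1: "(\<lambda>s. Hz x L (s - 1/2)) holomorphic_on U" by (rule Hz_hol) (use U(3) US(2) in blast)
  have h2: "(\<lambda>s. Hz x L (s - 1/2) * (deriv zeta_reg s / zeta_reg s * (s - 1) - 1)) holomorphic_on U"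
    using reg by (intro holomorphic_intros h1 dr) auto
  have "isCont (\<lambda>s. Hz x L (s - 1/2) * (deriv zeta_reg s / zeta_reg s * (s - 1) - 1)) 1"
    using U h2 holomorphic_on_imp_continuous_on continuous_on_eq_continuous_at by blast
  then have l: "((\<lambda>s. Hz x L (s - 1/2) * (deriv zeta_reg s / zeta_reg s * (s - 1) - 1)) \<longlongrightarrow> - Hz x L (1/2)) (at 1)"
    by (simp add: isCont_def)
  show ?thesis
  proof (rule residue_simple'[OF U(1,2)])
    show "K holomorphic_on U - {1}" by (rule holomorphic_on_subset[OF K_hol]) (use U in auto)
    show "((\<lambda>w. K w * (w - 1)) \<longlongrightarrow> - Hz x L (1/2)) (at 1)"
    proof (rule Lim_transform_eventually[OF l])
      show "\<forall>\<^sub>F s in at 1. Hz x L (s - 1/2) * (deriv zeta_reg s / zeta_reg s * (s - 1) - 1) = K s * (s - 1)"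
        using eventually_at_in_open[OF U(1,2)]
      proof eventually_elim
        case (elim s)
        then have s: "s \<in> U" "s \<noteq> 1" by auto
        have "(D - 1 / u) * u = D * u - 1" if "u \<noteq> 0" for D u :: complex using that by (simp add: field_simps)
        from this[of "s - 1" "deriv zeta_reg s / zeta_reg s"] show ?case
          unfolding K_def mult.assoc deriv_zeta_near_1[OF US(1)[OF s(1)] s(2) reg[OF s(1)]] using s(2) by simp
      qed
    qed
  qed
qed

private lemma residue_zero:
  assumes "p \<in> Zs" shows "residue K p = of_int (zorder riemann_zeta p) * Hz x L (p - 1/2)"
proof -
  have p: "Im p \<noteq> 0" using assms by (simp add: Zs_def)
  have "residue (\<lambda>s. Hz x L (s - 1/2) * (deriv riemann_zeta s / riemann_zeta s)) p = of_int (zorder riemann_zeta p) * Hz x L (p - 1/2)"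
  proof (rule residue_logderiv[where S = "- {1}" and U = "S - {1/2}" and h = "\<lambda>s. Hz x L (s - 1/2)"])
    show "\<exists>w\<in>- {1}. riemann_zeta w \<noteq> 0" using zeta_nonzero_right[of 2] by (intro bexI[of _ 2]) auto
    have "p \<noteq> 1/2" using p by (auto simp: times2_eq_1_iff)
    then show "p \<in> S - {1/2}" using Zs_strip[OF assms] by (auto simp: S_def)
  qed (use p So in \<open>auto intro!: Hz_hol riemann_zeta_spec simp: connected_punctured_universe open_Diff\<close>)
  then show ?thesis by (simp add: K_def[abs_def])
qed

text \<open>The quotient zeta'/zeta at 1 - s for s = z + 1/2.\<close>

private definition Xl :: "complex \<Rightarrow> complex" where
  "Xl z = of_real (ln (2 * pi)) + of_real pi / 2 * tanq z - Digamma (z + 1/2) + Lser (z + 1/2)"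

private lemma K_right: "K (Complex (5/4) y) = - (Hz x L (Complex (3/4) y) * Lser (Complex (3/4) y + 1/2))"
proof -
  have "Complex (5/4) y - 1/2 = Complex (3/4) y" "Complex (5/4) y = Complex (3/4) y + 1/2" by (auto simp: complex_eq_iff)
  then show ?thesis using zeta_deriv_quotient_right[of "Complex (5/4) y"] by (simp add: K_def)
qed

text \<open>The fold: s = -1/4 + i y is 1 - (z + 1/2) with z = 3/4 - i y, and \<open>Hz\<close> is
  even. Both vertical sides thus become integrals over Re z = 3/4.\<close>

private lemma K_left: "K (Complex (- 1/4) y) = Hz x L (Complex (3/4) (- y)) * Xl (Complex (3/4) (- y))"
proof -
  define z where "z = Complex (3/4) (- y)"
  have "Complex (- 1/4) y = 1 - (z + 1/2)" "Complex (- 1/4) y - 1/2 = - z" by (auto simp: z_def complex_eq_iff)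
  then show ?thesis
    unfolding z_def[symmetric] K_def using zeta_deriv_quotient_left[of "z + 1/2"] Hz_even[of x L z]
    by (simp add: Xl_def tanq_def z_def)
qed

private lemma line_integrable:
  "integrable lborel (\<lambda>y. Hz x L (Complex (3/4) y) * 1)"
  "integrable lborel (\<lambda>y. Hz x L (Complex (3/4) y) * tanq (Complex (3/4) y))"
  "integrable lborel (\<lambda>y. Hz x L (Complex (3/4) y) * Digamma (Complex (3/4) y + 1/2))"
  "integrable lborel (\<lambda>y. Hz x L (Complex (3/4) y) * Lser (Complex (3/4) y + 1/2))"
proof -
  show "integrable lborel (\<lambda>y. Hz x L (Complex (3/4) y) * 1)"
    by (rule Jint_expsin(2)[OF _ x(1), where X = "\<lambda>_. 1"]) (use x in \<open>simp add: vint_expsin(2)\<close>)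
  show "integrable lborel (\<lambda>y. Hz x L (Complex (3/4) y) * tanq (Complex (3/4) y))"
    by (rule Jint_expsin(2)[OF _ x(1)]) (use x in \<open>auto intro!: vint_expsin_tan(2)\<close>)
  show "integrable lborel (\<lambda>y. Hz x L (Complex (3/4) y) * Digamma (Complex (3/4) y + 1/2))"
    by (rule Jint_expsin(2)[OF _ x(1), where X = "\<lambda>z. Digamma (z + 1/2)"]) (use x in \<open>auto intro!: vint_expsin_Digamma(2)\<close>)
  show "integrable lborel (\<lambda>y. Hz x L (Complex (3/4) y) * Lser (Complex (3/4) y + 1/2))"
  proof (rule Jint_expsin(2)[OF _ x(1), where X = "\<lambda>z. Lser (z + 1/2)"])
    fix a b assume b: "\<bar>b\<bar> = x"
    show "integrable lborel (\<lambda>y. expsin (Complex a b) (Complex (3/4) y) * Lser (Complex (3/4) y + 1/2))"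
    proof (rule integrable_expsin_mult[where h = "\<lambda>z. Lser (z + 1/2)"])
      show "\<bar>Im (Complex a b)\<bar> < pi" using b x by simp
      have "continuous_on {s. 1 < Re s} Lser" by (rule holomorphic_on_imp_continuous_on[OF holomorphic_Lser])
      then show "continuous_on UNIV (\<lambda>y. Lser (Complex (3/4) y + 1/2))"
        by (rule continuous_on_compose2) (auto intro!: continuous_intros)
      show "norm (Lser (Complex (3/4) y + 1/2)) \<le> (\<Sum>n. 2 / (5/4 - 1) * real (Suc n) powr - ((5/4 + 1) / 2))" for y
        by (rule norm_Lser_le) auto
    qed
  qed
qed

private lemma Xl_integrable: "integrable lborel (\<lambda>y. Hz x L (Complex (3/4) y) * Xl (Complex (3/4) y))"
  and Jint_Xl: "Jint x L Xl = of_real (ln (2 * pi)) * Jint x L (\<lambda>_. 1) + of_real pi / 2 * Jint x L tanq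
      - Jint x L (\<lambda>z. Digamma (z + 1/2)) + Jint x L (\<lambda>z. Lser (z + 1/2))"
proof -
  note l = line_integrable
  have e: "Hz x L z * Xl z = of_real (ln (2 * pi)) * (Hz x L z * 1) + of_real pi / 2 * (Hz x L z * tanq z)
      - Hz x L z * Digamma (z + 1/2) + Hz x L z * Lser (z + 1/2)" for z
    by (simp add: Xl_def algebra_simps)
  show "integrable lborel (\<lambda>y. Hz x L (Complex (3/4) y) * Xl (Complex (3/4) y))"
    unfolding e by (intro Bochner_Integration.integrable_add Bochner_Integration.integrable_diff integrable_mult_right l)
  show "Jint x L Xl = of_real (ln (2 * pi)) * Jint x L (\<lambda>_. 1) + of_real pi / 2 * Jint x L tanq
      - Jint x L (\<lambda>z. Digamma (z + 1/2)) + Jint x L (\<lambda>z. Lser (z + 1/2))"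
  proof -
    have "(LINT y|lborel. Hz x L (Complex (3/4) y) * Xl (Complex (3/4) y))
      = of_real (ln (2 * pi)) * (LINT y|lborel. Hz x L (Complex (3/4) y) * 1) + of_real pi / 2 * (LINT y|lborel. Hz x L (Complex (3/4) y) * tanq (Complex (3/4) y))
      - (LINT y|lborel. Hz x L (Complex (3/4) y) * Digamma (Complex (3/4) y + 1/2)) + (LINT y|lborel. Hz x L (Complex (3/4) y) * Lser (Complex (3/4) y + 1/2))"
      unfolding e
      by (subst Bochner_Integration.integral_add Bochner_Integration.integral_diff;
          (intro Bochner_Integration.integrable_add Bochner_Integration.integrable_diff integrable_mult_right l)?)+
         (simp only: integral_mult_right_zero)
    then show ?thesis unfolding Jint_def vint_def by (simp only: distrib_left right_diff_distrib mult.left_commute)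
  qed
qed

theorem explicit_formula:
  "2 * infsum (\<lambda>\<rho>. of_int (zorder riemann_zeta \<rho>) * Hz x L (\<rho> - 1/2)) upper_zeros
    = Hz x L (1/2) + Jint x L (\<lambda>z. Digamma (z + 1/2)) - of_real (ln (2 * pi)) * Jint x L (\<lambda>_. 1)
      - of_real pi / 2 * Jint x L tanq - 2 * Jint x L (\<lambda>z. Lser (z + 1/2))"
proof -
  define f where "f = (\<lambda>\<rho>. of_int (zorder riemann_zeta \<rho>) * Hz x L (\<rho> - 1/2))"
  define \<delta> where "\<delta> = pi - x"
  have \<delta>: "\<delta> > 0" using x by (simp add: \<delta>_def)
  define G where "G k = exp (24 * ln (4 * zM (k + 1)) + zB (k + 1) * ln (16 * (zB (k + 1) + 1)))" for k
  \<comment> \<open>One admissible height above each k + 6, together with the bound of zeta'/zeta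
    there.\<close>
  have "\<exists>T. \<forall>k. real k + 6 \<le> T k \<and> (\<forall>\<rho>\<in>Zs. \<bar>Im \<rho>\<bar> \<noteq> T k) \<and> (\<forall>s. -1/4 \<le> Re s \<longrightarrow> Re s \<le> 5/4 \<longrightarrow> \<bar>Im s\<bar> = T k \<longrightarrow>
      norm (deriv riemann_zeta s / riemann_zeta s) \<le> G (real k + 6))"
  proof (rule choice, rule allI)
    fix k :: nat
    have k6: "6 \<le> real k + 6" by simp
    obtain T where T: "real k + 6 \<le> T" "\<And>\<rho>. \<rho> \<in> Zs \<Longrightarrow> \<bar>Im \<rho>\<bar> \<noteq> T"
      "\<And>s. \<lbrakk>-1/4 \<le> Re s; Re s \<le> 5/4; \<bar>Im s\<bar> = T\<rbrakk> \<Longrightarrow> norm (deriv riemann_zeta s / riemann_zeta s) \<le> G (real k + 6)"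
      unfolding G_def using good_height[OF k6] by metis
    then show "\<exists>T. real k + 6 \<le> T \<and> (\<forall>\<rho>\<in>Zs. \<bar>Im \<rho>\<bar> \<noteq> T) \<and> (\<forall>s. -1/4 \<le> Re s \<longrightarrow> Re s \<le> 5/4 \<longrightarrow> \<bar>Im s\<bar> = T \<longrightarrow>
      norm (deriv riemann_zeta s / riemann_zeta s) \<le> G (real k + 6))" by blast
  qed
  then obtain T where T6: "\<And>k. real k + 6 \<le> T k" and TZ: "\<And>k \<rho>. \<rho> \<in> Zs \<Longrightarrow> \<bar>Im \<rho>\<bar> \<noteq> T k"
    and TG: "\<And>k s. \<lbrakk>-1/4 \<le> Re s; Re s \<le> 5/4; \<bar>Im s\<bar> = T k\<rbrakk> \<Longrightarrow> norm (deriv riemann_zeta s / riemann_zeta s) \<le> G (real k + 6)"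
    by blast
  have T0: "T k > 0" for k using T6[of k] by simp
  define \<epsilon> where "\<epsilon> k = 4 * exp \<bar>L\<bar> * (G (real k + 6) * exp (- \<delta> * (real k + 6)))" for k
  have "(\<lambda>k. \<Sum>p\<in>{p \<in> P. \<bar>Im p\<bar> < T k}. residue K p) \<longlonglongrightarrow> vint (5/4) K - vint (- 1/4) K"
  proof (rule rectangle_limit[where a' = "- 2/5" and b' = "7/5" and \<epsilon> = \<epsilon>])
    show "K holomorphic_on {z. - 2/5 < Re z \<and> Re z < 7/5} - P" using K_hol by (simp add: S_def)
    show "P \<subseteq> {z. - 1/4 < Re z \<and> Re z < 5/4}"
    proof
      fix z assume "z \<in> P"
      then show "z \<in> {z. - 1/4 < Re z \<and> Re z < 5/4}" using Zs_strip[of z] by (auto simp: P_def times2_eq_1_iff)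
    qed
    show "integrable lborel (\<lambda>y. K (Complex (5/4) y))"
      unfolding K_right by (intro integrable_minus line_integrable(4))
    show "integrable lborel (\<lambda>y. K (Complex (- 1/4) y))"
      using lborel_integrable_real_affine[OF Xl_integrable, of "-1" 0] unfolding K_left by simp
    show "filterlim T at_top sequentially"
    proof (rule filterlim_at_top_mono)
      show "filterlim (\<lambda>k. real k + 6) at_top sequentially" by real_asymp
      show "\<forall>\<^sub>F k in sequentially. real k + 6 \<le> T k" using T6 by simp
    qed
    show "\<bar>Im p\<bar> \<noteq> T k" if "p \<in> P" for p k
      using that TZ T0[of k] by (auto simp: P_def times2_eq_1_iff)
    show "\<epsilon> \<longlonglongrightarrow> 0"
    proof -
      have "filterlim (\<lambda>k. real k + 6) at_top sequentially" by real_asymp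
      from filterlim_compose[OF good_height_bound_tendsto[OF \<delta>] this]
      have "(\<lambda>k. G (real k + 6) * exp (- \<delta> * (real k + 6))) \<longlonglongrightarrow> 0" unfolding G_def .
      from tendsto_mult_right_zero[OF this] show ?thesis unfolding \<epsilon>_def .
    qed
    show "norm (K z) \<le> \<epsilon> k" if z: "- 1/4 \<le> Re z" "Re z \<le> 5/4" "\<bar>Im z\<bar> = T k" for k z
    proof -
      have "norm (Hz x L (z - 1/2)) \<le> 4 * exp \<bar>L\<bar> * exp (- (pi - x) * \<bar>Im (z - 1/2)\<bar>)"
        using z T6[of k] by (intro norm_Hz_le x) auto
      also have "\<dots> \<le> 4 * exp \<bar>L\<bar> * exp (- \<delta> * (real k + 6))"
        using z T6[of k] \<delta> by (auto simp: \<delta>_def intro!: mult_left_mono)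
      finally have "norm (K z) \<le> (4 * exp \<bar>L\<bar> * exp (- \<delta> * (real k + 6))) * G (real k + 6)"
        unfolding K_def norm_mult using z by (intro mult_mono TG) auto
      then show ?thesis by (simp add: \<epsilon>_def mult_ac)
    qed
  qed (use finite_P T0 in auto)
  moreover have "(\<Sum>p\<in>{p \<in> P. \<bar>Im p\<bar> < T k}. residue K p) = - Hz x L (1/2) + (\<Sum>p\<in>{p \<in> Zs. \<bar>Im p\<bar> < T k}. f p)" for k
  proof -
    have fz: "finite {p \<in> Zs. \<bar>Im p\<bar> < T k}" by (rule finite_subset[OF _ finite_Zs_le[of "T k"]]) auto
    have "{p \<in> P. \<bar>Im p\<bar> < T k} = insert (1/2) (insert 1 {p \<in> Zs. \<bar>Im p\<bar> < T k})"
      using T0[of k] by (auto simp: P_def)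
    moreover have "1/2 \<notin> Zs" "1 \<notin> Zs" by (auto simp: Zs_def)
    ultimately have "(\<Sum>p\<in>{p \<in> P. \<bar>Im p\<bar> < T k}. residue K p) = residue K (1/2) + (residue K 1 + (\<Sum>p\<in>{p \<in> Zs. \<bar>Im p\<bar> < T k}. residue K p))"
      using fz by simp
    also have "(\<Sum>p\<in>{p \<in> Zs. \<bar>Im p\<bar> < T k}. residue K p) = (\<Sum>p\<in>{p \<in> Zs. \<bar>Im p\<bar> < T k}. f p)"
      by (intro sum.cong refl) (simp add: residue_zero f_def)
    finally show ?thesis by (simp add: residue_half residue_one)
  qed
  ultimately have "(\<lambda>k. - Hz x L (1/2) + (\<Sum>p\<in>{p \<in> Zs. \<bar>Im p\<bar> < T k}. f p)) \<longlonglongrightarrow> vint (5/4) K - vint (- 1/4) K" by simp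
  from tendsto_add[OF this tendsto_const[of "Hz x L (1/2)"]]
  have lim: "(\<lambda>k. \<Sum>p\<in>{p \<in> Zs. \<bar>Im p\<bar> < T k}. f p) \<longlonglongrightarrow> vint (5/4) K - vint (- 1/4) K + Hz x L (1/2)" by simp
  have "(f has_sum (vint (5/4) K - vint (- 1/4) K + Hz x L (1/2))) Zs"
  proof (rule tendsto_quotient_sum_has_sum[OF _ lim])
    show "f summable_on Zs" using zero_sum_upper_Zs(2)[OF x, of L] unfolding f_def by (rule has_sum_imp_summable)
    show "finite {p \<in> Zs. \<bar>Im p\<bar> < T k}" for k by (rule finite_subset[OF _ finite_Zs_le[of "T k"]]) auto
    show "\<forall>\<^sub>F k in sequentially. p \<in> {p \<in> Zs. \<bar>Im p\<bar> < T k}" if p: "p \<in> Zs" for p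
    proof -
      have "\<forall>\<^sub>F k in sequentially. \<bar>Im p\<bar> < real k"
        using filterlim_real_sequentially unfolding filterlim_at_top_dense by blast
      then show ?thesis
      proof eventually_elim
        case (elim k)
        then show ?case using T6[of k] p by simp
      qed
    qed
  qed auto
  moreover have "(f has_sum (2 * infsum f upper_zeros)) Zs" using zero_sum_upper_Zs(2)[OF x, of L] unfolding f_def .
  ultimately have "2 * infsum f upper_zeros = vint (5/4) K - vint (- 1/4) K + Hz x L (1/2)"
    using has_sum_unique by blast
  also have "vint (5/4) K = - Jint x L (\<lambda>z. Lser (z + 1/2))"
    unfolding vint_def Jint_def K_right by simp
  \<comment> \<open>The reflection y -> - y leaves the integral unchanged. The left line carries +
    Lser and is subtracted, the right line carries - Lser: hence the coefficient 2 of the prime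
    sum.\<close>
  also have "vint (- 1/4) K = Jint x L Xl"
    unfolding vint_def Jint_def K_left
    using lborel_integral_real_affine[of "- 1" "\<lambda>y. Hz x L (Complex (3/4) y) * Xl (Complex (3/4) y)" 0] by simp
  finally show ?thesis by (simp add: Jint_Xl f_def)
qed

end

section \<open>The elementary terms\<close>

text \<open>Multiplication by i rotates the lower half plane onto the right one, where the argument
  is an arctangent.\<close>

lemma Im_Ln_lower:
  assumes "Im z < 0" shows "Im (Ln z) = - pi / 2 - arctan (Re z / Im z)"
proof -
  define y where "y = \<i> * z"
  have y: "Re y > 0" "y \<noteq> 0" "Im y = Re z" "Re y = - Im z" using assms by (auto simp: y_def)
  have A: "Arg y = arctan (Im y / Re y)" using arg_conv_arctan[OF y(1)] .
  have b: "- pi / 2 < Arg y" "Arg y < pi / 2" unfolding A using arctan_bounded[of "Im y / Re y"] by auto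
  have "Arg z = Arg y - pi / 2"
  proof (rule Arg_unique)
    have "of_real (cmod y) * exp (\<i> * of_real (Arg y)) = y" using Arg_eq[OF y(2)] by simp
    moreover have "exp (\<i> * of_real (Arg y - pi / 2)) = exp (\<i> * of_real (Arg y)) * (- \<i>)"
    proof -
      have "cis (Arg y - pi / 2) = cis (Arg y) * (- \<i>)" by (simp add: complex_eq_iff cos_diff sin_diff)
      then show ?thesis by (simp only: cis_conv_exp)
    qed
    ultimately have "of_real (cmod y) * exp (\<i> * of_real (Arg y - pi / 2)) = y * (- \<i>)" by (simp only: mult.assoc[symmetric])
    also have "\<dots> = z" by (simp add: y_def complex_eq_iff)
    finally show "of_real (cmod y) * exp (\<i> * of_real (Arg y - pi / 2)) = z" .
  qed (use y b pi_gt_zero in auto)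
  moreover have "Im (Ln z) = Arg z" using assms by (subst Arg_eq_Im_Ln) auto
  ultimately show ?thesis using y by (simp add: A arctan_minus)
qed

text \<open>Arctan q = (i / 2) Ln ((1 - i q) / (1 + i q)), and for Re q > 0 the quotient lies in the
  lower half plane. Its argument and modulus become the arctangent and the logarithm in g.\<close>

lemma Arctan_cartesian:
  assumes q: "Re q > 0"
  defines "n \<equiv> (Re q)\<^sup>2 + (Im q)\<^sup>2"
  shows "2 * Re (Arctan q) = pi / 2 + arctan ((n - 1) / (2 * Re q))"
    and "4 * Im (Arctan q) = ln ((1 + n + 2 * Im q) / (1 + n - 2 * Im q))"
proof -
  define z where "z = (1 - \<i> * q) / (1 + \<i> * q)"
  have nz: "1 + \<i> * q \<noteq> 0" "1 - \<i> * q \<noteq> 0" using q by (auto simp: complex_eq_iff)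
  define N where "N = 1 + n - 2 * Im q"
  have N: "N = (cmod (1 + \<i> * q))\<^sup>2" by (simp only: cmod_power2) (simp add: N_def n_def power2_eq_square algebra_simps)
  have M: "1 + n + 2 * Im q = (cmod (1 - \<i> * q))\<^sup>2" by (simp only: cmod_power2) (simp add: n_def power2_eq_square algebra_simps)
  have N0: "N > 0" unfolding N using nz by simp
  have ze: "z = (1 - \<i> * q) * cnj (1 + \<i> * q) / of_real N"
    unfolding z_def N using complex_div_cnj[of "1 - \<i> * q" "1 + \<i> * q"] by (simp only: of_real_power)
  have Rz: "Re z = (1 - n) / N" "Im z = - (2 * Re q) / N"
    unfolding ze Re_divide_of_real Im_divide_of_real by (simp_all add: n_def power2_eq_square algebra_simps)
  have z0: "z \<noteq> 0" using nz by (simp add: z_def)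
  have At: "Arctan q = \<i> / 2 * Ln z" by (simp add: Arctan_def z_def)
  have "Re z / Im z = (n - 1) / (2 * Re q)" unfolding Rz using N0 q by (simp add: field_simps)
  moreover have "Im z < 0" unfolding Rz using N0 q by simp
  ultimately have "Im (Ln z) = - pi / 2 - arctan ((n - 1) / (2 * Re q))" using Im_Ln_lower[of z] by simp
  then show "2 * Re (Arctan q) = pi / 2 + arctan ((n - 1) / (2 * Re q))" by (simp add: At)
  have "4 * Im (Arctan q) = 2 * ln (cmod z)" using z0 by (simp add: At)
  also have "\<dots> = ln ((cmod z)\<^sup>2)" using z0 by (simp add: ln_realpow)
  also have "(cmod z)\<^sup>2 = (1 + n + 2 * Im q) / (1 + n - 2 * Im q)"
    unfolding M N[unfolded N_def] z_def by (simp add: norm_divide power_divide)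
  finally show "4 * Im (Arctan q) = ln ((1 + n + 2 * Im q) / (1 + n - 2 * Im q))" .
qed

lemma Arctan_cartesian_pos:
  assumes "Re q > 0"
  shows "0 < 1 + ((Re q)\<^sup>2 + (Im q)\<^sup>2) + 2 * Im q" "0 < 1 + ((Re q)\<^sup>2 + (Im q)\<^sup>2) - 2 * Im q"
proof -
  have "1 + ((Re q)\<^sup>2 + (Im q)\<^sup>2) + 2 * Im q = (Re q)\<^sup>2 + (1 + Im q)\<^sup>2" "1 + ((Re q)\<^sup>2 + (Im q)\<^sup>2) - 2 * Im q = (Re q)\<^sup>2 + (1 - Im q)\<^sup>2"
    by (simp_all add: power2_eq_square algebra_simps)
  then show "0 < 1 + ((Re q)\<^sup>2 + (Im q)\<^sup>2) + 2 * Im q" "0 < 1 + ((Re q)\<^sup>2 + (Im q)\<^sup>2) - 2 * Im q"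
    using assms by (simp_all only: add_pos_nonneg zero_less_power zero_le_power2)
qed

lemma Arctan_cnj:
  assumes "Re q > 0" shows "Arctan (cnj q) = cnj (Arctan q)"
proof (rule complex_eqI)
  define n where "n = (Re q)\<^sup>2 + (Im q)\<^sup>2"
  have "4 * Im (Arctan (cnj q)) = ln (inverse ((1 + n + 2 * Im q) / (1 + n - 2 * Im q)))"
    using Arctan_cartesian(2)[of "cnj q"] assms by (simp add: n_def)
  also have "\<dots> = - (4 * Im (Arctan q))"
    unfolding Arctan_cartesian(2)[OF assms, folded n_def]
    using Arctan_cartesian_pos[OF assms, folded n_def] by (intro ln_inverse divide_pos_pos)
  finally show "Im (Arctan (cnj q)) = Im (cnj (Arctan q))" by simp
  show "Re (Arctan (cnj q)) = Re (cnj (Arctan q))"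
    using Arctan_cartesian(1)[of "cnj q"] Arctan_cartesian(1)[of q] assms by simp
qed

lemma Arctan_inverse:
  assumes q: "Re q > 0" shows "Arctan (1 / q) = of_real pi / 2 - Arctan q"
proof (rule complex_eqI)
  define n where "n = (Re q)\<^sup>2 + (Im q)\<^sup>2"
  have n: "n > 0" using q by (simp add: n_def add_pos_nonneg)
  have i: "Re (1 / q) = Re q / n" "Im (1 / q) = - Im q / n" by (simp_all add: n_def Re_divide Im_divide)
  have Rp: "Re (1 / q) > 0" using q n by (simp add: i)
  have ni: "(Re (1 / q))\<^sup>2 + (Im (1 / q))\<^sup>2 = 1 / n"
  proof -
    have "(Re (1 / q))\<^sup>2 + (Im (1 / q))\<^sup>2 = n / n\<^sup>2" unfolding i by (simp add: n_def power_divide add_divide_distrib)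
    then show ?thesis using n by (simp add: power2_eq_square)
  qed
  have "(1 / n - 1) / (2 * (Re q / n)) = - ((n - 1) / (2 * Re q))" using n q by (simp add: field_simps)
  then show "Re (Arctan (1 / q)) = Re (of_real pi / 2 - Arctan q)"
    using Arctan_cartesian(1)[OF Rp, unfolded ni] Arctan_cartesian(1)[OF q, folded n_def] by (simp add: i arctan_minus)
  have "(1 + 1 / n + 2 * (- Im q / n)) / (1 + 1 / n - 2 * (- Im q / n)) = inverse ((1 + n + 2 * Im q) / (1 + n - 2 * Im q))"
  proof -
    have "1 + 1 / n + 2 * (- Im q / n) = (1 + n - 2 * Im q) / n" "1 + 1 / n - 2 * (- Im q / n) = (1 + n + 2 * Im q) / n"
      using n by (auto simp: field_simps)
    then show ?thesis using n by simp
  qed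
  then have "4 * Im (Arctan (1 / q)) = - (4 * Im (Arctan q))"
    using Arctan_cartesian(2)[OF Rp, unfolded ni, unfolded i] Arctan_cartesian(2)[OF q, folded n_def]
    using ln_inverse[of "(1 + n + 2 * Im q) / (1 + n - 2 * Im q)"] Arctan_cartesian_pos[OF q, folded n_def] by simp
  then show "Im (Arctan (1 / q)) = Im (of_real pi / 2 - Arctan q)" by simp
qed

text \<open>For q = exp ((L + i x) / 2) the four values of exp (w / 2) are q, cnj (1 / q), cnj q and
  1 / q; compatibility of V with conjugation leaves an imaginary part.\<close>

lemma Jint_Im:
  fixes x L :: real and X V :: "complex \<Rightarrow> complex"
  assumes x: "0 < x" "x < pi"
    and i: "\<And>w. \<bar>Im w\<bar> = x \<Longrightarrow> integrable lborel (\<lambda>y. expsin w (Complex (3/4) y) * X (Complex (3/4) y))"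
    and V: "\<And>w. \<bar>Im w\<bar> = x \<Longrightarrow> vint (3/4) (\<lambda>z. expsin w z * X z) = V (exp (w / 2))"
    and c: "\<And>q. Re q > 0 \<Longrightarrow> V (cnj q) = cnj (V q)"
  defines "q \<equiv> exp (Complex L x / 2)"
  shows "Jint x L X = of_real (Im (V q - V (1 / q)) / 2)"
proof -
  have ax: "\<bar>x\<bar> = x" "\<bar>- x\<bar> = x" using x by auto
  have R: "Re q > 0" "Re (1 / q) > 0"
  proof -
    have "cos (x / 2) > 0" using x by (intro cos_gt_zero) auto
    then show "Re q > 0" by (simp add: q_def Re_exp)
    then show "Re (1 / q) > 0" by (simp add: Re_divide) (auto intro!: divide_pos_pos add_pos_nonneg)
  qed
  have cn: "exp (Complex L (- x) / 2) = cnj q"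
  proof -
    have "Complex L (- x) / 2 = cnj (Complex L x / 2)" by (simp add: complex_eq_iff)
    then show ?thesis unfolding q_def by (simp only: exp_cnj)
  qed
  have iv: "exp (Complex (- L) (- x) / 2) = 1 / q"
  proof -
    have "Complex (- L) (- x) / 2 = - (Complex L x / 2)" by (simp add: complex_eq_iff)
    then show ?thesis unfolding q_def by (simp only: exp_minus inverse_eq_divide)
  qed
  have ic: "exp (Complex (- L) x / 2) = cnj (1 / q)"
  proof -
    have "Complex (- L) x / 2 = cnj (Complex (- L) (- x) / 2)" by (simp add: complex_eq_iff)
    then show ?thesis unfolding iv[symmetric] by (simp only: exp_cnj)
  qed
  have d: "w - cnj w = 2 * \<i> * of_real (Im w)" for w by (simp add: complex_eq_iff)
  have ii: "integrable lborel (\<lambda>y. expsin (Complex a b) (Complex (3/4) y) * X (Complex (3/4) y))" if "\<bar>b\<bar> = x" for a b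
    by (rule i) (simp add: that)
  have "Jint x L X = (V q + cnj (V (1 / q)) - cnj (V q) - V (1 / q)) / (4 * \<i>)"
    using Jint_expsin(1)[where X = X and L = L, OF ii x(1)] ax
    using c[OF R(2)] by (simp add: V cn iv ic c[OF R(1)] flip: q_def)
  also have "V q + cnj (V (1 / q)) - cnj (V q) - V (1 / q) = (V q - V (1 / q)) - cnj (V q - V (1 / q))" by simp
  also have "\<dots> / (4 * \<i>) = of_real (Im (V q - V (1 / q)) / 2)"
  proof -
    have "2 * \<i> * of_real v / (4 * \<i>) = of_real (v / 2)" for v by simp
    then show ?thesis unfolding d .
  qed
  finally show ?thesis .
qed

context
  fixes x t :: real
  assumes x: "0 < x" "x < pi" and t: "t > 1"
begin

private definition q :: complex where "q = exp (Complex (ln t) x / 2)"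
private definition s :: real where "s = sin (x / 2)"
private definition c :: real where "c = cos (x / 2)"
private definition r :: real where "r = sqrt t"

private lemma sc: "s > 0" "c > 0" "s\<^sup>2 + c\<^sup>2 = 1" "r > 0" "r\<^sup>2 = t"
proof -
  show "s > 0" unfolding s_def using x by (intro sin_gt_zero) auto
  show "c > 0" unfolding c_def using x by (intro cos_gt_zero) auto
qed (use t in \<open>auto simp: s_def c_def r_def\<close>)

private lemma rr: "r * r = t" "t / r = r"
proof -
  show r: "r * r = t" using sc(5) by (simp only: power2_eq_square)
  then show "t / r = r" using sc(4) by (simp add: divide_eq_eq)
qed

private lemma e_half: "exp (ln t / 2) = r"
proof -
  have "(exp (ln t / 2))\<^sup>2 = t" using t by (simp add: power2_eq_square flip: exp_add)
  then show ?thesis unfolding r_def by (intro real_sqrt_unique[symmetric]) auto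
qed

private lemma q_eq: "Re q = r * c" "Im q = r * s"
  unfolding q_def using e_half by (auto simp: Re_exp Im_exp s_def c_def)

private lemma q_nz: "Re q > 0" "q \<noteq> 0" "1 + q \<noteq> 0" "1 + q\<^sup>2 \<noteq> 0" "1 + 1 / q \<noteq> 0" "1 + (1 / q)\<^sup>2 \<noteq> 0"
proof -
  show R: "Re q > 0" using sc by (simp add: q_eq)
  then show q0: "q \<noteq> 0" by auto
  show q1: "1 + q \<noteq> 0" using R by (auto simp: complex_eq_iff)
  show q2: "1 + q\<^sup>2 \<noteq> 0"
  proof
    assume e: "1 + q\<^sup>2 = 0"
    then have "Im (1 + q\<^sup>2) = 0" "Re (1 + q\<^sup>2) = 0" by simp_all
    then have "Im q = 0" "1 + (Re q)\<^sup>2 - (Im q)\<^sup>2 = 0" using R by (auto simp: power2_eq_square)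
    then show False using zero_le_power2[of "Re q"] by simp
  qed
  have "1 + 1 / q = (1 + q) / q" "1 + (1 / q)\<^sup>2 = (1 + q\<^sup>2) / q\<^sup>2" using q0 by (auto simp: field_simps)
  then show "1 + 1 / q \<noteq> 0" "1 + (1 / q)\<^sup>2 \<noteq> 0" using q0 q1 q2 by simp_all
qed

text \<open>This is |1 + q^2|^2 for q = sqrt t exp (i x / 2).\<close>

private definition D :: real where "D = 1 + t\<^sup>2 + 2 * t * cos x"

private lemma cos_x: "cos x = c\<^sup>2 - s\<^sup>2" "sin x = 2 * s * c"
  using cos_double[of "x / 2"] sin_double[of "x / 2"] by (auto simp: c_def s_def)

private lemma q2: "Re (1 + q\<^sup>2) = 1 + t * (c\<^sup>2 - s\<^sup>2)" "Im (1 + q\<^sup>2) = 2 * t * s * c"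
  using sc by (simp_all add: power2_eq_square q_eq algebra_simps)

private lemma D_eq: "(Re (1 + q\<^sup>2))\<^sup>2 + (Im (1 + q\<^sup>2))\<^sup>2 = D" "D > 0"
proof -
  have "(1 + t * (c\<^sup>2 - s\<^sup>2))\<^sup>2 + (2 * t * s * c)\<^sup>2 = 1 + t\<^sup>2 * (s\<^sup>2 + c\<^sup>2)\<^sup>2 + 2 * t * (c\<^sup>2 - s\<^sup>2)" by algebra
  then show 1: "(Re (1 + q\<^sup>2))\<^sup>2 + (Im (1 + q\<^sup>2))\<^sup>2 = D" unfolding q2 by (simp add: D_def cos_x sc)
  have "(cmod (1 + q\<^sup>2))\<^sup>2 > 0" using q_nz by simp
  then show "D > 0" unfolding cmod_power2 1 .
qed

private lemma q_parts:
  "Re (q / (1 + q\<^sup>2)) = r * (1 + t) * c / D" "Im (q / (1 + q\<^sup>2)) = r * (1 - t) * s / D"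
  "Im ((q\<^sup>2 - 1) / (1 + q\<^sup>2)) = 4 * t * s * c / D"
  "Im (1 / q) = - s / r" "Im (1 / (1 + q)) = - r * s / (1 + 2 * r * c + t)"
proof -
  have 1: "r * c * (1 + t * (c\<^sup>2 - s\<^sup>2)) + r * s * (2 * t * s * c) = r * (1 + t) * c"
  proof -
    have "r * c * (1 + t * (c\<^sup>2 - s\<^sup>2)) + r * s * (2 * t * s * c) = r * c * (1 + t * (s\<^sup>2 + c\<^sup>2))" by algebra
    then show ?thesis by (simp add: sc)
  qed
  have 2: "r * s * (1 + t * (c\<^sup>2 - s\<^sup>2)) - r * c * (2 * t * s * c) = r * (1 - t) * s"
  proof -
    have "r * s * (1 + t * (c\<^sup>2 - s\<^sup>2)) - r * c * (2 * t * s * c) = r * s * (1 - t * (s\<^sup>2 + c\<^sup>2))" by algebra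
    then show ?thesis by (simp add: sc)
  qed
  show "Re (q / (1 + q\<^sup>2)) = r * (1 + t) * c / D" unfolding Re_divide D_eq(1) unfolding q2 q_eq by (simp only: 1)
  show "Im (q / (1 + q\<^sup>2)) = r * (1 - t) * s / D" unfolding Im_divide D_eq(1) unfolding q2 q_eq by (simp only: 2)
  have "(q\<^sup>2 - 1) / (1 + q\<^sup>2) = 1 - 2 / (1 + q\<^sup>2)" using q_nz by (simp add: field_simps)
  then have "Im ((q\<^sup>2 - 1) / (1 + q\<^sup>2)) = - Im (2 / (1 + q\<^sup>2))" by simp
  also have "\<dots> = 4 * t * s * c / D" unfolding Im_divide D_eq(1) unfolding q2 by simp
  finally show "Im ((q\<^sup>2 - 1) / (1 + q\<^sup>2)) = 4 * t * s * c / D" .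
  have n: "(r * c)\<^sup>2 + (r * s)\<^sup>2 = t" using sc by (metis add.commute distrib_left mult.right_neutral power_mult_distrib)
  have "Im (1 / q) = - (r * s) / t" unfolding Im_divide q_eq n by simp
  also have "\<dots> = - s / r"
  proof -
    have "r * s / (r * r) = s / r" using sc(4) by simp
    then show ?thesis unfolding rr by simp
  qed
  finally show "Im (1 / q) = - s / r" .
  have "(1 + r * c)\<^sup>2 + (r * s)\<^sup>2 = 1 + 2 * r * c + t" using n by (simp add: power2_eq_square algebra_simps)
  then show "Im (1 / (1 + q)) = - r * s / (1 + 2 * r * c + t)" unfolding Im_divide by (simp add: q_eq)
qed

private lemma Arctan_q:
  "4 * Im (Arctan q) = - ln ((1 + t - 2 * r * s) / (1 + t + 2 * r * s))"
  "4 * Re (Arctan q) - pi = 2 * arctan ((t - 1) / (2 * r * c))"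
proof -
  have n: "(Re q)\<^sup>2 + (Im q)\<^sup>2 = t"
    unfolding q_eq using sc by (metis add.commute distrib_left mult.right_neutral power_mult_distrib)
  note a = Arctan_cartesian[OF q_nz(1), unfolded n] Arctan_cartesian_pos[OF q_nz(1), unfolded n]
  show "4 * Re (Arctan q) - pi = 2 * arctan ((t - 1) / (2 * r * c))" using a(1) by (simp add: q_eq mult.assoc)
  have "ln ((1 + t - 2 * r * s) / (1 + t + 2 * r * s)) = - ln ((1 + t + 2 * r * s) / (1 + t - 2 * r * s))"
    using a(3,4) ln_inverse[of "(1 + t + 2 * r * s) / (1 + t - 2 * r * s)"] by (simp add: q_eq mult.assoc)
  then show "4 * Im (Arctan q) = - ln ((1 + t - 2 * r * s) / (1 + t + 2 * r * s))" using a(2) by (simp add: q_eq mult.assoc)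
qed

text \<open>Equals - Digamma (1/2).\<close>

private definition K0 :: complex where "K0 = euler_mascheroni + 2 * of_real (ln 2)"
text \<open>\<open>V1\<close>, \<open>VD\<close> and \<open>VT\<close> are the integrals of the
  kernel against 1, the digamma function and the tangent, as functions of exp (w / 2).\<close>

private definition V1 :: "complex \<Rightarrow> complex" where "V1 p = p\<^sup>2 / (of_real pi * (1 + p\<^sup>2))"
private definition VD :: "complex \<Rightarrow> complex" where
  "VD p = (2 * Arctan p * p - K0 * p\<^sup>2) / (of_real pi * (1 + p\<^sup>2))"
private definition VT :: "complex \<Rightarrow> complex" where
  "VT p = - p\<^sup>2 * (1 + p + 2 * p\<^sup>2) / (of_real pi * ((1 + p) * (1 + p\<^sup>2)))"

private lemma V1_diff: "V1 q - V1 (1 / q) = ((q\<^sup>2 - 1) / (1 + q\<^sup>2)) / of_real pi"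
proof -
  have i: "(1 / q)\<^sup>2 / (1 + (1 / q)\<^sup>2) = 1 / (1 + q\<^sup>2)" using q_nz by (simp add: divide_simps)
  have e: "V1 p = p\<^sup>2 / (1 + p\<^sup>2) / of_real pi" for p by (simp add: V1_def mult.commute)
  show ?thesis unfolding e i by (simp flip: diff_divide_distrib)
qed

private lemma VD_diff: "VD q - VD (1 / q) = (q / (1 + q\<^sup>2) * (4 * Arctan q - of_real pi) - K0 * ((q\<^sup>2 - 1) / (1 + q\<^sup>2))) / of_real pi"
proof -
  have i: "(1 / q)\<^sup>2 / (1 + (1 / q)\<^sup>2) = 1 / (1 + q\<^sup>2)" "(1 / q) / (1 + (1 / q)\<^sup>2) = q / (1 + q\<^sup>2)"
    using q_nz by (auto simp: divide_simps power2_eq_square)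
  have e: "VD p = (2 * Arctan p * (p / (1 + p\<^sup>2)) - K0 * (p\<^sup>2 / (1 + p\<^sup>2))) / of_real pi" for p
    by (simp add: VD_def diff_divide_distrib mult.commute)
  show ?thesis unfolding e i Arctan_inverse[OF q_nz(1)] diff_divide_distrib[of "q\<^sup>2"]
    by (simp add: algebra_simps diff_divide_distrib add_divide_distrib)
qed

text \<open>Under the antisymmetrization q -> 1 / q the factor 1 + q^2 cancels, so the tangent only
  feeds the terms of g without the denominator 1 + t^2 + 2 t cos x.\<close>

private lemma VT_diff: "VT q - VT (1 / q) = - 2 / of_real pi * (q - 1 / q + 1 / (1 + q) - 1 / 2)"
proof -
  have e: "(1 / q)\<^sup>2 * (1 + 1 / q + 2 * (1 / q)\<^sup>2) / ((1 + 1 / q) * (1 + (1 / q)\<^sup>2)) = (q\<^sup>2 + q + 2) / (q * ((1 + q) * (1 + q\<^sup>2)))"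
  proof -
    have a: "1 + 1 / q = (1 + q) / q" "1 + (1 / q)\<^sup>2 = (1 + q\<^sup>2) / q\<^sup>2"
      using q_nz by (simp_all add: divide_simps power2_eq_square)
    have b: "1 + 1 / q + 2 * (1 / q)\<^sup>2 = (q\<^sup>2 + q + 2) / q\<^sup>2"
      using q_nz by (simp add: field_simps power2_eq_square)
    show ?thesis unfolding b unfolding a using q_nz by (simp add: divide_simps power2_eq_square)
  qed
  have "q\<^sup>2 * (1 + q + 2 * q\<^sup>2) / ((1 + q) * (1 + q\<^sup>2)) - (q\<^sup>2 + q + 2) / (q * ((1 + q) * (1 + q\<^sup>2))) = 2 * (q - 1 / q + 1 / (1 + q) - 1 / 2)"
    using q_nz by (simp add: divide_simps) (simp add: power2_eq_square algebra_simps)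
  then have "(q\<^sup>2 * (1 + q + 2 * q\<^sup>2) / ((1 + q) * (1 + q\<^sup>2)) - (1 / q)\<^sup>2 * (1 + 1 / q + 2 * (1 / q)\<^sup>2) / ((1 + 1 / q) * (1 + (1 / q)\<^sup>2))) * (- 1 / of_real pi) = 2 * (q - 1 / q + 1 / (1 + q) - 1 / 2) * (- 1 / of_real pi)"
    unfolding e by simp
  moreover have "VT p = p\<^sup>2 * (1 + p + 2 * p\<^sup>2) / ((1 + p) * (1 + p\<^sup>2)) * (- 1 / of_real pi)" for p
    by (simp add: VT_def)
  ultimately show ?thesis by (simp only: flip: left_diff_distrib) simp
qed

private lemma cnj_em: "cnj euler_mascheroni = (euler_mascheroni :: complex)"
  using complex_cnj_complex_of_real[of euler_mascheroni] by simp

private lemma J_eval: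
  "Jint x (ln t) (\<lambda>_. 1) = of_real (Im (V1 q - V1 (1 / q)) / 2)"
  "Jint x (ln t) (\<lambda>z. Digamma (z + 1/2)) = of_real (Im (VD q - VD (1 / q)) / 2)"
  "Jint x (ln t) tanq = of_real (Im (VT q - VT (1 / q)) / 2)"
proof -
  have hh: "(exp (w / 2))\<^sup>2 = exp w" for w :: complex by (simp add: power2_eq_square flip: exp_add)
  have w: "\<bar>Im w\<bar> < pi" "Im w \<noteq> 0" if "\<bar>Im w\<bar> = x" for w using that x by auto
  show "Jint x (ln t) (\<lambda>_. 1) = of_real (Im (V1 q - V1 (1 / q)) / 2)"
    unfolding q_def by (rule Jint_Im[OF x]) (use w in \<open>auto simp: vint_expsin hh V1_def\<close>)
  show "Jint x (ln t) (\<lambda>z. Digamma (z + 1/2)) = of_real (Im (VD q - VD (1 / q)) / 2)"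
    unfolding q_def by (rule Jint_Im[OF x])
      (use w in \<open>auto simp: vint_expsin_Digamma(1) VD_def K0_def Arctan_cnj cnj_em intro!: vint_expsin_Digamma(2)\<close>)
  show "Jint x (ln t) tanq = of_real (Im (VT q - VT (1 / q)) / 2)"
    unfolding q_def by (rule Jint_Im[OF x])
      (use w in \<open>auto simp: vint_expsin_tan(1) VT_def intro!: vint_expsin_tan(2)\<close>)
qed

text \<open>Origin of the terms of g: the pole of zeta and the part q - 1 / q of the tangent give
  one half each of the first, 1 / (1 + q) gives the second; C + 2 log 2 from the digamma function
  and log (2 pi) combine to C + log (8 pi) in the third; imaginary and real part of Arctan q give
  the logarithm and the arctangent.\<close>

theorem explicit_g:
  "Hz x (ln t) (1/2) + Jint x (ln t) (\<lambda>z. Digamma (z + 1/2)) - of_real (ln (2 * pi)) * Jint x (ln t) (\<lambda>_. 1)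
      - of_real pi / 2 * Jint x (ln t) tanq = of_real (2 * g_fun x t)"
proof -
  define A where "A = arctan ((t - 1) / (2 * r * c))"
  define l where "l = ln ((1 + t - 2 * r * s) / (1 + t + 2 * r * s))"
  define \<kappa> where "\<kappa> = euler_mascheroni + 2 * ln 2 + ln (2 * pi)"
  have \<kappa>: "\<kappa> = euler_mascheroni + ln (8 * pi)"
  proof -
    have "ln (8 * pi) = ln ((2 * pi) * 2 ^ 2)" by (simp add: mult.commute)
    also have "\<dots> = ln (2 * pi) + 2 * ln 2" using ln_realpow[of 2 2] by (subst ln_mult_pos) auto
    finally show ?thesis by (simp add: \<kappa>_def)
  qed
  have H: "Hz x (ln t) (1/2) = of_real (s * ((r + 1 / r) / 2))"
  proof -
    have 1: "sin (of_real x * (1/2) :: complex) = of_real s" unfolding s_def by (simp flip: sin_of_real)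
    have 2: "sin (of_real pi * (1/2) :: complex) = 1" using sin_of_real[of "pi / 2", where ?'a = complex] by simp
    have 3: "cosh (of_real (ln t) * (1/2) :: complex) = of_real ((r + 1 / r) / 2)"
    proof -
      have "cosh (of_real (ln t) * (1/2) :: complex) = of_real (cosh (ln t / 2))"
        by (simp add: cosh_field_def flip: exp_of_real)
      also have "cosh (ln t / 2) = (r + 1 / r) / 2" by (simp add: cosh_field_def exp_minus e_half inverse_eq_divide)
      finally show ?thesis .
    qed
    show ?thesis unfolding Hz_def 1 2 3 by simp
  qed
  have DI: "Im (VD q - VD (1 / q)) = (r * (1 + t) * c / D * (4 * Im (Arctan q)) + r * (1 - t) * s / D * (4 * Re (Arctan q) - pi)
     - (euler_mascheroni + 2 * ln 2) * (4 * t * s * c / D)) / pi"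
  proof -
    have "K0 = of_real (euler_mascheroni + 2 * ln 2)" by (simp add: K0_def)
    moreover have "Im (of_real a * w) = a * Im w" for a w by simp
    ultimately have "Im (K0 * w) = (euler_mascheroni + 2 * ln 2) * Im w" for w by metis
    moreover have "Im (w * (4 * Arctan q - of_real pi)) = Re w * (4 * Im (Arctan q)) + Im w * (4 * Re (Arctan q) - pi)" for w
      by simp
    ultimately show ?thesis unfolding VD_diff Im_divide_of_real minus_complex.sel by (simp only: q_parts)
  qed
  have TI: "Im (VT q - VT (1 / q)) = - 2 / pi * (r * s + s / r - r * s / (1 + 2 * r * c + t))"
  proof -
    have "- 2 / complex_of_real pi = of_real (- 2 / pi)" by simp
    moreover have "Im (of_real a * w) = a * Im w" for a w by simp
    ultimately have "Im (- 2 / of_real pi * w) = - 2 / pi * Im w" for w by (simp only:)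
    moreover have "Im (q - 1 / q + 1 / (1 + q) - 1 / 2) = r * s + s / r - r * s / (1 + 2 * r * c + t)"
      unfolding plus_complex.sel minus_complex.sel q_parts by (simp add: q_eq)
    ultimately show ?thesis unfolding VT_diff by (simp only:)
  qed
  have OI: "Im (V1 q - V1 (1 / q)) = 4 * t * s * c / D / pi"
    unfolding V1_diff Im_divide_of_real q_parts ..
  define y where "y = 1 / (pi * D)"
  define e where "e = 1 / (1 + 2 * r * c + t)"
  have g: "g_fun x t = (1 + t) * s / (2 * r) - r * s * e / 4 - t * s * c * \<kappa> * y - (1 + t) * r * c * y * l / 4 - (t - 1) * r * s * y * A / 2"
  proof -
    have "r * s / (8 * r * c + 4 * (1 + t)) = r * s * e / 4"
    proof -
      have "8 * r * c + 4 * (1 + t) = 4 * (1 + 2 * r * c + t)" by simp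
      then show ?thesis unfolding e_def by simp
    qed
    moreover have "t * (2 * s * c) * \<kappa> / (2 * pi * D) = t * s * c * \<kappa> * y" by (simp add: y_def)
    moreover have "(1 + t) * r * c / (4 * pi * D) * l = (1 + t) * r * c * y * l / 4" by (simp add: y_def)
    moreover have "(t - 1) * r * s / (2 * pi * D) * A = (t - 1) * r * s * y * A / 2" by (simp add: y_def)
    ultimately show ?thesis
      unfolding g_fun_def cos_x(2) D_def[symmetric] s_def[symmetric] c_def[symmetric] r_def[symmetric] \<kappa>[symmetric]
        l_def[symmetric] A_def[symmetric] by (simp only:)
  qed
  have DI': "Im (VD q - VD (1 / q)) = (r * (1 + t) * c * (- l) + r * (1 - t) * s * (2 * A) - (euler_mascheroni + 2 * ln 2) * (4 * t * s * c)) * y"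
    unfolding DI Arctan_q y_def l_def A_def using D_eq(2) by (simp add: field_simps)
  have OI': "Im (V1 q - V1 (1 / q)) = 4 * t * s * c * y" unfolding OI y_def by (simp add: mult.commute)
  have TI': "pi / 2 * (Im (VT q - VT (1 / q)) / 2) = - (r * s + s / r - r * s * e) / 2"
  proof -
    have "pi / 2 * (- 2 / pi * X / 2) = - X / 2" for X by simp
    moreover have "r * s / (1 + 2 * r * c + t) = r * s * e" by (simp add: e_def)
    ultimately show ?thesis unfolding TI by (simp only:)
  qed
  have "(1 + t) * s / r = s / r + t / r * s" by (simp add: add_divide_distrib distrib_right)
  then have st: "(1 + t) * s / r = s / r + r * s" "s * ((r + 1 / r) / 2) = (s / r + r * s) / 2" "(1 + t) * s / (2 * r) = (s / r + r * s) / 2"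
    unfolding rr by (simp_all add: distrib_left add_divide_distrib mult.commute)
  have "2 * g_fun x t = s * ((r + 1 / r) / 2) + Im (VD q - VD (1 / q)) / 2 - ln (2 * pi) * (Im (V1 q - V1 (1 / q)) / 2)
      - pi / 2 * (Im (VT q - VT (1 / q)) / 2)"
    unfolding g TI' DI' OI' st \<kappa>_def by (simp add: algebra_simps add_divide_distrib diff_divide_distrib)
  then show ?thesis unfolding J_eval H by simp
qed

end

section \<open>The sum over prime powers\<close>

lemma Complex_minus_of_real: "Complex a b - of_real l = Complex (a - l) b"
  by (simp add: complex_eq_iff)

definition Lterm :: "nat \<Rightarrow> complex \<Rightarrow> complex" where
  "Lterm n z = of_real (mangoldt (Suc n)) / (of_nat (Suc n)) powr (z + 1/2)"

text \<open>A factor n^(-z) only moves w by - log n and leaves Im w alone, so the evaluation of the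
  bare kernel integral applies.\<close>

lemma expsin_Lterm:
  "expsin w z * Lterm n z = of_real (mangoldt (Suc n) * exp (- ln (real (Suc n)) / 2)) * expsin (w - of_real (ln (real (Suc n)))) z"
proof -
  define l where "l = ln (real (Suc n))"
  have "Ln (of_nat (Suc n)) = of_real l" unfolding l_def by (subst Ln_of_nat) auto
  then have "(of_nat (Suc n) :: complex) powr (z + 1/2) = exp (of_real l * z) * exp (of_real (l / 2))"
    unfolding powr_def by (simp add: distrib_right distrib_left mult.commute flip: exp_add del: of_nat_Suc)
  then have "Lterm n z = of_real (mangoldt (Suc n)) * (exp (- (of_real l * z)) * exp (- of_real (l / 2)))"
    unfolding Lterm_def by (simp add: exp_minus inverse_eq_divide)
  moreover have "exp (- of_real (l / 2) :: complex) = of_real (exp (- l / 2))"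
    unfolding exp_of_real[symmetric] by simp
  moreover have "exp (w * z) * exp (- (of_real l * z)) = exp ((w - of_real l) * z)"
    by (simp add: left_diff_distrib flip: exp_add)
  ultimately show ?thesis unfolding expsin_def l_def[symmetric] by (simp add: mult_ac)
qed

text \<open>Because of this the L1 norms of the terms are a constant multiple of a convergent
  series, which justifies integrating \<open>Lser\<close> termwise.\<close>

lemma norm_Lterm_line: "norm (Lterm n (Complex (3/4) y)) = norm (Lterm n (Complex (3/4) 0))"
  by (simp add: Lterm_def norm_divide norm_powr_real_powr del: of_nat_Suc)

text \<open>The two values are conjugate, so their difference is 2 i times an imaginary part; the
  denominator is |1 + exp (v + i x)|^2.\<close>

lemma kernel_diff:
  fixes v x :: real
  assumes "\<bar>x\<bar> < pi"
  defines "A \<equiv> \<lambda>w::complex. exp w / (of_real pi * (1 + exp w))"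
  shows "A (Complex v x) - A (Complex v (- x)) = 2 * \<i> * of_real (exp v * sin x / (pi * (1 + 2 * exp v * cos x + (exp v)\<^sup>2)))"
proof -
  define E where "E = exp (Complex v x)"
  define p where "p = exp v"
  have "Complex v (- x) = cnj (Complex v x)" by (simp add: complex_eq_iff)
  then have c: "A (Complex v (- x)) = cnj (A (Complex v x))" unfolding A_def by (simp add: exp_cnj)
  have E: "Re E = p * cos x" "Im E = p * sin x" by (simp_all add: E_def p_def Re_exp Im_exp)
  have "(1 + p * cos x)\<^sup>2 + (p * sin x)\<^sup>2 = 1 + 2 * p * cos x + p\<^sup>2 * ((sin x)\<^sup>2 + (cos x)\<^sup>2)" by algebra
  then have n: "(1 + p * cos x)\<^sup>2 + (p * sin x)\<^sup>2 = 1 + 2 * p * cos x + p\<^sup>2" by simp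
  have "A (Complex v x) = E / (1 + E) / of_real pi" by (simp add: A_def E_def mult.commute)
  then have "Im (A (Complex v x)) = Im (E / (1 + E)) / pi" by (simp only: Im_divide_of_real)
  also have "Im (E / (1 + E)) = p * sin x / (1 + 2 * p * cos x + p\<^sup>2)"
    unfolding Im_divide by (simp add: E n) (simp add: algebra_simps)
  finally have "Im (A (Complex v x)) = p * sin x / (pi * (1 + 2 * p * cos x + p\<^sup>2))" by (simp add: mult.commute)
  moreover have "w - cnj w = 2 * \<i> * of_real (Im w)" for w by (simp add: complex_eq_iff)
  ultimately show ?thesis unfolding c p_def by (simp only:)
qed

text \<open>This is |n + t exp (i x)|^2, written so that dropping a nonnegative term leaves (n -
  t)^2. \<open>Lden2\<close> is |n t + exp (i x)|^2, which comes from w with real part - log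
  t.\<close>

definition Lden1 :: "real \<Rightarrow> real \<Rightarrow> nat \<Rightarrow> real" where
  "Lden1 x t n = (real n - t)\<^sup>2 + 4 * t * real n * (cos (x/2))\<^sup>2"

definition Lden2 :: "real \<Rightarrow> real \<Rightarrow> nat \<Rightarrow> real" where
  "Lden2 x t n = (real n * t - 1)\<^sup>2 + 4 * t * real n * (cos (x/2))\<^sup>2"

context
  fixes x t :: real
  assumes x: "0 < x" "x < pi" and t: "t > 1"
begin

private lemma kernel_eval:
  assumes N: "N > 0"
  shows "exp (ln t - ln (real N)) * sin x / (pi * (1 + 2 * exp (ln t - ln (real N)) * cos x + (exp (ln t - ln (real N)))\<^sup>2))
      = t * sin x / pi * (real N / Lden1 x t N)"
    "exp (- ln t - ln (real N)) * sin x / (pi * (1 + 2 * exp (- ln t - ln (real N)) * cos x + (exp (- ln t - ln (real N)))\<^sup>2))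
      = t * sin x / pi * (real N / Lden2 x t N)"
proof -
  have cx: "cos x = 2 * (cos (x/2))\<^sup>2 - 1" using cos_double_cos[of "x/2"] by simp
  have u: "u * s / (pi * (1 + 2 * u * c + u\<^sup>2)) = s / pi * (u / (1 + 2 * u * c + u\<^sup>2))" for u s c by simp
  have e: "exp (ln t - ln (real N)) = t / N" "exp (- ln t - ln (real N)) = 1 / (t * N)"
    using t N by (auto simp: exp_diff exp_minus inverse_eq_divide)
  have l: "(real N)\<^sup>2 * (1 + 2 * (t / N) * cos x + (t / N)\<^sup>2) = Lden1 x t N"
    "(t * N)\<^sup>2 * (1 + 2 * (1 / (t * N)) * cos x + (1 / (t * N))\<^sup>2) = Lden2 x t N"
    unfolding cx Lden1_def Lden2_def using N t by (simp_all add: field_simps power2_eq_square)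
  have "t / N / (1 + 2 * (t / N) * cos x + (t / N)\<^sup>2) = (real N)\<^sup>2 * (t / N) / ((real N)\<^sup>2 * (1 + 2 * (t / N) * cos x + (t / N)\<^sup>2))"
    using N by simp
  also have "\<dots> = t * (real N / Lden1 x t N)" unfolding l using N by (simp add: power2_eq_square)
  finally show "exp (ln t - ln (real N)) * sin x / (pi * (1 + 2 * exp (ln t - ln (real N)) * cos x + (exp (ln t - ln (real N)))\<^sup>2))
      = t * sin x / pi * (real N / Lden1 x t N)" unfolding u e by simp
  have "1 / (t * N) / (1 + 2 * (1 / (t * N)) * cos x + (1 / (t * N))\<^sup>2) = (t * N)\<^sup>2 * (1 / (t * N)) / ((t * N)\<^sup>2 * (1 + 2 * (1 / (t * N)) * cos x + (1 / (t * N))\<^sup>2))"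
    using N t by simp
  also have "\<dots> = t * (real N / Lden2 x t N)" unfolding l using N t by (simp add: power2_eq_square)
  finally show "exp (- ln t - ln (real N)) * sin x / (pi * (1 + 2 * exp (- ln t - ln (real N)) * cos x + (exp (- ln t - ln (real N)))\<^sup>2))
      = t * sin x / pi * (real N / Lden2 x t N)" unfolding u e by simp
qed

private lemma Lterm_integrable:
  assumes "\<bar>b\<bar> = x"
  shows "integrable lborel (\<lambda>y. expsin (Complex a b) (Complex (3/4) y) * Lterm n (Complex (3/4) y))"
  unfolding expsin_Lterm Complex_minus_of_real using assms x
  by (intro integrable_mult_right vint_expsin(2)) simp

private lemma Jint_Lterm:
  "Jint x (ln t) (Lterm n) = of_real (t * sin x / (2 * pi) * (mangoldt (Suc n) * sqrt (Suc n) * (1 / Lden1 x t (Suc n) + 1 / Lden2 x t (Suc n))))"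
proof -
  define N where "N = Suc n"
  define l where "l = ln (real N)"
  define A where "A w = exp w / (of_real pi * (1 + exp w))" for w :: complex
  define k where "k = mangoldt N * exp (- l / 2)"
  have v: "vint (3/4) (\<lambda>z. expsin (Complex a b) z * Lterm n z) = of_real k * A (Complex (a - l) b)" if "\<bar>b\<bar> = x" for a b
  proof -
    have "vint (3/4) (\<lambda>z. expsin (Complex a b) z * Lterm n z) = of_real k * vint (3/4) (expsin (Complex a b - of_real l))"
      unfolding expsin_Lterm N_def[symmetric] l_def[symmetric] k_def[symmetric] by (rule vint_cmult)
    also have "vint (3/4) (expsin (Complex a b - of_real l)) = A (Complex (a - l) b)"
      unfolding Complex_minus_of_real A_def using that x by (intro vint_expsin(1)) simp
    finally show ?thesis .
  qed
  have ax: "\<bar>x\<bar> = x" "\<bar>- x\<bar> = x" "\<bar>x\<bar> < pi" using x by auto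
  have "Jint x (ln t) (Lterm n) = (of_real k * A (Complex (ln t - l) x) + of_real k * A (Complex (- ln t - l) x)
      - of_real k * A (Complex (ln t - l) (- x)) - of_real k * A (Complex (- ln t - l) (- x))) / (4 * \<i>)"
    using Jint_expsin(1)[where X = "Lterm n" and L = "ln t", OF Lterm_integrable x(1)]
    unfolding v[OF ax(1)] v[OF ax(2)] .
  also have "\<dots> = of_real k * ((A (Complex (ln t - l) x) - A (Complex (ln t - l) (- x))) + (A (Complex (- ln t - l) x) - A (Complex (- ln t - l) (- x)))) / (4 * \<i>)"
    by (simp only: distrib_left right_diff_distrib) (simp only: algebra_simps)
  also have "\<dots> = of_real k * (2 * \<i> * of_real (t * sin x / pi * (real N / Lden1 x t N)) + 2 * \<i> * of_real (t * sin x / pi * (real N / Lden2 x t N))) / (4 * \<i>)"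
    using kernel_eval[of N] unfolding kernel_diff[OF ax(3), folded A_def] l_def by (simp only: N_def zero_less_Suc)
  also have "\<dots> = of_real (k * (t * sin x / pi * (real N / Lden1 x t N) + t * sin x / pi * (real N / Lden2 x t N)) / 2)"
    by (simp add: field_simps)
  also have "k * (t * sin x / pi * (real N / Lden1 x t N) + t * sin x / pi * (real N / Lden2 x t N)) / 2
     = t * sin x / (2 * pi) * (mangoldt N * (exp (- l / 2) * real N) * (1 / Lden1 x t N + 1 / Lden2 x t N))"
    by (simp add: k_def algebra_simps add_divide_distrib)
  also have "exp (- l / 2) * real N = sqrt (real N)"
  proof -
    have "exp (- l / 2) * real N = exp (- l / 2) * exp l" by (simp add: l_def N_def)
    also have "\<dots> = exp (l / 2)" by (simp flip: exp_add)
    also have "\<dots> = sqrt (exp l)" by (intro real_sqrt_unique[symmetric]) (simp_all add: power2_eq_square flip: exp_add)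
    finally show ?thesis by (simp add: l_def N_def)
  qed
  finally show ?thesis unfolding N_def .
qed

lemma Jint_Lser_sums:
  "(\<lambda>n. of_real (t * sin x / (2 * pi) * (mangoldt (Suc n) * sqrt (Suc n) * (1 / Lden1 x t (Suc n) + 1 / Lden2 x t (Suc n)))))
    sums Jint x (ln t) (\<lambda>z. Lser (z + 1/2))"
proof -
  define H where "H y = Hz x (ln t) (Complex (3/4) y)" for y
  define F where "F n y = H y * Lterm n (Complex (3/4) y)" for n y
  have Fi: "integrable lborel (F n)" for n
    unfolding F_def H_def by (rule Jint_expsin(2)[OF Lterm_integrable x(1)])
  have sm: "summable (\<lambda>n. norm (Lterm n (Complex (3/4) y)))" "summable (\<lambda>n. Lterm n (Complex (3/4) y))" for y
    unfolding Lterm_def by (rule summable_Lser; simp)+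
  have L: "(\<Sum>n. Lterm n (Complex (3/4) y)) = Lser (Complex (3/4) y + 1/2)" for y
    by (simp only: Lterm_def Lser_def)
  have "(\<lambda>n. integral\<^sup>L lborel (F n)) sums (LINT y|lborel. (\<Sum>n. F n y))"
  proof (rule sums_integral[OF Fi])
    show "AE y in lborel. summable (\<lambda>n. norm (F n y))"
      unfolding F_def norm_mult by (intro AE_I2 summable_mult sm)
    have "norm (F n y) = norm (Lterm n (Complex (3/4) 0)) * norm (H y)" for n y
      using norm_Lterm_line[of n y] by (simp add: F_def norm_mult)
    then have "(LINT y|lborel. norm (F n y)) = norm (Lterm n (Complex (3/4) 0)) * (LINT y|lborel. norm (H y))" for n
      by simp
    then show "summable (\<lambda>n. LINT y|lborel. norm (F n y))" using sm(1) by (simp add: summable_mult2)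
  qed
  then have "(\<lambda>n. of_real (1 / (2 * pi)) * integral\<^sup>L lborel (F n)) sums (of_real (1 / (2 * pi)) * (LINT y|lborel. (\<Sum>n. F n y)))"
    by (rule sums_mult)
  moreover have "of_real (1 / (2 * pi)) * integral\<^sup>L lborel (F n)
      = of_real (t * sin x / (2 * pi) * (mangoldt (Suc n) * sqrt (Suc n) * (1 / Lden1 x t (Suc n) + 1 / Lden2 x t (Suc n))))" for n
    unfolding Jint_Lterm[symmetric] by (simp only: Jint_def vint_def F_def[abs_def] H_def)
  moreover have "(\<Sum>n. F n y) = H y * Lser (Complex (3/4) y + 1/2)" for y
    unfolding F_def using suminf_mult[OF sm(2)] L by simp
  moreover have "of_real (1 / (2 * pi)) * (LINT y|lborel. H y * Lser (Complex (3/4) y + 1/2)) = Jint x (ln t) (\<lambda>z. Lser (z + 1/2))"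
    by (simp only: Jint_def vint_def H_def)
  ultimately show ?thesis by (simp only:)
qed

end

section \<open>The series \<open>\<Sum>n. \<Lambda>(n) n\<^bsup>-3/2\<^esup>\<close>\<close>

text \<open>Each logarithm is reduced to log 2 and one of log (3/2), log (5/4), log (8/7), whose
  arguments are close enough to 1 for three terms of the expansion.\<close>

lemma ln_small_bounds:
  "0.6931 \<le> ln (2::real)" "ln (2::real) \<le> 0.6932"
  "1.0985 \<le> ln (3::real)" "ln (3::real) \<le> 1.0987"
  "1.6093 \<le> ln (5::real)" "ln (5::real) \<le> 1.6096"
  "1.9456 \<le> ln (7::real)" "ln (7::real) \<le> 1.9461"
proof -
  show 2: "0.6931 \<le> ln (2::real)" "ln (2::real) \<le> 0.6932"
    using ln_approx_bounds[of 2 5] by (simp_all add: eval_nat_numeral)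
  have "0.4054 \<le> ln (3/2::real)" "ln (3/2::real) \<le> 0.4055"
    using ln_approx_bounds[of "3/2" 3] by (simp_all add: eval_nat_numeral)
  moreover have "ln (3/2::real) = ln 3 - ln 2" by (simp add: ln_div)
  ultimately show "1.0985 \<le> ln (3::real)" "ln (3::real) \<le> 1.0987" using 2 by linarith+
  have "0.2231 \<le> ln (5/4::real)" "ln (5/4::real) \<le> 0.2232"
    using ln_approx_bounds[of "5/4" 3] by (simp_all add: eval_nat_numeral)
  moreover have "ln (5/4::real) = ln 5 - 2 * ln 2" using ln_realpow[of 2 2] by (simp add: ln_div)
  ultimately show "1.6093 \<le> ln (5::real)" "ln (5::real) \<le> 1.6096" using 2 by linarith+
  have "0.1335 \<le> ln (8/7::real)" "ln (8/7::real) \<le> 0.1336"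
    using ln_approx_bounds[of "8/7" 3] by (simp_all add: eval_nat_numeral)
  moreover have "ln (8/7::real) = 3 * ln 2 - ln 7" using ln_realpow[of 2 3] by (simp add: ln_div)
  ultimately show "1.9456 \<le> ln (7::real)" "ln (7::real) \<le> 1.9461" using 2 by linarith+
qed

lemma ln_composite: "ln (4::real) = 2 * ln 2" "ln (6::real) = ln 2 + ln 3" "ln (8::real) = 3 * ln 2" "ln (9::real) = 2 * ln 3"
  using ln_realpow[of 2 2] ln_realpow[of 2 3] ln_realpow[of 3 2] ln_mult_pos[of 2 3] by simp_all

lemma sqrt_small_bounds:
  "1.4142 \<le> sqrt 2" "sqrt 2 \<le> 1.4143" "1.7320 \<le> sqrt 3" "sqrt 3 \<le> 1.7321" "2.2360 \<le> sqrt 5" "sqrt 5 \<le> 2.2361"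
  "2.4494 \<le> sqrt 6" "sqrt 6 \<le> 2.4495" "2.6457 \<le> sqrt 7" "sqrt 7 \<le> 2.6458" "2.8284 \<le> sqrt 8" "sqrt 8 \<le> 2.8285" "sqrt 4 = 2" "sqrt 9 = 3"
proof -
  have 4: "sqrt 4 = sqrt (2\<^sup>2)" and 9: "sqrt 9 = sqrt (3\<^sup>2)" by simp_all
  show "sqrt 4 = 2" "sqrt 9 = 3" unfolding 4 9 by (simp_all only: real_sqrt_abs abs_numeral)
qed (rule real_le_rsqrt real_le_lsqrt; simp add: power2_eq_square)+

definition mang32 :: "nat \<Rightarrow> real" where
  "mang32 n = mangoldt n / (real n * sqrt (real n))"

lemma mang32_nonneg: "mang32 n \<ge> 0"
  by (simp add: mang32_def mangoldt_nonneg)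

lemma mangoldt_numerals:
  "(mangoldt 1 :: real) = 0" "(mangoldt 2 :: real) = ln 2" "(mangoldt 3 :: real) = ln 3" "(mangoldt 4 :: real) = ln 2"
  "(mangoldt 5 :: real) = ln 5" "(mangoldt 7 :: real) = ln 7" "(mangoldt 8 :: real) = ln 2"
  "(mangoldt 9 :: real) = ln 3" "(mangoldt 6 :: real) = 0"
proof -
  have p: "prime (2::nat)" "prime (3::nat)" "prime (5::nat)" "prime (7::nat)" by simp_all
  show "(mangoldt 1 :: real) = 0" by simp
  show "(mangoldt 2 :: real) = ln 2" "(mangoldt 3 :: real) = ln 3" "(mangoldt 5 :: real) = ln 5" "(mangoldt 7 :: real) = ln 7"
    using p by simp_all
  show "(mangoldt 4 :: real) = ln 2" "(mangoldt 8 :: real) = ln 2" "(mangoldt 9 :: real) = ln 3"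
    using mangoldt_primepow'[OF p(1), of 2, where ?'a = real] mangoldt_primepow'[OF p(1), of 3, where ?'a = real]
      mangoldt_primepow'[OF p(2), of 2, where ?'a = real] by simp_all
  have "\<not> primepow (6::nat)"
  proof
    assume "primepow (6::nat)"
    then obtain p k where pk: "prime p" "k > 0" "(6::nat) = p ^ k" unfolding primepow_def by blast
    have "2 dvd (6::nat)" "3 dvd (6::nat)" by presburger+
    then have "2 dvd p" "3 dvd p" unfolding pk(3) using p prime_dvd_power by blast+
    then have "2 = p" "3 = p" using pk(1) p primes_dvd_imp_eq by blast+
    then show False by simp
  qed
  then show "(mangoldt 6 :: real) = 0" by (simp add: mangoldt_def)
qed

lemma le_divide_mult:
  fixes c l n r u a :: real
  assumes "r \<le> u" "a \<le> l" "c * (n * u) \<le> a" "r > 0" "n > 0" "c > 0"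
  shows "c \<le> l / (n * r)"
proof -
  have "c * (n * r) \<le> c * (n * u)" using assms by (intro mult_left_mono) auto
  then have "c * (n * r) \<le> l" using assms by linarith
  then show ?thesis using assms by (simp add: le_divide_eq)
qed

lemma divide_mult_le:
  fixes c l n r u a :: real
  assumes "u \<le> r" "l \<le> a" "a \<le> c * (n * u)" "r > 0" "n > 0" "c > 0"
  shows "l / (n * r) \<le> c"
proof -
  have "c * (n * u) \<le> c * (n * r)" using assms by (intro mult_left_mono) auto
  then have "l \<le> c * (n * r)" using assms by linarith
  then show ?thesis using assms by (simp add: divide_le_eq)
qed

text \<open>Lower bounds are needed beside upper ones because the tails are found by subtracting
  initial terms from the whole sum.\<close>

lemma mang32_values:
  "0.245 \<le> mang32 2" "mang32 2 \<le> 0.2452" "0.2113 \<le> mang32 3" "mang32 3 \<le> 0.2116"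
  "0.0866 \<le> mang32 4" "mang32 4 \<le> 0.0867" "0.1438 \<le> mang32 5" "mang32 5 \<le> 0.1441" "mang32 6 = 0"
  "0.1050 \<le> mang32 7" "mang32 7 \<le> 0.1052" "0.0306 \<le> mang32 8" "0.0406 \<le> mang32 9" "mang32 0 = 0" "mang32 1 = 0"
proof -
  note b = sqrt_small_bounds ln_small_bounds
  show "0.245 \<le> mang32 2" "mang32 2 \<le> 0.2452"
    unfolding mang32_def mangoldt_numerals of_nat_numeral
    by (rule le_divide_mult[OF b(2) b(15)] divide_mult_le[OF b(1) b(16)]; simp)+
  show "0.2113 \<le> mang32 3" "mang32 3 \<le> 0.2116"
    unfolding mang32_def mangoldt_numerals of_nat_numeral
    by (rule le_divide_mult[OF b(4) b(17)] divide_mult_le[OF b(3) b(18)]; simp)+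
  show "0.0866 \<le> mang32 4" "mang32 4 \<le> 0.0867"
    unfolding mang32_def mangoldt_numerals of_nat_numeral b(13) using b(15,16) by simp_all
  show "0.1438 \<le> mang32 5" "mang32 5 \<le> 0.1441"
    unfolding mang32_def mangoldt_numerals of_nat_numeral
    by (rule le_divide_mult[OF b(6) b(19)] divide_mult_le[OF b(5) b(20)]; simp)+
  show "mang32 6 = 0" "mang32 0 = 0" "mang32 1 = 0" using mangoldt_numerals by (simp_all add: mang32_def)
  show "0.1050 \<le> mang32 7" "mang32 7 \<le> 0.1052"
    unfolding mang32_def mangoldt_numerals of_nat_numeral
    by (rule le_divide_mult[OF b(10) b(21)] divide_mult_le[OF b(9) b(22)]; simp)+
  show "0.0306 \<le> mang32 8"
    unfolding mang32_def mangoldt_numerals of_nat_numeral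
    by (rule le_divide_mult[OF b(12) b(15)]; simp)
  show "0.0406 \<le> mang32 9"
    unfolding mang32_def mangoldt_numerals of_nat_numeral b(14) using b(17,18) by simp
qed

text \<open>G x is the integral of log y / y^(3/2) from x to infinity, and the integrand decreases
  where log y >= 1.\<close>

lemma ln_32_le_diff:
  fixes x :: real
  assumes x: "x \<ge> 9"
  defines "G \<equiv> \<lambda>y::real. (2 * ln y + 4) / sqrt y"
  shows "ln x / (x * sqrt x) \<le> G (x - 1) - G x"
proof -
  define f where "f y = ln y / (y * sqrt y)" for y :: real
  have dln: "(ln has_real_derivative 1 / y) (at y)" if "y > 0" for y :: real
    using DERIV_ln_divide[OF that] .
  have dsq: "(sqrt has_real_derivative inverse (sqrt y) / 2) (at y)" if "y > 0" for y
    using DERIV_real_sqrt[OF that] .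
  have dG: "(G has_real_derivative - f y) (at y)" if y: "y > 0" for y
  proof -
    have "(G has_real_derivative (2 * (1 / y) * sqrt y - (2 * ln y + 4) * (inverse (sqrt y) / 2)) / (sqrt y * sqrt y)) (at y)"
    proof -
      have "((\<lambda>y. 2 * ln y + 4) has_real_derivative 2 * (1 / y)) (at y)"
        by (rule derivative_eq_intros dln[OF y] refl | simp)+
      from DERIV_divide[OF this dsq[OF y]] show ?thesis unfolding G_def using y by simp
    qed
    moreover have "(2 * (1 / (r * r)) * r - (2 * l + 4) * (inverse r / 2)) / (r * r) = - (l / (r * r * r))" if "r > 0" for r l :: real
      using that by (simp add: field_simps)
    from this[of "sqrt y" "ln y"] have "(2 * (1 / y) * sqrt y - (2 * ln y + 4) * (inverse (sqrt y) / 2)) / (sqrt y * sqrt y) = - f y"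
      using y by (simp add: f_def)
    ultimately show ?thesis by simp
  qed
  have df: "(f has_real_derivative (1 - 3 / 2 * ln y) / (y * (y * sqrt y))) (at y)" if y: "y > 0" for y
  proof -
    have "(f has_real_derivative ((1 / y) * (y * sqrt y) - ln y * (1 * sqrt y + y * (inverse (sqrt y) / 2))) / ((y * sqrt y) * (y * sqrt y))) (at y)"
    proof -
      have "((\<lambda>y. y * sqrt y) has_real_derivative (1 * sqrt y + y * (inverse (sqrt y) / 2))) (at y)"
        using DERIV_mult[OF DERIV_ident dsq[OF y]] by (simp add: mult.commute)
      from DERIV_divide[OF dln[OF y] this] show ?thesis unfolding f_def using y by simp
    qed
    moreover have "((1 / (r * r)) * (r * r * r) - l * (1 * r + r * r * (inverse r / 2))) / ((r * r * r) * (r * r * r)) = (1 - 3 / 2 * l) / (r * r * (r * r * r))" if "r > 0" for r l :: real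
      using that by (simp add: field_simps)
    from this[of "sqrt y" "ln y"] have "((1 / y) * (y * sqrt y) - ln y * (1 * sqrt y + y * (inverse (sqrt y) / 2))) / ((y * sqrt y) * (y * sqrt y)) = (1 - 3 / 2 * ln y) / (y * (y * sqrt y))"
      using y by simp
    ultimately show ?thesis by simp
  qed
  have "\<exists>z>x - 1. z < x \<and> G x - G (x - 1) = (x - (x - 1)) * - f z"
    by (rule MVT2) (use x dG in auto)
  then obtain z where z: "x - 1 < z" "z < x" "G x - G (x - 1) = - f z" by auto
  have "f x \<le> f z"
  proof (rule DERIV_nonpos_imp_nonincreasing[of z x f])
    fix y assume y: "z \<le> y" "y \<le> x"
    have "1 \<le> ln y"
    proof -
      have "exp 1 \<le> y" using exp_le y z x by linarith
      then show ?thesis using ln_mono[of "exp 1" y] by simp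
    qed
    then have "(1 - 3 / 2 * ln y) / (y * (y * sqrt y)) \<le> 0" using y z x by (intro divide_nonpos_nonneg) auto
    then show "\<exists>d. (f has_real_derivative d) (at y) \<and> d \<le> 0" using df[of y] y z x by auto
  qed (use z in auto)
  then show ?thesis using z by (simp add: f_def)
qed

lemma inverse_32_ge_diff:
  fixes x :: real
  assumes x: "x \<ge> 1"
  shows "2 / sqrt x - 2 / sqrt (x + 1) \<le> 1 / (x * sqrt x)"
proof -
  define a b where "a = sqrt x" and "b = sqrt (x + 1)"
  have ab: "a > 0" "a \<le> b" "b > 0" "a\<^sup>2 = x" "b\<^sup>2 = x + 1" using x by (auto simp: a_def b_def)
  have "(b - a) * (a + b) = 1" using ab by (simp add: power2_eq_square algebra_simps)
  then have "b - a = 1 / (a + b)" using ab by (simp add: field_simps)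
  moreover have "2 / a - 2 / b = 2 * (b - a) / (a * b)" using ab by (simp add: field_simps)
  ultimately have "2 / a - 2 / b = 2 / (a * b * (a + b))" by simp
  also have "\<dots> \<le> 2 / (a * a * (a + a))" using ab by (intro divide_left_mono mult_mono) auto
  also have "\<dots> = 1 / (x * a)" using ab by (simp add: power2_eq_square flip: ab(4))
  finally show ?thesis by (simp add: a_def b_def)
qed

lemma nat_powr_three_halves: "(of_nat (Suc n) :: complex) powr (3/2) = of_real (real (Suc n) * sqrt (real (Suc n)))"
proof -
  have "(of_nat (Suc n) :: complex) powr (3/2) = of_real (real (Suc n) powr (3/2))"
    using powr_of_real[of "real (Suc n)" "3/2"] by (simp del: of_nat_Suc)
  also have "real (Suc n) powr (3/2) = real (Suc n) powr 1 * real (Suc n) powr (1/2)"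
    by (subst powr_add[symmetric]) simp
  finally show ?thesis by (simp add: powr_half_sqrt del: of_nat_Suc)
qed

text \<open>By the convolution identity at s = 3/2 the sum is the quotient of the sums of log n /
  n^(3/2) and of n^(-3/2): the first is at most 3.9785, the second at least 2.592. In both, eight
  terms are computed and the rest is compared with an integral.\<close>

lemma mang32_sum:
  "summable mang32" "suminf mang32 \<le> 1.535"
proof -
  define l where "l n = ln (real (Suc n)) / (real (Suc n) * sqrt (real (Suc n)))" for n
  define g where "g n = 1 / (real (Suc n) * sqrt (real (Suc n)))" for n
  have e: "of_real (mangoldt (Suc n)) / (of_nat (Suc n)) powr (3/2) = complex_of_real (mang32 (Suc n))"
    "1 / (of_nat (Suc n)) powr (3/2) = complex_of_real (g n)"
    "of_real (ln (real (Suc n))) / (of_nat (Suc n)) powr (3/2) = complex_of_real (l n)" for n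
    unfolding nat_powr_three_halves mang32_def l_def g_def by (simp_all only: of_real_divide of_real_1)
  have h: "Re (3/2) > 1" by simp
  have sm: "summable (\<lambda>n. mang32 (Suc n))"
    using summable_Lser(2)[OF h] unfolding e summable_of_real_iff .
  have sl: "summable l"
    using summable_log_series(2)[OF _ _ h, of "\<lambda>n. ln (real (Suc n))"] unfolding e summable_of_real_iff by simp
  have sg: "summable g"
    using summable_dirichlet(1)[OF h] unfolding e summable_of_real_iff .
  show s: "summable mang32" using sm by (simp add: summable_Suc_iff)
  have M: "suminf mang32 = (\<Sum>n. mang32 (Suc n))" using suminf_split_head[OF s] by (simp add: mang32_def)
  have prod: "(\<Sum>n. mang32 (Suc n)) * suminf g = suminf l"
  proof -
    have "complex_of_real (\<Sum>n. mang32 (Suc n)) * of_real (suminf g) = of_real (suminf l)"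
      using Lser_mult_zeta[OF h] unfolding Lser_def e by (simp only: suminf_of_real sm sg sl)
    then show ?thesis unfolding of_real_mult[symmetric] of_real_eq_iff .
  qed
  define G where "G y = (2 * ln y + 4) / sqrt y" for y :: real
  have "suminf l \<le> 3.9785"
  proof -
    have t1: "(\<lambda>n. G (real (n + 8)) - G (real (Suc n + 8))) sums (G (real (0 + 8)) - 0)"
    proof (rule telescope_sums')
      show "(\<lambda>n. G (real (n + 8))) \<longlonglongrightarrow> 0" unfolding G_def by real_asymp
    qed
    have "(\<Sum>n. l (n + 8)) \<le> G 8"
    proof -
      have "(\<Sum>n. l (n + 8)) \<le> (\<Sum>n. G (real (n + 8)) - G (real (Suc n + 8)))"
      proof (rule suminf_le)
        show "l (n + 8) \<le> G (real (n + 8)) - G (real (Suc n + 8))" for n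
          using ln_32_le_diff[of "real (Suc (n + 8))"] by (simp add: l_def G_def add_ac)
        show "summable (\<lambda>n. l (n + 8))" using sl by (subst summable_iff_shift)
      qed (rule sums_summable[OF t1])
      then show ?thesis using sums_unique[OF t1] by simp
    qed
    moreover have "suminf l = (\<Sum>n. l (n + 8)) + (\<Sum>n<8. l n)" by (rule suminf_split_initial_segment[OF sl])
    moreover have "G 8 \<le> 2.88475"
    proof -
      have "2 * ln (8::real) + 4 \<le> 8.1592" unfolding ln_composite using ln_small_bounds by simp
      also have "\<dots> \<le> 2.88475 * sqrt 8" using sqrt_small_bounds by simp
      finally show ?thesis unfolding G_def by (simp add: divide_le_eq)
    qed
    moreover have "(\<Sum>n<8. l n) \<le> 1.0937"
    proof -
      have "(\<Sum>n<8. l n) = ln 2 / (2 * sqrt 2) + ln 3 / (3 * sqrt 3) + ln 4 / (4 * sqrt 4) + ln 5 / (5 * sqrt 5)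
        + ln 6 / (6 * sqrt 6) + ln 7 / (7 * sqrt 7) + ln 8 / (8 * sqrt 8)"
        by (simp add: l_def eval_nat_numeral)
      moreover note b = sqrt_small_bounds ln_small_bounds
      have "ln 2 / (2 * sqrt 2) \<le> (0.2452::real)" by (rule divide_mult_le[OF b(1) b(16)]; simp)
      moreover have "ln 3 / (3 * sqrt 3) \<le> (0.2116::real)" by (rule divide_mult_le[OF b(3) b(18)]; simp)
      moreover have "ln 4 / (4 * sqrt 4) \<le> (0.1734::real)" unfolding b(13) ln_composite using b(16) by simp
      moreover have "ln 5 / (5 * sqrt 5) \<le> (0.1441::real)" by (rule divide_mult_le[OF b(5) b(20)]; simp)
      moreover have "ln 6 / (6 * sqrt 6) \<le> (0.1221::real)"
      proof -
        have "ln 6 \<le> (1.7920::real)" unfolding ln_composite using b by simp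
        then show ?thesis by (rule divide_mult_le[OF b(7)]; simp)
      qed
      moreover have "ln 7 / (7 * sqrt 7) \<le> (0.1052::real)" by (rule divide_mult_le[OF b(9) b(22)]; simp)
      moreover have "ln 8 / (8 * sqrt 8) \<le> (0.0920::real)"
      proof -
        have "ln 8 \<le> (2.0796::real)" unfolding ln_composite using b by simp
        then show ?thesis by (rule divide_mult_le[OF b(11)]; simp)
      qed
      moreover have "S \<le> 1.0937" if "S = a + b + c + d + e + f + h" "a \<le> 0.2452" "b \<le> 0.2116" "c \<le> 0.1734" "d \<le> 0.1441"
        "e \<le> 0.1221" "f \<le> 0.1052" "h \<le> 0.0920" for S a b c d e f h :: real using that by simp
      ultimately show ?thesis by blast
    qed
    ultimately show ?thesis by simp
  qed
  moreover have "suminf g \<ge> 2.592"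
  proof -
    have t1: "(\<lambda>n. 2 / sqrt (real (n + 9)) - 2 / sqrt (real (Suc n + 9))) sums (2 / sqrt (real (0 + 9)) - 0)"
    proof (rule telescope_sums')
      show "(\<lambda>n. 2 / sqrt (real (n + 9))) \<longlonglongrightarrow> 0" by real_asymp
    qed
    have "2/3 \<le> (\<Sum>n. g (n + 8))"
    proof -
      have "(\<Sum>n. 2 / sqrt (real (n + 9)) - 2 / sqrt (real (Suc n + 9))) \<le> (\<Sum>n. g (n + 8))"
      proof (rule suminf_le)
        show "2 / sqrt (real (n + 9)) - 2 / sqrt (real (Suc n + 9)) \<le> g (n + 8)" for n
          using inverse_32_ge_diff[of "real (n + 9)"] by (simp add: g_def add_ac)
        show "summable (\<lambda>n. g (n + 8))" using sg by (subst summable_iff_shift)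
      qed (rule sums_summable[OF t1])
      then show ?thesis using sums_unique[OF t1] sqrt_small_bounds by simp
    qed
    moreover have "suminf g = (\<Sum>n. g (n + 8)) + (\<Sum>n<8. g n)" by (rule suminf_split_initial_segment[OF sg])
    moreover have "(\<Sum>n<8. g n) \<ge> 1.926"
    proof -
      have "(\<Sum>n<8. g n) = 1 + 1 / (2 * sqrt 2) + 1 / (3 * sqrt 3) + 1 / (4 * sqrt 4) + 1 / (5 * sqrt 5)
        + 1 / (6 * sqrt 6) + 1 / (7 * sqrt 7) + 1 / (8 * sqrt 8)"
        by (simp add: g_def eval_nat_numeral)
      moreover note b = sqrt_small_bounds
      have "0.3535 \<le> 1 / (2 * sqrt 2)" by (rule le_divide_mult[OF b(2) order_refl]; simp)
      moreover have "0.1924 \<le> 1 / (3 * sqrt 3)" by (rule le_divide_mult[OF b(4) order_refl]; simp)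
      moreover have "0.125 \<le> 1 / (4 * sqrt 4)" unfolding b(13) by simp
      moreover have "0.0894 \<le> 1 / (5 * sqrt 5)" by (rule le_divide_mult[OF b(6) order_refl]; simp)
      moreover have "0.0680 \<le> 1 / (6 * sqrt 6)" by (rule le_divide_mult[OF b(8) order_refl]; simp)
      moreover have "0.0539 \<le> 1 / (7 * sqrt 7)" by (rule le_divide_mult[OF b(10) order_refl]; simp)
      moreover have "0.0441 \<le> 1 / (8 * sqrt 8)" by (rule le_divide_mult[OF b(12) order_refl]; simp)
      moreover have "1.926 \<le> S" if "S = 1 + a + b + c + d + e + f + h" "0.3535 \<le> a" "0.1924 \<le> b" "0.125 \<le> c" "0.0894 \<le> d"
        "0.0680 \<le> e" "0.0539 \<le> f" "0.0441 \<le> h" for S a b c d e f h :: real using that by simp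
      ultimately show ?thesis by blast
    qed
    ultimately show ?thesis by simp
  qed
  ultimately have "(\<Sum>n. mang32 (Suc n)) * suminf g \<le> 3.9785" "suminf g \<ge> 2.592" using prod by simp_all
  moreover have "(\<Sum>n. mang32 (Suc n)) \<ge> 0" by (rule suminf_nonneg[OF sm]) (rule mang32_nonneg)
  ultimately have "(\<Sum>n. mang32 (Suc n)) * 2.592 \<le> 3.9785"
    by (meson mult_left_mono order_trans)
  then show "suminf mang32 \<le> 1.535" unfolding M by simp
qed

section \<open>The prime powers away from \<open>t\<close>\<close>

text \<open>Convexity through the tangent at the intermediate point y: the tangent values at a and b
  average to 1 / y^2.\<close>

lemma inverse_square_chord:
  fixes a b f :: real
  assumes ab: "a > 0" "b > 0" and f: "0 \<le> f" "f \<le> 1"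
  shows "1 / ((1 - f) * a + f * b)\<^sup>2 \<le> (1 - f) / a\<^sup>2 + f / b\<^sup>2"
proof -
  define y where "y = (1 - f) * a + f * b"
  have y: "y > 0"
  proof (cases "f = 0")
    case False
    then show ?thesis unfolding y_def using ab f by (intro add_nonneg_pos mult_pos_pos mult_nonneg_nonneg) auto
  qed (use ab in \<open>simp add: y_def\<close>)
  have tan: "1 / y\<^sup>2 - 2 * (x - y) / y ^ 3 \<le> 1 / x\<^sup>2" if x: "x > 0" for x
  proof -
    have "1 / x\<^sup>2 - (1 / y\<^sup>2 - 2 * (x - y) / y ^ 3) = (x - y)\<^sup>2 * (2 * x + y) / (x\<^sup>2 * y ^ 3)"
      using x y by (simp add: field_simps power2_eq_square power3_eq_cube)
    moreover have "(x - y)\<^sup>2 * (2 * x + y) / (x\<^sup>2 * y ^ 3) \<ge> 0" using x y by simp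
    ultimately show ?thesis by linarith
  qed
  have "(1 - f) * (1 / y\<^sup>2 - 2 * (a - y) / y ^ 3) + f * (1 / y\<^sup>2 - 2 * (b - y) / y ^ 3) \<le> (1 - f) * (1 / a\<^sup>2) + f * (1 / b\<^sup>2)"
    using f ab by (intro add_mono mult_left_mono tan) auto
  also have "(1 - f) * (1 / y\<^sup>2 - 2 * (a - y) / y ^ 3) + f * (1 / y\<^sup>2 - 2 * (b - y) / y ^ 3) = 1 / y\<^sup>2 - 2 * ((1 - f) * a + f * b - y) / y ^ 3"
    using y by (simp add: field_simps)
  finally show ?thesis by (simp add: y_def)
qed

lemma sum_inverse_squares_le: "(\<Sum>k=1..n. 1 / (real k)\<^sup>2) \<le> 1.645"
proof -
  have "(\<Sum>k=1..n. 1 / (real k)\<^sup>2) = (\<Sum>k<n. 1 / (real k + 1)\<^sup>2)"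
    by (rule sum.reindex_bij_witness[of _ Suc "\<lambda>k. k - 1"]) auto
  also have "\<dots> \<le> pi\<^sup>2 / 6"
    using sum_le_suminf[OF sums_summable[OF inverse_squares_sums], of "{..<n}"] sums_unique[OF inverse_squares_sums]
    by (simp add: add.commute)
  also have "pi\<^sup>2 \<le> 3.1416\<^sup>2" using pi_approx pi_gt3 by (intro power_mono) auto
  then have "pi\<^sup>2 / 6 \<le> 1.645" by (simp add: power2_eq_square)
  finally show ?thesis .
qed

lemma inverse_le_ln_diff: "d > 1/2 \<Longrightarrow> 1 / d \<le> ln (d + 1/2) - ln (d - 1/2)" for d :: real
  using ln_inverse_approx_ge[of "d - 1/2" "d + 1/2"] by simp

text \<open>The right side is the tangent at t of the concave function sqrt n log n. Divided by (n -
  t)^2 it leaves log t / (n - t)^2 and a harmonic term.\<close>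

lemma sqrt_mult_ln_le:
  fixes t n :: real
  assumes t: "1 \<le> t" "t < n"
  shows "sqrt n * ln n \<le> sqrt t * (ln t + (n - t) / t * (1 + ln t / 2))"
proof -
  define y where "y = (n - t) / t"
  have y: "y > 0" "n = t * (1 + y)" using t by (auto simp: y_def field_simps)
  define s where "s = sqrt (1 + y)"
  have s: "s > 1" "s\<^sup>2 = 1 + y" using y by (auto simp: s_def)
  have s1: "s \<le> 1 + y / 2"
  proof -
    have "0 \<le> (s - 1)\<^sup>2" by simp
    then show ?thesis using s(2) by (simp add: power2_eq_square algebra_simps)
  qed
  \<comment> \<open>The trapezoidal bound for the integral of 1 / u, giving 2 s log s <= s^2 -
    1.\<close>
  have "ln s - ln 1 \<le> (s - 1) * (inverse 1 + inverse s) / 2"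
    using ln_inverse_approx_le[of 1 "s - 1"] s by simp
  also have "\<dots> = (s\<^sup>2 - 1) / (2 * s)" using s by (simp add: field_simps power2_eq_square)
  finally have "2 * s * ln s \<le> s\<^sup>2 - 1" using s(1) by (simp add: field_simps)
  then have s2: "s * ln (1 + y) \<le> y" using s ln_realpow[of s 2] by simp
  have "sqrt n = sqrt t * s" unfolding y(2) s_def by (rule real_sqrt_mult)
  moreover have "ln n = ln t + ln (1 + y)" unfolding y(2) using y(1) t by (intro ln_mult_pos) auto
  ultimately have "sqrt n * ln n = sqrt t * (s * ln t + s * ln (1 + y))" by (simp add: algebra_simps)
  also have "\<dots> \<le> sqrt t * ((1 + y / 2) * ln t + y)"
    using s1 s2 t by (intro mult_left_mono add_mono mult_right_mono) auto
  also have "\<dots> = sqrt t * (ln t + y * (1 + ln t / 2))" by (simp add: algebra_simps)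
  finally show ?thesis by (simp add: y_def)
qed

lemma mangoldt_sqrt: "mangoldt n * sqrt (real n) = (real n)\<^sup>2 * mang32 n"
proof (cases "n = 0")
  case False
  have "real n / sqrt (real n) = sqrt (real n)" by (rule real_div_sqrt) simp
  moreover have "(real n)\<^sup>2 * mang32 n = mangoldt n * (real n / sqrt (real n))"
    using False by (simp add: mang32_def power2_eq_square)
  ultimately show ?thesis by simp
qed (simp add: mang32_def)

lemma mangoldt_le_ln: "n \<ge> 1 \<Longrightarrow> (mangoldt n :: real) \<le> ln (real n)"
  using mangoldt_le[of n] by simp

section \<open>Weights of the two prime sums and their estimates by ranges of n\<close>

definition mang32_tail :: "nat \<Rightarrow> real" where
  "mang32_tail N = (\<Sum>n. mang32 (n + N))"

lemma mang32_tail_eq: "mang32_tail N = suminf mang32 - (\<Sum>n<N. mang32 n)"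
  unfolding mang32_tail_def using suminf_split_initial_segment[OF mang32_sum(1), of N] by simp

lemma mang32_tail_values: "mang32_tail 7 \<le> 0.8483" "mang32_tail 8 \<le> 0.7433" "mang32_tail 10 \<le> 0.6721"
proof -
  have e: "(\<Sum>n<7. mang32 n) = mang32 0 + mang32 1 + mang32 2 + mang32 3 + mang32 4 + mang32 5 + mang32 6"
    "(\<Sum>n<8. mang32 n) = (\<Sum>n<7. mang32 n) + mang32 7"
    "(\<Sum>n<10. mang32 n) = (\<Sum>n<8. mang32 n) + mang32 8 + mang32 9"
    by (simp_all add: eval_nat_numeral)
  show "mang32_tail 7 \<le> 0.8483" "mang32_tail 8 \<le> 0.7433" "mang32_tail 10 \<le> 0.6721"
    unfolding mang32_tail_eq e using mang32_values mang32_sum(2) by simp_all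
qed

definition dual_weight :: "real \<Rightarrow> nat \<Rightarrow> real" where
  "dual_weight t n = mangoldt n * sqrt (real n) / (real n * t - 1)\<^sup>2"

text \<open>The two integers next to t, where the denominator may be small or zero, are left out;
  their exact terms account for F(t) and Lambda (t).\<close>

definition far_weight :: "real \<Rightarrow> nat \<Rightarrow> real" where
  "far_weight t n = (if n = nat \<lfloor>t\<rfloor> \<or> n = nat \<lfloor>t\<rfloor> + 1 then 0 else mangoldt n * sqrt (real n) / (real n - t)\<^sup>2)"

lemma weight_nonneg: "dual_weight t n \<ge> 0" "far_weight t n \<ge> 0"
  by (auto simp: dual_weight_def far_weight_def mangoldt_nonneg)

text \<open>Lambda (1) = 0, and n, t >= 2 give n t - 1 >= 3/4 n t, whence 16/9.\<close>

lemma dual_weight_le: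
  assumes t: "t \<ge> 2"
  shows "dual_weight t n \<le> 16 / 9 / t\<^sup>2 * mang32 n"
proof (cases "n \<le> 1")
  case True
  then have "n = 0 \<or> n = 1" by auto
  then show ?thesis using mang32_values by (auto simp: dual_weight_def)
next
  case False
  then have n: "real n \<ge> 2" by simp
  have "2 * 2 \<le> real n * t" using n t by (intro mult_mono) auto
  then have "3 / 4 * (real n * t) \<le> real n * t - 1" by linarith
  then have "(3 / 4 * (real n * t))\<^sup>2 \<le> (real n * t - 1)\<^sup>2" using n t by (intro power_mono) auto
  then have "dual_weight t n \<le> (real n)\<^sup>2 * mang32 n / (3 / 4 * (real n * t))\<^sup>2"
    unfolding dual_weight_def mangoldt_sqrt using n t mang32_nonneg by (intro divide_left_mono mult_nonneg_nonneg mult_pos_pos) (auto intro!: zero_less_power)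
  also have "\<dots> = 16 / 9 / t\<^sup>2 * mang32 n" using n t by (simp add: power2_eq_square)
  finally show ?thesis .
qed

text \<open>n > 3 t gives n - t >= 2/3 n, whence 9/4.\<close>

lemma tail_weight_le:
  assumes t: "t > 0" "real n > 3 * t"
  shows "mangoldt n * sqrt (real n) / (real n - t)\<^sup>2 \<le> 9 / 4 * mang32 n"
proof -
  have "2 / 3 * real n \<le> real n - t" using t by simp
  then have "(2 / 3 * real n)\<^sup>2 \<le> (real n - t)\<^sup>2" using t by (intro power_mono) auto
  then have "mangoldt n * sqrt (real n) / (real n - t)\<^sup>2 \<le> (real n)\<^sup>2 * mang32 n / (2 / 3 * real n)\<^sup>2"
    unfolding mangoldt_sqrt using t mang32_nonneg by (intro divide_left_mono mult_nonneg_nonneg mult_pos_pos) (auto intro!: zero_less_power)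
  also have "\<dots> = 9 / 4 * mang32 n" using t by (simp add: power2_eq_square)
  finally show ?thesis .
qed

lemma nat_floor_bounds: "t \<ge> 1 \<Longrightarrow> real (nat \<lfloor>t\<rfloor>) \<le> t \<and> t < real (nat \<lfloor>t\<rfloor>) + 1"
  by linarith

text \<open>Five ranges: n <= 1 and the neighbours of t give nothing; 2 <= n < m uses Lambda (n) <=
  log t; m + 2 <= n <= 3 t uses the tangent bound; beyond 3 t the comparison series takes over, from
  a starting point \<open>N0\<close> that later depends on the range of t.\<close>

lemma far_weight_sum_le:
  assumes t: "t \<ge> 2" and N0: "\<And>n. real n > 3 * t \<Longrightarrow> n \<ge> N0"
  defines "m \<equiv> nat \<lfloor>t\<rfloor>" and "M \<equiv> nat \<lfloor>3 * t\<rfloor>"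
  shows "summable (far_weight t)"
    and "suminf (far_weight t) \<le> 9 / 4 * mang32_tail N0
      + sqrt t * (ln t * ((\<Sum>n\<in>{2..<m}. 1 / (t - real n)\<^sup>2) + (\<Sum>n\<in>{m + 2..M}. 1 / (real n - t)\<^sup>2))
           + (1 + ln t / 2) / t * (\<Sum>n\<in>{m + 2..M}. 1 / (real n - t)))"
proof -
  have m: "real m \<le> t" "t < real m + 1" "2 \<le> m" unfolding m_def using t nat_floor_bounds[of t] by (auto simp: le_nat_floor)
  have M: "n \<le> M \<longleftrightarrow> real n \<le> 3 * t" for n unfolding M_def using t by (simp add: le_nat_iff le_floor_iff)
  define B where "B n = (if n \<ge> N0 then mang32 n else 0)" for n
  define l where "l n = (if n \<in> {2..<m} then sqrt t * (ln t * (1 / (t - real n)\<^sup>2)) else 0)" for n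
  define r where "r n = (if n \<in> {m + 2..M} then sqrt t * (ln t * (1 / (real n - t)\<^sup>2) + (1 + ln t / 2) / t * (1 / (real n - t))) else 0)" for n
  have B0: "B n \<ge> 0" for n by (simp add: B_def mang32_nonneg)
  have le: "far_weight t n \<le> 9 / 4 * B n + (l n + r n)" for n
  proof -
    consider "n \<le> 1" | "n \<in> {2..<m}" | "n = m \<or> n = m + 1" | "n \<in> {m + 2..M}" | "n \<ge> m + 2" "n > M"
      by (cases "n \<le> 1"; cases "n < m"; cases "n \<le> m + 1"; cases "n \<le> M"; force)
    then show ?thesis
    proof cases
      case 1
      then have "n = 0 \<or> n = 1" by auto
      then have "far_weight t n = 0" by (auto simp: far_weight_def)
      moreover have "l n = 0" "r n = 0" using 1 by (auto simp: l_def r_def)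
      ultimately show ?thesis using B0[of n] by simp
    next
      case 2
      have n: "n \<ge> 1" "real n \<le> t" using 2 m by auto
      have "mangoldt n * sqrt (real n) \<le> ln t * sqrt t"
        using n mangoldt_le_ln[of n] by (intro mult_mono order_trans[OF mangoldt_le_ln]) (auto simp: mangoldt_nonneg)
      then have "mangoldt n * sqrt (real n) / (real n - t)\<^sup>2 \<le> ln t * sqrt t / (real n - t)\<^sup>2" by (intro divide_right_mono) auto
      also have "\<dots> = l n" using 2 by (simp add: l_def power2_commute)
      moreover have "far_weight t n = mangoldt n * sqrt (real n) / (real n - t)\<^sup>2" using 2 by (simp add: far_weight_def m_def)
      moreover have "r n = 0" using 2 by (simp add: r_def)
      ultimately show ?thesis using B0[of n] by simp
    next
      case 3
      then have "far_weight t n = 0" by (auto simp: far_weight_def m_def)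
      moreover have "l n = 0" "r n = 0" using 3 by (auto simp: l_def r_def)
      ultimately show ?thesis using B0[of n] by simp
    next
      case 4
      have n: "n \<ge> 1" "real n > t" using 4 m by auto
      have "mangoldt n * sqrt (real n) \<le> ln (real n) * sqrt (real n)"
        using mangoldt_le_ln[OF n(1)] by (intro mult_right_mono) auto
      also have "\<dots> = sqrt (real n) * ln (real n)" by (rule mult.commute)
      also have "\<dots> \<le> sqrt t * (ln t + (real n - t) / t * (1 + ln t / 2))" using n t by (intro sqrt_mult_ln_le) auto
      finally have "mangoldt n * sqrt (real n) / (real n - t)\<^sup>2 \<le> sqrt t * (ln t + (real n - t) / t * (1 + ln t / 2)) / (real n - t)\<^sup>2"
        by (intro divide_right_mono) auto
      also have "\<dots> = r n"
      proof -
        have "q * (a + d / t * b) / d\<^sup>2 = q * (a * (1 / d\<^sup>2) + b / t * (1 / d))" if "d \<noteq> 0" for q a b d :: real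
          using that t by (simp add: field_simps power2_eq_square)
        then show ?thesis using 4 n by (simp add: r_def)
      qed
      moreover have "far_weight t n = mangoldt n * sqrt (real n) / (real n - t)\<^sup>2" using 4 by (simp add: far_weight_def m_def)
      moreover have "l n = 0" using 4 by (simp add: l_def)
      ultimately show ?thesis using B0[of n] by simp
    next
      case 5
      have n: "real n > 3 * t" using 5 M[of n] by simp
      have "far_weight t n \<le> 9 / 4 * mang32 n"
        using tail_weight_le[OF _ n] 5 t by (simp add: far_weight_def m_def)
      moreover have "l n = 0" "r n = 0" "B n = mang32 n" using 5 N0[OF n] by (auto simp: l_def r_def B_def)
      ultimately show ?thesis by simp
    qed
  qed
  have Bs: "summable B"
    by (rule summable_comparison_test'[OF mang32_sum(1), of 0]) (auto simp: B_def mang32_nonneg)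
  have Bt: "suminf B = mang32_tail N0"
    unfolding mang32_tail_def using suminf_split_initial_segment[OF Bs, of N0] by (simp add: B_def)
  have ls: "l sums (\<Sum>n\<in>{2..<m}. sqrt t * (ln t * (1 / (t - real n)\<^sup>2)))"
    unfolding l_def by (rule sums_If_finite_set) simp
  have rs: "r sums (\<Sum>n\<in>{m + 2..M}. sqrt t * (ln t * (1 / (real n - t)\<^sup>2) + (1 + ln t / 2) / t * (1 / (real n - t))))"
    unfolding r_def by (rule sums_If_finite_set) simp
  have tot: "(\<lambda>n. 9 / 4 * B n + (l n + r n)) sums (9 / 4 * mang32_tail N0 +
     ((\<Sum>n\<in>{2..<m}. sqrt t * (ln t * (1 / (t - real n)\<^sup>2))) +
      (\<Sum>n\<in>{m + 2..M}. sqrt t * (ln t * (1 / (real n - t)\<^sup>2) + (1 + ln t / 2) / t * (1 / (real n - t))))))"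
    unfolding Bt[symmetric] by (intro sums_add sums_mult summable_sums Bs ls rs)
  show s: "summable (far_weight t)"
    by (rule summable_comparison_test'[OF sums_summable[OF tot], of 0]) (use le weight_nonneg in auto)
  have "suminf (far_weight t) \<le> 9 / 4 * mang32_tail N0 +
     ((\<Sum>n\<in>{2..<m}. sqrt t * (ln t * (1 / (t - real n)\<^sup>2))) +
      (\<Sum>n\<in>{m + 2..M}. sqrt t * (ln t * (1 / (real n - t)\<^sup>2) + (1 + ln t / 2) / t * (1 / (real n - t)))))"
    using suminf_le[OF le s sums_summable[OF tot]] sums_unique[OF tot] by simp
  also have "(\<Sum>n\<in>{2..<m}. sqrt t * (ln t * (1 / (t - real n)\<^sup>2))) +
      (\<Sum>n\<in>{m + 2..M}. sqrt t * (ln t * (1 / (real n - t)\<^sup>2) + (1 + ln t / 2) / t * (1 / (real n - t))))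
      = sqrt t * (ln t * ((\<Sum>n\<in>{2..<m}. 1 / (t - real n)\<^sup>2) + (\<Sum>n\<in>{m + 2..M}. 1 / (real n - t)\<^sup>2))
           + (1 + ln t / 2) / t * (\<Sum>n\<in>{m + 2..M}. 1 / (real n - t)))"
    by (simp only: sum_distrib_left[symmetric] sum.distrib) (simp only: distrib_left add.assoc)
  finally show "suminf (far_weight t) \<le> 9 / 4 * mang32_tail N0
      + sqrt t * (ln t * ((\<Sum>n\<in>{2..<m}. 1 / (t - real n)\<^sup>2) + (\<Sum>n\<in>{m + 2..M}. 1 / (real n - t)\<^sup>2))
           + (1 + ln t / 2) / t * (\<Sum>n\<in>{m + 2..M}. 1 / (real n - t)))" .
qed

text \<open>With f the fractional part of t the distances are k + f on the left and k + 1 - f on the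
  right, k >= 1. The chord inequality on [k, k + 1] bounds such a pair by 1/k^2 + 1/(k + 1)^2, so
  the total is at most 2 * 1.645 - 1 = 2.29. The harmonic sum is compared with logarithms at
  half-integer offsets.\<close>

lemma neighbour_sums_le:
  assumes t: "t \<ge> 2"
  defines "m \<equiv> nat \<lfloor>t\<rfloor>" and "M \<equiv> nat \<lfloor>3 * t\<rfloor>"
  shows "(\<Sum>n\<in>{m + 2..M}. 1 / (real n - t)\<^sup>2) \<le> 1.645"
    and "(\<Sum>n\<in>{2..<m}. 1 / (t - real n)\<^sup>2) + (\<Sum>n\<in>{m + 2..M}. 1 / (real n - t)\<^sup>2) \<le> 2.29"
    and "(\<Sum>n\<in>{m + 2..M}. 1 / (real n - t)) \<le> ln (4 * t + 1)"
proof -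
  have m: "real m \<le> t" "t < real m + 1" "2 \<le> m" unfolding m_def using t nat_floor_bounds[of t] by (auto simp: le_nat_floor)
  have M: "real M \<le> 3 * t" "m + 2 \<le> Suc M" unfolding M_def m_def using t by linarith+
  define f where "f = t - real m"
  have f: "0 \<le> f" "f \<le> 1" using m by (auto simp: f_def)
  define R where "R k = 1 / (real k + 1 - f)\<^sup>2" for k
  define L where "L k = 1 / (real k + f)\<^sup>2" for k
  have nn: "R k \<ge> 0" "L k \<ge> 0" for k by (auto simp: R_def L_def)
  have "(\<Sum>n\<in>{m + 2..M}. 1 / (real n - t)\<^sup>2) = (\<Sum>k=1..M - (m + 1). R k)"
    by (rule sum.reindex_bij_witness[of _ "\<lambda>k. k + (m + 1)" "\<lambda>n. n - (m + 1)"]) (auto simp: R_def f_def of_nat_diff algebra_simps)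
  also have "\<dots> \<le> (\<Sum>k=1..M. R k)" using nn by (intro sum_mono2) auto
  finally have Rc: "(\<Sum>n\<in>{m + 2..M}. 1 / (real n - t)\<^sup>2) \<le> (\<Sum>k=1..M. R k)" .
  have "(\<Sum>n\<in>{2..<m}. 1 / (t - real n)\<^sup>2) = (\<Sum>k=1..m - 2. L k)"
    by (rule sum.reindex_bij_witness[of _ "\<lambda>k. m - k" "\<lambda>n. m - n"]) (auto simp: L_def f_def of_nat_diff algebra_simps)
  also have "\<dots> \<le> (\<Sum>k=1..M. L k)" using nn M by (intro sum_mono2) auto
  finally have Lc: "(\<Sum>n\<in>{2..<m}. 1 / (t - real n)\<^sup>2) \<le> (\<Sum>k=1..M. L k)" .
  have "(\<Sum>k=1..M. R k) \<le> (\<Sum>k=1..M. 1 / (real k)\<^sup>2)"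
    unfolding R_def using f by (intro sum_mono divide_left_mono power_mono) (auto intro!: mult_pos_pos zero_less_power)
  then show "(\<Sum>n\<in>{m + 2..M}. 1 / (real n - t)\<^sup>2) \<le> 1.645" using Rc sum_inverse_squares_le[of M] by linarith
  have pair: "L k + R k \<le> 1 / (real k)\<^sup>2 + 1 / (real (Suc k))\<^sup>2" if k: "k \<ge> 1" for k
  proof -
    have e1: "(1 - f) * real k + f * (real k + 1) = real k + f" by (simp add: algebra_simps)
    have e2: "(1 - (1 - f)) * real k + (1 - f) * (real k + 1) = real k + 1 - f" by (simp add: algebra_simps)
    have "L k \<le> (1 - f) / (real k)\<^sup>2 + f / (real k + 1)\<^sup>2"
      using inverse_square_chord[of "real k" "real k + 1" f] k f unfolding e1 L_def by simp
    moreover have "R k \<le> (1 - (1 - f)) / (real k)\<^sup>2 + (1 - f) / (real k + 1)\<^sup>2"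
      using inverse_square_chord[of "real k" "real k + 1" "1 - f"] k f unfolding e2 R_def by simp
    ultimately have "L k + R k \<le> ((1 - f) / (real k)\<^sup>2 + f / (real k + 1)\<^sup>2) + ((1 - (1 - f)) / (real k)\<^sup>2 + (1 - f) / (real k + 1)\<^sup>2)"
      by (rule add_mono)
    also have "\<dots> = 1 / (real k)\<^sup>2 + 1 / (real k + 1)\<^sup>2" by (simp add: diff_divide_distrib)
    finally show ?thesis by (simp add: add.commute)
  qed
  have "(\<Sum>k=1..M. L k) + (\<Sum>k=1..M. R k) \<le> (\<Sum>k=1..M. 1 / (real k)\<^sup>2 + 1 / (real (Suc k))\<^sup>2)"
    unfolding sum.distrib[symmetric] by (intro sum_mono pair) auto
  also have "\<dots> = (\<Sum>k=1..M. 1 / (real k)\<^sup>2) + (\<Sum>k=1..M. 1 / (real (Suc k))\<^sup>2)" by (rule sum.distrib)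
  also have "(\<Sum>k=1..M. 1 / (real (Suc k))\<^sup>2) = (\<Sum>k=2..Suc M. 1 / (real k)\<^sup>2)"
    by (rule sum.reindex_bij_witness[of _ "\<lambda>k. k - 1" Suc]) auto
  also have "\<dots> = (\<Sum>k=1..Suc M. 1 / (real k)\<^sup>2) - 1"
    by (subst (2) sum.atLeast_Suc_atMost) (auto simp: numeral_2_eq_2)
  finally have "(\<Sum>k=1..M. L k) + (\<Sum>k=1..M. R k) \<le> 2.29"
    using sum_inverse_squares_le[of M] sum_inverse_squares_le[of "Suc M"] by simp
  then show "(\<Sum>n\<in>{2..<m}. 1 / (t - real n)\<^sup>2) + (\<Sum>n\<in>{m + 2..M}. 1 / (real n - t)\<^sup>2) \<le> 2.29"
    using Lc Rc by linarith
  have "(\<Sum>n\<in>{m + 2..M}. 1 / (real n - t)) \<le> (\<Sum>n=m + 2..M. ln (real (Suc n) - t - 1/2) - ln (real n - t - 1/2))"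
  proof (rule sum_mono)
    fix n assume "n \<in> {m + 2..M}"
    then have "real n - t > 1/2" using m by auto
    from inverse_le_ln_diff[OF this] show "1 / (real n - t) \<le> ln (real (Suc n) - t - 1/2) - ln (real n - t - 1/2)"
      by (simp add: algebra_simps)
  qed
  also have "\<dots> = ln (real (Suc M) - t - 1/2) - ln (real (m + 2) - t - 1/2)"
    by (rule sum_Suc_diff[OF M(2)])
  \<comment> \<open>M <= 3 t bounds the upper argument by 2 t + 1/2, and t < m + 1 keeps the lower
    one above 1/2.\<close>
  also have "\<dots> \<le> ln (2 * t + 1/2) - ln (1/2)"
    using M m t by (intro diff_mono ln_mono) auto
  also have "\<dots> = ln (4 * t + 1)" using t ln_div[of "2 * t + 1/2" "1/2"] by (simp add: algebra_simps)
  finally show "(\<Sum>n\<in>{m + 2..M}. 1 / (real n - t)) \<le> ln (4 * t + 1)" .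
qed


text \<open>What remains after division by t: 1.5123 covers 9/4 of the tail from n = 10 on, 2.729
  covers 16/9 * 1.535, 0.71 = 3 - 2.29, and 4.93 < pi^2 / 2. Put t = 3 exp w, use t >= 3 (1 + w) and
  compare polynomials in w.\<close>

lemma log_ineq_ge_3:
  fixes t :: real
  assumes t: "t \<ge> 3"
  shows "1.5123 * sqrt t + 2.729 / (t * sqrt t) + (1 + ln t / 2) * ln (4 * t + 1) < 0.71 * t * ln t + 4.93"
proof -
  define v w where "v = ln t" and "w = ln (t / 3)"
  have w: "w \<ge> 0" using t by (simp add: w_def)
  have vw: "v = ln 3 + w" using t by (simp add: v_def w_def ln_div)
  have v: "1.0985 + w \<le> v" "v \<le> 1.0987 + w" using ln_small_bounds vw by auto
  have tw: "3 * (1 + w) \<le> t"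
  proof -
    have "1 + w \<le> exp w" by (rule exp_ge_add_one_self)
    also have "exp w = t / 3" using t by (simp add: w_def)
    finally show ?thesis by simp
  qed
  have l: "ln (4 * t + 1) \<le> v + 1.4764"
  proof -
    have "ln (4 * t + 1) \<le> ln (t * (5 * 7 / 8))" using t by (intro ln_mono) auto
    also have "\<dots> = v + (ln 5 + ln 7 - ln 8)" using t ln_mult_pos[of 5 7] by (simp add: v_def ln_mult_pos ln_div)
    also have "\<dots> \<le> v + 1.4764" unfolding ln_composite using ln_small_bounds by simp
    finally show ?thesis .
  qed
  \<comment> \<open>The arithmetic-geometric mean inequality for t and 3, sharp up to rounding at t
    = 3.\<close>
  have s: "sqrt t \<le> 0.8661 + 0.2887 * t"
  proof -
    have "sqrt t * sqrt 3 \<le> (t + 3) / 2" using arith_geo_mean_sqrt[of t 3] t by (simp add: real_sqrt_mult)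
    moreover have "sqrt t * 1.7320 \<le> sqrt t * sqrt 3" using sqrt_small_bounds t by (intro mult_left_mono) auto
    ultimately have "sqrt t * 1.7320 \<le> (t + 3) / 2" by linarith
    then show ?thesis using t by (simp add: field_simps)
  qed
  have d: "2.729 / (t * sqrt t) \<le> 0.5253"
  proof -
    have "1.7320 \<le> sqrt t" using sqrt_small_bounds(3) real_sqrt_le_mono[OF t] by linarith
    then have "3 * 1.7320 \<le> t * sqrt t" using t by (intro mult_mono) auto
    then show ?thesis using t by (simp add: divide_le_eq)
  qed
  have p: "(1 + v / 2) * ln (4 * t + 1) \<le> (1 + (1.0987 + w) / 2) * (1.0987 + w + 1.4764)"
    using v l w t by (intro mult_mono) auto
  \<comment> \<open>0.43661 covers 1.5123 * 0.2887, the coefficient of t that the linear bound of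
    sqrt t brings in.\<close>
  have c: "3 * (1 + w) * (0.71 * (1.0985 + w) - 0.43661) \<le> t * (0.71 * v - 0.43661)"
    using tw v w t by (intro mult_mono) auto
  have e1: "3 * (1 + w) * (0.71 * (1.0985 + w) - 0.43661) \<ge> 1.029975 + 3.159975 * w + 2.13 * (w * w)" using w by (simp add: algebra_simps add_divide_distrib diff_divide_distrib)
  have e2: "(1 + (1.0987 + w) / 2) * (1.0987 + w + 1.4764) \<le> 3.98978 + 2.8369 * w + 0.5 * (w * w)" using w by (simp add: algebra_simps add_divide_distrib diff_divide_distrib)
  have ww: "w * w \<ge> 0" by simp
  have x: "t * (0.71 * v - 0.43661) = 0.71 * (t * v) - 0.43661 * t" by (simp add: algebra_simps)
  have "1.5123 * A + B + P < 0.71 * X + 4.93"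
    if "P \<le> E2" "E2 \<le> 3.98978 + 2.8369 * w + 0.5 * q" "E1 \<le> 0.71 * X - 0.43661 * t" "E1 \<ge> 1.029975 + 3.159975 * w + 2.13 * q"
      "B \<le> 0.5253" "A \<le> 0.8661 + 0.2887 * t" "q \<ge> 0" for A B P X E1 E2 q :: real
    using that w t by simp
  from this[OF p e2 c[unfolded x] e1 d s ww] show ?thesis unfolding v_def[symmetric] by (simp only: mult.assoc)
qed

text \<open>The same scheme with t = 2 exp w, meant for t < 3: 1.9087 covers 9/4 of the tail from n
  = 7 on, and 1.355 = 3 - 1.645 because only integers to the right of t contribute then.\<close>

lemma log_ineq_ge_2:
  fixes t :: real
  assumes t: "t \<ge> 2"
  shows "1.9087 * sqrt t + 2.729 / (t * sqrt t) + (1 + ln t / 2) * ln (4 * t + 1) < 1.355 * t * ln t + 4.93"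
proof -
  define v w where "v = ln t" and "w = ln (t / 2)"
  have w: "w \<ge> 0" using t by (simp add: w_def)
  have vw: "v = ln 2 + w" using t by (simp add: v_def w_def ln_div)
  have v: "0.6931 + w \<le> v" "v \<le> 0.6932 + w" using ln_small_bounds vw by auto
  have tw: "2 * (1 + w) \<le> t"
  proof -
    have "1 + w \<le> exp w" by (rule exp_ge_add_one_self)
    also have "exp w = t / 2" using t by (simp add: w_def)
    finally show ?thesis by simp
  qed
  have l: "ln (4 * t + 1) \<le> v + 1.5043"
  proof -
    have "ln (4 * t + 1) \<le> ln (t * (9 / 2))" using t by (intro ln_mono) auto
    also have "\<dots> = v + (ln 9 - ln 2)" using t by (simp add: v_def ln_mult_pos ln_div)
    also have "\<dots> \<le> v + 1.5043" unfolding ln_composite using ln_small_bounds by simp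
    finally show ?thesis .
  qed
  have s: "sqrt t \<le> 0.7072 + 0.3536 * t"
  proof -
    have "sqrt t * sqrt 2 \<le> (t + 2) / 2" using arith_geo_mean_sqrt[of t 2] t by (simp add: real_sqrt_mult)
    moreover have "sqrt t * 1.4142 \<le> sqrt t * sqrt 2" using sqrt_small_bounds t by (intro mult_left_mono) auto
    ultimately have "sqrt t * 1.4142 \<le> (t + 2) / 2" by linarith
    then show ?thesis using t by (simp add: field_simps)
  qed
  have d: "2.729 / (t * sqrt t) \<le> 0.965"
  proof -
    have "1.4142 \<le> sqrt t" using sqrt_small_bounds(1) real_sqrt_le_mono[OF t] by linarith
    then have "2 * 1.4142 \<le> t * sqrt t" using t by (intro mult_mono) auto
    then show ?thesis using t by (simp add: divide_le_eq)
  qed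
  have p: "(1 + v / 2) * ln (4 * t + 1) \<le> (1 + (0.6932 + w) / 2) * (0.6932 + w + 1.5043)"
    using v l w t by (intro mult_mono) auto
  have c: "2 * (1 + w) * (1.355 * (0.6931 + w) - 0.67492) \<le> t * (1.355 * v - 0.67492)"
    using tw v w t by (intro mult_mono) auto
  have e1: "2 * (1 + w) * (1.355 * (0.6931 + w) - 0.67492) \<ge> 0.5284 + 3.238 * w + 2.71 * (w * w)" using w by (simp add: algebra_simps add_divide_distrib diff_divide_distrib)
  have e2: "(1 + (0.6932 + w) / 2) * (0.6932 + w + 1.5043) \<le> 2.9592 + 2.4454 * w + 0.5 * (w * w)" using w by (simp add: algebra_simps add_divide_distrib diff_divide_distrib)
  have ww: "w * w \<ge> 0" by simp
  have x: "t * (1.355 * v - 0.67492) = 1.355 * (t * v) - 0.67492 * t" by (simp add: algebra_simps)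
  have "1.9087 * A + B + P < 1.355 * X + 4.93"
    if "P \<le> E2" "E2 \<le> 2.9592 + 2.4454 * w + 0.5 * q" "E1 \<le> 1.355 * X - 0.67492 * t" "E1 \<ge> 0.5284 + 3.238 * w + 2.71 * q"
      "B \<le> 0.965" "A \<le> 0.7072 + 0.3536 * t" "q \<ge> 0" for A B P X E1 E2 q :: real
    using that w t by simp
  from this[OF p e2 c[unfolded x] e1 d s ww] show ?thesis unfolding v_def[symmetric] by (simp only: mult.assoc)
qed

text \<open>Common end of both ranges: \<open>T\<close> is the tail of the comparison series and
  \<open>c\<close> the bound for the inverse squares near t. The term c t^2 log t cancels against
  part of 3 t^2 log t, and division by t leaves the second numerical hypothesis.\<close>

lemma weight_bound_ge_2_aux:
  assumes t: "t \<ge> 2"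
    and F: "suminf (far_weight t) \<le> 9 / 4 * T + sqrt t * (ln t * c + (1 + ln t / 2) / t * ln (4 * t + 1))"
    and I: "9 / 4 * T * sqrt t + 2.729 / (t * sqrt t) + (1 + ln t / 2) * ln (4 * t + 1) < (3 - c) * t * ln t + 4.93"
  shows "t * sqrt t * (suminf (far_weight t) + suminf (dual_weight t))
    < 3 * t\<^sup>2 * ln t + pi\<^sup>2 / 2 * t + 1/4 * ln t + 0.6"
    and "summable (dual_weight t)"
proof -
  define H where "H = (1 + ln t / 2) * ln (4 * t + 1)"
  define r where "r = sqrt t"
  define v where "v = ln t"
  have v: "v \<ge> 0" using t by (simp add: v_def)
  have r: "r * r = t" "r > 0" using t by (auto simp: r_def)
  have ds: "summable (\<lambda>n. 16 / 9 / t\<^sup>2 * mang32 n)" by (intro summable_mult mang32_sum)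
  show s: "summable (dual_weight t)"
    by (rule summable_comparison_test'[OF ds, of 0]) (use dual_weight_le[OF t] weight_nonneg in auto)
  have "suminf (dual_weight t) \<le> (\<Sum>n. 16 / 9 / t\<^sup>2 * mang32 n)" by (rule suminf_le[OF dual_weight_le[OF t] s ds])
  also have "\<dots> = 16 / 9 / t\<^sup>2 * suminf mang32" by (rule suminf_mult[OF mang32_sum(1)])
  also have "\<dots> \<le> 16 / 9 / t\<^sup>2 * 1.535" by (intro mult_left_mono mang32_sum) auto
  also have "\<dots> = (16 / 9 * 1.535) / t\<^sup>2" by simp
  also have "\<dots> \<le> 2.729 / t\<^sup>2" by (intro divide_right_mono) auto
  finally have D: "suminf (dual_weight t) \<le> 2.729 / t\<^sup>2" .
  have "t * r * (suminf (far_weight t) + suminf (dual_weight t))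
     \<le> t * r * ((9 / 4 * T + r * (v * c + H / t)) + 2.729 / t\<^sup>2)"
    using F D t r unfolding H_def r_def v_def by (intro mult_left_mono add_mono) auto
  also have "\<dots> = t * (9 / 4 * T * r + (r * r) * (v * c) + (r * r) * (H / t)) + t * (2.729 * (r / t\<^sup>2))"
    by (simp add: algebra_simps)
  also have "\<dots> = t * (9 / 4 * T * r + 2.729 * (r / t\<^sup>2) + H) + c * (t\<^sup>2 * v)"
    unfolding r using t by (simp add: algebra_simps power2_eq_square)
  also have "r / t\<^sup>2 = 1 / (t * r)"
  proof -
    have "r * (t * r) = t\<^sup>2" using r by (simp add: power2_eq_square algebra_simps)
    then show ?thesis using r t by (simp add: field_simps)
  qed
  also have "t * (9 / 4 * T * r + 2.729 * (1 / (t * r)) + H) < t * ((3 - c) * t * v + 4.93)"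
    using I t unfolding H_def r_def v_def by (intro mult_strict_left_mono) auto
  finally have 1: "t * r * (suminf (far_weight t) + suminf (dual_weight t)) < t * ((3 - c) * t * v + 4.93) + c * (t\<^sup>2 * v)" by simp
  have 2: "t * ((3 - c) * t * v + 4.93) + c * (t\<^sup>2 * v) = 3 * t\<^sup>2 * v + 4.93 * t" by (simp add: algebra_simps power2_eq_square)
  have "3.1415\<^sup>2 \<le> pi\<^sup>2" using pi_approx by (intro power_mono) auto
  then have "4.93 * t \<le> pi\<^sup>2 / 2 * t" using t by (intro mult_right_mono) (auto simp: power2_eq_square)
  then show "t * sqrt t * (suminf (far_weight t) + suminf (dual_weight t))
    < 3 * t\<^sup>2 * ln t + pi\<^sup>2 / 2 * t + 1/4 * ln t + 0.6"
    using 1 v unfolding 2 unfolding r_def v_def by simp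
qed

text \<open>The split at 3 balances two constants: for t >= 3 both sides of t contribute, but the
  tail starts at 10; for t < 3 it starts at 7, but no integer n with 2 <= n < m exists, so 1.645
  replaces 2.29.\<close>

lemma weight_bound_ge_2:
  assumes t: "t \<ge> 2"
  shows "t * sqrt t * (suminf (far_weight t) + suminf (dual_weight t))
    < 3 * t\<^sup>2 * ln t + pi\<^sup>2 / 2 * t + 1/4 * ln t + 0.6"
    and "summable (far_weight t)" "summable (dual_weight t)"
proof -
  define m M where "m = nat \<lfloor>t\<rfloor>" and "M = nat \<lfloor>3 * t\<rfloor>"
  note nb = neighbour_sums_le[OF t, folded m_def M_def]
  have lt: "ln t \<ge> 0" using t by simp
  have F: "suminf (far_weight t) \<le> 9 / 4 * mang32_tail N0 + sqrt t * (ln t * c + (1 + ln t / 2) / t * ln (4 * t + 1))"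
    if "\<And>n. real n > 3 * t \<Longrightarrow> n \<ge> N0"
      "(\<Sum>n\<in>{2..<m}. 1 / (t - real n)\<^sup>2) + (\<Sum>n\<in>{m + 2..M}. 1 / (real n - t)\<^sup>2) \<le> c" for N0 c
  proof -
    have "sqrt t * (ln t * ((\<Sum>n\<in>{2..<m}. 1 / (t - real n)\<^sup>2) + (\<Sum>n\<in>{m + 2..M}. 1 / (real n - t)\<^sup>2))
           + (1 + ln t / 2) / t * (\<Sum>n\<in>{m + 2..M}. 1 / (real n - t)))
      \<le> sqrt t * (ln t * c + (1 + ln t / 2) / t * ln (4 * t + 1))"
      using t lt by (intro mult_left_mono add_mono that(2) nb(3)) auto
    then show ?thesis using far_weight_sum_le(2)[OF t that(1), folded m_def M_def] by linarith
  qed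
  show "summable (far_weight t)" by (rule far_weight_sum_le(1)[OF t, of 0]) simp
  have "t * sqrt t * (suminf (far_weight t) + suminf (dual_weight t)) < 3 * t\<^sup>2 * ln t + pi\<^sup>2 / 2 * t + 1/4 * ln t + 0.6
     \<and> summable (dual_weight t)"
  proof (cases "t \<ge> 3")
    case True
    have "9 / 4 * mang32_tail 10 * sqrt t \<le> 1.5123 * sqrt t"
      using mang32_tail_values(3) t by (intro mult_right_mono) auto
    then have "9 / 4 * mang32_tail 10 * sqrt t + 2.729 / (t * sqrt t) + (1 + ln t / 2) * ln (4 * t + 1)
      \<le> 1.5123 * sqrt t + 2.729 / (t * sqrt t) + (1 + ln t / 2) * ln (4 * t + 1)" by (intro add_right_mono)
    also have "\<dots> < (3 - 2.29) * t * ln t + 4.93"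
    proof -
      have "3 - 2.29 = (0.71::real)" by simp
      then show ?thesis using log_ineq_ge_3[OF True] by (simp only:)
    qed
    finally have I: "9 / 4 * mang32_tail 10 * sqrt t + 2.729 / (t * sqrt t) + (1 + ln t / 2) * ln (4 * t + 1) < (3 - 2.29) * t * ln t + 4.93" .
    have "n \<ge> 10" if "real n > 3 * t" for n
    proof -
      have "real n > real 9" using that True by simp
      then show ?thesis by (simp only: of_nat_less_iff)
    qed
    from weight_bound_ge_2_aux[OF t F[OF this nb(2)] I] show ?thesis by blast
  next
    case False
    have "9 / 4 * mang32_tail 7 * sqrt t \<le> 1.9087 * sqrt t"
      using mang32_tail_values(1) t by (intro mult_right_mono) auto
    then have "9 / 4 * mang32_tail 7 * sqrt t + 2.729 / (t * sqrt t) + (1 + ln t / 2) * ln (4 * t + 1)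
      \<le> 1.9087 * sqrt t + 2.729 / (t * sqrt t) + (1 + ln t / 2) * ln (4 * t + 1)" by (intro add_right_mono)
    also have "\<dots> < (3 - 1.645) * t * ln t + 4.93"
    proof -
      have "3 - 1.645 = (1.355::real)" by simp
      then show ?thesis using log_ineq_ge_2[OF t] by (simp only:)
    qed
    finally have I: "9 / 4 * mang32_tail 7 * sqrt t + 2.729 / (t * sqrt t) + (1 + ln t / 2) * ln (4 * t + 1) < (3 - 1.645) * t * ln t + 4.93" .
    have n7: "n \<ge> 7" if "real n > 3 * t" for n
    proof -
      have "real n > real 6" using that t by simp
      then show ?thesis by (simp only: of_nat_less_iff)
    qed
    have "m = 2" unfolding m_def using t False by linarith
    then have "(\<Sum>n\<in>{2..<m}. 1 / (t - real n)\<^sup>2) + (\<Sum>n\<in>{m + 2..M}. 1 / (real n - t)\<^sup>2) \<le> 1.645"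
      using nb(1) by simp
    from weight_bound_ge_2_aux[OF t F[OF n7 this] I] show ?thesis by blast
  qed
  then show "t * sqrt t * (suminf (far_weight t) + suminf (dual_weight t)) < 3 * t\<^sup>2 * ln t + pi\<^sup>2 / 2 * t + 1/4 * ln t + 0.6"
    "summable (dual_weight t)" by blast+
qed

text \<open>Near t = 1 the logarithm vanishes and pi^2/2 + 0.6 must suffice. With u = t - 1 the
  inverse squares are interpolated by convexity between the distances n - 1 and n - 2; n = 3, 4, 5,
  7 are evaluated one by one and n >= 8 together. For the dual sum n t - 1 >= t (n - 1) is
  used.\<close>

lemma weight_bound_lt_2:
  assumes t: "1 < t" "t < 2"
  shows "t * sqrt t * (suminf (far_weight t) + suminf (dual_weight t))
    < 3 * t\<^sup>2 * ln t + pi\<^sup>2 / 2 * t + 1/4 * ln t + 0.6"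
    and "summable (far_weight t)" "summable (dual_weight t)"
proof -
  define u where "u = t - 1"
  have u: "0 < u" "u < 1" "t = 1 + u" using t by (auto simp: u_def)
  have m: "nat \<lfloor>t\<rfloor> = 1" using t by linarith
  \<comment> \<open>(8/7)^2 and (8/6)^2 are the largest values of n^2 / (n - 1)^2 and n^2 / (n -
    2)^2 for n >= 8; they are mixed with the weights of the chord.\<close>
  define \<kappa> where "\<kappa> = (1 - u) * (64/49) + u * (16/9)"
  have k0: "\<kappa> \<ge> 0" using u by (simp add: \<kappa>_def)
  have f0: "far_weight t 0 = 0" "far_weight t 1 = 0" "far_weight t 2 = 0" "far_weight t 6 = 0"
    using mangoldt_numerals by (auto simp: far_weight_def m)
  have fe: "far_weight t n = (real n)\<^sup>2 * mang32 n / (real n - t)\<^sup>2" if "n \<ge> 3" for n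
    using that by (simp add: far_weight_def m mangoldt_sqrt)
  have chord: "1 / (real n - t)\<^sup>2 \<le> (1 - u) / (real n - 1)\<^sup>2 + u / (real n - 2)\<^sup>2" if n: "n \<ge> 3" for n
  proof -
    have "(1 - u) * (real n - 1) + u * (real n - 2) = real n - t" unfolding u(3) by (simp add: algebra_simps)
    then show ?thesis using inverse_square_chord[of "real n - 1" "real n - 2" u] n u by simp
  qed
  have F: "far_weight t n \<le> ((1 - u) * ((real n)\<^sup>2 / (real n - 1)\<^sup>2) + u * ((real n)\<^sup>2 / (real n - 2)\<^sup>2)) * mang32 n" if n: "n \<ge> 3" for n
  proof -
    have "far_weight t n = (real n)\<^sup>2 * mang32 n * (1 / (real n - t)\<^sup>2)" using fe[OF n] by simp
    also have "\<dots> \<le> (real n)\<^sup>2 * mang32 n * ((1 - u) / (real n - 1)\<^sup>2 + u / (real n - 2)\<^sup>2)"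
      by (intro mult_left_mono chord n mult_nonneg_nonneg mang32_nonneg) simp
    finally show ?thesis by (simp add: algebra_simps)
  qed
  have q: "(real n)\<^sup>2 / (real n - a)\<^sup>2 \<le> (8 / (8 - a))\<^sup>2" if "n \<ge> 8" "0 \<le> a" "a < 8" for n a
  proof -
    have "real n \<ge> 8" using that by simp
    then have "a * 8 \<le> a * real n" using that by (intro mult_left_mono) auto
    then have "real n / (real n - a) \<le> 8 / (8 - a)" using that \<open>real n \<ge> 8\<close> by (simp add: field_simps)
    then show ?thesis unfolding power_divide[symmetric] using that \<open>real n \<ge> 8\<close> by (intro power_mono) auto
  qed
  have F8: "far_weight t (n + 8) \<le> \<kappa> * mang32 (n + 8)" for n
  proof -
    have "(1 - u) * ((real (n + 8))\<^sup>2 / (real (n + 8) - 1)\<^sup>2) + u * ((real (n + 8))\<^sup>2 / (real (n + 8) - 2)\<^sup>2) \<le> (1 - u) * (8 / (8 - 1))\<^sup>2 + u * (8 / (8 - 2))\<^sup>2"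
      using u by (intro add_mono mult_left_mono q) auto
    also have "\<dots> = \<kappa>" by (simp add: \<kappa>_def power2_eq_square)
    finally show ?thesis using F[of "n + 8"] mult_right_mono[OF _ mang32_nonneg[of "n + 8"]] by fastforce
  qed
  have ms: "summable (\<lambda>n. mang32 (n + 8))" using mang32_sum(1) by (subst summable_iff_shift)
  have fs8: "summable (\<lambda>n. far_weight t (n + 8))"
    by (rule summable_comparison_test'[OF summable_mult[OF ms, of \<kappa>], of 0]) (use F8 weight_nonneg in auto)
  then show fs: "summable (far_weight t)" by (subst (asm) summable_iff_shift)
  have "suminf (far_weight t) = (\<Sum>n. far_weight t (n + 8)) + (\<Sum>n<8. far_weight t n)"
    by (rule suminf_split_initial_segment[OF fs])
  also have "(\<Sum>n<8. far_weight t n) = far_weight t 3 + far_weight t 4 + far_weight t 5 + far_weight t 7"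
    using f0 by (simp add: eval_nat_numeral)
  also have "(\<Sum>n. far_weight t (n + 8)) \<le> (\<Sum>n. \<kappa> * mang32 (n + 8))" by (rule suminf_le[OF F8 fs8 summable_mult[OF ms]])
  also have "\<dots> = \<kappa> * mang32_tail 8" unfolding mang32_tail_def by (rule suminf_mult[OF ms])
  also have "\<dots> \<le> \<kappa> * 0.7433" by (intro mult_left_mono mang32_tail_values k0)
  finally have S1: "suminf (far_weight t) \<le> \<kappa> * 0.7433 + (far_weight t 3 + far_weight t 4 + far_weight t 5 + far_weight t 7)" by simp
  have W: "far_weight t n \<le> ((1 - u) * a + u * b) * c" if "n \<ge> 3" "(real n)\<^sup>2 / (real n - 1)\<^sup>2 = a" "(real n)\<^sup>2 / (real n - 2)\<^sup>2 = b" "mang32 n \<le> c" for n a b c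
  proof -
    have "a \<ge> 0" "b \<ge> 0" using that by auto
    then have "((1 - u) * a + u * b) * mang32 n \<le> ((1 - u) * a + u * b) * c" using u that by (intro mult_left_mono) auto
    then show ?thesis using F[OF that(1)] that by simp
  qed
  have "far_weight t 3 \<le> ((1 - u) * (9/4) + u * 9) * 0.2116" by (rule W) (use mang32_values in auto)
  moreover have "far_weight t 4 \<le> ((1 - u) * (16/9) + u * 4) * 0.0867" by (rule W) (use mang32_values in auto)
  moreover have "far_weight t 5 \<le> ((1 - u) * (25/16) + u * (25/9)) * 0.1441" by (rule W) (use mang32_values in auto)
  moreover have "far_weight t 7 \<le> ((1 - u) * (49/36) + u * (49/25)) * 0.1052" by (rule W) (use mang32_values in auto)
  ultimately have FS: "suminf (far_weight t) \<le> 1.97 + 2.21 * u"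
    using S1 u unfolding \<kappa>_def by (simp add: algebra_simps add_divide_distrib diff_divide_distrib)
  have D: "dual_weight t n \<le> (real n)\<^sup>2 / (real n - 1)\<^sup>2 * mang32 n / t\<^sup>2" if n: "n \<ge> 2" for n
  proof -
    have "t * (real n - 1) \<le> real n * t - 1" using t by (simp add: algebra_simps)
    then have "(t * (real n - 1))\<^sup>2 \<le> (real n * t - 1)\<^sup>2" using n t by (intro power_mono) auto
    then have "dual_weight t n \<le> (real n)\<^sup>2 * mang32 n / (t * (real n - 1))\<^sup>2"
      unfolding dual_weight_def mangoldt_sqrt using n t mang32_nonneg
      by (intro divide_left_mono mult_nonneg_nonneg mult_pos_pos) (auto intro!: zero_less_power)
    then show ?thesis by (simp add: power_mult_distrib mult_ac)
  qed
  have D8: "dual_weight t (n + 8) \<le> 64 / 49 / t\<^sup>2 * mang32 (n + 8)" for n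
  proof -
    have "(real (n + 8))\<^sup>2 / (real (n + 8) - 1)\<^sup>2 * mang32 (n + 8) / t\<^sup>2 \<le> (8 / (8 - 1))\<^sup>2 * mang32 (n + 8) / t\<^sup>2"
      by (intro divide_right_mono mult_right_mono q mang32_nonneg) auto
    then show ?thesis using D[of "n + 8"] by (simp add: power2_eq_square)
  qed
  have ds8: "summable (\<lambda>n. dual_weight t (n + 8))"
    by (rule summable_comparison_test'[OF summable_mult[OF ms, of "64 / 49 / t\<^sup>2"], of 0]) (use D8 weight_nonneg in auto)
  then show ds: "summable (dual_weight t)" by (subst (asm) summable_iff_shift)
  have d0: "dual_weight t 0 = 0" "dual_weight t 1 = 0" "dual_weight t 6 = 0"
    using mangoldt_numerals by (auto simp: dual_weight_def)
  have "suminf (dual_weight t) = (\<Sum>n. dual_weight t (n + 8)) + (\<Sum>n<8. dual_weight t n)"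
    by (rule suminf_split_initial_segment[OF ds])
  also have "(\<Sum>n<8. dual_weight t n) = dual_weight t 2 + dual_weight t 3 + dual_weight t 4 + dual_weight t 5 + dual_weight t 7"
    using d0 by (simp add: eval_nat_numeral)
  also have "(\<Sum>n. dual_weight t (n + 8)) \<le> (\<Sum>n. 64 / 49 / t\<^sup>2 * mang32 (n + 8))" by (rule suminf_le[OF D8 ds8 summable_mult[OF ms]])
  also have "\<dots> = 64 / 49 / t\<^sup>2 * mang32_tail 8" unfolding mang32_tail_def by (rule suminf_mult[OF ms])
  also have "\<dots> \<le> 64 / 49 / t\<^sup>2 * 0.7433" by (intro mult_left_mono mang32_tail_values) auto
  finally have S2: "suminf (dual_weight t) \<le> 64 / 49 * 0.7433 / t\<^sup>2 + (dual_weight t 2 + dual_weight t 3 + dual_weight t 4 + dual_weight t 5 + dual_weight t 7)" by simp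
  have V: "dual_weight t n \<le> a * c / t\<^sup>2" if "n \<ge> 2" "(real n)\<^sup>2 / (real n - 1)\<^sup>2 = a" "mang32 n \<le> c" for n a c
  proof -
    have "a \<ge> 0" using that by auto
    then have "a * mang32 n / t\<^sup>2 \<le> a * c / t\<^sup>2" using that by (intro mult_left_mono divide_right_mono) auto
    then show ?thesis using D[OF that(1)] that by simp
  qed
  have "dual_weight t 2 \<le> 4 * 0.2452 / t\<^sup>2" by (rule V) (use mang32_values in auto)
  moreover have "dual_weight t 3 \<le> 9/4 * 0.2116 / t\<^sup>2" by (rule V) (use mang32_values in auto)
  moreover have "dual_weight t 4 \<le> 16/9 * 0.0867 / t\<^sup>2" by (rule V) (use mang32_values in auto)
  moreover have "dual_weight t 5 \<le> 25/16 * 0.1441 / t\<^sup>2" by (rule V) (use mang32_values in auto)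
  moreover have "dual_weight t 7 \<le> 49/36 * 0.1052 / t\<^sup>2" by (rule V) (use mang32_values in auto)
  ultimately have "suminf (dual_weight t) \<le> (64 / 49 * 0.7433 + 4 * 0.2452 + 9/4 * 0.2116 + 16/9 * 0.0867 + 25/16 * 0.1441 + 49/36 * 0.1052) / t\<^sup>2"
    using S2 unfolding add_divide_distrib by linarith
  also have "\<dots> \<le> 2.951 / t\<^sup>2" by (intro divide_right_mono) auto
  finally have DS: "suminf (dual_weight t) \<le> 2.951 / t\<^sup>2" .
  have sq: "sqrt t \<le> 1 + u / 2" using u by (intro real_le_lsqrt) (auto simp: power2_eq_square algebra_simps)
  have "t * sqrt t * suminf (far_weight t) \<le> t * (1 + u / 2) * (1.97 + 2.21 * u)"
    using t sq FS u suminf_nonneg[OF fs weight_nonneg(2)] by (intro mult_mono) auto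
  moreover have "t * sqrt t * suminf (dual_weight t) \<le> 2.951"
  proof -
    have "sqrt t \<le> t" using t by (intro real_le_lsqrt) (auto simp: power2_eq_square)
    then have "t * sqrt t \<le> t\<^sup>2" using t by (simp add: power2_eq_square)
    then have "t * sqrt t * suminf (dual_weight t) \<le> t\<^sup>2 * (2.951 / t\<^sup>2)"
      using DS t suminf_nonneg[OF ds weight_nonneg(1)] by (intro mult_mono) auto
    then show ?thesis using t by simp
  qed
  ultimately have A: "t * sqrt t * (suminf (far_weight t) + suminf (dual_weight t)) \<le> t * (1 + u / 2) * (1.97 + 2.21 * u) + 2.951"
    unfolding distrib_left by (rule add_mono)
  have "3.1415\<^sup>2 \<le> pi\<^sup>2" using pi_approx by (intro power_mono) auto
  then have p: "4.93 * t \<le> pi\<^sup>2 / 2 * t" using t by (intro mult_right_mono) (auto simp: power2_eq_square)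
  \<comment> \<open>log (1 + u) >= 2 u / (2 + u) >= u - u^2 / 2.\<close>
  have l: "u - u\<^sup>2 / 2 \<le> ln t"
  proof -
    have "(u - u\<^sup>2 / 2) * (1 + t) = 2 * u - u ^ 3 / 2" unfolding u(3) by (simp add: field_simps power2_eq_square power3_eq_cube)
    then have "(u - u\<^sup>2 / 2) * (1 + t) \<le> 2 * u" using u by simp
    then have "u - u\<^sup>2 / 2 \<le> 2 * u / (1 + t)" using t by (simp add: le_divide_eq)
    also have "\<dots> \<le> ln t" using ln_inverse_approx_ge[of 1 t] t by (simp add: u_def)
    finally show ?thesis .
  qed
  have "3 * t\<^sup>2 * (u - u\<^sup>2 / 2) \<le> 3 * t\<^sup>2 * ln t" using l by (intro mult_left_mono) auto
  moreover have "t * (1 + u / 2) * (1.97 + 2.21 * u) + 2.951 < 3 * t\<^sup>2 * (u - u\<^sup>2 / 2) + 4.93 * t + 0.6"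
  proof -
    have w: "0 \<le> u * u" "u * u \<le> u" "u * (u * u) \<le> u * u" "u * (u * (u * u)) \<le> u * (u * u)" using u by (auto simp: mult_left_le)
    have "(1 + u) * (1 + u / 2) * (1.97 + 2.21 * u) = 1.97 + 5.165 * u + 4.3 * (u * u) + 1.105 * (u * (u * u))"
      by (simp add: field_simps)
    moreover have "3 * (1 + u)\<^sup>2 * (u - u\<^sup>2 / 2) = 3 * u + 4.5 * (u * u) - 1.5 * (u * (u * (u * u)))"
      by (simp add: field_simps power2_eq_square)
    moreover have "1.97 + 5.165 * u + 4.3 * q + 1.105 * k + 2.951 < 3 * u + 4.5 * q - 1.5 * h + 4.93 * (1 + u) + 0.6"
      if "0 \<le> q" "q \<le> u" "k \<le> q" "h \<le> k" for q k h
    proof -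
      \<comment> \<open>0.609 = 4.93 + 0.6 - 1.97 - 2.951 is the slack at u = 0; the rest is
        regrouped along u >= u^2 >= u^3 >= u^4 into nonnegative pieces.\<close>
      have "(3 * u + 4.5 * q - 1.5 * h + 4.93 * (1 + u) + 0.6) - (1.97 + 5.165 * u + 4.3 * q + 1.105 * k + 2.951)
          = 0.609 + (0.36 * u + 2.405 * (u - q) + 2.605 * (q - k) + 1.5 * (k - h))" by (simp add: field_simps)
      moreover have "0 \<le> 0.36 * u + 2.405 * (u - q) + 2.605 * (q - k) + 1.5 * (k - h)"
        using that u by (intro add_nonneg_nonneg mult_nonneg_nonneg) auto
      moreover have "l < r" if "r - l = 0.609 + z" "0 \<le> z" for l r z :: real using that by simp
      ultimately show ?thesis by blast
    qed
    ultimately show ?thesis unfolding u(3) using w by simp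
  qed
  moreover have "ln t \<ge> 0" using t by simp
  ultimately show "t * sqrt t * (suminf (far_weight t) + suminf (dual_weight t))
    < 3 * t\<^sup>2 * ln t + pi\<^sup>2 / 2 * t + 1/4 * ln t + 0.6"
    using A p by simp
qed

theorem weight_bound:
  assumes "t > 1"
  shows "t * sqrt t * (suminf (far_weight t) + suminf (dual_weight t))
    < 3 * t\<^sup>2 * ln t + pi\<^sup>2 / 2 * t + 1/4 * ln t + 0.6"
    and "summable (far_weight t)" "summable (dual_weight t)"
  using weight_bound_ge_2[of t] weight_bound_lt_2[of t] assms by (cases "t \<ge> 2"; force)+

section \<open>The two inequalities\<close>

context
  fixes x t :: real
  assumes x: "0 < x" "x < pi" and t: "t > 1"
begin

private definition csq :: real where "csq = (cos (x/2))\<^sup>2"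
private definition k :: real where "k = 4 * t * sqrt t * csq"
private definition p :: "nat \<Rightarrow> real" where "p n = mangoldt n * sqrt (real n) / Lden1 x t n"
private definition d :: "nat \<Rightarrow> real" where "d n = mangoldt n * sqrt (real n) / Lden2 x t n"

private lemma trig: "sin (x/2) > 0" "cos (x/2) > 0" "csq > 0" "k > 0"
proof -
  show "sin (x/2) > 0" using x by (intro sin_gt_zero) auto
  show "cos (x/2) > 0" using x by (intro cos_gt_zero) auto
  then show "csq > 0" by (simp add: csq_def)
  then show "k > 0" using t by (simp add: k_def)
qed

private lemma den: "Lden1 x t n = (real n - t)\<^sup>2 + 4 * t * real n * csq" "Lden2 x t n = (real n * t - 1)\<^sup>2 + 4 * t * real n * csq"
  by (simp_all add: Lden1_def Lden2_def csq_def)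

private lemma den_pos: "n > 0 \<Longrightarrow> Lden1 x t n > 0" "n > 0 \<Longrightarrow> Lden2 x t n > 0"
  unfolding den using t trig by (auto intro!: add_nonneg_pos mult_pos_pos)

private lemma pd_nonneg: "p n \<ge> 0" "d n \<ge> 0"
  using trig t unfolding p_def d_def den by (auto intro!: divide_nonneg_nonneg mult_nonneg_nonneg add_nonneg_nonneg mangoldt_nonneg)

private lemma d_le: "d n \<le> dual_weight t n"
proof (cases "n \<le> 1")
  case True
  then have "n = 0 \<or> n = 1" by auto
  then show ?thesis by (auto simp: d_def dual_weight_def)
next
  case False
  have "1 * 1 < real n * t" using False t by (intro mult_strict_mono) auto
  then show ?thesis unfolding d_def dual_weight_def den using trig t mangoldt_nonneg[of n]
    by (intro divide_left_mono mult_nonneg_nonneg mult_pos_pos add_pos_nonneg) (auto intro!: zero_less_power)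
qed

private lemma p_le: "n \<noteq> nat \<lfloor>t\<rfloor> \<Longrightarrow> n \<noteq> nat \<lfloor>t\<rfloor> + 1 \<Longrightarrow> p n \<le> far_weight t n"
proof -
  assume n: "n \<noteq> nat \<lfloor>t\<rfloor>" "n \<noteq> nat \<lfloor>t\<rfloor> + 1"
  have "real n \<noteq> t"
  proof
    assume "real n = t"
    then have "nat \<lfloor>t\<rfloor> = n" by linarith
    then show False using n by simp
  qed
  then show ?thesis unfolding p_def far_weight_def den using n trig t mangoldt_nonneg[of n]
    by (auto intro!: divide_left_mono mult_nonneg_nonneg mult_pos_pos add_pos_nonneg)
qed

private lemma summable_p: "summable p" and summable_d: "summable d"
proof -
  show "summable d"
    by (rule summable_comparison_test'[OF weight_bound(3)[OF t], of 0]) (use d_le pd_nonneg in auto)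
  \<comment> \<open>Compared only from floor t + 2 on: at the neighbours of t the weight is 0 while
    p need not be.\<close>
  show "summable p"
    by (rule summable_comparison_test'[OF weight_bound(2)[OF t], of "nat \<lfloor>t\<rfloor> + 2"]) (use p_le pd_nonneg in auto)
qed

private lemma zero_sum:
  "zero_term x t summable_on upper_zeros"
  "2 * infsum (zero_term x t) upper_zeros = of_real (2 * g_fun x t - 2 * (t * sin x / (2 * pi) * (suminf p + suminf d)))"
proof -
  have z: "zero_term x t = (\<lambda>\<rho>. of_int (zorder riemann_zeta \<rho>) * Hz x (ln t) (\<rho> - 1/2))"
    by (rule ext) (rule zero_term_Hz)
  show "zero_term x t summable_on upper_zeros" unfolding z by (rule zero_sum_upper_Zs(1)[OF x])
  have p0: "p 0 = 0" "d 0 = 0" by (simp_all add: p_def d_def)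
  have "(\<lambda>n. p (Suc n) + d (Suc n)) sums (suminf p + suminf d)"
    using sums_Suc_iff[of p "suminf p"] sums_Suc_iff[of d "suminf d"] summable_sums[OF summable_p] summable_sums[OF summable_d]
    by (intro sums_add) (simp_all add: p0)
  from sums_of_real[OF sums_mult[OF this, of "t * sin x / (2 * pi)"]]
  have "(\<lambda>n. complex_of_real (t * sin x / (2 * pi) * (p (Suc n) + d (Suc n)))) sums of_real (t * sin x / (2 * pi) * (suminf p + suminf d))" .
  moreover have "t * sin x / (2 * pi) * (p (Suc n) + d (Suc n)) = t * sin x / (2 * pi) * (mangoldt (Suc n) * sqrt (Suc n) * (1 / Lden1 x t (Suc n) + 1 / Lden2 x t (Suc n)))" for n
    by (simp add: p_def d_def distrib_left)
  ultimately have "Jint x (ln t) (\<lambda>z. Lser (z + 1/2)) = of_real (t * sin x / (2 * pi) * (suminf p + suminf d))"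
    using Jint_Lser_sums[OF x t] sums_unique2 by (simp only:)
  moreover have "2 * infsum (zero_term x t) upper_zeros = of_real (2 * g_fun x t) - 2 * Jint x (ln t) (\<lambda>z. Lser (z + 1/2))"
    unfolding z explicit_formula[OF x] explicit_g[OF x t, symmetric] ..
  ultimately show "2 * infsum (zero_term x t) upper_zeros = of_real (2 * g_fun x t - 2 * (t * sin x / (2 * pi) * (suminf p + suminf d)))"
    by simp
qed

text \<open>The two contributions of g cancel, and sin x cot (x/2) = 2 cos^2 (x/2) turns the
  prefactor of the prime sum into \<open>k\<close>. In particular the quantity is real.\<close>

private lemma Q_eq:
  "- 4 * of_real (pi * sqrt t * cot (x/2)) * infsum (zero_term x t) upper_zeros
    + of_real (4 * pi * sqrt t * g_fun x t * cot (x/2)) - of_real (Lambda_real t)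
   = of_real (k * (suminf p + suminf d) - Lambda_real t)"
proof -
  define q where "q = pi * sqrt t * cot (x/2)"
  define P where "P = suminf p + suminf d"
  have "- 4 * of_real q * infsum (zero_term x t) upper_zeros = - 2 * of_real q * (2 * infsum (zero_term x t) upper_zeros)" by simp
  also have "\<dots> = of_real (- 2 * q * (2 * g_fun x t - 2 * (t * sin x / (2 * pi) * P)))"
    unfolding zero_sum(2) P_def by simp
  finally have "- 4 * of_real q * infsum (zero_term x t) upper_zeros + of_real (4 * pi * sqrt t * g_fun x t * cot (x/2)) - of_real (Lambda_real t)
     = complex_of_real (- 2 * q * (2 * g_fun x t - 2 * (t * sin x / (2 * pi) * P)) + 4 * pi * sqrt t * g_fun x t * cot (x/2) - Lambda_real t)"
    by simp
  also have "- 2 * q * (2 * g_fun x t - 2 * (t * sin x / (2 * pi) * P)) + 4 * pi * sqrt t * g_fun x t * cot (x/2)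
     = 2 * (t * sqrt t) * (sin x * cot (x/2)) * P"
    by (simp add: q_def algebra_simps)
  also have "sin x * cot (x/2) = 2 * csq"
    using sin_double[of "x/2"] trig by (simp add: cot_def csq_def power2_eq_square)
  finally show ?thesis by (simp add: q_def P_def k_def mult_ac)
qed

text \<open>For integral t the term at m = t has distance 0, and multiplied by \<open>k\<close> it
  is exactly Lambda (t), which is why E(t) = 0 there. Otherwise Lambda (t) = 0 and both neighbours
  belong to F.\<close>

private lemma Q_split:
  "k * (suminf p + suminf d) - Lambda_real t = F_fun x t
    + k * ((\<Sum>n. if n = nat \<lfloor>t\<rfloor> \<or> n = nat \<lfloor>t\<rfloor> + 1 then 0 else p n) + suminf d)"
proof -
  define m where "m = nat \<lfloor>t\<rfloor>"
  have m: "m \<ge> 1" "real m = of_int \<lfloor>t\<rfloor>" "nat \<lfloor>t\<rfloor> = m" unfolding m_def using t by (auto simp: le_nat_floor)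
  have m1: "real (m + 1) = of_int \<lfloor>t\<rfloor> + 1" using m by simp
  have fr: "frac t = t - real m" using m by (simp add: frac_def)
  define w where "w n = (if n = m \<or> n = m + 1 then 0 else p n)" for n
  have e: "p n = w n + (if n \<in> {m, m + 1} then p n else 0)" for n by (auto simp: w_def)
  have fs: "(\<lambda>n. if n \<in> {m, m + 1} then p n else 0) sums (p m + p (m + 1))"
    using sums_If_finite_set[of "{m, m + 1}" p] by simp
  have "w = (\<lambda>n. p n - (if n \<in> {m, m + 1} then p n else 0))" by (auto simp: w_def fun_eq_iff)
  then have "w sums (suminf p - (p m + p (m + 1)))" using sums_diff[OF summable_sums[OF summable_p] fs] by simp
  then have sp: "suminf p = p m + p (m + 1) + suminf w" using sums_unique by force
  have L1: "Lambda_real (of_int \<lfloor>t\<rfloor>) = mangoldt m" "Lambda_real (of_int \<lfloor>t\<rfloor> + 1) = mangoldt (m + 1)"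
  proof -
    show "Lambda_real (of_int \<lfloor>t\<rfloor>) = mangoldt m" using t m by (simp add: Lambda_real_def)
    have "of_int \<lfloor>t\<rfloor> + 1 = (of_int (\<lfloor>t\<rfloor> + 1) :: real)" by simp
    then show "Lambda_real (of_int \<lfloor>t\<rfloor> + 1) = mangoldt (m + 1)" unfolding Lambda_real_def
      using t m by (simp add: nat_add_distrib)
  qed
  have F2: "4 * t * sqrt t * (Lambda_real (of_int \<lfloor>t\<rfloor> + 1) * sqrt (of_int \<lfloor>t\<rfloor> + 1) * (cos (x / 2))\<^sup>2)
         / ((1 - frac t)\<^sup>2 + 4 * t * (of_int \<lfloor>t\<rfloor> + 1) * (cos (x / 2))\<^sup>2) = k * p (m + 1)"
  proof -
    have e: "1 - frac t = real (m + 1) - t" using fr by simp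
    show ?thesis unfolding L1 unfolding m1[symmetric] e p_def den k_def csq_def by simp
  qed
  have F1: "4 * t * sqrt t * (Lambda_real (of_int \<lfloor>t\<rfloor>) * sqrt (of_int \<lfloor>t\<rfloor>) * (cos (x / 2))\<^sup>2)
         / ((frac t)\<^sup>2 + 4 * t * of_int \<lfloor>t\<rfloor> * (cos (x / 2))\<^sup>2) = k * p m"
    unfolding L1 unfolding m(2)[symmetric] p_def den k_def csq_def fr power2_commute[of t "real m"] by simp
  have "k * p m - Lambda_real t = (if t \<in> \<int> then 0 else 1) * (k * p m)"
  proof (cases "t \<in> \<int>")
    case True
    then have "frac t = 0" by (simp add: frac_eq_0_iff)
    then have tm: "t = real m" using fr by simp
    have "k * p m = mangoldt m"
    proof -
      have "k * p m = 4 * t * sqrt t * csq * (mangoldt m * sqrt t) / (4 * t * t * csq)"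
        unfolding p_def den k_def using tm by simp
      also have "\<dots> = mangoldt m * (4 * t * csq * (sqrt t * sqrt t)) / (4 * t * t * csq)" by (simp add: mult_ac)
      also have "\<dots> = mangoldt m" using t trig by simp
      finally show ?thesis .
    qed
    moreover have "Lambda_real t = mangoldt m" using True t m by (simp add: Lambda_real_def)
    ultimately show ?thesis using True by simp
  next
    case False
    then show ?thesis by (simp add: Lambda_real_def)
  qed
  moreover have "k * (suminf p + suminf d) - Lambda_real t = (k * p m - Lambda_real t) + k * p (m + 1) + k * (suminf w + suminf d)"
    unfolding sp by (simp add: algebra_simps)
  ultimately show ?thesis unfolding F_fun_def F1 F2 m(3) w_def by simp
qed

text \<open>Strict positivity comes from the term n = 2 of the dual sum, as Lambda (2) > 0;
  strictness above is inherited from the bound on the weights.\<close>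

private lemma Q_bounds:
  "0 < k * (suminf p + suminf d) - Lambda_real t"
  "k * (suminf p + suminf d) - Lambda_real t < F_fun x t + 4 * (cos (x/2))\<^sup>2 * (3 * t\<^sup>2 * ln t + pi\<^sup>2 / 2 * t + 1/4 * ln t + 0.6)"
proof -
  define w where "w n = (if n = nat \<lfloor>t\<rfloor> \<or> n = nat \<lfloor>t\<rfloor> + 1 then 0 else p n)" for n
  have wf: "w n \<le> far_weight t n" "w n \<ge> 0" for n
    using p_le[of n] pd_nonneg weight_nonneg by (auto simp: w_def)
  have ws: "summable w"
    by (rule summable_comparison_test'[OF weight_bound(2)[OF t], of 0]) (use wf in auto)
  have "suminf d \<ge> d 2" using sum_le_suminf[OF summable_d, of "{2}"] pd_nonneg by simp
  moreover have "d 2 > 0" unfolding d_def using den_pos(2)[of 2] by (simp add: mangoldt_prime[of 2])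
  ultimately have dpos: "suminf d > 0" by simp
  have wpos: "suminf w \<ge> 0" by (rule suminf_nonneg[OF ws]) (rule wf)
  have F: "F_fun x t \<ge> 0"
    unfolding F_fun_def Lambda_real_def using t
    by (auto intro!: add_nonneg_nonneg mult_nonneg_nonneg divide_nonneg_nonneg mangoldt_nonneg)
  have "k * (suminf w + suminf d) > 0" using trig wpos dpos by (intro mult_pos_pos) auto
  then show "0 < k * (suminf p + suminf d) - Lambda_real t" unfolding Q_split w_def[symmetric] using F by simp
  have "suminf w + suminf d \<le> suminf (far_weight t) + suminf (dual_weight t)"
    by (intro add_mono suminf_le wf ws weight_bound(2,3) t d_le summable_d)
  then have "k * (suminf w + suminf d) \<le> k * (suminf (far_weight t) + suminf (dual_weight t))"
    using trig by (intro mult_left_mono) auto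
  also have "\<dots> = 4 * csq * (t * sqrt t * (suminf (far_weight t) + suminf (dual_weight t)))"
    by (simp add: k_def mult_ac)
  also have "\<dots> < 4 * csq * (3 * t\<^sup>2 * ln t + pi\<^sup>2 / 2 * t + 1/4 * ln t + 0.6)"
    using trig by (intro mult_strict_left_mono weight_bound(1) t) auto
  finally show "k * (suminf p + suminf d) - Lambda_real t < F_fun x t + 4 * (cos (x/2))\<^sup>2 * (3 * t\<^sup>2 * ln t + pi\<^sup>2 / 2 * t + 1/4 * ln t + 0.6)"
    unfolding Q_split w_def[symmetric] csq_def by simp
qed

lemmas zero_sum_bounds = zero_sum(1) Q_eq Q_bounds

end

theorem theorem4:
  fixes t x :: real
  assumes "t > 1" and "0 < x" and "x < pi"
  defines "S \<equiv> infsum (zero_term x t) upper_zeros"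
  defines "Q \<equiv> - 4 * of_real (pi * sqrt t * cot (x/2)) * S
               + of_real (4 * pi * sqrt t * g_fun x t * cot (x/2)) - of_real (Lambda_real t)"
  shows "zero_term x t summable_on upper_zeros \<and> Im Q = 0 \<and> 0 < Re Q \<and>
         Re Q < F_fun x t + 4 * (cos (x/2))^2 *
           (3 * t^2 * ln t + pi^2 / 2 * t + 1/4 * ln t + 0.6)"
  using zero_sum_bounds[OF assms(2,3,1)] unfolding S_def Q_def by (simp only: complex.sel Re_complex_of_real Im_complex_of_real)

end
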